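(* Suppose that $\Omega$ satisfies Condition A (see context). Suppose also that the incompressible Navier-Stokes problem $v_t=-(v\cdot\nabla)v+\Delta v+f-\nabla p$, $\nabla\cdot v=0$ in $(0,T]\times\Omega$, $v(0,\cdot)=v^0$ in $\Omega$, $v=0$ on $\partial\Omega$, with a smooth external force $f$, possesses a solution $(v,p)$ with $v\in C^3([0,T]\times\bar\Omega)$ and $p\in C^2([0,T]\times\bar\Omega)$. Let $\theta_0,\theta_1>0$ be fixed constants. Then there is a constant $\beta^*>0$, independent of $\tau$, $h$ and $\theta$, such that, under the scaling condition $\tau=\theta h^{3/4}$ with $\theta\in[\theta_0,\theta_1]$, for all sufficiently small $\tau,h$ the solution $u^n,\tilde u^n$ of the discrete Navier-Stokes equations (see context) satisfies $$\max_{0\le n\le T_\tau}\|u^n-v(\tau n,\cdot)\|_{\Omega_h}\le\beta^*h^{1/4},\qquad \max_{0\le n\le T_\tau}\|\tilde u^n-v(\tau n,\cdot)\|_{\Omega_h}\le\beta^*h^{1/4}.$$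
   Context: $\Omega\subset\mathbb R^3$ is a bounded connected open set with Lipschitz boundary; $e^1,e^2,e^3$ is the standard basis of $\mathbb R^3$; $T>0$. Condition A on $\Omega$: there exist $s_0>0$ and a finite family $\{V_k\}_{k=1,\dots,K}$ of open subsets of planes in $\mathbb R^3$ such that: (1) each $V_k$ is contained in $\Omega$ and has a normal vector $\omega_k\in\{\pm e^j\}_{j=1,2,3}$ such that for each $y\in V_k$ the set $\{y+s\omega_k\mid s\ge0\}\cap\partial\Omega$ is a singleton, written $\{y+\varphi_k(y)\omega_k\}$ with $\varphi_k:V_k\to\mathbb R_{>0}$; (2) $\varphi_k(y)\ge s_0$ for all $k$ and $y\in V_k$; (3) $\bigcup_k\{y+\varphi_k(y)\omega_k\mid y\in V_k\}=\partial\Omega$. Grid: for $h>0$ and $B\subset h\mathbb Z^3$, $\partial B:=\{x\in B\mid \{x\pm he^i\}_{i=1,2,3}\not\subset B\}$. $C_r(x):=\prod_{i=1}^3[x_i-\frac r2,x_i+\frac r2]$ and $\Omega_h:=\{x\in\Omega\cap h\mathbb Z^3\mid C_{4h}(x)\subset\Omega\}$. Functions on $\Omega_h$ are extended by $0$ outside $\Omega_h$, and $D_i\phi(x)=\frac{\phi(x+he^i)-\phi(x-he^i)}{2h}$, $D_i^2\phi(x)=\frac{\phi(x+he^i)+\phi(x-he^i)-2\phi(x)}{h^2}$, $\mathcal D\phi=(D_1\phi,D_2\phi,D_3\phi)$, $\mathcal D\cdot w=\sum_iD_iw_i$. Norm: $\|u\|_{\Omega_h}=(\sum_{x\in\Omega_h}|u(x)|^2h^3)^{1/2}$.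 $h\mathbb Z^3$ is partitioned into the eight parity classes $G^1,\dots,G^8$ (points $hz$ according to the parities of $z_1,z_2,z_3$). $\Omega_h^\circ:=\{x\in\Omega_h\setminus\partial\Omega_h\mid x+\sum_ia^ihe^i\in\Omega_h\setminus\partial\Omega_h \text{ for all } a^1,a^2,a^3\in\{0,1,2\}\}$, $\Omega_h^{\circ j}:=\Omega_h^\circ\cap G^j$. Standing assumption: $h$ is small enough that each $\Omega_h^{\circ j}$ is connected (via steps in $\{\pm2he^i\}$). Discrete Helmholtz-Hodge decomposition: for each $u:\Omega_h\to\mathbb R^3$ there are $w:\Omega_h\to\mathbb R^3$, $\phi:\Omega_h\to\mathbb R$ with $\mathcal D\cdot w=0$ on $\Omega_h$, $w+\mathcal D\phi=u$ on $\Omega_h\setminus\partial\Omega_h$, $w=0$ on $\partial\Omega_h$, $\sum_{x\in\Omega_h^{\circ j}}\phi(x)=0$ ($j=1,\dots,8$); $w$ is uniquely determined and $P_hu:=w$. Discrete Navier-Stokes equations: $\tau>0$, $T_\tau\in\mathbb N$ with $T\in[\tau T_\tau,\tau T_\tau+\tau)$; $\tilde u^0(x):=h^{-3}\int_{C_h(x)}v^0(y)dy$ for $x\in\Omega_h\setminus\partial\Omega_h$ and $\tilde u^0=0$ on $\partial\Omega_h$, where $v^0=v(0,\cdot)$; $f^n(x):=\tau^{-1}h^{-3}\int_{\tau n}^{\tau(n+1)}\int_{C_h(x)}f\,dy\,dt$; $u^0=P_h\tilde u^0$ and for $n=0,\dots,T_\tau-1$ $$\frac{\tilde u^{n+1}(x)-u^n(x)}{\tau}=-\frac12\sum_{j=1}^3\Big(u^n_j(x-he^j)D_j\tilde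 u^{n+1}(x-he^j)+u^n_j(x+he^j)D_j\tilde u^{n+1}(x+he^j)\Big)+\sum_{j=1}^3D_j^2\tilde u^{n+1}(x)+f^n(x)$$ for $x\in\Omega_h\setminus\partial\Omega_h$, $\tilde u^{n+1}=0$ on $\partial\Omega_h$, $u^{n+1}=P_h\tilde u^{n+1}$. (These are uniquely solvable.) *)

theory Defs
  imports "HOL-Analysis.Analysis"
begin

section \<open>Domains\<close>

text \<open>Near each boundary point, in suitable orthonormal coordinates, the domain is the part of the
  space strictly above the graph of a Lipschitz function of two variables.\<close>

definition lipschitz_boundary :: "(real^3) set \<Rightarrow> bool" where
  "lipschitz_boundary \<Omega> \<longleftrightarrow>
     (\<forall>q\<in>frontier \<Omega>. \<exists>U R g L. open U \<and> q \<in> U \<and>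
        orthogonal_transformation (R :: real^3 \<Rightarrow> real^3) \<and>
        L-lipschitz_on UNIV (g :: real \<times> real \<Rightarrow> real) \<and>
        \<Omega> \<inter> U = {x \<in> U. g (R x $ 1, R x $ 2) < R x $ 3})"

abbreviation ax :: "3 \<Rightarrow> real^3" where
  "ax i \<equiv> axis i 1"

definition condition_A :: "(real^3) set \<Rightarrow> bool" where
  "condition_A \<Omega> \<longleftrightarrow>
     (\<exists>s\<^sub>0>0. \<exists>(K::nat) (V :: nat \<Rightarrow> (real^3) set) (\<omega> :: nat \<Rightarrow> real^3) (\<phi> :: nat \<Rightarrow> real^3 \<Rightarrow> real).
        (\<forall>k\<in>{1..K}.
           \<omega> k \<in> range ax \<union> range (\<lambda>j. - ax j) \<and>
           (\<exists>c. openin (top_of_set {y. \<omega> k \<bullet> y = c}) (V k)) \<and>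
           V k \<subseteq> \<Omega> \<and>
           (\<forall>y\<in>V k. \<phi> k y > 0 \<and>
              {y + s *\<^sub>R \<omega> k | s. s \<ge> 0} \<inter> frontier \<Omega> = {y + \<phi> k y *\<^sub>R \<omega> k})) \<and>
        (\<forall>k\<in>{1..K}. \<forall>y\<in>V k. \<phi> k y \<ge> s\<^sub>0) \<and>
        (\<Union>k\<in>{1..K}. {y + \<phi> k y *\<^sub>R \<omega> k | y. y \<in> V k}) = frontier \<Omega>)"


section \<open>The incompressible Navier-Stokes problem\<close>

text \<open>\<open>C_closure k U F\<close>, for open \<open>U\<close>: \<open>F\<close> is of class \<open>C\<^sup>k\<close> on the closure of \<open>U\<close>, that is, the
  partial derivatives of \<open>F\<close> up to order \<open>k\<close> exist on \<open>U\<close> and extend continuously to the closure.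
  The existentially quantified \<open>G\<close> is such an extension: it is a derivative only on \<open>U\<close>, but is
  continuous on all of the closure.\<close>

primrec C_closure ::
  "nat \<Rightarrow> 'a::euclidean_space set \<Rightarrow> ('a \<Rightarrow> 'b::real_normed_vector) \<Rightarrow> bool" where
  "C_closure 0 U F \<longleftrightarrow> continuous_on (closure U) F"
| "C_closure (Suc k) U F \<longleftrightarrow> continuous_on (closure U) F \<and>
     (\<forall>b\<in>Basis. \<exists>G. (\<forall>z\<in>U. ((\<lambda>s. F (z + s *\<^sub>R b)) has_vector_derivative G z) (at 0)) \<and>
        C_closure k U G)"

definition C_spacetime ::
  "nat \<Rightarrow> real \<Rightarrow> (real^3) set \<Rightarrow> (real \<Rightarrow> real^3 \<Rightarrow> 'b::real_normed_vector) \<Rightarrow> bool" where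
  "C_spacetime k T \<Omega> F \<longleftrightarrow> C_closure k ({0<..<T} \<times> \<Omega>) (\<lambda>(t, x). F t x)"

definition pderiv_at :: "3 \<Rightarrow> (real^3 \<Rightarrow> 'b::real_normed_vector) \<Rightarrow> real^3 \<Rightarrow> 'b" where
  "pderiv_at i g x = vector_derivative (\<lambda>s. g (x + s *\<^sub>R ax i)) (at 0)"

text \<open>The time derivative is taken within \<open>[0,T]\<close>, hence is one-sided at \<open>t = T\<close>. For \<open>v\<close> and \<open>p\<close> of
  the regularity required here all derivatives in the equations exist.\<close>

definition navier_stokes ::
  "(real^3) set \<Rightarrow> real \<Rightarrow> (real \<Rightarrow> real^3 \<Rightarrow> real^3) \<Rightarrow> (real^3 \<Rightarrow> real^3) \<Rightarrow>
   (real \<Rightarrow> real^3 \<Rightarrow> real^3) \<Rightarrow> (real \<Rightarrow> real^3 \<Rightarrow> real) \<Rightarrow> bool" where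
  "navier_stokes \<Omega> T f v\<^sub>0 v p \<longleftrightarrow>
     (\<forall>t\<in>{0<..T}. \<forall>x\<in>\<Omega>.
        vector_derivative (\<lambda>s. v s x) (at t within {0..T}) =
          - (\<Sum>j\<in>UNIV. v t x $ j *\<^sub>R pderiv_at j (v t) x)
          + (\<Sum>j\<in>UNIV. pderiv_at j (pderiv_at j (v t)) x)
          + f t x
          - (\<chi> i. pderiv_at i (p t) x)) \<and>
     (\<forall>t\<in>{0<..T}. \<forall>x\<in>\<Omega>. (\<Sum>i\<in>UNIV. pderiv_at i (v t) x $ i) = 0) \<and>
     (\<forall>x\<in>\<Omega>. v 0 x = v\<^sub>0 x) \<and>
     (\<forall>t\<in>{0<..T}. \<forall>x\<in>frontier \<Omega>. v t x = 0)"


section \<open>Grids and difference operators\<close>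

definition grid :: "real \<Rightarrow> (real^3) set" where
  "grid h = {x. \<forall>i. \<exists>z::int. x $ i = h * of_int z}"

definition grid_boundary :: "real \<Rightarrow> (real^3) set \<Rightarrow> (real^3) set" where
  "grid_boundary h B = {x \<in> B. \<not> (\<Union>i. {x + h *\<^sub>R ax i, x - h *\<^sub>R ax i}) \<subseteq> B}"

definition cube :: "real \<Rightarrow> real^3 \<Rightarrow> (real^3) set" where
  "cube r x = cbox (x - vec (r/2)) (x + vec (r/2))"

definition grid_domain :: "(real^3) set \<Rightarrow> real \<Rightarrow> (real^3) set" where
  "grid_domain \<Omega> h = {x \<in> \<Omega> \<inter> grid h. cube (4*h) x \<subseteq> \<Omega>}"

definition grid_interior :: "(real^3) set \<Rightarrow> real \<Rightarrow> (real^3) set" where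
  "grid_interior \<Omega> h = grid_domain \<Omega> h - grid_boundary h (grid_domain \<Omega> h)"

text \<open>A function on \<open>grid_domain \<Omega> h\<close> is represented by its extension by zero to the whole space.\<close>

definition grid_fun :: "(real^3) set \<Rightarrow> real \<Rightarrow> (real^3 \<Rightarrow> 'b::zero) \<Rightarrow> bool" where
  "grid_fun \<Omega> h \<phi> \<longleftrightarrow> (\<forall>x. x \<notin> grid_domain \<Omega> h \<longrightarrow> \<phi> x = 0)"

definition D1 :: "real \<Rightarrow> 3 \<Rightarrow> (real^3 \<Rightarrow> 'b::real_vector) \<Rightarrow> real^3 \<Rightarrow> 'b" where
  "D1 h i \<phi> x = (\<phi> (x + h *\<^sub>R ax i) - \<phi> (x - h *\<^sub>R ax i)) /\<^sub>R (2*h)"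

definition D2 :: "real \<Rightarrow> 3 \<Rightarrow> (real^3 \<Rightarrow> 'b::real_vector) \<Rightarrow> real^3 \<Rightarrow> 'b" where
  "D2 h i \<phi> x = (\<phi> (x + h *\<^sub>R ax i) + \<phi> (x - h *\<^sub>R ax i) - 2 *\<^sub>R \<phi> x) /\<^sub>R h\<^sup>2"

definition grid_grad :: "real \<Rightarrow> (real^3 \<Rightarrow> real) \<Rightarrow> real^3 \<Rightarrow> real^3" where
  "grid_grad h \<phi> x = (\<chi> i. D1 h i \<phi> x)"

definition grid_div :: "real \<Rightarrow> (real^3 \<Rightarrow> real^3) \<Rightarrow> real^3 \<Rightarrow> real" where
  "grid_div h w x = (\<Sum>i\<in>UNIV. D1 h i (\<lambda>y. w y $ i) x)"

definition grid_norm :: "(real^3) set \<Rightarrow> real \<Rightarrow> (real^3 \<Rightarrow> real^3) \<Rightarrow> real" where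
  "grid_norm \<Omega> h u = sqrt (\<Sum>x\<in>grid_domain \<Omega> h. (norm (u x))\<^sup>2 * h^3)"

text \<open>The eight parity classes are indexed by \<open>bool^3\<close>: \<open>c $ i\<close> says that the \<open>i\<close>-th coordinate is
  an even multiple of \<open>h\<close>.\<close>

definition parity_class :: "real \<Rightarrow> bool^3 \<Rightarrow> (real^3) set" where
  "parity_class h c = {x. \<forall>i. \<exists>z::int. x $ i = h * of_int z \<and> even z = c $ i}"

definition grid_core :: "(real^3) set \<Rightarrow> real \<Rightarrow> (real^3) set" where
  "grid_core \<Omega> h = {x \<in> grid_interior \<Omega> h.
     \<forall>a :: 3 \<Rightarrow> nat. (\<forall>i. a i \<in> {0, 1, 2}) \<longrightarrow>
       x + (\<Sum>i\<in>UNIV. (real (a i) * h) *\<^sub>R ax i) \<in> grid_interior \<Omega> h}"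

definition grid_core_class :: "(real^3) set \<Rightarrow> real \<Rightarrow> bool^3 \<Rightarrow> (real^3) set" where
  "grid_core_class \<Omega> h c = grid_core \<Omega> h \<inter> parity_class h c"

definition grid_connected :: "real \<Rightarrow> (real^3) set \<Rightarrow> bool" where
  "grid_connected h A \<longleftrightarrow> (\<forall>x\<in>A. \<forall>y\<in>A.
     (x, y) \<in> {(a, b). a \<in> A \<and> b \<in> A \<and>
                 (\<exists>i. b = a + (2*h) *\<^sub>R ax i \<or> b = a - (2*h) *\<^sub>R ax i)}\<^sup>*)"


section \<open>The discrete Helmholtz-Hodge decomposition and the discrete Navier-Stokes equations\<close>

definition helmholtz_hodge ::
  "(real^3) set \<Rightarrow> real \<Rightarrow> (real^3 \<Rightarrow> real^3) \<Rightarrow> (real^3 \<Rightarrow> real^3) \<Rightarrow> (real^3 \<Rightarrow> real) \<Rightarrow> bool" where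
  "helmholtz_hodge \<Omega> h u w \<phi> \<longleftrightarrow>
     grid_fun \<Omega> h w \<and> grid_fun \<Omega> h \<phi> \<and>
     (\<forall>x\<in>grid_domain \<Omega> h. grid_div h w x = 0) \<and>
     (\<forall>x\<in>grid_interior \<Omega> h. w x + grid_grad h \<phi> x = u x) \<and>
     (\<forall>x\<in>grid_boundary h (grid_domain \<Omega> h). w x = 0) \<and>
     (\<forall>c. (\<Sum>x\<in>grid_core_class \<Omega> h c. \<phi> x) = 0)"

definition P_h :: "(real^3) set \<Rightarrow> real \<Rightarrow> (real^3 \<Rightarrow> real^3) \<Rightarrow> real^3 \<Rightarrow> real^3" where
  "P_h \<Omega> h u = (THE w. \<exists>\<phi>. helmholtz_hodge \<Omega> h u w \<phi>)"

definition force_avg ::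
  "real \<Rightarrow> real \<Rightarrow> (real \<Rightarrow> real^3 \<Rightarrow> real^3) \<Rightarrow> nat \<Rightarrow> real^3 \<Rightarrow> real^3" where
  "force_avg h \<tau> f n x =
     integral {\<tau> * real n .. \<tau> * real (n + 1)} (\<lambda>t. integral (cube h x) (\<lambda>y. f t y)) /\<^sub>R (\<tau> * h^3)"

text \<open>\<open>N\<close> is the number of time steps, \<open>u\<close> and \<open>ut\<close> are the sequences \<open>u\<^sup>n\<close> and (with tilde) the
  intermediate velocities; only the entries with index at most \<open>N\<close> are constrained.\<close>

definition discrete_navier_stokes ::
  "(real^3) set \<Rightarrow> real \<Rightarrow> real \<Rightarrow> nat \<Rightarrow> (real \<Rightarrow> real^3 \<Rightarrow> real^3) \<Rightarrow> (real^3 \<Rightarrow> real^3) \<Rightarrow>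
   (nat \<Rightarrow> real^3 \<Rightarrow> real^3) \<Rightarrow> (nat \<Rightarrow> real^3 \<Rightarrow> real^3) \<Rightarrow> bool" where
  "discrete_navier_stokes \<Omega> h \<tau> N f v\<^sub>0 u ut \<longleftrightarrow>
     (\<forall>n\<le>N. grid_fun \<Omega> h (u n) \<and> grid_fun \<Omega> h (ut n)) \<and>
     (\<forall>x\<in>grid_interior \<Omega> h. ut 0 x = integral (cube h x) v\<^sub>0 /\<^sub>R h^3) \<and>
     (\<forall>x\<in>grid_boundary h (grid_domain \<Omega> h). ut 0 x = 0) \<and>
     u 0 = P_h \<Omega> h (ut 0) \<and>
     (\<forall>n<N.
        (\<forall>x\<in>grid_interior \<Omega> h.
           (ut (n+1) x - u n x) /\<^sub>R \<tau> =
             - (1/2) *\<^sub>R (\<Sum>j\<in>UNIV.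
                  u n (x - h *\<^sub>R ax j) $ j *\<^sub>R D1 h j (ut (n+1)) (x - h *\<^sub>R ax j)
                + u n (x + h *\<^sub>R ax j) $ j *\<^sub>R D1 h j (ut (n+1)) (x + h *\<^sub>R ax j))
             + (\<Sum>j\<in>UNIV. D2 h j (ut (n+1)) x)
             + force_avg h \<tau> f n x) \<and>
        (\<forall>x\<in>grid_boundary h (grid_domain \<Omega> h). ut (n+1) x = 0) \<and>
        u (n+1) = P_h \<Omega> h (ut (n+1)))"

end

theory Submission
  imports Defs
begin

text \<open>
  The error is measured against the zero extension of \<open>v\<close>, which is Lipschitz and bounded by a
  multiple of the distance to the complement of \<open>\<Omega>\<close>; its restriction to \<open>grid_interior\<close> differs from
  it by \<open>O(h)\<close>, and only in a boundary layer of \<open>O(h\<^sup>-\<^sup>2)\<close> lattice points. Testing the error equation with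
  the error of \<open>ut\<close>, the convection is skew because \<open>u\<close> is discretely divergence-free, and the layer
  costs \<open>O(\<tau> h)\<close> per step.

  The discrete projection is not applied to a discretely divergence-free field, so one needs that \<open>v\<close>
  is almost orthogonal to discrete gradients: its pairing with \<open>D\<phi>\<close> is \<open>O(h)\<close> times the norm of \<open>D\<phi>\<close>
  over \<open>grid_interior\<close> alone. This uses no discrete Poincare inequality. Averaging \<open>v\<close> over faces of
  cubes of side \<open>2h\<close> gives a field that is exactly discretely divergence-free on the whole lattice, and
  \<open>\<phi>\<close> is replaced by \<open>\<Phi>(x) = \<phi>(r(x))\<close>, where \<open>r\<close> pushes the points near the boundary inwards along a
  Lipschitz field of cone directions by multiples of \<open>2h\<close>, so that the parity classes are respected.
  The two gradients differ only in the layer, where the averaged \<open>v\<close> is \<open>O(h)\<close>.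

  A discrete Gronwall argument then bounds the squared errors by \<open>O(h + \<tau>\<^sup>2 + h\<^sup>2/\<tau>)\<close>, which is
  \<open>O(h\<^bsup>1/2\<^esup>)\<close> for \<open>\<tau> = \<theta> h\<^bsup>3/4\<^esup>\<close>.
\<close>

section \<open>Summation by parts and the discrete projection\<close>

text \<open>The scheme contains no pressure, so the residual of the exact velocity in one step
  carries the full gradient Dp, which is O(1). Tested with the error of \<open>ut\<close> it does
  not vanish either: \<open>u\<close> is orthogonal to discrete gradients, but \<open>ut\<close>
  differs from \<open>u\<close> by a gradient D\<phi> whose norm d is not known to be small. The
  step thus contributes a multiple of \<tau> (h + d). The way out is Pythagoras in the projection:
  passing from \<open>ut\<close> to \<open>u\<close> lowers the squared error by d^2, up to O(h d).
  Young's inequality absorbs both terms linear in d into this gain, at the price O(\<tau>^2 + h^2)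
  per step, hence O(\<tau> + h^2/\<tau>) in total; here \<tau> is O(h^(1/2)) by the scaling, and the
  lower bound on \<theta> controls h^2/\<tau>.

  Since d sees D\<phi> on \<open>grid_interior\<close> only, the bound for the pairing with the
  exact velocity must not involve values of D\<phi> elsewhere. This is what forces the extension of
  the potential.\<close>

lemma sum_shift:
  fixes F :: "'a::ab_group_add \<Rightarrow> 'b::comm_monoid_add"
  assumes "finite G" and supp: "\<And>x. F x \<noteq> 0 \<Longrightarrow> x \<in> G \<and> x - s \<in> G"
  shows "(\<Sum>x\<in>G. F (x + s)) = (\<Sum>x\<in>G. F x)"
proof -
  have "(\<Sum>x\<in>G. F (x + s)) = (\<Sum>x\<in>{x\<in>G. F (x+s) \<noteq> 0}. F (x + s))"
    by (rule sum.mono_neutral_right) (use assms in auto)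
  also have "\<dots> = (\<Sum>x\<in>{x\<in>G. F x \<noteq> 0}. F x)"
    by (rule sum.reindex_bij_witness[where i="\<lambda>x. x - s" and j="\<lambda>x. x + s"]) (use supp in auto)
  also have "\<dots> = (\<Sum>x\<in>G. F x)"
    by (rule sum.mono_neutral_left) (use assms in auto)
  finally show ?thesis .
qed

lemma sum_shift_eq:
  fixes F :: "'a::ab_group_add \<Rightarrow> 'b::comm_monoid_add"
  assumes "finite G" and "\<And>x. F x \<noteq> 0 \<Longrightarrow> x \<in> G" "\<And>x. F x \<noteq> 0 \<Longrightarrow> x - s \<in> G"
    and "\<And>x. H x = F (x + s)"
  shows "sum H G = sum F G"
  using sum_shift[of G F s] assms by simp

text \<open>Room for one lattice step on every side of the support: the summations by parts below
  then have no boundary terms, and sums over \<open>G\<close> act like sums over the whole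
  lattice.\<close>

definition padded :: "real \<Rightarrow> (real^3) set \<Rightarrow> (real^3 \<Rightarrow> 'b::zero) \<Rightarrow> bool" where
  "padded h G w \<longleftrightarrow>
     (\<forall>x. w x \<noteq> 0 \<longrightarrow> x \<in> G \<and> (\<forall>i. x + h *\<^sub>R ax i \<in> G \<and> x - h *\<^sub>R ax i \<in> G))"

text \<open>Forward difference. \<open>D2\<close> is its composition with the backward difference,
  so this is the gradient that belongs to the viscous term, unlike the central difference
  \<open>D1\<close>.\<close>

definition Df :: "real \<Rightarrow> 3 \<Rightarrow> (real^3 \<Rightarrow> 'b::real_vector) \<Rightarrow> real^3 \<Rightarrow> 'b" where
  "Df h i a x = (a (x + h *\<^sub>R ax i) - a x) /\<^sub>R h"

lemma padded_minus:
  assumes "padded h G w" and "w (x - h *\<^sub>R ax i) \<noteq> 0"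
  shows "x \<in> G \<and> x - h *\<^sub>R ax i \<in> G"
proof -
  have "(x - h *\<^sub>R ax i) + h *\<^sub>R ax i \<in> G" "x - h *\<^sub>R ax i \<in> G"
    using assms unfolding padded_def by blast+
  then show ?thesis by simp
qed

lemma padded_plus:
  assumes "padded h G w" and "w (x + h *\<^sub>R ax i) \<noteq> 0"
  shows "x \<in> G \<and> x + h *\<^sub>R ax i \<in> G"
proof -
  have "(x + h *\<^sub>R ax i) - h *\<^sub>R ax i \<in> G" "x + h *\<^sub>R ax i \<in> G"
    using assms unfolding padded_def by blast+
  then show ?thesis by simp
qed

lemma padded_at:
  assumes "padded h G w" and "w x \<noteq> 0"
  shows "x \<in> G" "x + h *\<^sub>R ax i \<in> G" "x - h *\<^sub>R ax i \<in> G"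
  using assms unfolding padded_def by blast+

lemma D1_real: "D1 h i \<phi> x = (\<phi> (x + h *\<^sub>R ax i) - \<phi> (x - h *\<^sub>R ax i)) / (2 * h)" for \<phi> :: "real^3 \<Rightarrow> real"
  by (simp only: D1_def real_scaleR_def divide_inverse mult.commute)

lemma D1_adjoint:
  fixes w \<phi> :: "real^3 \<Rightarrow> real"
  assumes "finite G" and "padded h G w"
  shows "(\<Sum>x\<in>G. w x * D1 h i \<phi> x) = - (\<Sum>x\<in>G. D1 h i w x * \<phi> x)"
proof -
  let ?s = "h *\<^sub>R ax i"
  have 1: "(\<Sum>x\<in>G. w x * \<phi> (x + ?s)) = (\<Sum>x\<in>G. w (x - ?s) * \<phi> x)"
    by (rule sum_shift_eq[where s="?s"]) (use assms padded_minus[of h G w] in auto)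
  have 2: "(\<Sum>x\<in>G. w x * \<phi> (x - ?s)) = (\<Sum>x\<in>G. w (x + ?s) * \<phi> x)"
    by (rule sum_shift_eq[where s="-?s"]) (use assms padded_plus[of h G w] in auto)
  have "(\<Sum>x\<in>G. w x * D1 h i \<phi> x)
      = ((\<Sum>x\<in>G. w x * \<phi> (x + ?s)) - (\<Sum>x\<in>G. w x * \<phi> (x - ?s))) / (2*h)"
    unfolding sum_subtractf[symmetric] sum_divide_distrib
    by (intro sum.cong refl) (simp only: D1_real times_divide_eq_right times_divide_eq_left right_diff_distrib left_diff_distrib minus_divide_left minus_diff_eq)
  also have "\<dots> = - (\<Sum>x\<in>G. D1 h i w x * \<phi> x)"
    unfolding 1 2 sum_subtractf[symmetric] sum_divide_distrib sum_negf[symmetric]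
    by (intro sum.cong refl) (simp only: D1_real times_divide_eq_right times_divide_eq_left right_diff_distrib left_diff_distrib minus_divide_left minus_diff_eq)
  finally show ?thesis .
qed

text \<open>\<open>D2\<close> is a difference of consecutive forward differences, so a single shift
  moves one of them onto \<open>b\<close>. Padding is asked of \<open>b\<close> alone, since
  \<open>a\<close> will also be the boundary defect.\<close>

lemma D2_adjoint:
  fixes a b :: "real^3 \<Rightarrow> real^3"
  assumes "finite G" and "padded h G b"
  shows "(\<Sum>x\<in>G. D2 h i a x \<bullet> b x) = - (\<Sum>x\<in>G. Df h i a x \<bullet> Df h i b x)"
proof -
  let ?s = "h *\<^sub>R ax i"
  have 1: "(\<Sum>x\<in>G. (a (x + ?s) - a x) \<bullet> b (x + ?s)) = (\<Sum>x\<in>G. (a x - a (x - ?s)) \<bullet> b x)"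
    by (rule sum_shift_eq[where s="?s"]) (use assms padded_at[of h G b] in \<open>auto, (metis inner_zero_right)+\<close>)
  have "(\<Sum>x\<in>G. D2 h i a x \<bullet> b x) =
      ((\<Sum>x\<in>G. (a (x + ?s) - a x) \<bullet> b x) - (\<Sum>x\<in>G. (a x - a (x - ?s)) \<bullet> b x)) / h\<^sup>2"
    unfolding sum_subtractf[symmetric] sum_divide_distrib
    by (intro sum.cong refl) (simp add: D2_def inner_diff_left inner_add_left divide_inverse algebra_simps)
  also have "\<dots> = ((\<Sum>x\<in>G. (a (x + ?s) - a x) \<bullet> b x) - (\<Sum>x\<in>G. (a (x + ?s) - a x) \<bullet> b (x + ?s))) / h\<^sup>2"
    unfolding 1 ..
  also have "\<dots> = - (\<Sum>x\<in>G. Df h i a x \<bullet> Df h i b x)"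
    unfolding sum_subtractf[symmetric] sum_divide_distrib sum_negf[symmetric]
    by (intro sum.cong refl) (simp add: Df_def inner_diff_right power2_eq_square divide_inverse algebra_simps)
  finally show ?thesis .
qed

lemma grad_adjoint:
  fixes w :: "real^3 \<Rightarrow> real^3"
  assumes "finite G" and "padded h G w"
  shows "(\<Sum>x\<in>G. w x \<bullet> grid_grad h \<phi> x) = - (\<Sum>x\<in>G. grid_div h w x * \<phi> x)"
proof -
  have pad: "padded h G (\<lambda>y. w y $ i)" for i
    using assms(2) unfolding padded_def by (metis zero_index)
  have "(\<Sum>x\<in>G. w x \<bullet> grid_grad h \<phi> x) = (\<Sum>i\<in>UNIV. \<Sum>x\<in>G. w x $ i * D1 h i \<phi> x)"
    by (subst sum.swap) (simp add: grid_grad_def inner_vec_def)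
  also have "\<dots> = (\<Sum>i\<in>UNIV. - (\<Sum>x\<in>G. D1 h i (\<lambda>y. w y $ i) x * \<phi> x))"
    by (intro sum.cong refl D1_adjoint assms pad)
  also have "\<dots> = - (\<Sum>x\<in>G. grid_div h w x * \<phi> x)"
    unfolding sum_negf grid_div_def sum_distrib_right by (subst sum.swap) simp
  finally show ?thesis .
qed

definition convection :: "real \<Rightarrow> (real^3 \<Rightarrow> real^3) \<Rightarrow> (real^3 \<Rightarrow> real^3) \<Rightarrow> real^3 \<Rightarrow> real^3" where
  "convection h a b x = (1/2) *\<^sub>R (\<Sum>j\<in>UNIV.
      a (x - h *\<^sub>R ax j) $ j *\<^sub>R D1 h j b (x - h *\<^sub>R ax j)
    + a (x + h *\<^sub>R ax j) $ j *\<^sub>R D1 h j b (x + h *\<^sub>R ax j))"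

text \<open>\<open>D1 h j (b \<bullet> b) = D1 h j b \<bullet> (b (x + h) + b (x - h))\<close>, which is why the convection term averages the
  two neighbours.\<close>

lemma convection_skew:
  fixes a b :: "real^3 \<Rightarrow> real^3"
  assumes fin: "finite G" and pad: "padded h G b"
    and div: "\<And>x. b x \<noteq> 0 \<Longrightarrow> grid_div h a x = 0"
  shows "(\<Sum>x\<in>G. convection h a b x \<bullet> b x) = 0"
proof -
  define q where "q x = b x \<bullet> b x" for x
  have padq: "padded h G q" using pad unfolding padded_def q_def by auto
  have "(\<Sum>x\<in>G. (a (x - h *\<^sub>R ax j) $ j *\<^sub>R D1 h j b (x - h *\<^sub>R ax j)
      + a (x + h *\<^sub>R ax j) $ j *\<^sub>R D1 h j b (x + h *\<^sub>R ax j)) \<bullet> b x)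
     = (\<Sum>x\<in>G. a x $ j * D1 h j q x)" for j
  proof -
    let ?s = "h *\<^sub>R ax j"
    have 1: "(\<Sum>x\<in>G. (a x $ j *\<^sub>R D1 h j b x) \<bullet> b (x + ?s))
       = (\<Sum>x\<in>G. (a (x - ?s) $ j *\<^sub>R D1 h j b (x - ?s)) \<bullet> b x)"
      by (rule sum_shift_eq[where s="?s"]) (use fin padded_at[OF pad] in \<open>auto, (metis inner_zero_right)+\<close>)
    have 2: "(\<Sum>x\<in>G. (a x $ j *\<^sub>R D1 h j b x) \<bullet> b (x - ?s))
       = (\<Sum>x\<in>G. (a (x + ?s) $ j *\<^sub>R D1 h j b (x + ?s)) \<bullet> b x)"
      by (rule sum_shift_eq[where s="-?s"]) (use fin padded_at[OF pad] in \<open>auto, (metis inner_zero_right)+\<close>)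
    have "(\<Sum>x\<in>G. (a x $ j *\<^sub>R D1 h j b x) \<bullet> b (x + ?s)) + (\<Sum>x\<in>G. (a x $ j *\<^sub>R D1 h j b x) \<bullet> b (x - ?s))
      = (\<Sum>x\<in>G. a x $ j * D1 h j q x)"
      unfolding sum.distrib[symmetric]
    proof (intro sum.cong refl)
      fix x
      have "D1 h j b x \<bullet> (b (x + ?s) + b (x - ?s)) = D1 h j q x"
        by (simp add: D1_def q_def inner_diff_left inner_diff_right inner_add_right inner_commute)
      then show "a x $ j *\<^sub>R D1 h j b x \<bullet> b (x + ?s) + a x $ j *\<^sub>R D1 h j b x \<bullet> b (x - ?s) = a x $ j * D1 h j q x"
        by (simp add: inner_add_right distrib_left[symmetric])
    qed
    then show ?thesis unfolding 1 2 by (simp add: inner_add_left sum.distrib)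
  qed
  then have "(\<Sum>x\<in>G. convection h a b x \<bullet> b x) = (1/2) * (\<Sum>j\<in>UNIV. \<Sum>x\<in>G. a x $ j * D1 h j q x)"
    unfolding convection_def
    by (simp add: inner_sum_left sum_distrib_left[symmetric] sum.swap[of _ _ G] sum_divide_distrib[symmetric])
  also have "\<dots> = (1/2) * (\<Sum>j\<in>UNIV. - (\<Sum>x\<in>G. D1 h j (\<lambda>y. a y $ j) x * q x))"
  proof -
    have "(\<Sum>x\<in>G. a x $ j * D1 h j q x) = - (\<Sum>x\<in>G. D1 h j (\<lambda>y. a y $ j) x * q x)" for j
      using D1_adjoint[OF fin padq, of j "\<lambda>y. a y $ j"] by (simp add: mult.commute)
    then show ?thesis by simp
  qed
  also have "\<dots> = - (1/2) * (\<Sum>x\<in>G. grid_div h a x * q x)"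
    unfolding sum_negf grid_div_def sum_distrib_right by (subst sum.swap) simp
  also have "(\<Sum>x\<in>G. grid_div h a x * q x) = 0"
    by (rule sum.neutral) (use div in \<open>auto simp: q_def\<close>)
  finally show ?thesis by simp
qed

text \<open>Orthogonal projection onto the span of the \<open>g y\<close> by Gram-Schmidt along
  \<open>Y\<close>: the new function is first made orthogonal to the span of the earlier ones. The
  \<open>g y\<close> may be linearly dependent on \<open>I\<close>, as gradients of point masses are
  in general.\<close>

lemma least_squares:
  fixes g :: "'y \<Rightarrow> 'x \<Rightarrow> 'b::real_inner" and u :: "'x \<Rightarrow> 'b"
  assumes "finite Y" and fin: "finite I"
  shows "\<exists>c. \<forall>z\<in>Y. (\<Sum>x\<in>I. (u x - (\<Sum>y\<in>Y. c y *\<^sub>R g y x)) \<bullet> g z x) = 0"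
  using assms(1)
proof (induction Y arbitrary: u)
  case empty
  then show ?case by simp
next
  case (insert y Y)
  obtain cu where cu: "\<And>z. z \<in> Y \<Longrightarrow> (\<Sum>x\<in>I. (u x - (\<Sum>y\<in>Y. cu y *\<^sub>R g y x)) \<bullet> g z x) = 0"
    using insert.IH by blast
  obtain cg where cg: "\<And>z. z \<in> Y \<Longrightarrow> (\<Sum>x\<in>I. (g y x - (\<Sum>y\<in>Y. cg y *\<^sub>R g y x)) \<bullet> g z x) = 0"
    using insert.IH by blast
  define ru where "ru x = u x - (\<Sum>y\<in>Y. cu y *\<^sub>R g y x)" for x
  define rg where "rg x = g y x - (\<Sum>y\<in>Y. cg y *\<^sub>R g y x)" for x
  \<comment> \<open>If the residual \<open>rg\<close> vanishes on \<open>I\<close>, the quotient is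
    0 / 0 = 0, and every coefficient would do.\<close>
  define \<alpha> where "\<alpha> = (\<Sum>x\<in>I. ru x \<bullet> rg x) / (\<Sum>x\<in>I. rg x \<bullet> rg x)"
  define c where "c z = (if z = y then \<alpha> else cu z - \<alpha> * cg z)" for z
  have res: "u x - (\<Sum>z\<in>insert y Y. c z *\<^sub>R g z x) = ru x - \<alpha> *\<^sub>R rg x" for x
  proof -
    have "(\<Sum>z\<in>Y. c z *\<^sub>R g z x) = (\<Sum>z\<in>Y. cu z *\<^sub>R g z x) - \<alpha> *\<^sub>R (\<Sum>z\<in>Y. cg z *\<^sub>R g z x)"
      unfolding scaleR_sum_right sum_subtractf[symmetric]
      by (intro sum.cong refl) (use insert.hyps in \<open>auto simp: c_def algebra_simps\<close>)
    then show ?thesis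
      using insert.hyps by (simp add: c_def ru_def rg_def algebra_simps)
  qed
  have orth: "(\<Sum>x\<in>I. (ru x - \<alpha> *\<^sub>R rg x) \<bullet> g z x) = 0" if "z \<in> Y" for z
    using cu[OF that] cg[OF that]
    by (simp add: ru_def[symmetric] rg_def[symmetric] inner_diff_left sum_subtractf sum_distrib_left[symmetric])
  have orth_rg: "(\<Sum>x\<in>I. (ru x - \<alpha> *\<^sub>R rg x) \<bullet> rg x) = 0"
  proof (cases "(\<Sum>x\<in>I. rg x \<bullet> rg x) = 0")
    case True
    then have "rg x = 0" if "x \<in> I" for x
      using fin that by (simp add: sum_nonneg_eq_0_iff)
    then show ?thesis by simp
  next
    case False
    then have "\<alpha> * (\<Sum>x\<in>I. rg x \<bullet> rg x) = (\<Sum>x\<in>I. ru x \<bullet> rg x)"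
      by (simp add: \<alpha>_def)
    then show ?thesis
      by (simp add: inner_diff_left sum_subtractf sum_distrib_left[symmetric])
  qed
  have "(\<Sum>x\<in>I. (ru x - \<alpha> *\<^sub>R rg x) \<bullet> g y x)
      = (\<Sum>x\<in>I. (ru x - \<alpha> *\<^sub>R rg x) \<bullet> rg x) + (\<Sum>z\<in>Y. cg z * (\<Sum>x\<in>I. (ru x - \<alpha> *\<^sub>R rg x) \<bullet> g z x))"
  proof -
    have "(\<Sum>z\<in>Y. cg z * (\<Sum>x\<in>I. (ru x - \<alpha> *\<^sub>R rg x) \<bullet> g z x))
        = (\<Sum>x\<in>I. (ru x - \<alpha> *\<^sub>R rg x) \<bullet> (\<Sum>z\<in>Y. cg z *\<^sub>R g z x))"
      unfolding sum_distrib_left inner_sum_right by (subst sum.swap) simp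
    moreover have "g y x = rg x + (\<Sum>z\<in>Y. cg z *\<^sub>R g z x)" for x by (simp add: rg_def)
    ultimately show ?thesis by (simp add: inner_add_right sum.distrib del: inner_diff_left)
  qed
  then have "(\<Sum>x\<in>I. (ru x - \<alpha> *\<^sub>R rg x) \<bullet> g y x) = 0"
    using orth orth_rg by simp
  with orth show ?case
    by (intro exI[of _ c]) (auto simp: res)
qed

text \<open>After the neighbours of \<open>D\<close> have been added to the summation set,
  \<open>w\<close> is padded there; then each sum is confined to the support of the factor that
  vanishes elsewhere.\<close>

lemma grad_adjoint_supp:
  fixes w :: "real^3 \<Rightarrow> real^3"
  assumes fin: "finite D" "finite D'" and w: "\<And>x. x \<notin> D \<Longrightarrow> w x = 0" and \<phi>: "\<And>x. x \<notin> D' \<Longrightarrow> \<phi> x = 0"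
  shows "(\<Sum>x\<in>D. w x \<bullet> grid_grad h \<phi> x) = - (\<Sum>x\<in>D'. grid_div h w x * \<phi> x)"
proof -
  define G where "G = D \<union> D' \<union> (\<Union>i. (\<lambda>x. x + h *\<^sub>R ax i) ` D \<union> (\<lambda>x. x - h *\<^sub>R ax i) ` D)"
  have G: "finite G" unfolding G_def using fin by auto
  have "padded h G w" unfolding padded_def G_def using w by blast
  from grad_adjoint[OF G this, of \<phi>]
  have "(\<Sum>x\<in>G. w x \<bullet> grid_grad h \<phi> x) = - (\<Sum>x\<in>G. grid_div h w x * \<phi> x)" .
  moreover have "(\<Sum>x\<in>G. w x \<bullet> grid_grad h \<phi> x) = (\<Sum>x\<in>D. w x \<bullet> grid_grad h \<phi> x)"
    by (rule sum.mono_neutral_right) (use G w in \<open>auto simp: G_def\<close>)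
  moreover have "(\<Sum>x\<in>G. grid_div h w x * \<phi> x) = (\<Sum>x\<in>D'. grid_div h w x * \<phi> x)"
    by (rule sum.mono_neutral_right) (use G \<phi> in \<open>auto simp: G_def\<close>)
  ultimately show ?thesis by simp
qed

section \<open>Counting lattice points\<close>

text \<open>Integer coordinates are injective on the lattice, and an interval of length 2 \<rho>
  holds at most 2 \<rho> / h + 1 multiples of h. All volume bounds below go back to this
  count.\<close>

lemma grid_box_count:
  fixes y :: "real^3"
  assumes h: "0 < h" and \<rho>: "0 \<le> \<rho>"
  defines "S \<equiv> {x \<in> grid h. \<forall>k. \<bar>x $ k - y $ k\<bar> \<le> \<rho>}"
  shows "finite S" and "real (card S) \<le> (2 * \<rho> / h + 1) ^ 3"
proof -
  define A where "A k = {\<lceil>(y $ k - \<rho>) / h\<rceil>..\<lfloor>(y $ k + \<rho>) / h\<rfloor>}" for k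
  define F where "F x = (\<lfloor>x $ 1 / h\<rfloor>, \<lfloor>x $ 2 / h\<rfloor>, \<lfloor>x $ 3 / h\<rfloor>)" for x :: "real^3"
  have coord: "x $ k = h * of_int \<lfloor>x $ k / h\<rfloor>" if xg: "x \<in> grid h" for x k
  proof -
    obtain z :: int where "x $ k = h * of_int z" using xg unfolding grid_def by blast
    then show ?thesis using h by simp
  qed
  have inj: "inj_on F S"
  proof (rule inj_onI)
    fix x x' assume x: "x \<in> S" "x' \<in> S" and eq: "F x = F x'"
    have "x $ k = x' $ k" for k
      using coord[of x k] coord[of x' k] x eq exhaust_3[of k] unfolding F_def S_def by auto
    then show "x = x'" by (simp add: vec_eq_iff)
  qed
  have sub: "F ` S \<subseteq> A 1 \<times> A 2 \<times> A 3"
  proof -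
    have "\<lfloor>x $ k / h\<rfloor> \<in> A k" if "x \<in> S" for x k
    proof -
      have "\<bar>x $ k - y $ k\<bar> \<le> \<rho>" using that by (auto simp: S_def)
      then have "(y $ k - \<rho>) / h \<le> x $ k / h" "x $ k / h \<le> (y $ k + \<rho>) / h"
        using h by (auto intro!: divide_right_mono simp: abs_le_iff)
      moreover have "x $ k / h = of_int \<lfloor>x $ k / h\<rfloor>"
        using coord[of x k] that h by (auto simp: S_def field_simps)
      ultimately show ?thesis unfolding A_def by (metis atLeastAtMost_iff ceiling_le le_floor_iff)
    qed
    then show ?thesis unfolding F_def by auto
  qed
  have finA: "finite (A 1 \<times> A 2 \<times> A 3)" by (auto simp: A_def)
  show "finite S" using inj_on_finite[OF inj sub finA] .
  have cA: "real (card (A k)) \<le> 2 * \<rho> / h + 1" for k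
  proof -
    have 1: "of_int \<lfloor>(y $ k + \<rho>) / h\<rfloor> \<le> (y $ k + \<rho>) / h" "of_int \<lceil>(y $ k - \<rho>) / h\<rceil> \<ge> (y $ k - \<rho>) / h"
      by auto
    have "(y $ k + \<rho>) / h - (y $ k - \<rho>) / h = 2 * \<rho> / h"
      using h by (simp add: field_simps)
    then have "of_int (\<lfloor>(y $ k + \<rho>) / h\<rfloor> - \<lceil>(y $ k - \<rho>) / h\<rceil> + 1) \<le> 2 * \<rho> / h + 1"
      using 1 by linarith
    moreover have "0 \<le> 2 * \<rho> / h + 1" using h \<rho> by simp
    ultimately show ?thesis unfolding A_def by (simp add: of_nat_nat)
  qed
  have "card S \<le> card (A 1) * (card (A 2) * card (A 3))"
    using card_inj_on_le[OF inj sub finA] by (simp add: card_cartesian_product)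
  then have "real (card S) \<le> real (card (A 1)) * (real (card (A 2)) * real (card (A 3)))"
    by (metis of_nat_le_iff of_nat_mult)
  also have "\<dots> \<le> (2 * \<rho> / h + 1) * ((2 * \<rho> / h + 1) * (2 * \<rho> / h + 1))"
    using h \<rho> by (intro mult_mono cA) auto
  finally show "real (card S) \<le> (2 * \<rho> / h + 1) ^ 3" by (simp add: power3_eq_cube mult.assoc)
qed

lemma finite_grid_bounded:
  assumes "0 < h" and "bounded (S :: (real^3) set)"
  shows "finite (grid h \<inter> S)"
proof -
  obtain B where B: "\<And>x. x \<in> S \<Longrightarrow> norm x \<le> B" "0 < B"
    using assms(2) bounded_pos by metis
  have "grid h \<inter> S \<subseteq> {x \<in> grid h. \<forall>k. \<bar>x $ k - 0 $ k\<bar> \<le> B}"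
    using B component_le_norm_cart order_trans by fastforce
  then show ?thesis
    using grid_box_count(1)[of h B 0] assms(1) B(2) finite_subset by (metis (no_types, lifting) less_imp_le)
qed

lemma grid_domain_subset: "grid_domain \<Omega> h \<subseteq> grid h \<inter> \<Omega>"
  by (auto simp: grid_domain_def)

lemma finite_grid_domain: "0 < h \<Longrightarrow> bounded \<Omega> \<Longrightarrow> finite (grid_domain \<Omega> h)"
  using finite_grid_bounded grid_domain_subset finite_subset by metis

lemma grid_interior_subset: "grid_interior \<Omega> h \<subseteq> grid_domain \<Omega> h"
  by (auto simp: grid_interior_def)

lemma finite_grid_interior: "0 < h \<Longrightarrow> bounded \<Omega> \<Longrightarrow> finite (grid_interior \<Omega> h)"
  using finite_grid_domain grid_interior_subset finite_subset by metis

lemma grid_interior_nbr: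
  assumes "x \<in> grid_interior \<Omega> h"
  shows "x + h *\<^sub>R ax i \<in> grid_domain \<Omega> h" and "x - h *\<^sub>R ax i \<in> grid_domain \<Omega> h"
  using assms unfolding grid_interior_def grid_boundary_def by auto

section \<open>The discrete Helmholtz-Hodge decomposition: orthogonality, uniqueness,
  existence\<close>

lemma helmholtz_hodge_zero:
  assumes "helmholtz_hodge \<Omega> h u w \<phi>" and "x \<notin> grid_interior \<Omega> h"
  shows "w x = 0"
proof (cases "x \<in> grid_domain \<Omega> h")
  case True
  then have "x \<in> grid_boundary h (grid_domain \<Omega> h)" using assms(2) by (simp add: grid_interior_def)
  then show ?thesis using assms(1) by (simp add: helmholtz_hodge_def)
next
  case False
  then show ?thesis using assms(1) by (simp add: helmholtz_hodge_def grid_fun_def)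
qed

text \<open>\<open>w\<close> lives on the interior but is divergence-free on all of
  \<open>grid_domain\<close>, hence on the support of \<psi>, so summation by parts leaves
  nothing.\<close>

lemma helmholtz_hodge_orthogonal:
  assumes h: "0 < h" and bd: "bounded \<Omega>" and hh: "helmholtz_hodge \<Omega> h u w \<phi>"
    and \<psi>: "grid_fun \<Omega> h (\<psi> :: real^3 \<Rightarrow> real)"
  shows "(\<Sum>x\<in>grid_interior \<Omega> h. w x \<bullet> grid_grad h \<psi> x) = 0"
proof -
  note w0 = helmholtz_hodge_zero[OF hh]
  have "(\<Sum>x\<in>grid_interior \<Omega> h. w x \<bullet> grid_grad h \<psi> x) = - (\<Sum>x\<in>grid_domain \<Omega> h. grid_div h w x * \<psi> x)"
    using \<psi> w0 by (intro grad_adjoint_supp finite_grid_interior finite_grid_domain h bd) (auto simp: grid_fun_def)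
  also have "\<dots> = 0" using hh by (simp add: helmholtz_hodge_def)
  finally show ?thesis .
qed

lemma grid_grad_diff: "grid_grad h (\<lambda>x. \<phi> x - \<psi> x) x = grid_grad h \<phi> x - grid_grad h \<psi> x"
  by (simp add: grid_grad_def D1_def vec_eq_iff algebra_simps)

text \<open>The difference of two solutions is a gradient on the interior and at the same time
  orthogonal to gradients.\<close>

lemma helmholtz_hodge_unique:
  assumes h: "0 < h" and bd: "bounded \<Omega>"
    and hh: "helmholtz_hodge \<Omega> h u w \<phi>" "helmholtz_hodge \<Omega> h u w' \<phi>'"
  shows "w = w'"
proof -
  let ?I = "grid_interior \<Omega> h"
  have gf: "grid_fun \<Omega> h (\<lambda>x. \<phi> x - \<phi>' x)"
    using hh unfolding helmholtz_hodge_def grid_fun_def by simp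
  have g: "grid_grad h (\<lambda>x. \<phi> x - \<phi>' x) x = - (w x - w' x)" if "x \<in> ?I" for x
  proof -
    have "w x + grid_grad h \<phi> x = w' x + grid_grad h \<phi>' x"
      using hh that unfolding helmholtz_hodge_def by metis
    then show ?thesis unfolding grid_grad_diff by (simp add: algebra_simps)
  qed
  have "(\<Sum>x\<in>?I. (w x - w' x) \<bullet> (w x - w' x)) = - (\<Sum>x\<in>?I. (w x - w' x) \<bullet> grid_grad h (\<lambda>x. \<phi> x - \<phi>' x) x)"
    by (subst sum_negf[symmetric], intro sum.cong refl)
      (simp add: g inner_diff_right inner_diff_left)
  also have "\<dots> = 0"
    using helmholtz_hodge_orthogonal[OF h bd hh(1) gf] helmholtz_hodge_orthogonal[OF h bd hh(2) gf]
    by (simp add: inner_diff_left sum_subtractf)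
  finally have "\<forall>x\<in>?I. (w x - w' x) \<bullet> (w x - w' x) = 0"
    using finite_grid_interior[OF h bd] by (simp add: sum_nonneg_eq_0_iff)
  then have 1: "w x = w' x" if "x \<in> ?I" for x using that by simp
  have 2: "w x = w' x" if "x \<notin> ?I" for x
    using helmholtz_hodge_zero[OF hh(1) that] helmholtz_hodge_zero[OF hh(2) that] by simp
  show ?thesis using 1 2 by blast
qed

text \<open>Function form of \<open>parity_class\<close>, defined at every point, so that one
  constant per class can be subtracted by a formula.\<close>

definition parity :: "real \<Rightarrow> real^3 \<Rightarrow> bool^3" where
  "parity h x = (\<chi> i. even \<lfloor>x $ i / h\<rfloor>)"

lemma parity_class_parity: "0 < h \<Longrightarrow> x \<in> parity_class h c \<Longrightarrow> parity h x = c"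
  unfolding parity_def parity_class_def vec_eq_iff
proof (intro allI)
  fix i
  assume "0 < h" and "x \<in> {x. \<forall>i. \<exists>z::int. x $ i = h * of_int z \<and> even z = c $ i}"
  then obtain z :: int where "x $ i = h * of_int z" "even z = c $ i" by auto
  then show "(\<chi> i. even \<lfloor>x $ i / h\<rfloor>) $ i = c $ i" using \<open>0 < h\<close> by simp
qed

text \<open>A central difference joins two points of the same class, so it does not see constants on
  the classes. This is the freedom used to meet the eight mean conditions.\<close>

lemma parity_shift:
  assumes "0 < h"
  shows "parity h (x + h *\<^sub>R ax i) = parity h (x - h *\<^sub>R ax i)"
proof -
  have "even \<lfloor>(x + h *\<^sub>R ax i) $ k / h\<rfloor> = even \<lfloor>(x - h *\<^sub>R ax i) $ k / h\<rfloor>" for k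
  proof (cases "k = i")
    case True
    have "(x + h *\<^sub>R ax i) $ k / h = x $ k / h + 1" "(x - h *\<^sub>R ax i) $ k / h = x $ k / h - 1"
      using assms True by (simp_all add: add_divide_distrib diff_divide_distrib)
    then show ?thesis by simp
  qed (simp add: axis_def)
  then show ?thesis by (simp add: parity_def vec_eq_iff)
qed

text \<open>Least squares against the gradients of point masses in \<open>grid_domain\<close>: that
  the residual is orthogonal to the gradient of the mass at z says exactly that its divergence
  vanishes at z. Subtracting the class means afterwards leaves the gradient on the interior
  unchanged.\<close>

lemma helmholtz_hodge_exists:
  assumes h: "0 < h" and bd: "bounded \<Omega>"
  shows "\<exists>w \<phi>. helmholtz_hodge \<Omega> h u w \<phi>"
proof -
  let ?I = "grid_interior \<Omega> h" and ?D = "grid_domain \<Omega> h"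
  note fin = finite_grid_interior[OF h bd] finite_grid_domain[OF h bd]
  define \<delta> :: "real^3 \<Rightarrow> real^3 \<Rightarrow> real" where "\<delta> y x = (if x = y then 1 else 0)" for y x
  have "\<exists>c. \<forall>z\<in>?D. (\<Sum>x\<in>?I. (u x - (\<Sum>y\<in>?D. c y *\<^sub>R grid_grad h (\<delta> y) x)) \<bullet> grid_grad h (\<delta> z) x) = 0"
    by (rule least_squares[OF fin(2,1), where g="\<lambda>y. grid_grad h (\<delta> y)"])
  then obtain c where c: "\<forall>z\<in>?D. (\<Sum>x\<in>?I. (u x - (\<Sum>y\<in>?D. c y *\<^sub>R grid_grad h (\<delta> y) x)) \<bullet> grid_grad h (\<delta> z) x) = 0" ..
  define \<phi>0 where "\<phi>0 x = (if x \<in> ?D then c x else 0)" for x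
  have \<phi>0: "\<phi>0 x = (\<Sum>y\<in>?D. c y * \<delta> y x)" for x
    using fin by (simp add: \<phi>0_def \<delta>_def if_distrib sum.delta cong: if_cong)
  have grad0: "grid_grad h \<phi>0 x = (\<Sum>y\<in>?D. c y *\<^sub>R grid_grad h (\<delta> y) x)" for x
    by (simp add: grid_grad_def D1_def vec_eq_iff \<phi>0 sum_subtractf[symmetric] sum_distrib_left algebra_simps)
  define w where "w x = (if x \<in> ?I then u x - grid_grad h \<phi>0 x else 0)" for x
  have w0: "w x = 0" if "x \<notin> ?I" for x using that by (simp add: w_def)
  have div: "grid_div h w z = 0" if "z \<in> ?D" for z
  proof -
    have "(\<Sum>x\<in>?I. w x \<bullet> grid_grad h (\<delta> z) x) = - (\<Sum>x\<in>?D. grid_div h w x * \<delta> z x)"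
      using that by (intro grad_adjoint_supp fin w0) (auto simp: \<delta>_def)
    moreover have "(\<Sum>x\<in>?I. w x \<bullet> grid_grad h (\<delta> z) x) = 0"
      using c that by (simp add: w_def grad0)
    ultimately show ?thesis
      using fin that by (simp add: \<delta>_def if_distrib sum.delta cong: if_cong)
  qed
  \<comment> \<open>For an empty class the value is 0 / 0 = 0, and its mean condition is an empty
    sum.\<close>
  define m where "m q = (\<Sum>x\<in>grid_core_class \<Omega> h q. \<phi>0 x) / card (grid_core_class \<Omega> h q)" for q
  define \<phi> where "\<phi> x = (if x \<in> ?D then \<phi>0 x - m (parity h x) else 0)" for x
  have core: "grid_core_class \<Omega> h q \<subseteq> ?D" for q
    using grid_interior_subset by (auto simp: grid_core_class_def grid_core_def)
  have grad: "grid_grad h \<phi> x = grid_grad h \<phi>0 x" if "x \<in> ?I" for x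
  proof -
    have "D1 h i \<phi> x = D1 h i \<phi>0 x" for i
      using grid_interior_nbr[OF that, of i] parity_shift[OF h, of x i] by (simp add: D1_def \<phi>_def)
    then show ?thesis by (simp add: grid_grad_def)
  qed
  have mean: "(\<Sum>x\<in>grid_core_class \<Omega> h q. \<phi> x) = 0" for q
  proof -
    have "(\<Sum>x\<in>grid_core_class \<Omega> h q. \<phi> x) = (\<Sum>x\<in>grid_core_class \<Omega> h q. \<phi>0 x - m q)"
    proof (rule sum.cong[OF refl])
      fix x assume x: "x \<in> grid_core_class \<Omega> h q"
      then have "parity h x = q" using parity_class_parity[OF h] by (auto simp: grid_core_class_def)
      then show "\<phi> x = \<phi>0 x - m q" using core x by (auto simp: \<phi>_def)
    qed
    also have "\<dots> = 0"
      using finite_subset[OF core fin(2), of q]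
      by (cases "grid_core_class \<Omega> h q = {}") (auto simp: sum_subtractf m_def)
    finally show ?thesis .
  qed
  have "helmholtz_hodge \<Omega> h u w \<phi>"
    unfolding helmholtz_hodge_def grid_fun_def
  proof (intro conjI allI ballI impI)
    show "w x = 0" if "x \<notin> ?D" for x using that grid_interior_subset w0 by blast
    show "w x = 0" if "x \<in> grid_boundary h ?D" for x using that w0 by (simp add: grid_interior_def)
    show "w x + grid_grad h \<phi> x = u x" if "x \<in> ?I" for x using that grad[OF that] by (simp add: w_def)
  qed (use div mean in \<open>simp_all add: \<phi>_def\<close>)
  then show ?thesis by blast
qed

lemma helmholtz_hodge_P_h:
  assumes "0 < h" and "bounded \<Omega>"
  shows "\<exists>\<phi>. helmholtz_hodge \<Omega> h u (P_h \<Omega> h u) \<phi>"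
proof -
  have "\<exists>!w. \<exists>\<phi>. helmholtz_hodge \<Omega> h u w \<phi>"
    using helmholtz_hodge_exists[OF assms] helmholtz_hodge_unique[OF assms] by blast
  from theI'[OF this] show ?thesis unfolding P_h_def .
qed

section \<open>Discrete energy estimates\<close>

text \<open>\<open>grid_norm\<close> over an arbitrary set, so that one calculus serves the
  interior, the padded set around it and the larger \<open>grid_nbhd\<close>.\<close>

definition gnorm :: "real \<Rightarrow> (real^3) set \<Rightarrow> (real^3 \<Rightarrow> real^3) \<Rightarrow> real" where
  "gnorm h G a = sqrt (\<Sum>x\<in>G. (norm (a x))\<^sup>2 * h^3)"

lemma grid_norm_gnorm: "grid_norm \<Omega> h = gnorm h (grid_domain \<Omega> h)"
  by (simp add: grid_norm_def gnorm_def fun_eq_iff)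

lemma gnorm_L2_set: "gnorm h G a = sqrt (h^3) * L2_set (\<lambda>x. norm (a x)) G"
  by (simp add: gnorm_def L2_set_def real_sqrt_mult[symmetric] sum_distrib_left mult.commute)

lemma gnorm_nonneg [simp]: "0 \<le> h \<Longrightarrow> 0 \<le> gnorm h G a"
  by (simp add: gnorm_L2_set)

lemma gnorm_sq: "0 \<le> h \<Longrightarrow> (gnorm h G a)\<^sup>2 = (\<Sum>x\<in>G. (norm (a x))\<^sup>2 * h^3)"
  by (simp add: gnorm_def sum_nonneg)

lemma gnorm_cauchy_schwarz:
  assumes "0 \<le> h"
  shows "\<bar>\<Sum>x\<in>G. a x \<bullet> b x * h^3\<bar> \<le> gnorm h G a * gnorm h G b"
proof -
  have "\<bar>\<Sum>x\<in>G. a x \<bullet> b x * h^3\<bar> \<le> (\<Sum>x\<in>G. \<bar>norm (a x)\<bar> * \<bar>norm (b x)\<bar>) * h^3"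
    unfolding sum_distrib_right[symmetric] abs_mult
    using assms by (intro mult_mono order_trans[OF sum_abs] sum_mono) (auto simp: Cauchy_Schwarz_ineq2 sum_nonneg)
  also have "\<dots> \<le> (L2_set (\<lambda>x. norm (a x)) G * L2_set (\<lambda>x. norm (b x)) G) * h^3"
    using assms by (intro mult_right_mono L2_set_mult_ineq) auto
  also have "\<dots> = gnorm h G a * gnorm h G b"
    using assms by (simp add: gnorm_L2_set)
  finally show ?thesis .
qed

lemma gnorm_triangle:
  assumes "0 \<le> h"
  shows "gnorm h G (\<lambda>x. a x + b x) \<le> gnorm h G a + gnorm h G b"
proof -
  have "L2_set (\<lambda>x. norm (a x + b x)) G \<le> L2_set (\<lambda>x. norm (a x) + norm (b x)) G"
    by (intro L2_set_mono norm_triangle_ineq) auto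
  also have "\<dots> \<le> L2_set (\<lambda>x. norm (a x)) G + L2_set (\<lambda>x. norm (b x)) G"
    by (rule L2_set_triangle_ineq)
  finally show ?thesis
    using assms unfolding gnorm_L2_set distrib_left[symmetric] by (intro mult_left_mono) auto
qed

lemma gnorm_mono:
  assumes "0 \<le> h" and "\<And>x. x \<in> G \<Longrightarrow> norm (a x) \<le> norm (b x)"
  shows "gnorm h G a \<le> gnorm h G b"
  unfolding gnorm_def using assms
  by (intro real_sqrt_le_mono sum_mono mult_right_mono power_mono) auto

lemma gnorm_scaleR: "gnorm h G (\<lambda>x. c *\<^sub>R a x) = \<bar>c\<bar> * gnorm h G a"
  unfolding gnorm_L2_set by (simp add: L2_set_right_distrib)

lemma gnorm_sum:
  assumes "0 \<le> h" "finite J"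
  shows "gnorm h G (\<lambda>x. \<Sum>j\<in>J. a j x) \<le> (\<Sum>j\<in>J. gnorm h G (a j))"
  using assms(2)
proof (induction J)
  case (insert j J)
  have "gnorm h G (\<lambda>x. \<Sum>j\<in>insert j J. a j x) = gnorm h G (\<lambda>x. a j x + (\<Sum>j\<in>J. a j x))"
    using insert.hyps by simp
  also have "\<dots> \<le> gnorm h G (a j) + gnorm h G (\<lambda>x. \<Sum>j\<in>J. a j x)"
    by (rule gnorm_triangle[OF assms(1)])
  finally show ?case using insert by simp
qed (simp add: gnorm_def)

lemma gnorm_shift:
  assumes "0 \<le> h" "finite I" and "\<And>x. x \<notin> I \<Longrightarrow> a x = 0"
  shows "gnorm h I (\<lambda>x. a (x + s)) \<le> gnorm h I a"
proof -
  have "(\<Sum>x\<in>I. (norm (a (x + s)))\<^sup>2 * h^3) = (\<Sum>x\<in>(\<lambda>x. x + s) ` I. (norm (a x))\<^sup>2 * h^3)"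
    by (subst sum.reindex) (auto simp: inj_on_def)
  also have "\<dots> \<le> (\<Sum>x\<in>(\<lambda>x. x + s) ` I \<union> I. (norm (a x))\<^sup>2 * h^3)"
    by (rule sum_mono2) (use assms in auto)
  also have "\<dots> = (\<Sum>x\<in>I. (norm (a x))\<^sup>2 * h^3)"
    by (rule sum.mono_neutral_right) (use assms in auto)
  finally show ?thesis unfolding gnorm_def by (rule real_sqrt_le_mono)
qed

text \<open>Two uses: a pointwise bound on a set of bounded volume, as for the consistency error,
  and an O(1) bound on the boundary layer, where K = O(h) produces a factor sqrt h.\<close>

lemma gnorm_le:
  assumes h: "0 \<le> h" and c: "0 \<le> c" and K: "0 \<le> K" and fin: "finite G"
    and b: "\<And>x. x \<in> G \<Longrightarrow> norm (a x) \<le> c" and S: "real (card {x\<in>G. a x \<noteq> 0}) * h^3 \<le> K"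
  shows "gnorm h G a \<le> c * sqrt K"
proof -
  have "(\<Sum>x\<in>G. (norm (a x))\<^sup>2 * h^3) = (\<Sum>x\<in>{x\<in>G. a x \<noteq> 0}. (norm (a x))\<^sup>2 * h^3)"
    by (rule sum.mono_neutral_right) (use fin in auto)
  also have "\<dots> \<le> (\<Sum>x\<in>{x\<in>G. a x \<noteq> 0}. c\<^sup>2 * h^3)"
    using b h by (intro sum_mono mult_right_mono power_mono) auto
  also have "\<dots> = c\<^sup>2 * (real (card {x\<in>G. a x \<noteq> 0}) * h^3)" by simp
  also have "\<dots> \<le> c\<^sup>2 * K" using S by (intro mult_left_mono) auto
  finally have "gnorm h G a \<le> sqrt (c\<^sup>2 * K)" unfolding gnorm_def by (rule real_sqrt_le_mono)
  then show ?thesis using c by (simp add: real_sqrt_mult)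
qed

lemma norm_convection_le:
  assumes "\<And>y j. norm (D1 h j b y) \<le> L"
  shows "norm (convection h a b x) \<le>
    L / 2 * (\<Sum>j\<in>UNIV. norm (a (x - h *\<^sub>R ax j)) + norm (a (x + h *\<^sub>R ax j)))"
proof -
  have L: "0 \<le> L" using assms[of undefined undefined] norm_ge_zero order_trans by blast
  have *: "norm (a y $ j *\<^sub>R D1 h j b y) \<le> L * norm (a y)" for y j
    using mult_mono[OF component_le_norm_cart[of "a y" j] assms[of j y]] by (simp add: mult.commute)
  have "norm (convection h a b x) \<le> 1/2 * (\<Sum>j\<in>UNIV. L * norm (a (x - h *\<^sub>R ax j)) + L * norm (a (x + h *\<^sub>R ax j)))"
    unfolding convection_def norm_scaleR
    by (intro mult_mono order_trans[OF norm_sum] sum_mono order_trans[OF norm_triangle_ineq] add_mono *) auto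
  also have "\<dots> = L / 2 * (\<Sum>j\<in>UNIV. norm (a (x - h *\<^sub>R ax j)) + norm (a (x + h *\<^sub>R ax j)))"
    by (simp add: sum_distrib_left algebra_simps)
  finally show ?thesis .
qed

text \<open>Six neighbour translates of \<open>a\<close>, each with weight L / 2 and with norm at
  most that of \<open>a\<close>.\<close>

lemma gnorm_convection_le:
  assumes h: "0 \<le> h" and fin: "finite I" and a: "\<And>x. x \<notin> I \<Longrightarrow> a x = 0"
    and L: "\<And>y j. norm (D1 h j b y) \<le> L"
  shows "gnorm h I (convection h a b) \<le> 3 * L * gnorm h I a"
proof -
  have L0: "0 \<le> L" using L[of undefined undefined] norm_ge_zero order_trans by blast
  \<comment> \<open>\<open>gnorm\<close> takes vector fields, so the scalars |a| are carried by a
    fixed unit vector.\<close>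
  define e where "e = (axis 1 1 :: real^3)"
  have e: "norm e = 1" by (simp add: e_def norm_axis_1)
  define N where "N j x = norm (a (x - h *\<^sub>R ax j)) *\<^sub>R e + norm (a (x + h *\<^sub>R ax j)) *\<^sub>R e" for j x
  have eq: "(\<Sum>j\<in>UNIV. N j x) = (\<Sum>j\<in>UNIV. norm (a (x - h *\<^sub>R ax j)) + norm (a (x + h *\<^sub>R ax j))) *\<^sub>R e" for x
    by (simp add: N_def scaleR_left.sum algebra_simps)
  have "gnorm h I (convection h a b) \<le> gnorm h I (\<lambda>x. (L/2) *\<^sub>R (\<Sum>j\<in>UNIV. N j x))"
  proof (rule gnorm_mono[OF h])
    fix x
    have "norm (convection h a b x) \<le> L / 2 * (\<Sum>j\<in>UNIV. norm (a (x - h *\<^sub>R ax j)) + norm (a (x + h *\<^sub>R ax j)))"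
      by (rule norm_convection_le) (rule L)
    also have "\<dots> = norm ((L/2) *\<^sub>R (\<Sum>j\<in>UNIV. N j x))"
      unfolding eq using L0 e by (simp add: sum_nonneg add_nonneg_nonneg)
    finally show "norm (convection h a b x) \<le> norm ((L/2) *\<^sub>R (\<Sum>j\<in>UNIV. N j x))" .
  qed
  also have "\<dots> \<le> (L/2) * (\<Sum>j\<in>UNIV. gnorm h I (N j))"
    unfolding gnorm_scaleR using L0 gnorm_sum[OF h, of UNIV I N] by (simp add: mult_left_mono)
  also have "\<dots> \<le> (L/2) * (\<Sum>j\<in>(UNIV :: 3 set). 2 * gnorm h I a)"
  proof (intro mult_left_mono sum_mono)
    fix j :: 3
    have "gnorm h I (\<lambda>x. norm (a (x + s)) *\<^sub>R e) \<le> gnorm h I a" for s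
      using gnorm_shift[OF h fin a, where s=s] by (simp add: gnorm_def e)
    from this[of "- h *\<^sub>R ax j"] this[of "h *\<^sub>R ax j"]
    show "gnorm h I (N j) \<le> 2 * gnorm h I a"
      using gnorm_triangle[OF h, of I "\<lambda>x. norm (a (x - h *\<^sub>R ax j)) *\<^sub>R e" "\<lambda>x. norm (a (x + h *\<^sub>R ax j)) *\<^sub>R e"]
      by (simp add: N_def[abs_def])
  qed (use L0 in auto)
  also have "\<dots> = 3 * L * gnorm h I a" by simp
  finally show ?thesis .
qed

text \<open>\<open>Et\<close> is the error before the projection, \<open>e\<close> the projected
  error of the previous step, \<open>B\<close> the boundary defect. Tested with \<open>Et\<close>,
  the convection by \<open>u\<close> drops out by skewness, and completing the square lets the
  dissipation of \<open>Et\<close> absorb the defect up to a quarter of the squared gradient of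
  \<open>B\<close>. The pairing with \<open>g\<close> is kept as it stands, since orthogonality and
  not size controls it.\<close>

lemma energy_step:
  fixes Et e u Q B g R :: "real^3 \<Rightarrow> real^3"
  assumes h: "0 < h" and \<tau>: "0 < \<tau>" and fin: "finite I" "finite G" and IG: "I \<subseteq> G"
    and pad: "padded h G Et" and Et0: "\<And>x. x \<notin> I \<Longrightarrow> Et x = 0"
    and div: "\<And>x. x \<in> I \<Longrightarrow> grid_div h u x = 0"
    and eq: "\<And>x. x \<in> I \<Longrightarrow> (Et x - e x) /\<^sub>R \<tau> = - convection h u Et x - Q x
        + (\<Sum>j\<in>UNIV. D2 h j Et x) - (\<Sum>j\<in>UNIV. D2 h j B x) + g x - R x"
  shows "(gnorm h I Et)\<^sup>2 - (gnorm h I e)\<^sup>2 \<le>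
    2 * \<tau> * (gnorm h I Q * gnorm h I Et + gnorm h I R * gnorm h I Et
      + (\<Sum>x\<in>I. g x \<bullet> Et x * h^3) + (\<Sum>j\<in>UNIV. (gnorm h G (Df h j B))\<^sup>2) / 4)"
proof -
  have toG: "(\<Sum>x\<in>I. a x \<bullet> Et x) = (\<Sum>x\<in>G. a x \<bullet> Et x)" for a
    by (rule sum.mono_neutral_left) (use fin IG Et0 in auto)
  have h3: "0 < h^3" using h by simp
  have conv: "(\<Sum>x\<in>I. convection h u Et x \<bullet> Et x) = 0"
    unfolding toG by (rule convection_skew[OF fin(2) pad]) (use Et0 div in blast)
  have visc: "(\<Sum>x\<in>I. ((\<Sum>j\<in>UNIV. D2 h j Et x) - (\<Sum>j\<in>UNIV. D2 h j B x)) \<bullet> Et x)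
      \<le> (\<Sum>j\<in>UNIV. \<Sum>x\<in>G. (norm (Df h j B x))\<^sup>2) / 4"
  proof -
    have "(\<Sum>x\<in>I. ((\<Sum>j\<in>UNIV. D2 h j Et x) - (\<Sum>j\<in>UNIV. D2 h j B x)) \<bullet> Et x)
       = (\<Sum>j\<in>UNIV. (\<Sum>x\<in>G. D2 h j Et x \<bullet> Et x) - (\<Sum>x\<in>G. D2 h j B x \<bullet> Et x))"
    proof -
      have "(\<Sum>x\<in>I. ((\<Sum>j\<in>UNIV. D2 h j Et x) - (\<Sum>j\<in>UNIV. D2 h j B x)) \<bullet> Et x)
         = (\<Sum>x\<in>I. \<Sum>j\<in>UNIV. (D2 h j Et x - D2 h j B x) \<bullet> Et x)"
        by (simp add: inner_diff_left inner_sum_left sum_subtractf)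
      also have "\<dots> = (\<Sum>j\<in>UNIV. \<Sum>x\<in>G. (D2 h j Et x - D2 h j B x) \<bullet> Et x)"
        by (subst sum.swap) (simp only: toG)
      finally show ?thesis by (simp add: inner_diff_left sum_subtractf)
    qed
    also have "\<dots> = (\<Sum>j\<in>UNIV. \<Sum>x\<in>G. Df h j B x \<bullet> Df h j Et x - Df h j Et x \<bullet> Df h j Et x)"
      by (simp add: D2_adjoint[OF fin(2) pad] sum_subtractf)
    also have "\<dots> \<le> (\<Sum>j\<in>UNIV. \<Sum>x\<in>G. (norm (Df h j B x))\<^sup>2 / 4)"
    proof (intro sum_mono)
      fix j x
      have "0 \<le> (norm (Df h j Et x - (1/2) *\<^sub>R Df h j B x))\<^sup>2" by simp
      also have "\<dots> = Df h j Et x \<bullet> Df h j Et x - Df h j B x \<bullet> Df h j Et x + (norm (Df h j B x))\<^sup>2 / 4"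
        by (simp add: power2_norm_eq_inner inner_diff_left inner_diff_right inner_commute)
      finally show "Df h j B x \<bullet> Df h j Et x - Df h j Et x \<bullet> Df h j Et x \<le> (norm (Df h j B x))\<^sup>2 / 4" by simp
    qed
    finally show ?thesis by (simp add: sum_divide_distrib)
  qed
  have main: "(\<Sum>x\<in>I. (Et x - e x) \<bullet> Et x) =
    \<tau> * (- (\<Sum>x\<in>I. convection h u Et x \<bullet> Et x) - (\<Sum>x\<in>I. Q x \<bullet> Et x)
     + (\<Sum>x\<in>I. ((\<Sum>j\<in>UNIV. D2 h j Et x) - (\<Sum>j\<in>UNIV. D2 h j B x)) \<bullet> Et x)
     + (\<Sum>x\<in>I. g x \<bullet> Et x) - (\<Sum>x\<in>I. R x \<bullet> Et x))"
  proof -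
    have "(\<Sum>x\<in>I. (Et x - e x) \<bullet> Et x) = \<tau> * (\<Sum>x\<in>I. ((Et x - e x) /\<^sub>R \<tau>) \<bullet> Et x)"
      using \<tau> by (simp add: sum_distrib_left mult.assoc[symmetric])
    also have "(\<Sum>x\<in>I. ((Et x - e x) /\<^sub>R \<tau>) \<bullet> Et x) =
       - (\<Sum>x\<in>I. convection h u Et x \<bullet> Et x) - (\<Sum>x\<in>I. Q x \<bullet> Et x)
     + (\<Sum>x\<in>I. ((\<Sum>j\<in>UNIV. D2 h j Et x) - (\<Sum>j\<in>UNIV. D2 h j B x)) \<bullet> Et x)
     + (\<Sum>x\<in>I. g x \<bullet> Et x) - (\<Sum>x\<in>I. R x \<bullet> Et x)"
    proof -
      have "(\<Sum>x\<in>I. ((Et x - e x) /\<^sub>R \<tau>) \<bullet> Et x) = (\<Sum>x\<in>I. (- convection h u Et x - Q x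
        + ((\<Sum>j\<in>UNIV. D2 h j Et x) - (\<Sum>j\<in>UNIV. D2 h j B x)) + g x - R x) \<bullet> Et x)"
        by (intro sum.cong refl) (simp only: eq add_diff_eq)
      then show ?thesis
        by (simp only: inner_diff_left inner_add_left inner_minus_left sum_subtractf sum.distrib sum_negf)
    qed
    finally show ?thesis .
  qed
  have "(gnorm h I Et)\<^sup>2 - (gnorm h I e)\<^sup>2 = (\<Sum>x\<in>I. (norm (Et x))\<^sup>2 - (norm (e x))\<^sup>2) * h^3"
    using h by (simp add: gnorm_sq sum_subtractf sum_distrib_right[symmetric] left_diff_distrib)
  also have "\<dots> \<le> (\<Sum>x\<in>I. 2 * ((Et x - e x) \<bullet> Et x)) * h^3"
  proof (intro mult_right_mono sum_mono)
    fix x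
    have "0 \<le> (norm (Et x - e x))\<^sup>2" by simp
    then show "(norm (Et x))\<^sup>2 - (norm (e x))\<^sup>2 \<le> 2 * ((Et x - e x) \<bullet> Et x)"
      by (simp add: power2_norm_eq_inner inner_diff_left inner_diff_right inner_commute)
  qed (use h in auto)
  also have "\<dots> = 2 * \<tau> * ((- (\<Sum>x\<in>I. Q x \<bullet> Et x)
     + (\<Sum>x\<in>I. ((\<Sum>j\<in>UNIV. D2 h j Et x) - (\<Sum>j\<in>UNIV. D2 h j B x)) \<bullet> Et x)
     + (\<Sum>x\<in>I. g x \<bullet> Et x) - (\<Sum>x\<in>I. R x \<bullet> Et x)) * h^3)"
    unfolding sum_distrib_left[symmetric] main conv by simp
  also have "\<dots> \<le> 2 * \<tau> * (gnorm h I Q * gnorm h I Et + gnorm h I R * gnorm h I Et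
      + (\<Sum>x\<in>I. g x \<bullet> Et x * h^3) + (\<Sum>j\<in>UNIV. (gnorm h G (Df h j B))\<^sup>2) / 4)"
  proof (intro mult_left_mono)
    have 1: "- (\<Sum>x\<in>I. Q x \<bullet> Et x) * h^3 \<le> gnorm h I Q * gnorm h I Et"
      using gnorm_cauchy_schwarz[of h Q Et I] h by (simp add: sum_distrib_right[symmetric])
    have 2: "- (\<Sum>x\<in>I. R x \<bullet> Et x) * h^3 \<le> gnorm h I R * gnorm h I Et"
      using gnorm_cauchy_schwarz[of h R Et I] h by (simp add: sum_distrib_right[symmetric])
    have 3: "(\<Sum>j\<in>UNIV. \<Sum>x\<in>G. (norm (Df h j B x))\<^sup>2) / 4 * h^3 = (\<Sum>j\<in>UNIV. (gnorm h G (Df h j B))\<^sup>2) / 4"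
      using h by (simp add: gnorm_sq sum_distrib_right)
    have 4: "(\<Sum>x\<in>I. ((\<Sum>j\<in>UNIV. D2 h j Et x) - (\<Sum>j\<in>UNIV. D2 h j B x)) \<bullet> Et x) * h^3
       \<le> (\<Sum>j\<in>UNIV. \<Sum>x\<in>G. (norm (Df h j B x))\<^sup>2) / 4 * h^3"
      using visc h3 by (intro mult_right_mono) auto
    show "(- (\<Sum>x\<in>I. Q x \<bullet> Et x) + (\<Sum>x\<in>I. ((\<Sum>j\<in>UNIV. D2 h j Et x) - (\<Sum>j\<in>UNIV. D2 h j B x)) \<bullet> Et x)
     + (\<Sum>x\<in>I. g x \<bullet> Et x) - (\<Sum>x\<in>I. R x \<bullet> Et x)) * h^3
     \<le> gnorm h I Q * gnorm h I Et + gnorm h I R * gnorm h I Et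
      + (\<Sum>x\<in>I. g x \<bullet> Et x * h^3) + (\<Sum>j\<in>UNIV. (gnorm h G (Df h j B))\<^sup>2) / 4"
      using 1 2 4 unfolding 3 sum_distrib_right[symmetric]
      by (simp only: distrib_right left_diff_distrib)
  qed (use \<tau> in auto)
  finally show ?thesis .
qed

section \<open>Scalar recurrences for the squared errors\<close>

text \<open>Here \<open>a\<close>, \<open>b\<close>, \<open>a'\<close> are the squared errors before
  the step, before the projection and after it, and \<open>d\<close> is the norm of the gradient
  removed. The gain d^2 in \<open>ii\<close> pays for both terms linear in \<open>d\<close> and
  leaves multiples of K^2 \<tau>^2 and K^2 h^2, the latter without a factor \<tau>. For
  \<open>b\<close> itself there is no such gain, so a cruder bound with factor 6 is taken, which is
  harmless because it is not iterated.\<close>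

lemma recurrence_step:
  fixes a b a' d h K \<tau> :: real
  assumes nn: "0 \<le> a" "0 \<le> b" "0 \<le> h" "0 \<le> d" and K: "0 < K" and \<tau>: "0 < \<tau>" and small: "K * \<tau> \<le> 1/2"
    and i: "b - a \<le> K * \<tau> * (a + b + h + \<tau>\<^sup>2) + K * \<tau> * d"
    and ii: "a' \<le> b - d\<^sup>2 + K * h * d"
  shows "a' \<le> (1 + 4 * K * \<tau>) * a + (2 * K * \<tau> * (h + \<tau>\<^sup>2) + 2 * K\<^sup>2 * \<tau>\<^sup>2 + K\<^sup>2 * h\<^sup>2)"
    and "0 \<le> a' \<Longrightarrow> b \<le> 6 * a + 4 * K * \<tau> * (h + \<tau>\<^sup>2) + K\<^sup>2 * h\<^sup>2 + 8 * K\<^sup>2 * \<tau>\<^sup>2"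
proof -
  define y where "y = K * \<tau>"
  have y: "0 < y" "y \<le> 1/2" using K \<tau> small by (auto simp: y_def)
  define X where "X = y * (h + \<tau>\<^sup>2) + y * d"
  have X: "0 \<le> X" using y nn by (auto simp: X_def intro!: add_nonneg_nonneg mult_nonneg_nonneg)
  have i': "b * (1 - y) \<le> (1 + y) * a + X"
    using i by (simp add: X_def y_def algebra_simps)
  \<comment> \<open>In place of a division by 1 - y: the product (1 - y) (1 + 2 y) is at least 1
    because y <= 1/2.\<close>
  have "b = b * ((1 - y) * (1 + 2 * y) - y * (1 - 2 * y))" by (simp add: algebra_simps power2_eq_square)
  also have "\<dots> \<le> b * ((1 - y) * (1 + 2 * y))"
    using y nn by (intro mult_left_mono) auto
  also have "\<dots> = (b * (1 - y)) * (1 + 2 * y)" by simp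
  also have "\<dots> \<le> ((1 + y) * a + X) * (1 + 2 * y)"
    using i' y by (intro mult_right_mono) auto
  also have "\<dots> = ((1 + y) * (1 + 2 * y)) * a + (1 + 2 * y) * X" by (simp add: algebra_simps)
  also have "\<dots> \<le> (1 + 4 * y) * a + 2 * X"
  proof -
    have "y * y \<le> y * (1/2)" using y by (intro mult_left_mono) auto
    then have "(1 + y) * (1 + 2 * y) \<le> 1 + 4 * y" by (simp add: algebra_simps)
    then show ?thesis using nn X y by (intro add_mono mult_right_mono) auto
  qed
  finally have b: "b \<le> (1 + 4 * y) * a + 2 * X" .
  have d1: "2 * (y * d) \<le> d\<^sup>2 / 2 + 2 * y\<^sup>2"
    using zero_le_power2[of "d - 2 * y"] by (simp add: power2_diff algebra_simps power2_eq_square)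
  have d2: "K * h * d \<le> d\<^sup>2 / 2 + K\<^sup>2 * h\<^sup>2 / 2"
    using zero_le_power2[of "d - K * h"] by (simp add: power2_eq_square algebra_simps)
  have "a' \<le> (1 + 4 * y) * a + 2 * (y * (h + \<tau>\<^sup>2)) + 2 * (y * d) - d\<^sup>2 + K * h * d"
    using ii b by (simp add: X_def algebra_simps)
  also have "\<dots> \<le> (1 + 4 * y) * a + 2 * (y * (h + \<tau>\<^sup>2)) + 2 * y\<^sup>2 + K\<^sup>2 * h\<^sup>2"
    using d1 d2 zero_le_power2[of "K * h"] unfolding power_mult_distrib by linarith
  finally show "a' \<le> (1 + 4 * K * \<tau>) * a + (2 * K * \<tau> * (h + \<tau>\<^sup>2) + 2 * K\<^sup>2 * \<tau>\<^sup>2 + K\<^sup>2 * h\<^sup>2)"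
    by (simp add: y_def power_mult_distrib mult.assoc)
  assume a': "0 \<le> a'"
  \<comment> \<open>The gain read backwards: as the projected error cannot be negative, d^2 is
    bounded by \<open>b\<close>. The weight 1/4 in the next estimate keeps half of \<open>b\<close>
    on the left.\<close>
  have dd: "d\<^sup>2 \<le> 2 * b + K\<^sup>2 * h\<^sup>2" using ii a' d2 by simp
  have d3: "2 * (y * d) \<le> d\<^sup>2 / 4 + 4 * y\<^sup>2"
    using zero_le_power2[of "d / 2 - 2 * y"] by (simp add: power2_diff algebra_simps power2_eq_square)
  have "4 * y * a \<le> 2 * a" using y nn mult_right_mono[of "4*y" 2 a] by simp
  then have "b \<le> 3 * a + 2 * (y * (h + \<tau>\<^sup>2)) + d\<^sup>2 / 4 + 4 * y\<^sup>2"
    using b d3 by (simp add: X_def algebra_simps)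
  then have "b / 2 \<le> 3 * a + 2 * (y * (h + \<tau>\<^sup>2)) + K\<^sup>2 * h\<^sup>2 / 4 + 4 * y\<^sup>2"
    using dd by linarith
  moreover have "0 \<le> K\<^sup>2 * h\<^sup>2" by simp
  ultimately have "b \<le> 6 * a + 4 * (y * (h + \<tau>\<^sup>2)) + K\<^sup>2 * h\<^sup>2 + 8 * y\<^sup>2" by linarith
  then show "b \<le> 6 * a + 4 * K * \<tau> * (h + \<tau>\<^sup>2) + K\<^sup>2 * h\<^sup>2 + 8 * K\<^sup>2 * \<tau>\<^sup>2"
    by (simp add: y_def power_mult_distrib mult.assoc)
qed

lemma discrete_gronwall:
  fixes a :: "nat \<Rightarrow> real"
  assumes q: "0 \<le> q" and r: "0 \<le> r" and a0: "0 \<le> a 0"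
    and step: "\<And>n. n < N \<Longrightarrow> a (Suc n) \<le> (1 + q) * a n + r" and n: "n \<le> N"
  shows "a n \<le> exp (q * real n) * (a 0 + real n * r)"
  using n
proof (induction n)
  case (Suc n)
  let ?X = "exp (q * real n) * (a 0 + real n * r)"
  have X: "0 \<le> ?X" using r a0 by simp
  have "a (Suc n) \<le> (1 + q) * a n + r" using step Suc.prems by simp
  also have "\<dots> \<le> (1 + q) * ?X + r" using Suc q by (intro add_right_mono mult_left_mono) auto
  also have "\<dots> \<le> exp q * ?X + exp (q * real (Suc n)) * r"
    using X q r mult_right_mono[of 1 "exp (q * real (Suc n))" r] exp_ge_add_one_self[of q]
    by (intro add_mono mult_right_mono) auto
  also have "\<dots> = exp (q * real (Suc n)) * (a 0 + real (Suc n) * r)"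
    by (simp add: exp_add[symmetric] algebra_simps)
  finally show ?case .
qed simp

section \<open>Lattice points near a Lipschitz boundary\<close>

lemma norm_pair_le_norm_vec3: "norm (v $ 1, v $ 2) \<le> norm (v :: real^3)"
proof -
  have "(norm v)\<^sup>2 = (v$1)\<^sup>2 + (v$2)\<^sup>2 + (v$3)\<^sup>2"
    unfolding power2_norm_eq_inner inner_vec_def by (simp add: sum_3 power2_eq_square)
  then have "(v$1)\<^sup>2 + (v$2)\<^sup>2 \<le> (norm v)\<^sup>2" by simp
  then have "sqrt ((v$1)\<^sup>2 + (v$2)\<^sup>2) \<le> norm v" by (simp add: real_le_lsqrt)
  then show ?thesis by (simp add: norm_Pair)
qed

text \<open>The axis \<open>n\<close> is the preimage of the third coordinate direction under
  \<open>R\<close>. A displacement w raises the graph by at most L |w| and lowers the point by at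
  most |w|, so the aperture 1 / (L + 1) is safe. The vertex ranges over all points of \<Omega> near
  \<open>q\<close>, with one common direction.\<close>

lemma lipschitz_cone:
  assumes "lipschitz_boundary \<Omega>" and q: "q \<in> frontier \<Omega>"
  shows "\<exists>n r \<epsilon>. norm n = 1 \<and> 0 < r \<and> 0 < \<epsilon> \<and> \<epsilon> \<le> 1 \<and>
    (\<forall>z\<in>\<Omega> \<inter> ball q r. \<forall>s y. 0 \<le> s \<and> s < r \<and> norm (y - (z + s *\<^sub>R n)) \<le> \<epsilon> * s \<longrightarrow> y \<in> \<Omega>)"
proof -
  from bspec[OF assms(1)[unfolded lipschitz_boundary_def] q] obtain U R g L where U: "open U" "q \<in> U"
    and R: "orthogonal_transformation (R :: real^3 \<Rightarrow> real^3)"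
    and g: "L-lipschitz_on UNIV (g :: real \<times> real \<Rightarrow> real)"
    and eq: "\<Omega> \<inter> U = {x \<in> U. g (R x $ 1, R x $ 2) < R x $ 3}"
    by (elim exE conjE) (rule that)
  obtain e where e: "0 < e" "ball q e \<subseteq> U" using U openE by blast
  have L: "0 \<le> L" using g lipschitz_on_nonneg by blast
  obtain n where n: "R n = axis 3 1"
    using orthogonal_transformation_surj[OF R] by (metis surjD)
  have normn: "norm n = 1" using orthogonal_transformation_norm[OF R, of n] n by simp
  have lin: "linear R" using R orthogonal_transformation_def by blast
  \<comment> \<open>Radius e / 3: the end point is at most 2 s away from \<open>z\<close>, hence
    still in the ball of radius \<open>e\<close> around \<open>q\<close>.\<close>
  have "y \<in> \<Omega>" if z: "z \<in> \<Omega>" "dist q z < e/3" and s: "0 \<le> s" "s < e/3"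
    and y: "norm (y - (z + s *\<^sub>R n)) \<le> 1 / (L+1) * s" for z s y
  proof -
    define w where "w = y - (z + s *\<^sub>R n)"
    have w: "(L+1) * norm w \<le> s" using y L by (simp add: w_def field_simps)
    have w1: "norm w \<le> s" using w mult_right_mono[of 1 "L+1" "norm w"] L by simp
    have yeq: "y = z + s *\<^sub>R n + w" by (simp add: w_def)
    have "dist q y \<le> dist q z + norm (s *\<^sub>R n + w)"
      unfolding yeq by (metis (no_types, opaque_lifting) add.assoc add_diff_cancel_left' dist_norm dist_commute dist_triangle)
    also have "\<dots> \<le> dist q z + (s + s)"
      using norm_triangle_ineq[of "s *\<^sub>R n" w] w1 s normn by simp
    finally have yU: "y \<in> U" using z s e by (auto simp: subset_iff)
    have zU: "z \<in> U" using z e by (auto simp: subset_iff)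
    have gz: "g (R z $ 1, R z $ 2) < R z $ 3" using eq z zU by blast
    have Ry: "R y = R z + s *\<^sub>R axis 3 1 + R w"
      unfolding yeq by (simp add: linear_add[OF lin] linear_scale[OF lin] n)
    have c: "R y $ 1 = R z $ 1 + R w $ 1" "R y $ 2 = R z $ 2 + R w $ 2" "R y $ 3 = R z $ 3 + s + R w $ 3"
      unfolding Ry by (simp_all add: axis_def)
    have "dist (R y $ 1, R y $ 2) (R z $ 1, R z $ 2) = norm (R w $ 1, R w $ 2)"
      by (simp add: dist_norm c)
    also have "\<dots> \<le> norm w"
      using norm_pair_le_norm_vec3[of "R w"] orthogonal_transformation_norm[OF R, of w] by simp
    finally have "L * dist (R y $ 1, R y $ 2) (R z $ 1, R z $ 2) \<le> L * norm w"
      using L by (rule mult_left_mono)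
    moreover have "dist (g (R y $ 1, R y $ 2)) (g (R z $ 1, R z $ 2)) \<le> L * dist (R y $ 1, R y $ 2) (R z $ 1, R z $ 2)"
      using lipschitz_onD[OF g] by simp
    ultimately have "g (R y $ 1, R y $ 2) \<le> g (R z $ 1, R z $ 2) + L * norm w"
      by (simp add: dist_real_def)
    also have "\<dots> < R z $ 3 + L * norm w" using gz by simp
    also have "\<dots> \<le> R z $ 3 + s - norm w" using w by (simp add: algebra_simps)
    also have "\<dots> \<le> R y $ 3"
      using component_le_norm_cart[of "R w" 3] orthogonal_transformation_norm[OF R, of w] by (simp add: c)
    finally have "y \<in> {x \<in> U. g (R x $ 1, R x $ 2) < R x $ 3}" using yU by simp
    then show ?thesis using eq by blast
  qed
  then show ?thesis
    using normn e L by (intro exI[of _ n] exI[of _ "e/3"] exI[of _ "1/(L+1)"]) auto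
qed

text \<open>A ball is the Minkowski sum of balls whose radii add up to its radius; this distributes
  an error over moves that are made one after another.\<close>

lemma norm_split:
  fixes d :: "'a::real_normed_vector"
  assumes "norm d \<le> \<alpha> + \<beta>" "0 \<le> \<alpha>" "0 \<le> \<beta>"
  shows "\<exists>d1 d2. d = d1 + d2 \<and> norm d1 \<le> \<alpha> \<and> norm d2 \<le> \<beta>"
proof (cases "\<alpha> + \<beta> = 0")
  case True
  then show ?thesis using assms by (intro exI[of _ 0]) auto
next
  case False
  then have pos: "0 < \<alpha> + \<beta>" using assms by simp
  have "\<alpha> / (\<alpha> + \<beta>) * norm d \<le> \<alpha> / (\<alpha> + \<beta>) * (\<alpha> + \<beta>)"
    using assms pos by (intro mult_left_mono) auto
  moreover have "\<beta> / (\<alpha> + \<beta>) * norm d \<le> \<beta> / (\<alpha> + \<beta>) * (\<alpha> + \<beta>)"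
    using assms pos by (intro mult_left_mono) auto
  moreover have "d = (\<alpha> / (\<alpha> + \<beta>)) *\<^sub>R d + (\<beta> / (\<alpha> + \<beta>)) *\<^sub>R d"
    using pos unfolding scaleR_left_distrib[symmetric] add_divide_distrib[symmetric] by simp
  ultimately show ?thesis
    using assms pos by (intro exI[of _ "(\<alpha> / (\<alpha> + \<beta>)) *\<^sub>R d"] exI[of _ "(\<beta> / (\<alpha> + \<beta>)) *\<^sub>R d"]) auto
qed

lemma finite_pos_lower_bound:
  assumes "finite Q" and "\<And>q. q \<in> Q \<Longrightarrow> 0 < (f q :: real)"
  shows "\<exists>\<rho>>0. \<forall>q\<in>Q. \<rho> \<le> f q"
  using assms
proof (induction Q)
  case empty then show ?case by (intro exI[of _ 1]) auto
next
  case (insert q Q)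
  then obtain \<rho> where "0 < \<rho>" "\<forall>q\<in>Q. \<rho> \<le> f q" by auto
  then show ?case using insert.prems[of q] by (intro exI[of _ "min \<rho> (f q)"]) auto
qed

lemma compact_frontier_cover:
  assumes "bounded (\<Omega> :: (real^3) set)" and r: "\<And>q. q \<in> frontier \<Omega> \<Longrightarrow> 0 < r q"
  shows "\<exists>Q. finite Q \<and> Q \<subseteq> frontier \<Omega> \<and> frontier \<Omega> \<subseteq> (\<Union>q\<in>Q. ball q (r q))"
proof -
  have "compact (frontier \<Omega>)" using assms(1) by (rule compact_frontier_bounded)
  moreover have "frontier \<Omega> \<subseteq> (\<Union>q\<in>frontier \<Omega>. ball q (r q))" using r by auto
  ultimately obtain Q where "Q \<subseteq> frontier \<Omega>" "finite Q" "frontier \<Omega> \<subseteq> (\<Union>q\<in>Q. ball q (r q))"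
    by (elim compactE_image[where f="\<lambda>q. ball q (r q)"]) auto
  then show ?thesis by blast
qed

lemma lipschitz_cone_fun:
  assumes "lipschitz_boundary \<Omega>"
  obtains n r \<epsilon> where "\<And>q. q \<in> frontier \<Omega> \<Longrightarrow> norm (n q) = 1 \<and> 0 < r q \<and> 0 < \<epsilon> q \<and> \<epsilon> q \<le> (1::real)"
    and "\<And>q z s y. q \<in> frontier \<Omega> \<Longrightarrow> z \<in> \<Omega> \<Longrightarrow> dist q z < r q \<Longrightarrow> 0 \<le> s \<Longrightarrow> s < r q \<Longrightarrow>
        norm (y - (z + s *\<^sub>R n q)) \<le> \<epsilon> q * s \<Longrightarrow> y \<in> \<Omega>"
proof -
  have "\<forall>q\<in>frontier \<Omega>. \<exists>n r \<epsilon>. norm n = 1 \<and> 0 < r \<and> 0 < \<epsilon> \<and> \<epsilon> \<le> (1::real) \<and>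
    (\<forall>z\<in>\<Omega> \<inter> ball q r. \<forall>s y. 0 \<le> s \<and> s < r \<and> norm (y - (z + s *\<^sub>R n)) \<le> \<epsilon> * s \<longrightarrow> y \<in> \<Omega>)"
    using lipschitz_cone[OF assms] by blast
  then obtain n r \<epsilon> where "\<forall>q\<in>frontier \<Omega>. norm (n q) = 1 \<and> 0 < r q \<and> 0 < \<epsilon> q \<and> \<epsilon> q \<le> (1::real) \<and>
    (\<forall>z\<in>\<Omega> \<inter> ball q (r q). \<forall>s y. 0 \<le> s \<and> s < r q \<and> norm (y - (z + s *\<^sub>R n q)) \<le> \<epsilon> q * s \<longrightarrow> y \<in> \<Omega>)"
    by metis
  then show ?thesis by (intro that[of n r \<epsilon>]) auto
qed

text \<open>The field is a sum of local cone directions weighted by Lipschitz bumps. The weights are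
  not normalised; it is enough that one of them is bounded below near the frontier. A move by s
  \<nu>(x) is broken into moves along single directions, and each direction with positive weight is
  still a cone direction where the path passes.\<close>

lemma cone_field:
  assumes bd: "bounded \<Omega>" and lip: "lipschitz_boundary \<Omega>"
  shows "\<exists>\<nu> \<epsilon> s1 \<Lambda>. 0 < \<epsilon> \<and> \<epsilon> \<le> 1 \<and> 0 < s1 \<and> 0 \<le> \<Lambda> \<and> (\<forall>x. norm (\<nu> x) \<le> \<Lambda>) \<and>
    (\<forall>x y. norm (\<nu> x - \<nu> y) \<le> \<Lambda> * norm (x - y)) \<and>
    (\<forall>q\<in>frontier \<Omega>. \<forall>x z s y. dist x q < s1 \<and> dist z q < s1 \<and> z \<in> \<Omega> \<and> 0 \<le> s \<and> s < s1 \<and>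
        norm (y - (z + s *\<^sub>R \<nu> x)) \<le> \<epsilon> * s \<longrightarrow> y \<in> \<Omega>)"
proof -
  obtain n r \<epsilon> where nr: "\<And>q. q \<in> frontier \<Omega> \<Longrightarrow> norm (n q) = 1 \<and> 0 < r q \<and> 0 < \<epsilon> q \<and> \<epsilon> q \<le> (1::real)"
    and cone: "\<And>q z s y. q \<in> frontier \<Omega> \<Longrightarrow> z \<in> \<Omega> \<Longrightarrow> dist q z < r q \<Longrightarrow> 0 \<le> s \<Longrightarrow> s < r q \<Longrightarrow>
        norm (y - (z + s *\<^sub>R n q)) \<le> \<epsilon> q * s \<Longrightarrow> y \<in> \<Omega>"
    using lipschitz_cone_fun[OF lip] by blast
  obtain Q where Q: "finite Q" "Q \<subseteq> frontier \<Omega>" "frontier \<Omega> \<subseteq> (\<Union>q\<in>Q. ball q (r q / 4))"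
    using compact_frontier_cover[OF bd, of "\<lambda>q. r q / 4"] nr by auto
  obtain \<rho> where \<rho>: "0 < \<rho>" "\<And>q. q \<in> Q \<Longrightarrow> \<rho> \<le> r q"
    using finite_pos_lower_bound[OF Q(1), of r] nr Q(2) by blast
  obtain \<eta> where \<eta>: "0 < \<eta>" "\<And>q. q \<in> Q \<Longrightarrow> \<eta> \<le> \<epsilon> q"
    using finite_pos_lower_bound[OF Q(1), of \<epsilon>] nr Q(2) by blast
  define W where "W = (\<Sum>q\<in>Q. r q)"
  have rpos: "0 < r q" if "q \<in> Q" for q using nr Q that by blast
  have W: "0 \<le> W" unfolding W_def using rpos by (intro sum_nonneg) (auto intro: less_imp_le)
  \<comment> \<open>The bump has radius \<open>r q / 2\<close>; the other half of the range
    \<open>r q\<close> is left for the path.\<close>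
  define w where "w q x = max 0 (r q / 2 - dist x q)" for q x
  have w0: "0 \<le> w q x" for q x by (simp add: w_def)
  have wr: "w q x \<le> r q / 2" if "q \<in> Q" for q x using rpos[OF that] by (auto simp: w_def max_def)
  have wr': "w q x \<le> r q" if "q \<in> Q" for q x using wr[OF that, of x] rpos[OF that] by linarith
  define \<nu> where "\<nu> x = (\<Sum>q\<in>Q. w q x *\<^sub>R n q)" for x
  \<comment> \<open>With this \<open>s1\<close> the intermediate points stay within
    \<open>r q\<close> of every centre \<open>q\<close> whose bump is positive at \<open>x\<close>.
    The aperture \<open>\<epsilon>0\<close> counts a single direction, with weight at least \<rho> /
    8 and aperture at least \<eta>.\<close>
  define s1 where "s1 = min 1 (\<rho> / (8 * (1 + W)))"
  define \<epsilon>0 where "\<epsilon>0 = min 1 (\<eta> * \<rho> / 8)"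
  have s1: "0 < s1" "s1 \<le> 1" "s1 * (1 + W) \<le> \<rho> / 8" "s1 \<le> \<rho> / 8"
  proof -
    show a: "0 < s1" "s1 \<le> 1" using \<rho> W by (auto simp: s1_def)
    have "s1 \<le> \<rho> / (8 * (1 + W))" by (simp add: s1_def)
    then show b: "s1 * (1 + W) \<le> \<rho> / 8" using W by (simp add: field_simps)
    show "s1 \<le> \<rho> / 8" using b a W mult_left_mono[of 1 "1+W" s1] by linarith
  qed
  have \<epsilon>0: "0 < \<epsilon>0" "\<epsilon>0 \<le> 1" "\<epsilon>0 \<le> \<eta> * \<rho> / 8" using \<eta>(1) \<rho>(1) by (simp_all add: \<epsilon>0_def)
  have norm\<nu>: "norm (\<nu> x) \<le> W" for x
    unfolding \<nu>_def W_def
  proof (rule order_trans[OF norm_sum], rule sum_mono)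
    fix q assume "q \<in> Q"
    then show "norm (w q x *\<^sub>R n q) \<le> r q"
      using nr Q(2) w0[of q x] wr[of q x] rpos[of q] by fastforce
  qed
  have lip\<nu>: "norm (\<nu> x - \<nu> y) \<le> real (card Q) * norm (x - y)" for x y
  proof -
    have "norm (\<nu> x - \<nu> y) \<le> (\<Sum>q\<in>Q. norm ((w q x - w q y) *\<^sub>R n q))"
      unfolding \<nu>_def sum_subtractf[symmetric] scaleR_left_diff_distrib[symmetric] by (rule norm_sum)
    also have "\<dots> \<le> (\<Sum>q\<in>Q. norm (x - y))"
    proof (rule sum_mono)
      fix q assume "q \<in> Q"
      then have "norm (n q) = 1" using nr Q by blast
      moreover have "\<bar>w q x - w q y\<bar> \<le> norm (x - y)"
        using dist_triangle[of x q y] dist_triangle[of y q x]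
        by (auto simp: w_def dist_norm[symmetric] dist_commute)
      ultimately show "norm ((w q x - w q y) *\<^sub>R n q) \<le> norm (x - y)" by simp
    qed
    finally show ?thesis by simp
  qed
  have main: "y \<in> \<Omega>" if p: "p \<in> frontier \<Omega>" and x: "dist x p < s1" and z: "dist z p < s1" "z \<in> \<Omega>"
    and s: "0 \<le> s" "s < s1" and y: "norm (y - (z + s *\<^sub>R \<nu> x)) \<le> \<epsilon>0 * s" for p x z s y
  proof -
    \<comment> \<open>What is reached from \<open>z\<close> along the directions in \<open>A\<close>
      contains a ball whose radius is the weighted sum of the apertures. One more direction means
      one more use of the cone property, started at an arbitrary point of the previous ball.\<close>
    have claim: "\<forall>y. norm (y - (z + s *\<^sub>R (\<Sum>q\<in>A. w q x *\<^sub>R n q))) \<le> s * (\<Sum>q\<in>A. w q x * \<epsilon> q) \<longrightarrow> y \<in> \<Omega>"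
      if "finite A" "A \<subseteq> Q" for A
      using that
    proof (induction A)
      case empty
      then show ?case using z by simp
    next
      case (insert q A)
      let ?a = "\<Sum>q\<in>A. w q x *\<^sub>R n q" and ?b = "\<Sum>q\<in>A. w q x * \<epsilon> q"
      have q: "q \<in> Q" "q \<in> frontier \<Omega>" using insert.prems Q(2) by auto
      have A: "A \<subseteq> Q" using insert.prems by simp
      have IH: "y \<in> \<Omega>" if "norm (y - (z + s *\<^sub>R ?a)) \<le> s * ?b" for y
        using insert.IH[OF A] that by blast
      have AW: "(\<Sum>q\<in>A. w q x) \<le> W"
      proof -
        have "(\<Sum>q\<in>A. w q x) \<le> (\<Sum>q\<in>Q. w q x)" by (rule sum_mono2[OF Q(1) A]) (rule w0)
        also have "\<dots> \<le> W" unfolding W_def by (rule sum_mono) (rule wr')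
        finally show ?thesis .
      qed
      have b: "0 \<le> ?b" "?b \<le> W"
      proof -
        show "0 \<le> ?b" using A nr Q(2) w0 by (intro sum_nonneg mult_nonneg_nonneg) (auto simp: less_imp_le subset_iff)
        have "?b \<le> (\<Sum>q\<in>A. w q x)"
        proof (rule sum_mono)
          fix q' assume "q' \<in> A"
          then have "\<epsilon> q' \<le> 1" using A Q(2) nr by blast
          then show "w q' x * \<epsilon> q' \<le> w q' x" using w0[of q' x] mult_left_mono[of "\<epsilon> q'" 1] by simp
        qed
        then show "?b \<le> W" using AW by simp
      qed
      have na: "norm ?a \<le> W"
      proof -
        have "norm ?a \<le> (\<Sum>q\<in>A. w q x)"
        proof (rule order_trans[OF norm_sum], rule sum_mono)
          fix q' assume "q' \<in> A"
          then have "norm (n q') = 1" using A Q(2) nr by blast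
          then show "norm (w q' x *\<^sub>R n q') \<le> w q' x" using w0[of q' x] by simp
        qed
        then show ?thesis using AW by simp
      qed
      show ?case
      proof (intro allI impI)
        fix y assume y: "norm (y - (z + s *\<^sub>R (\<Sum>q\<in>insert q A. w q x *\<^sub>R n q))) \<le> s * (\<Sum>q\<in>insert q A. w q x * \<epsilon> q)"
        define d where "d = y - (z + s *\<^sub>R (\<Sum>q\<in>insert q A. w q x *\<^sub>R n q))"
        have "norm d \<le> s * ?b + s * (w q x * \<epsilon> q)"
          using y insert.hyps unfolding d_def by (simp add: algebra_simps)
        moreover have "0 \<le> s * ?b" using s b by simp
        moreover have eq0: "0 \<le> s * (w q x * \<epsilon> q)" using s w0[of q x] nr[OF q(2)] by simp
        ultimately obtain d1 d2 where d: "d = d1 + d2" "norm d1 \<le> s * ?b" "norm d2 \<le> s * (w q x * \<epsilon> q)"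
          using norm_split by blast
        define y' where "y' = z + s *\<^sub>R ?a + d1"
        have y': "y' \<in> \<Omega>" by (rule IH) (use d in \<open>simp add: y'_def\<close>)
        have yy: "y - (y' + (s * w q x) *\<^sub>R n q) = d2"
          using insert.hyps d(1) unfolding d_def y'_def by (simp add: algebra_simps)
        show "y \<in> \<Omega>"
        proof (cases "w q x = 0")
          case True
          then show ?thesis using yy y' d(3) by simp
        next
          case False
          then have xq: "dist x q < r q / 2" by (auto simp: w_def max_def split: if_splits)
          have "norm (y' - z) \<le> s * W + s * W"
          proof -
            have "norm (y' - z) \<le> norm (s *\<^sub>R ?a) + norm d1"
            proof -
              have "y' - z = s *\<^sub>R ?a + d1" by (simp add: y'_def)
              then show ?thesis by (simp only: norm_triangle_ineq)
            qed
            moreover have "norm (s *\<^sub>R ?a) \<le> s * W" using s na by (simp add: mult_left_mono)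
            moreover have "norm d1 \<le> s * W" using d(2) s b mult_left_mono[of ?b W s] by simp
            ultimately show ?thesis by linarith
          qed
          moreover have "s * W \<le> s1 * W" using s W by (intro mult_right_mono) auto
          ultimately have y'z: "norm (y' - z) \<le> 2 * (s1 * W)" by linarith
          have "dist q y' \<le> dist q x + dist x p + dist p z + dist z y'"
            using dist_triangle[of q y' x] dist_triangle[of x y' p] dist_triangle[of p y' z] by linarith
          also have "\<dots> < r q / 2 + s1 + s1 + 2 * (s1 * W)"
            using xq x z(1) y'z dist_norm[of y' z] dist_commute[of q x] dist_commute[of p z] dist_commute[of z y']
            by linarith
          also have "\<dots> = r q / 2 + 2 * (s1 * (1 + W))" by (simp add: algebra_simps)
          also have "\<dots> \<le> r q" using s1(3) \<rho>(1) \<rho>(2)[OF q(1)] by simp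
          finally have 1: "dist q y' < r q" .
          have "s * w q x \<le> 1 * (r q / 2)"
            using s s1 wr[OF q(1), of x] w0[of q x] by (intro mult_mono) auto
          then have 2: "s * w q x < r q" using rpos[OF q(1)] by simp
          show ?thesis
            by (rule cone[OF q(2) y' 1 _ 2]) (use yy d(3) s w0[of q x] in \<open>auto simp: algebra_simps\<close>)
        qed
      qed
    qed
    obtain q0 where q0: "q0 \<in> Q" "dist q0 p < r q0 / 4" using Q(3) p by auto
    have "dist x q0 < s1 + r q0 / 4"
      using x q0(2) dist_triangle[of x q0 p] by (simp add: dist_commute)
    then have wq0: "\<rho> / 8 \<le> w q0 x"
    proof -
      have "\<rho> / 8 \<le> r q0 / 2 - dist x q0"
        using s1(4) \<rho>(2)[OF q0(1)] \<open>dist x q0 < s1 + r q0 / 4\<close> by linarith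
      then show ?thesis unfolding w_def by linarith
    qed
    have "\<epsilon>0 \<le> w q0 x * \<epsilon> q0"
      using \<epsilon>0(3) mult_mono[OF wq0 \<eta>(2)[OF q0(1)]] \<rho> \<eta> w0[of q0 x] by (simp add: mult.commute)
    also have "\<dots> \<le> (\<Sum>q\<in>Q. w q x * \<epsilon> q)"
      using q0 Q w0 nr by (intro member_le_sum) (auto simp: less_imp_le subset_iff)
    finally have "s * \<epsilon>0 \<le> s * (\<Sum>q\<in>Q. w q x * \<epsilon> q)" using s(1) by (rule mult_left_mono)
    then have "\<epsilon>0 * s \<le> s * (\<Sum>q\<in>Q. w q x * \<epsilon> q)" by (simp only: mult.commute[of \<epsilon>0 s])
    then show ?thesis using claim[OF Q(1) subset_refl] y unfolding \<nu>_def by (meson order_trans)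
  qed
  define \<Lambda> where "\<Lambda> = max W (real (card Q))"
  have "norm (\<nu> x) \<le> \<Lambda>" for x using norm\<nu>[of x] by (simp add: \<Lambda>_def)
  moreover have "norm (\<nu> x - \<nu> y) \<le> \<Lambda> * norm (x - y)" for x y
    using lip\<nu>[of x y] mult_right_mono[of "real (card Q)" \<Lambda> "norm (x-y)"] by (simp add: \<Lambda>_def)
  moreover have "0 \<le> \<Lambda>" using W by (simp add: \<Lambda>_def)
  ultimately show ?thesis
    using main \<epsilon>0(1,2) s1(1) by (intro exI[of _ \<nu>] exI[of _ \<epsilon>0] exI[of _ s1] exI[of _ \<Lambda>]) blast
qed

lemma near_frontier:
  assumes "(x :: real^3) \<in> \<Omega>" "p \<notin> \<Omega>"
  shows "\<exists>q\<in>frontier \<Omega>. dist x q \<le> dist x p"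
proof -
  have "closed_segment x p \<inter> frontier \<Omega> \<noteq> {}"
    using assms by (intro connected_Int_frontier) auto
  then obtain q where "q \<in> closed_segment x p" "q \<in> frontier \<Omega>" by blast
  then show ?thesis using segment_bound(1)[of q x p] by (metis dist_norm norm_minus_commute)
qed

lemma infdist_ge: "A \<noteq> {} \<Longrightarrow> (\<And>a. a \<in> A \<Longrightarrow> \<rho> \<le> dist x a) \<Longrightarrow> \<rho> \<le> infdist x A"
  unfolding infdist_def by (auto intro: cINF_greatest)

lemma infdist_compl_attained:
  fixes \<Omega> :: "(real^3) set"
  assumes "open \<Omega>" "bounded \<Omega>"
  obtains p where "p \<notin> \<Omega>" "infdist x (-\<Omega>) = dist x p"
proof -
  have "closed (-\<Omega>)" using assms by auto
  moreover have "\<Omega> \<noteq> UNIV" using assms(2) not_bounded_UNIV by auto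
  then have "-\<Omega> \<noteq> {}" by auto
  ultimately show ?thesis using infdist_attains_inf[of "-\<Omega>" x] that by (metis ComplD)
qed

definition round_grid :: "real \<Rightarrow> real^3 \<Rightarrow> real^3" where
  "round_grid h x = (\<chi> k. h * of_int (round (x $ k / h)))"

lemma round_grid_component: "0 < h \<Longrightarrow> \<bar>round_grid h x $ k - x $ k\<bar> \<le> h / 2"
proof -
  assume h: "0 < h"
  have "round_grid h x $ k - x $ k = h * (of_int (round (x $ k / h)) - x $ k / h)"
    using h by (simp add: round_grid_def right_diff_distrib)
  then have "\<bar>round_grid h x $ k - x $ k\<bar> = h * \<bar>of_int (round (x $ k / h)) - x $ k / h\<bar>"
    using h by (simp add: abs_mult)
  also have "\<dots> \<le> h * (1/2)"
    using h by (intro mult_left_mono of_int_round_abs_le) auto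
  finally show ?thesis by simp
qed

lemma norm_le_3_components:
  assumes "\<And>k. \<bar>x $ k\<bar> \<le> c"
  shows "norm (x :: real^3) \<le> 3 * c"
  using norm_le_l1_cart[of x] assms[of 1] assms[of 2] assms[of 3] by (simp add: sum_3)

lemma round_grid_norm: "0 < h \<Longrightarrow> norm (round_grid h x - x) \<le> 3 / 2 * h"
  using norm_le_3_components[of "round_grid h x - x" "h/2"] round_grid_component[of h x] by simp

lemma grid_add:
  assumes "x \<in> grid h" "y \<in> grid h"
  shows "x + y \<in> grid h"
  unfolding grid_def
proof (intro CollectI allI)
  fix i
  obtain a b :: int where "x $ i = h * of_int a" "y $ i = h * of_int b"
    using assms unfolding grid_def by blast
  then show "\<exists>z::int. (x + y) $ i = h * of_int z"
    by (intro exI[of _ "a + b"]) (simp add: distrib_left)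
qed

lemma grid_uminus:
  assumes "x \<in> grid h"
  shows "- x \<in> grid h"
  unfolding grid_def
proof (intro CollectI allI)
  fix i
  obtain a :: int where "x $ i = h * of_int a"
    using assms unfolding grid_def by blast
  then show "\<exists>z::int. (- x) $ i = h * of_int z"
    by (intro exI[of _ "- a"]) simp
qed

lemma grid_diff: "x \<in> grid h \<Longrightarrow> y \<in> grid h \<Longrightarrow> x - y \<in> grid h"
  using grid_add[of x h "-y"] grid_uminus by simp

lemma grid_axis: "h *\<^sub>R ax i \<in> grid h"
  unfolding grid_def
proof (intro CollectI allI)
  fix k show "\<exists>z::int. (h *\<^sub>R ax i) $ k = h * of_int z"
    by (intro exI[of _ "if k = i then 1 else 0"]) (auto simp: axis_def)
qed

lemma round_grid_grid: "round_grid h x \<in> grid h"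
  unfolding grid_def round_grid_def by auto

section \<open>The boundary layer has O(h^-2) lattice points\<close>

definition boundary_layer :: "(real^3) set \<Rightarrow> real \<Rightarrow> real \<Rightarrow> (real^3) set" where
  "boundary_layer \<Omega> h K = {x \<in> grid h \<inter> \<Omega>. infdist x (-\<Omega>) \<le> K * h}"

text \<open>The translates of the layer along the cone direction by multiples of a fixed multiple of \<open>h\<close> are
  pairwise disjoint, and about \<open>1/h\<close> of them fit into a bounded region.\<close>

lemma boundary_layer_local_count:
  assumes op: "open \<Omega>" and bd: "bounded \<Omega>" and n: "norm n = 1" and r: "0 < r" and \<epsilon>: "0 < \<epsilon>" "\<epsilon> \<le> (1::real)"
    and cone: "\<And>z s y. z \<in> \<Omega> \<Longrightarrow> dist q z < r \<Longrightarrow> 0 \<le> s \<Longrightarrow> s < r \<Longrightarrow>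
        norm (y - (z + s *\<^sub>R n)) \<le> \<epsilon> * s \<Longrightarrow> y \<in> \<Omega>"
    and K: "0 \<le> K"
  shows "\<exists>C\<ge>0. \<forall>h. 0 < h \<and> h \<le> 1 \<longrightarrow>
      real (card (boundary_layer \<Omega> h K \<inter> ball q r)) * h^3 \<le> C * h"
proof -
  \<comment> \<open>The least shift K' h deepens a point of \<Omega> by \<epsilon> K' h - 3 h = (K +
    1) h, which takes it out of the layer. The 3 h are the two errors made in rounding shifts to the
    lattice.\<close>
  define K' where "K' = (K + 4) / \<epsilon>"
  have K': "0 < K'" "\<epsilon> * K' = K + 4" using \<epsilon> K by (auto simp: K'_def)
  define C where "C = K' * (4 * r + 7)^3 / r"
  have C: "0 \<le> C" using K' r by (simp add: C_def)
  have "real (card (boundary_layer \<Omega> h K \<inter> ball q r)) * h^3 \<le> C * h" if h: "0 < h" "h \<le> 1" for h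
  proof -
    let ?A = "boundary_layer \<Omega> h K \<inter> ball q r"
    have finA: "finite ?A"
      by (rule finite_subset[OF _ finite_grid_bounded[OF h(1) bd]]) (auto simp: boundary_layer_def)
    define \<sigma> where "\<sigma> j = round_grid h ((real j * (K' * h)) *\<^sub>R n)" for j :: nat
    \<comment> \<open>The number of shifts: at least r / (K' h), and all of them shorter than the
      range \<open>r\<close> of the cone.\<close>
    define J where "J = nat \<lceil>r / (K' * h)\<rceil>"
    have pos: "0 < K' * h" using K' h by simp
    have J1: "r / (K' * h) \<le> real J" using r pos by (simp add: J_def)
    have J2: "real j * (K' * h) < r" if "j < J" for j
    proof -
      have "int j < \<lceil>r / (K' * h)\<rceil>" using that by (simp add: J_def)
      then have "real j < r / (K' * h)" by (simp add: less_ceiling_iff)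
      then show ?thesis using pos by (simp add: field_simps)
    qed
    have disj: "(\<lambda>x. x + \<sigma> i) ` ?A \<inter> (\<lambda>x. x + \<sigma> j) ` ?A = {}" if ij: "i < j" "j < J" for i j
    proof (rule ccontr)
      assume "\<not> ?thesis"
      then obtain b where b: "b \<in> (\<lambda>x. x + \<sigma> i) ` ?A" "b \<in> (\<lambda>x. x + \<sigma> j) ` ?A" by blast
      from b(1) obtain x where x: "x \<in> ?A" and bx: "b = x + \<sigma> i" by (rule imageE)
      from b(2) obtain y where y: "y \<in> ?A" and eq: "b = y + \<sigma> j" by (rule imageE)
      note eq = eq[unfolded bx]
      define s where "s = real (j - i) * (K' * h)"
      have s0: "0 \<le> s" using pos by (simp add: s_def)
      have "s \<le> real j * (K' * h)" unfolding s_def using pos by (intro mult_right_mono) auto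
      then have sr: "s < r" using J2[OF ij(2)] by simp
      have Kh: "K' * h \<le> s" unfolding s_def using pos ij mult_right_mono[of 1 "real (j-i)" "K' * h"] by simp
      have "x - (y + s *\<^sub>R n) = (\<sigma> j - (real j * (K' * h)) *\<^sub>R n) - (\<sigma> i - (real i * (K' * h)) *\<^sub>R n)"
        using eq ij unfolding s_def by (simp add: of_nat_diff algebra_simps)
      then have d: "norm (x - (y + s *\<^sub>R n)) \<le> 3 * h"
        using norm_triangle_ineq4[of "\<sigma> j - (real j * (K' * h)) *\<^sub>R n" "\<sigma> i - (real i * (K' * h)) *\<^sub>R n"]
          round_grid_norm[OF h(1), of "(real j * (K' * h)) *\<^sub>R n"] round_grid_norm[OF h(1), of "(real i * (K' * h)) *\<^sub>R n"]
        unfolding \<sigma>_def by simp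
      have "\<epsilon> * s - 3 * h \<le> infdist x (-\<Omega>)"
      proof (rule infdist_ge)
        show "-\<Omega> \<noteq> {}" using bd not_bounded_UNIV by (metis Compl_eq_Diff_UNIV Diff_eq_empty_iff top.extremum_uniqueI)
        fix p assume p: "p \<in> -\<Omega>"
        show "\<epsilon> * s - 3 * h \<le> dist x p"
        proof (rule ccontr)
          assume "\<not> ?thesis"
          then have "norm (p - x) < \<epsilon> * s - 3 * h" by (simp add: dist_norm norm_minus_commute)
          then have "norm (p - (y + s *\<^sub>R n)) \<le> \<epsilon> * s"
            using d norm_diff_triangle_ineq[of p x x "y + s *\<^sub>R n"] norm_triangle_ineq[of "p - x" "x - (y + s *\<^sub>R n)"]
            unfolding diff_add_cancel add_diff_eq by linarith
          then have "p \<in> \<Omega>" using cone[of y s p] y s0 sr by (auto simp: boundary_layer_def)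
          then show False using p by simp
        qed
      qed
      moreover have "\<epsilon> * (K' * h) \<le> \<epsilon> * s" using Kh \<epsilon> by simp
      then have "(K + 4) * h \<le> \<epsilon> * s" using K'(2) by (simp add: mult.assoc[symmetric])
      ultimately have "K * h < infdist x (-\<Omega>)" using h by (simp add: algebra_simps)
      then show False using x by (simp add: boundary_layer_def)
    qed
    let ?U = "\<Union>j\<in>{..<J}. (\<lambda>x. x + \<sigma> j) ` ?A"
    have "card ?U = (\<Sum>j\<in>{..<J}. card ((\<lambda>x. x + \<sigma> j) ` ?A))"
    proof (rule card_UN_disjoint)
      show "\<forall>i\<in>{..<J}. \<forall>j\<in>{..<J}. i \<noteq> j \<longrightarrow> (\<lambda>x. x + \<sigma> i) ` ?A \<inter> (\<lambda>x. x + \<sigma> j) ` ?A = {}"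
      proof (intro ballI impI)
        fix i j assume "i \<in> {..<J}" "j \<in> {..<J}" "i \<noteq> j"
        then show "(\<lambda>x. x + \<sigma> i) ` ?A \<inter> (\<lambda>x. x + \<sigma> j) ` ?A = {}"
          using disj[of i j] disj[of j i] by (cases i j rule: linorder_cases) (auto simp: Int_commute)
      qed
    qed (use finA in auto)
    also have "\<dots> = J * card ?A" by (simp add: card_image)
    finally have cU: "card ?U = J * card ?A" .
    have "?U \<subseteq> {x \<in> grid h. \<forall>k. \<bar>x $ k - q $ k\<bar> \<le> 2 * r + 3 * h}"
    proof (rule UN_least, rule image_subsetI)
      fix j x assume j: "j \<in> {..<J}" and x: "x \<in> ?A"
      have "norm (\<sigma> j) \<le> norm ((real j * (K' * h)) *\<^sub>R n) + 3 / 2 * h"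
        using round_grid_norm[OF h(1), of "(real j * (K' * h)) *\<^sub>R n"] norm_triangle_sub[of "\<sigma> j" "(real j * (K' * h)) *\<^sub>R n"]
        unfolding \<sigma>_def by linarith
      also have "\<dots> \<le> r + 3 / 2 * h" using J2[of j] j n pos h K' by simp
      finally have s: "norm (\<sigma> j) \<le> r + 3 / 2 * h" .
      have "norm (x + \<sigma> j - q) \<le> norm (x - q) + norm (\<sigma> j)"
        by (metis add_diff_eq add.commute diff_add_eq norm_triangle_ineq)
      then have "norm (x + \<sigma> j - q) \<le> 2 * r + 3 * h"
        using s x h by (simp add: dist_norm norm_minus_commute)
      then have "\<bar>(x + \<sigma> j) $ k - q $ k\<bar> \<le> 2 * r + 3 * h" for k
        using component_le_norm_cart[of "x + \<sigma> j - q" k] by simp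
      moreover have "x + \<sigma> j \<in> grid h"
        using x grid_add round_grid_grid unfolding boundary_layer_def \<sigma>_def by blast
      ultimately show "x + \<sigma> j \<in> {x \<in> grid h. \<forall>k. \<bar>x $ k - q $ k\<bar> \<le> 2 * r + 3 * h}" by simp
    qed
    then have "real (card ?U) \<le> (2 * (2 * r + 3 * h) / h + 1)^3"
      using grid_box_count[OF h(1), of "2 * r + 3 * h" q] r h
      by (meson card_mono order_trans of_nat_mono add_nonneg_nonneg less_imp_le mult_nonneg_nonneg zero_le_numeral)
    also have "\<dots> \<le> ((4 * r + 7) / h)^3"
      using h r by (intro power_mono) (auto simp: field_simps)
    finally have "real J * real (card ?A) \<le> ((4 * r + 7) / h)^3" unfolding cU by simp
    then have "(r / (K' * h)) * real (card ?A) \<le> ((4 * r + 7) / h)^3"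
      using J1 mult_right_mono[OF J1, of "real (card ?A)"] by simp
    then have "(r / (K' * h)) * (real (card ?A) * h^3) \<le> (4 * r + 7)^3"
      using h by (simp add: power_divide field_simps)
    then show ?thesis
      using pos r h K' by (simp add: C_def field_simps)
  qed
  then show ?thesis using C by blast
qed

text \<open>Finitely many cone neighbourhoods cover the frontier. The cover uses half the radii, and
  for small h the layer is thinner than the margin gained in this way.\<close>

lemma boundary_layer_count:
  assumes op: "open \<Omega>" and bd: "bounded \<Omega>" and lip: "lipschitz_boundary \<Omega>" and K: "0 \<le> K"
  shows "\<exists>C\<ge>0. \<exists>\<delta>>0. \<forall>h. 0 < h \<and> h < \<delta> \<longrightarrow> real (card (boundary_layer \<Omega> h K)) * h^3 \<le> C * h"
proof -
  obtain n r \<epsilon> where nr: "\<And>q. q \<in> frontier \<Omega> \<Longrightarrow> norm (n q) = 1 \<and> 0 < r q \<and> 0 < \<epsilon> q \<and> \<epsilon> q \<le> (1::real)"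
    and cone: "\<And>q z s y. q \<in> frontier \<Omega> \<Longrightarrow> z \<in> \<Omega> \<Longrightarrow> dist q z < r q \<Longrightarrow> 0 \<le> s \<Longrightarrow> s < r q \<Longrightarrow>
        norm (y - (z + s *\<^sub>R n q)) \<le> \<epsilon> q * s \<Longrightarrow> y \<in> \<Omega>"
    using lipschitz_cone_fun[OF lip] by blast
  obtain Q where Q: "finite Q" "Q \<subseteq> frontier \<Omega>" "frontier \<Omega> \<subseteq> (\<Union>q\<in>Q. ball q (r q / 2))"
    using compact_frontier_cover[OF bd, of "\<lambda>q. r q / 2"] nr by auto
  obtain \<rho> where \<rho>: "0 < \<rho>" "\<And>q. q \<in> Q \<Longrightarrow> \<rho> \<le> r q"
    using finite_pos_lower_bound[OF Q(1), of r] nr Q(2) by blast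
  have "\<exists>C\<ge>0. \<forall>h. 0 < h \<and> h \<le> 1 \<longrightarrow> real (card (boundary_layer \<Omega> h K \<inter> ball q (r q))) * h^3 \<le> C * h" if "q \<in> Q" for q
  proof -
    have q: "q \<in> frontier \<Omega>" using that Q by blast
    show ?thesis
      by (rule boundary_layer_local_count[OF op bd _ _ _ _ cone[OF q] K, where \<epsilon>="\<epsilon> q"]) (use nr[OF q] in auto)
  qed
  then obtain c where c: "\<And>q. q \<in> Q \<Longrightarrow> 0 \<le> c q"
    "\<And>q h. q \<in> Q \<Longrightarrow> 0 < h \<Longrightarrow> h \<le> 1 \<Longrightarrow> real (card (boundary_layer \<Omega> h K \<inter> ball q (r q))) * h^3 \<le> c q * h"
    by metis
  define \<delta> where "\<delta> = min 1 (\<rho> / (2 * (K + 1)))"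
  have \<delta>: "0 < \<delta>" "\<delta> \<le> 1" "K * \<delta> < \<rho> / 2"
  proof -
    show a: "0 < \<delta>" "\<delta> \<le> 1" using \<rho>(1) K by (auto simp: \<delta>_def)
    have "\<delta> * (2 * (K + 1)) \<le> \<rho>"
      using K by (simp add: \<delta>_def pos_le_divide_eq[symmetric])
    then show "K * \<delta> < \<rho> / 2" using a by (simp add: algebra_simps)
  qed
  have "real (card (boundary_layer \<Omega> h K)) * h^3 \<le> (\<Sum>q\<in>Q. c q) * h" if h: "0 < h" "h < \<delta>" for h
  proof -
    have fin: "finite (boundary_layer \<Omega> h K)"
      by (rule finite_subset[OF _ finite_grid_bounded[OF h(1) bd]]) (auto simp: boundary_layer_def)
    have cover: "boundary_layer \<Omega> h K \<subseteq> (\<Union>q\<in>Q. boundary_layer \<Omega> h K \<inter> ball q (r q))"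
    proof
      fix x assume x: "x \<in> boundary_layer \<Omega> h K"
      obtain p where p: "p \<notin> \<Omega>" "infdist x (-\<Omega>) = dist x p"
        using infdist_compl_attained[OF op bd] by blast
      obtain y where y: "y \<in> frontier \<Omega>" "dist x y \<le> dist x p"
        using near_frontier[of x \<Omega> p] x p by (auto simp: boundary_layer_def)
      obtain q where q: "q \<in> Q" "dist q y < r q / 2" using Q(3) y by auto
      have "dist x y \<le> K * h" using x p y by (auto simp: boundary_layer_def)
      also have "\<dots> \<le> K * \<delta>" using h K by (intro mult_left_mono) auto
      also have "\<dots> < r q / 2" using \<delta>(3) \<rho>(2)[OF q(1)] by simp
      finally have "dist q x < r q" using q(2) dist_triangle[of q x y] by (simp add: dist_commute)
      then show "x \<in> (\<Union>q\<in>Q. boundary_layer \<Omega> h K \<inter> ball q (r q))" using q(1) x by auto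
    qed
    have "card (boundary_layer \<Omega> h K) \<le> (\<Sum>q\<in>Q. card (boundary_layer \<Omega> h K \<inter> ball q (r q)))"
    proof (rule order_trans[OF card_mono[OF _ cover] card_UN_le[OF Q(1)]])
      show "finite (\<Union>q\<in>Q. boundary_layer \<Omega> h K \<inter> ball q (r q))" using fin Q(1) by blast
    qed
    then have "real (card (boundary_layer \<Omega> h K)) \<le> real (\<Sum>q\<in>Q. card (boundary_layer \<Omega> h K \<inter> ball q (r q)))"
      by (rule of_nat_mono)
    also have "\<dots> = (\<Sum>q\<in>Q. real (card (boundary_layer \<Omega> h K \<inter> ball q (r q))))" by (rule of_nat_sum)
    finally have "real (card (boundary_layer \<Omega> h K)) \<le> (\<Sum>q\<in>Q. real (card (boundary_layer \<Omega> h K \<inter> ball q (r q))))" .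
    then have "real (card (boundary_layer \<Omega> h K)) * h^3 \<le> (\<Sum>q\<in>Q. real (card (boundary_layer \<Omega> h K \<inter> ball q (r q)))) * h^3"
      using h by (intro mult_right_mono) auto
    also have "\<dots> \<le> (\<Sum>q\<in>Q. c q * h)"
      unfolding sum_distrib_right using c h \<delta> by (intro sum_mono) auto
    finally show ?thesis by (simp add: sum_distrib_right)
  qed
  moreover have "0 \<le> (\<Sum>q\<in>Q. c q)" using c by (intro sum_nonneg) auto
  ultimately show ?thesis using \<delta>(1) by blast
qed

section \<open>Extension of lattice potentials\<close>

text \<open>The 3 h are the half side 2 h of the cube in \<open>grid_domain\<close> plus one lattice
  step to a neighbour.\<close>

lemma grid_interiorI:
  assumes h: "0 < h" and y: "y \<in> grid h" and near: "\<And>w. (\<And>k. \<bar>w $ k - y $ k\<bar> \<le> 3 * h) \<Longrightarrow> w \<in> \<Omega>"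
  shows "y \<in> grid_interior \<Omega> h"
proof -
  have dom: "z \<in> grid_domain \<Omega> h" if "z \<in> grid h" "\<And>k. \<bar>z $ k - y $ k\<bar> \<le> h" for z
  proof -
    have "w \<in> \<Omega>" if w: "w \<in> cube (4 * h) z" for w
    proof (rule near)
      fix k
      have "\<bar>w $ k - z $ k\<bar> \<le> 2 * h" using w by (auto simp: cube_def mem_box_cart abs_le_iff dest: spec[of _ k])
      then show "\<bar>w $ k - y $ k\<bar> \<le> 3 * h" using \<open>\<And>k. \<bar>z $ k - y $ k\<bar> \<le> h\<close>[of k] by linarith
    qed
    moreover have "z \<in> cube (4 * h) z" using h by (auto simp: cube_def mem_box_cart)
    ultimately show ?thesis using that(1) by (auto simp: grid_domain_def)
  qed
  have "y \<in> grid_domain \<Omega> h" using dom[OF y] h by simp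
  moreover have "y + h *\<^sub>R ax i \<in> grid_domain \<Omega> h" "y - h *\<^sub>R ax i \<in> grid_domain \<Omega> h" for i
    using h by (intro dom grid_add grid_diff y grid_axis; simp add: axis_def)+
  ultimately show ?thesis unfolding grid_interior_def grid_boundary_def by auto
qed

text \<open>The walk only visits midpoints inside the box, because each step moves one coordinate of the
  endpoint towards the starting point.\<close>

lemma grid_walk:
  fixes \<phi> :: "real^3 \<Rightarrow> real" and z :: "3 \<Rightarrow> int"
  assumes h: "0 < h" and S: "0 \<le> S"
    and grad: "\<And>y. y \<in> grid h \<Longrightarrow> (\<And>k. \<bar>y $ k - c $ k\<bar> \<le> \<rho>) \<Longrightarrow> norm (grid_grad h \<phi> y) \<le> S"
    and a: "a \<in> grid h" "\<And>k. \<bar>a $ k - c $ k\<bar> \<le> \<rho>"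
    and b: "\<And>k. \<bar>b $ k - c $ k\<bar> \<le> \<rho>" "\<And>k. b $ k = a $ k + 2 * h * of_int (z k)"
    and n: "(\<Sum>k\<in>UNIV. nat \<bar>z k\<bar>) = n"
  shows "\<bar>\<phi> b - \<phi> a\<bar> \<le> 2 * h * S * real n"
  using b n
proof (induction n arbitrary: b z)
  case 0
  then have "z k = 0" for k by simp
  then have "b = a" using 0(2) by (simp add: vec_eq_iff)
  then show ?case by simp
next
  case (Suc n)
  have "\<exists>k. z k \<noteq> 0"
  proof (rule ccontr)
    assume "\<not> ?thesis"
    then show False using Suc.prems(3) by simp
  qed
  then obtain k where k: "z k \<noteq> 0" by blast
  define \<sigma> where "\<sigma> = sgn (z k)"
  have \<sigma>: "\<sigma> = 1 \<or> \<sigma> = -1" using k by (auto simp: \<sigma>_def sgn_if)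
  define z' where "z' = z(k := z k - \<sigma>)"
  define b' where "b' = b - (2 * h * of_int \<sigma>) *\<^sub>R ax k"
  define y where "y = b - (h * of_int \<sigma>) *\<^sub>R ax k"
  have b'k: "b' $ j = a $ j + 2 * h * of_int (z' j)" for j
    using Suc.prems(2)[of j] by (auto simp: b'_def z'_def axis_def algebra_simps)
  have between: "\<bar>of_int (z k - \<sigma>) :: real\<bar> \<le> \<bar>of_int (z k)\<bar>" "0 \<le> of_int \<sigma> * (of_int (z k - \<sigma>) :: real)"
    "\<sigma> * z k \<ge> 1"
  proof -
    have "\<bar>z k - \<sigma>\<bar> \<le> \<bar>z k\<bar> \<and> 0 \<le> \<sigma> * (z k - \<sigma>) \<and> 1 \<le> \<sigma> * z k"
      using k by (auto simp: \<sigma>_def sgn_if)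
    then show "\<bar>of_int (z k - \<sigma>) :: real\<bar> \<le> \<bar>of_int (z k)\<bar>" "0 \<le> of_int \<sigma> * (of_int (z k - \<sigma>) :: real)" "\<sigma> * z k \<ge> 1"
      unfolding of_int_mult[symmetric] of_int_abs[symmetric] of_int_le_iff of_int_0_le_iff by simp_all
  qed
  have coord: "min (a $ j) (b $ j) \<le> b' $ j \<and> b' $ j \<le> max (a $ j) (b $ j) \<and>
      min (b' $ j) (b $ j) \<le> y $ j \<and> y $ j \<le> max (b' $ j) (b $ j)" for j
  proof (cases "j = k")
    case True
    have bk: "b $ k = a $ k + 2 * h * of_int (z k)" by (rule Suc.prems(2))
    show ?thesis
    proof (cases "\<sigma> = 1")
      case s: True
      then have "1 \<le> z k" using between(3) by simp
      then have "h * 1 \<le> h * of_int (z k)" using h by (intro mult_left_mono) auto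
      then show ?thesis using True s bk h by (auto simp: b'_def y_def)
    next
      case False
      then have s: "\<sigma> = -1" using \<sigma> by simp
      then have "z k \<le> -1" using between(3) by simp
      then have "real_of_int (z k) \<le> -1" by linarith
      then have "h * of_int (z k) \<le> h * (-1)" using h by (intro mult_left_mono) auto
      then show ?thesis using True s bk h by (auto simp: b'_def y_def)
    qed
  next
    case False
    then show ?thesis by (auto simp: b'_def y_def axis_def)
  qed
  have b'box: "\<bar>b' $ j - c $ j\<bar> \<le> \<rho>" for j
    using coord[of j] Suc.prems(1)[of j] a(2)[of j] by (auto simp: abs_le_iff min_def max_def split: if_splits)
  have ybox: "\<bar>y $ j - c $ j\<bar> \<le> \<rho>" for j
    using coord[of j] Suc.prems(1)[of j] b'box[of j] by (auto simp: abs_le_iff min_def max_def split: if_splits)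
  have bgrid: "y \<in> grid h"
    unfolding grid_def
  proof (intro CollectI allI)
    fix j
    obtain m :: int where "a $ j = h * of_int m" using a(1) unfolding grid_def by blast
    then show "\<exists>m::int. y $ j = h * of_int m"
      using Suc.prems(2)[of j]
      by (intro exI[of _ "m + 2 * z j - (if j = k then \<sigma> else 0)"]) (auto simp: y_def axis_def algebra_simps)
  qed
  have IH: "\<bar>\<phi> b' - \<phi> a\<bar> \<le> 2 * h * S * real n"
  proof (rule Suc.IH[OF b'box b'k])
    have "(\<Sum>j\<in>UNIV. nat \<bar>z' j\<bar>) + 1 = (\<Sum>j\<in>UNIV. nat \<bar>z j\<bar>)"
    proof -
      have "(\<Sum>j\<in>UNIV. nat \<bar>z j\<bar>) = nat \<bar>z k\<bar> + (\<Sum>j\<in>UNIV - {k}. nat \<bar>z j\<bar>)"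
        by (rule sum.remove) auto
      moreover have "(\<Sum>j\<in>UNIV. nat \<bar>z' j\<bar>) = nat \<bar>z' k\<bar> + (\<Sum>j\<in>UNIV - {k}. nat \<bar>z' j\<bar>)"
        by (rule sum.remove) auto
      moreover have "(\<Sum>j\<in>UNIV - {k}. nat \<bar>z' j\<bar>) = (\<Sum>j\<in>UNIV - {k}. nat \<bar>z j\<bar>)"
        by (intro sum.cong) (auto simp: z'_def)
      moreover have "nat \<bar>z' k\<bar> + 1 = nat \<bar>z k\<bar>" using k by (auto simp: z'_def \<sigma>_def sgn_if)
      ultimately show ?thesis by simp
    qed
    then show "(\<Sum>j\<in>UNIV. nat \<bar>z' j\<bar>) = n" using Suc.prems(3) by simp
  qed
  have "\<bar>\<phi> b - \<phi> b'\<bar> = 2 * h * \<bar>D1 h k \<phi> y\<bar>"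
  proof -
    have 1: "{y + h *\<^sub>R ax k, y - h *\<^sub>R ax k} = {b, b'}"
      using \<sigma> unfolding y_def b'_def by (auto simp: algebra_simps scaleR_2[symmetric])
    then have "\<bar>\<phi> (y + h *\<^sub>R ax k) - \<phi> (y - h *\<^sub>R ax k)\<bar> = \<bar>\<phi> b - \<phi> b'\<bar>"
      by (auto simp: doubleton_eq_iff)
    then show ?thesis using h by (simp add: D1_real abs_mult)
  qed
  also have "\<bar>D1 h k \<phi> y\<bar> \<le> S"
    using grad[OF bgrid ybox] component_le_norm_cart[of "grid_grad h \<phi> y" k] by (simp add: grid_grad_def)
  finally have "\<bar>\<phi> b - \<phi> b'\<bar> \<le> 2 * h * S" using h by (simp add: mult_left_mono)
  then show ?case using IH by (simp add: algebra_simps abs_le_iff)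
qed

lemma infdist_dist_le: "\<bar>infdist x A - infdist y A\<bar> \<le> dist x y"
  using infdist_triangle[of x A y] infdist_triangle[of y A x] by (simp add: dist_commute abs_le_iff)

text \<open>The map \<open>r\<close> moves points by a field with Lipschitz constant independent of
  h that vanishes at depth M h. The images of the two neighbours of x therefore differ by boundedly
  many steps of length 2 h, joined by a walk on which every central difference is taken in
  \<open>grid_interior\<close>. Each gradient value is used for boundedly many x, so the squares sum
  up with a constant that depends on \<Omega> only.\<close>

lemma potential_extension:
  assumes op: "open \<Omega>" and bd: "bounded \<Omega>" and lip: "lipschitz_boundary \<Omega>"
  shows "\<exists>C\<ge>0. \<exists>c\<ge>0. \<exists>\<delta>>0. \<forall>h (\<phi> :: real^3 \<Rightarrow> real). 0 < h \<and> h < \<delta> \<longrightarrow>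
    (\<exists>\<Phi>. (\<forall>x. c * h \<le> infdist x (-\<Omega>) \<longrightarrow> \<Phi> x = \<phi> x) \<and>
      (\<forall>N. finite N \<and> N \<subseteq> grid h \<and> (\<forall>x\<in>N. \<exists>z\<in>\<Omega>. dist x z \<le> 2 * h) \<longrightarrow>
        (\<Sum>x\<in>N. (norm (grid_grad h \<Phi> x))\<^sup>2) \<le> C * (\<Sum>x\<in>grid_interior \<Omega> h. (norm (grid_grad h \<phi> x))\<^sup>2)))"
proof -
  from cone_field[OF bd lip] obtain \<nu> \<epsilon> s1 \<Lambda>
    where \<epsilon>: "0 < \<epsilon>" "\<epsilon> \<le> (1::real)" and s1: "(0::real) < s1" and \<Lambda>: "(0::real) \<le> \<Lambda>"
    and \<nu>': "\<forall>x. norm (\<nu> x) \<le> \<Lambda>" "\<forall>x y. norm (\<nu> x - \<nu> y) \<le> \<Lambda> * norm (x - y)"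
    and cone': "\<forall>q\<in>frontier \<Omega>. \<forall>x z s y. dist x q < s1 \<and> dist z q < s1 \<and> z \<in> \<Omega> \<and> 0 \<le> s \<and> s < s1 \<and>
        norm (y - (z + s *\<^sub>R \<nu> x)) \<le> \<epsilon> * s \<longrightarrow> y \<in> \<Omega>"
    by (elim exE conjE) (rule that)
  have \<nu>: "norm (\<nu> x) \<le> \<Lambda>" "norm (\<nu> x - \<nu> y) \<le> \<Lambda> * norm (x - y)" for x y using \<nu>' by blast+
  have cone: "y \<in> \<Omega>" if "q \<in> frontier \<Omega>" "dist x q < s1" "dist z q < s1" "z \<in> \<Omega>" "0 \<le> s" "s < s1"
        "norm (y - (z + s *\<^sub>R \<nu> x)) \<le> \<epsilon> * s" for q x z s y
    using cone' that by blast
  \<comment> \<open>The images of the neighbours of x lie within \<rho>1 h of x + m x in each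
    coordinate: h from the step, h from rounding, 2 \<Lambda> h from the variation of
    \<open>m\<close>.\<close>
  define \<rho>1 where "\<rho>1 = 2 + 2 * \<Lambda>"
  \<comment> \<open>Around x + m x a box of half-width (\<rho>1 + 3) h has to fit into \<Omega>, for
    the walk and the stencil of \<open>grid_interior\<close>; in norm this is three times as much.
    The extra 2 h serve x outside \<Omega>, and the division by \<epsilon> is there because a shift
    gains only the fraction \<epsilon> of its length in depth.\<close>
  define M where "M = (3 * (\<rho>1 + 3) + 2) / \<epsilon>"
  \<comment> \<open>The walk for x stays within K h of x in each coordinate, so a given point serves
    at most (2 K + 1)^3 lattice points x.\<close>
  define K where "K = \<rho>1 + M * \<Lambda>"
  define C where "C = 27 * \<rho>1\<^sup>2 * (2 * K + 1)^3"
  define \<delta> where "\<delta> = min (1 / M) (s1 / (2 * M + 5))"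
  have \<rho>1: "2 \<le> \<rho>1" using \<Lambda> by (simp add: \<rho>1_def)
  have M\<epsilon>: "\<epsilon> * M = 3 * (\<rho>1 + 3) + 2" using \<epsilon> by (simp add: M_def)
  have M: "3 * (\<rho>1 + 3) + 2 \<le> M"
    unfolding M_def using \<epsilon> \<rho>1 by (simp add: pos_le_divide_eq)
  have M0: "0 < M" using M \<rho>1 by simp
  have K: "0 \<le> K" "\<rho>1 \<le> K" using M0 \<rho>1 \<Lambda> by (simp_all add: K_def)
  have C: "0 \<le> C" using K by (simp add: C_def)
  have \<delta>: "0 < \<delta>" using M0 s1 by (simp add: \<delta>_def)
  define d where "d x = infdist x (-\<Omega>)" for x
  have d0: "0 \<le> d x" for x by (simp add: d_def infdist_nonneg)
  have dball: "y \<in> \<Omega>" if "dist x y < d x" for x y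
    using that infdist_le[of y "-\<Omega>" x] by (force simp: d_def)
  have dout: "d x = 0" if "x \<notin> \<Omega>" for x using that by (simp add: d_def)
  have main: "\<exists>\<Phi>. (\<forall>x. M * h \<le> d x \<longrightarrow> \<Phi> x = \<phi> x) \<and>
      (\<forall>N. finite N \<and> N \<subseteq> grid h \<and> (\<forall>x\<in>N. \<exists>z\<in>\<Omega>. dist x z \<le> 2 * h) \<longrightarrow>
        (\<Sum>x\<in>N. (norm (grid_grad h \<Phi> x))\<^sup>2) \<le> C * (\<Sum>x\<in>grid_interior \<Omega> h. (norm (grid_grad h \<phi> x))\<^sup>2))"
    if h: "0 < h" "h < \<delta>" for h and \<phi> :: "real^3 \<Rightarrow> real"
  proof -
    have hM: "M * h \<le> 1" using h M0 by (simp add: \<delta>_def field_simps)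
    have hs: "(2 * M + 5) * h < s1" using h M0 by (simp add: \<delta>_def field_simps)
    \<comment> \<open>The scalar factor is 1-Lipschitz and, by \<open>hM\<close>, at most 1, so
      \<open>m\<close> is Lipschitz with the constant 2 \<Lambda>, independent of h.\<close>
    define m where "m x = max 0 (M * h - d x) *\<^sub>R \<nu> x" for x
    have m1: "norm (m x) \<le> M * h * \<Lambda>" for x
      unfolding m_def norm_scaleR using d0[of x] M0 h \<nu>(1) by (intro mult_mono) auto
    have m2: "norm (m x - m y) \<le> 2 * \<Lambda> * norm (x - y)" for x y
    proof -
      let ?a = "max 0 (M * h - d x)" and ?b = "max 0 (M * h - d y)"
      have "m x - m y = (?a - ?b) *\<^sub>R \<nu> x + ?b *\<^sub>R (\<nu> x - \<nu> y)"
        by (simp add: m_def algebra_simps)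
      then have "norm (m x - m y) \<le> \<bar>?a - ?b\<bar> * norm (\<nu> x) + \<bar>?b\<bar> * norm (\<nu> x - \<nu> y)"
        by (metis norm_scaleR norm_triangle_ineq)
      also have "\<dots> \<le> norm (x - y) * \<Lambda> + 1 * (\<Lambda> * norm (x - y))"
      proof (intro add_mono mult_mono \<nu>)
        show "\<bar>?a - ?b\<bar> \<le> norm (x - y)"
          using infdist_dist_le[of x "-\<Omega>" y] by (simp add: d_def dist_norm)
        show "\<bar>?b\<bar> \<le> 1" using hM d0[of y] by simp
      qed auto
      finally show ?thesis by simp
    qed
    define r where "r x = x + round_grid (2 * h) (m x)" for x
    have rm: "\<bar>r x $ k - (x + m x) $ k\<bar> \<le> h" for x k
      using round_grid_component[of "2 * h" "m x" k] h by (simp add: r_def)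
    have r_id: "r x = x" if "M * h \<le> d x" for x
      using that by (simp add: r_def m_def round_grid_def vec_eq_iff)
    define \<Phi> where "\<Phi> x = \<phi> (r x)" for x
    \<comment> \<open>Three positions of x. At depth at least M h there is no shift and the ball
      around x suffices. In \<Omega> but shallower, the error is shared between the ball around x
      and the cone. Outside \<Omega>, the cone starts at the nearby point \<open>z\<close>
      instead.\<close>
    have deep: "y \<in> \<Omega>" if x: "z \<in> \<Omega>" "dist x z \<le> 2 * h" and y: "norm (y - (x + m x)) \<le> 3 * (\<rho>1 + 3) * h" for x y z
    proof (cases "M * h \<le> d x")
      case True
      then have "m x = 0" by (simp add: m_def)
      moreover have "3 * (\<rho>1 + 3) * h < M * h" using M h by (intro mult_strict_right_mono) auto
      ultimately show ?thesis using dball[of x y] y True by (simp add: dist_norm norm_minus_commute)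
    next
      case False
      define s where "s = M * h - d x"
      have s: "0 < s" "s \<le> M * h" using False d0[of x] by (auto simp: s_def)
      have mx: "m x = s *\<^sub>R \<nu> x" using s by (simp add: m_def s_def)
      obtain p where p: "p \<notin> \<Omega>" "d x = dist x p"
        unfolding d_def using infdist_compl_attained[OF op bd] by blast
      obtain q where q: "q \<in> frontier \<Omega>" "dist z q \<le> dist z p" using near_frontier[OF x(1) p(1)] by blast
      have "dist z p \<le> 2 * h + M * h" using dist_triangle[of z p x] x(2) p(2) False by (simp add: dist_commute)
      then have zq: "dist z q \<le> (M + 2) * h" using q(2) by (simp add: algebra_simps)
      then have xq: "dist x q \<le> (M + 4) * h" using dist_triangle[of x q z] x(2) by (simp add: algebra_simps)
      have hM0: "0 < M * h" using M0 h by simp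
      have xq': "dist x q < s1" and ss1: "s < s1" and zq': "dist z q < s1"
        using xq zq hs s hM0 h by (simp_all add: algebra_simps)
      have y': "norm (y - (x + s *\<^sub>R \<nu> x)) \<le> \<epsilon> * (M * h) - 2 * h"
        using y M\<epsilon> unfolding mx mult.assoc[symmetric] M\<epsilon> by (simp add: algebra_simps)
      show ?thesis
      proof (cases "x \<in> \<Omega>")
        case True
        define \<alpha> where "\<alpha> = max 0 (d x - 2 * h)"
        have "\<epsilon> * (M * h) = \<epsilon> * s + \<epsilon> * d x" by (simp add: s_def algebra_simps)
        also have "\<epsilon> * d x \<le> d x" using \<epsilon> d0[of x] mult_right_mono[of \<epsilon> 1 "d x"] by simp
        finally have "norm (y - (x + s *\<^sub>R \<nu> x)) \<le> \<alpha> + \<epsilon> * s" using y' by (simp add: \<alpha>_def)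
        moreover have "0 \<le> \<alpha>" "0 \<le> \<epsilon> * s" using \<epsilon> s by (auto simp: \<alpha>_def)
        ultimately obtain d1 d2 where dd: "y - (x + s *\<^sub>R \<nu> x) = d1 + d2" "norm d1 \<le> \<alpha>" "norm d2 \<le> \<epsilon> * s"
          using norm_split by blast
        have "x + d1 \<in> \<Omega>"
        proof (cases "\<alpha> = 0")
          case True
          then show ?thesis using dd(2) \<open>x \<in> \<Omega>\<close> by simp
        next
          case False
          then have "norm d1 < d x" using dd(2) h by (simp add: \<alpha>_def)
          then show ?thesis by (intro dball[of x]) (simp add: dist_norm)
        qed
        moreover have "dist (x + d1) q < s1"
        proof -
          have "norm d1 \<le> M * h" using dd(2) False h hM0 by (simp add: \<alpha>_def)
          then have "dist (x + d1) q \<le> M * h + dist x q"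
            using dist_triangle[of "x + d1" q x] by (simp add: dist_norm)
          then show ?thesis using xq hs h by (simp add: algebra_simps)
        qed
        moreover have "y - (x + d1 + s *\<^sub>R \<nu> x) = d2" using dd(1) by (simp add: algebra_simps)
        ultimately show ?thesis using cone[OF q(1) xq', of "x + d1" s y] s ss1 dd(3) by simp
      next
        case False
        then have seq: "s = M * h" using dout by (simp add: s_def)
        have "norm (y - (z + s *\<^sub>R \<nu> x)) \<le> norm (y - (x + s *\<^sub>R \<nu> x)) + norm (x - z)"
        proof -
          have "y - (z + s *\<^sub>R \<nu> x) = (y - (x + s *\<^sub>R \<nu> x)) + (x - z)" by simp
          then show ?thesis by (metis norm_triangle_ineq)
        qed
        then have "norm (y - (z + s *\<^sub>R \<nu> x)) \<le> \<epsilon> * s"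
          using y'[folded seq] x(2) unfolding dist_norm by linarith
        then show ?thesis using cone[OF q(1) xq' zq' x(1), of s y] s ss1 by simp
      qed
    qed
    let ?I = "grid_interior \<Omega> h"
    note finI = finite_grid_interior[OF h(1) bd]
    define near where "near x = {y \<in> ?I. \<forall>k. \<bar>y $ k - x $ k\<bar> \<le> K * h}" for x
    have local: "(norm (grid_grad h \<Phi> x))\<^sup>2 \<le> 27 * \<rho>1\<^sup>2 * (\<Sum>y\<in>near x. (norm (grid_grad h \<phi> y))\<^sup>2)"
      if x: "x \<in> grid h" "z \<in> \<Omega>" "dist x z \<le> 2 * h" for x z
    proof -
      define c where "c = x + m x"
      \<comment> \<open>One number bounds all gradient values that the walk can meet, so the path
        itself need not be recorded.\<close>
      define S where "S = sqrt (\<Sum>y\<in>near x. (norm (grid_grad h \<phi> y))\<^sup>2)"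
      have S: "0 \<le> S" "S\<^sup>2 = (\<Sum>y\<in>near x. (norm (grid_grad h \<phi> y))\<^sup>2)" by (simp_all add: S_def sum_nonneg)
      have finnear: "finite (near x)" using finI by (simp add: near_def)
      have grad: "norm (grid_grad h \<phi> y) \<le> S" if y: "y \<in> grid h" "\<And>k. \<bar>y $ k - c $ k\<bar> \<le> \<rho>1 * h" for y
      proof -
        have "y \<in> ?I"
        proof (rule grid_interiorI[OF h(1) y(1)])
          fix w assume w: "\<And>k. \<bar>w $ k - y $ k\<bar> \<le> 3 * h"
          have "\<bar>(w - c) $ k\<bar> \<le> (\<rho>1 + 3) * h" for k using w[of k] y(2)[of k] by (simp add: algebra_simps)
          then have "norm (w - c) \<le> 3 * ((\<rho>1 + 3) * h)" by (rule norm_le_3_components)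
          then show "w \<in> \<Omega>" using deep[OF x(2,3), of w] unfolding c_def mult.assoc by blast
        qed
        moreover have "\<bar>y $ k - x $ k\<bar> \<le> K * h" for k
        proof -
          have "\<bar>m x $ k\<bar> \<le> M * h * \<Lambda>" using component_le_norm_cart[of "m x" k] m1[of x] by linarith
          moreover have "\<bar>y $ k - (x $ k + m x $ k)\<bar> \<le> \<rho>1 * h" using y(2)[of k] by (simp add: c_def)
          moreover have "K * h = \<rho>1 * h + M * h * \<Lambda>" by (simp add: K_def algebra_simps)
          ultimately show ?thesis by linarith
        qed
        ultimately have "y \<in> near x" by (simp add: near_def)
        then have "(norm (grid_grad h \<phi> y))\<^sup>2 \<le> S\<^sup>2"
          unfolding S(2) using finnear by (intro member_le_sum) auto
        then show ?thesis using S(1) by (rule power2_le_imp_le)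
      qed
      have nbr: "\<bar>r (x + t *\<^sub>R ax i) $ k - c $ k\<bar> \<le> \<rho>1 * h" if t: "\<bar>t\<bar> = h" for t i k
      proof -
        let ?y = "x + t *\<^sub>R ax i"
        have "\<bar>(m ?y - m x) $ k\<bar> \<le> 2 * \<Lambda> * h"
          using component_le_norm_cart[of "m ?y - m x" k] m2[of ?y x] t by simp
        moreover have "\<bar>(t *\<^sub>R ax i) $ k\<bar> \<le> h" using t h by (simp add: axis_def)
        moreover have "\<rho>1 * h = 2 * h + 2 * \<Lambda> * h" by (simp add: \<rho>1_def algebra_simps)
        ultimately show ?thesis
          using rm[of ?y k] unfolding c_def vector_add_component vector_minus_component by linarith
      qed
      have comp: "\<bar>D1 h i \<Phi> x\<bar> \<le> 3 * \<rho>1 * S" for i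
      proof -
        let ?b = "r (x + h *\<^sub>R ax i)" and ?a = "r (x - h *\<^sub>R ax i)"
        have a: "\<bar>?a $ k - c $ k\<bar> \<le> \<rho>1 * h" for k using nbr[of "-h" i k] h by simp
        have b: "\<bar>?b $ k - c $ k\<bar> \<le> \<rho>1 * h" for k using nbr[of h i k] h by simp
        define z where "z k = (if k = i then 1 else 0)
            + round (m (x + h *\<^sub>R ax i) $ k / (2 * h)) - round (m (x - h *\<^sub>R ax i) $ k / (2 * h))" for k
        have z: "?b $ k = ?a $ k + 2 * h * of_int (z k)" for k
          by (simp add: r_def z_def round_grid_def axis_def algebra_simps)
        have agrid: "?a \<in> grid h"
        proof -
          have "round_grid (2 * h) y \<in> grid h" for y
            unfolding grid_def
          proof (intro CollectI allI)
            fix k show "\<exists>z::int. round_grid (2 * h) y $ k = h * of_int z"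
              by (intro exI[of _ "2 * round (y $ k / (2 * h))"]) (simp add: round_grid_def)
          qed
          then show ?thesis unfolding r_def by (intro grid_add grid_diff x(1) grid_axis)
        qed
        have walk: "\<bar>\<phi> ?b - \<phi> ?a\<bar> \<le> 2 * h * S * real (\<Sum>k\<in>UNIV. nat \<bar>z k\<bar>)"
          by (rule grid_walk[OF h(1) S(1) grad agrid a b z refl])
        have "real (\<Sum>k\<in>UNIV. nat \<bar>z k\<bar>) \<le> (\<Sum>k\<in>(UNIV :: 3 set). \<rho>1)"
          unfolding of_nat_sum
        proof (rule sum_mono)
          fix k
          have "\<bar>2 * h * of_int (z k)\<bar> \<le> 2 * (\<rho>1 * h)" using a[of k] b[of k] z[of k] by linarith
          then have "2 * h * \<bar>of_int (z k)\<bar> \<le> 2 * h * \<rho>1" using h by (simp add: abs_mult mult.commute)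
          then have "\<bar>of_int (z k)\<bar> \<le> \<rho>1" using h by simp
          then show "real (nat \<bar>z k\<bar>) \<le> \<rho>1" by simp
        qed
        then have cnt: "real (\<Sum>k\<in>UNIV. nat \<bar>z k\<bar>) \<le> 3 * \<rho>1" by simp
        have "\<bar>\<phi> ?b - \<phi> ?a\<bar> \<le> 2 * h * (3 * \<rho>1 * S)"
        proof -
          have "2 * h * S * real (\<Sum>k\<in>UNIV. nat \<bar>z k\<bar>) \<le> 2 * h * S * (3 * \<rho>1)"
            using cnt h S(1) by (intro mult_left_mono) auto
          then show ?thesis using walk by (simp add: mult.assoc mult.commute mult.left_commute)
        qed
        then have "\<bar>\<phi> ?b - \<phi> ?a\<bar> / (2 * h) \<le> 3 * \<rho>1 * S"
          using h by (simp add: pos_divide_le_eq mult.commute)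
        then show ?thesis using h by (simp add: D1_real \<Phi>_def abs_divide)
      qed
      have "(norm (grid_grad h \<Phi> x))\<^sup>2 = (\<Sum>i\<in>UNIV. (D1 h i \<Phi> x)\<^sup>2)"
        unfolding power2_norm_eq_inner inner_vec_def by (simp add: grid_grad_def power2_eq_square)
      also have "\<dots> \<le> (\<Sum>i\<in>(UNIV :: 3 set). (3 * \<rho>1 * S)\<^sup>2)"
        using comp \<rho>1 S by (intro sum_mono abs_le_square_iff[THEN iffD1]) (auto simp: abs_mult)
      also have "\<dots> = 27 * \<rho>1\<^sup>2 * S\<^sup>2" by (simp add: power_mult_distrib)
      finally show ?thesis by (simp add: S(2))
    qed
    have "(\<Sum>x\<in>N. (norm (grid_grad h \<Phi> x))\<^sup>2) \<le> C * (\<Sum>x\<in>?I. (norm (grid_grad h \<phi> x))\<^sup>2)"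
      if N: "finite N" "N \<subseteq> grid h" "\<forall>x\<in>N. \<exists>z\<in>\<Omega>. dist x z \<le> 2 * h" for N
    proof -
      let ?g = "\<lambda>y. (norm (grid_grad h \<phi> y))\<^sup>2"
      have "(\<Sum>x\<in>N. (norm (grid_grad h \<Phi> x))\<^sup>2) \<le> (\<Sum>x\<in>N. 27 * \<rho>1\<^sup>2 * (\<Sum>y\<in>near x. ?g y))"
        using N local by (intro sum_mono) blast
      also have "\<dots> = 27 * \<rho>1\<^sup>2 * (\<Sum>x\<in>N. \<Sum>y\<in>?I. if \<forall>k. \<bar>y $ k - x $ k\<bar> \<le> K * h then ?g y else 0)"
        using finI by (simp add: sum_distrib_left[symmetric] near_def sum.inter_filter)
      also have "(\<Sum>x\<in>N. \<Sum>y\<in>?I. if \<forall>k. \<bar>y $ k - x $ k\<bar> \<le> K * h then ?g y else 0)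
          = (\<Sum>y\<in>?I. \<Sum>x\<in>N. if \<forall>k. \<bar>y $ k - x $ k\<bar> \<le> K * h then ?g y else 0)"
        by (rule sum.swap)
      also have "\<dots> \<le> (\<Sum>y\<in>?I. (2 * K + 1)^3 * ?g y)"
      proof (rule sum_mono)
        fix y assume "y \<in> ?I"
        let ?S = "{x \<in> grid h. \<forall>k. \<bar>x $ k - y $ k\<bar> \<le> K * h}"
        have Kh: "0 \<le> K * h" using K h by simp
        have "(\<Sum>x\<in>N. if \<forall>k. \<bar>y $ k - x $ k\<bar> \<le> K * h then ?g y else 0)
            = (\<Sum>x\<in>{x\<in>N. \<forall>k. \<bar>y $ k - x $ k\<bar> \<le> K * h}. ?g y)"
          by (rule sum.inter_filter[OF N(1), symmetric])
        also have "\<dots> \<le> (\<Sum>x\<in>?S. ?g y)"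
        proof (rule sum_mono2)
          show "finite ?S" by (rule grid_box_count(1)[OF h(1) Kh])
          show "{x \<in> N. \<forall>k. \<bar>y $ k - x $ k\<bar> \<le> K * h} \<subseteq> ?S"
            using N(2) by (auto simp: abs_minus_commute)
        qed simp
        also have "\<dots> = real (card ?S) * ?g y" by simp
        also have "\<dots> \<le> (2 * (K * h) / h + 1)^3 * ?g y"
          by (intro mult_right_mono grid_box_count(2)[OF h(1) Kh]) auto
        finally show "(\<Sum>x\<in>N. if \<forall>k. \<bar>y $ k - x $ k\<bar> \<le> K * h then ?g y else 0) \<le> (2 * K + 1)^3 * ?g y"
          using h by simp
      qed
      finally have "(\<Sum>x\<in>N. (norm (grid_grad h \<Phi> x))\<^sup>2) \<le> 27 * \<rho>1\<^sup>2 * (\<Sum>y\<in>?I. (2 * K + 1)^3 * ?g y)"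
        by (simp add: mult_left_mono)
      then show ?thesis by (simp add: C_def sum_distrib_left[symmetric] mult.assoc)
    qed
    moreover have "\<forall>x. M * h \<le> d x \<longrightarrow> \<Phi> x = \<phi> x" using r_id by (simp add: \<Phi>_def)
    ultimately show ?thesis by blast
  qed
  show ?thesis
    using main C M0 \<delta> unfolding d_def by (intro exI[of _ C] conjI exI[of _ M] exI[of _ \<delta>]) auto
qed

section \<open>Regularity up to the boundary and consistency\<close>

lemma vector_derivative_bound:
  fixes g :: "real \<Rightarrow> 'b::real_normed_vector"
  assumes "a \<le> b" and g: "\<And>s. a \<le> s \<Longrightarrow> s \<le> b \<Longrightarrow> (g has_vector_derivative g' s) (at s)"
    and B: "\<And>s. a \<le> s \<Longrightarrow> s \<le> b \<Longrightarrow> norm (g' s) \<le> B"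
  shows "norm (g b - g a) \<le> B * (b - a)"
proof -
  have "norm (g b - g a) \<le> B * norm (b - a)"
  proof (rule differentiable_bound[where S="{a..b}" and f'="\<lambda>s r. r *\<^sub>R g' s"])
    fix s assume "s \<in> {a..b}"
    then show "(g has_derivative (\<lambda>r. r *\<^sub>R g' s)) (at s within {a..b})"
      using g[of s] by (auto simp: has_vector_derivative_def intro: has_derivative_at_withinI)
    show "onorm (\<lambda>r. r *\<^sub>R g' s) \<le> B"
      using B[of s] \<open>s \<in> {a..b}\<close> by (intro onorm_bound) (auto simp: mult.commute[of B] intro: mult_left_mono order_trans[OF norm_ge_zero])
  qed (use assms in auto)
  then show ?thesis using assms(1) by simp
qed

text \<open>Mean value inequality for \<open>g s - s *\<^sub>R c\<close>; for vector values there is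
  no exact intermediate point to evaluate the derivative at.\<close>

lemma difference_quotient_bound:
  fixes g :: "real \<Rightarrow> 'b::real_normed_vector"
  assumes ab: "a < b" and g: "\<And>s. a \<le> s \<Longrightarrow> s \<le> b \<Longrightarrow> (g has_vector_derivative g' s) (at s)"
    and L: "\<And>s. a \<le> s \<Longrightarrow> s \<le> b \<Longrightarrow> norm (g' s - c) \<le> L"
  shows "norm ((g b - g a) /\<^sub>R (b - a) - c) \<le> L"
proof -
  define k where "k s = g s - s *\<^sub>R c" for s
  have "norm (k b - k a) \<le> L * (b - a)"
  proof (rule vector_derivative_bound[where g'="\<lambda>s. g' s - c"])
    fix s assume "a \<le> s" "s \<le> b"
    then show "(k has_vector_derivative g' s - c) (at s)"
      unfolding k_def by (auto intro!: derivative_eq_intros g)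
  qed (use ab L in auto)
  moreover have "k b - k a = (b - a) *\<^sub>R ((g b - g a) /\<^sub>R (b - a) - c)"
  proof -
    have "(b - a) *\<^sub>R ((g b - g a) /\<^sub>R (b - a)) = g b - g a" using ab by simp
    then show ?thesis
      unfolding scaleR_right_diff_distrib[of "b - a" "(g b - g a) /\<^sub>R (b - a)" c]
      by (simp add: k_def algebra_simps)
  qed
  ultimately have "(b - a) * norm ((g b - g a) /\<^sub>R (b - a) - c) \<le> (b - a) * L"
    using ab by (simp add: mult.commute)
  then show ?thesis using ab by simp
qed

text \<open>The function g(s) + g(-s) - s^2 c has the derivative g'(s) - g'(-s) - 2 s c, to which
  the first-order bound applies on [-s, s]. Only the variation of \<open>g''\<close> enters, not a
  third derivative.\<close>

lemma second_difference_bound: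
  fixes g :: "real \<Rightarrow> 'b::real_normed_vector"
  assumes h: "0 < h" and g: "\<And>s. \<bar>s\<bar> \<le> h \<Longrightarrow> (g has_vector_derivative g' s) (at s)"
    and g': "\<And>s. \<bar>s\<bar> \<le> h \<Longrightarrow> (g' has_vector_derivative g'' s) (at s)"
    and L: "\<And>s. \<bar>s\<bar> \<le> h \<Longrightarrow> norm (g'' s - c) \<le> L"
  shows "norm ((g h + g (-h) - 2 *\<^sub>R g 0) /\<^sub>R h\<^sup>2 - c) \<le> 2 * L"
proof -
  have "norm (g'' 0 - c) \<le> L" using L[of 0] h by simp
  then have L0: "0 \<le> L" by (meson norm_ge_zero order_trans)
  define k where "k s = g s + g (-s) - s\<^sup>2 *\<^sub>R c" for s
  have "norm (k h - k 0) \<le> (2 * h * L) * (h - 0)"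
  proof (rule vector_derivative_bound[where g'="\<lambda>s. g' s - g' (-s) - (2 * s) *\<^sub>R c"])
    fix s assume s: "0 \<le> s" "s \<le> h"
    have 1: "((\<lambda>s. g (-s)) has_vector_derivative (-1) *\<^sub>R g' (-s)) (at s)"
    proof -
      have "((\<lambda>s. - s) has_vector_derivative (-1)) (at s)" by (auto intro!: derivative_eq_intros)
      from vector_diff_chain_at[OF this g[of "-s"]] show ?thesis using s by (simp add: o_def)
    qed
    have 2: "((\<lambda>s. s\<^sup>2 *\<^sub>R c) has_vector_derivative (2 * s) *\<^sub>R c) (at s)"
      by (auto intro!: derivative_eq_intros)
    show "(k has_vector_derivative g' s - g' (-s) - (2 * s) *\<^sub>R c) (at s)"
      unfolding k_def using has_vector_derivative_diff[OF has_vector_derivative_add[OF g 1] 2] s by simp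
    show "norm (g' s - g' (-s) - (2 * s) *\<^sub>R c) \<le> 2 * h * L"
    proof (cases "s = 0")
      case True
      then show ?thesis using h L0 by simp
    next
      case False
      have "norm ((g' s - g' (-s)) /\<^sub>R (s - (-s)) - c) \<le> L"
        by (rule difference_quotient_bound[where g'=g'']) (use g' L s False in auto)
      moreover have "g' s - g' (-s) - (2 * s) *\<^sub>R c = (2 * s) *\<^sub>R ((g' s - g' (-s)) /\<^sub>R (s - (-s)) - c)"
      proof -
        have "(2 * s) *\<^sub>R ((g' s - g' (-s)) /\<^sub>R (s - (-s))) = g' s - g' (-s)" using False by simp
        then show ?thesis
          unfolding scaleR_right_diff_distrib[of "2 * s" "(g' s - g' (-s)) /\<^sub>R (s - (-s))" c] by simp
      qed
      ultimately have "norm (g' s - g' (-s) - (2 * s) *\<^sub>R c) \<le> (2 * s) * L"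
        using s by (simp add: mult_left_mono)
      also have "\<dots> \<le> 2 * h * L" using s L0 by (simp add: mult_right_mono)
      finally show ?thesis .
    qed
  qed (use h in auto)
  moreover have "k h - k 0 = h\<^sup>2 *\<^sub>R ((g h + g (-h) - 2 *\<^sub>R g 0) /\<^sub>R h\<^sup>2 - c)"
  proof -
    have "h\<^sup>2 *\<^sub>R ((g h + g (-h) - 2 *\<^sub>R g 0) /\<^sub>R h\<^sup>2) = g h + g (-h) - 2 *\<^sub>R g 0" using h by simp
    then show ?thesis
      unfolding scaleR_right_diff_distrib[of "h\<^sup>2" "(g h + g (-h) - 2 *\<^sub>R g 0) /\<^sub>R h\<^sup>2" c]
      by (simp add: k_def scaleR_2)
  qed
  ultimately have "h\<^sup>2 * norm ((g h + g (-h) - 2 *\<^sub>R g 0) /\<^sub>R h\<^sup>2 - c) \<le> h\<^sup>2 * (2 * L)"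
    by (simp add: power2_eq_square mult_ac)
  then show ?thesis using h by simp
qed

section \<open>Functions of class C^k up to the boundary of the space-time cylinder\<close>

lemma closure_cylinder:
  assumes "0 < T"
  shows "closure ({0<..<T} \<times> \<Omega>) = {0..T::real} \<times> closure \<Omega>"
  using assms by (simp add: closure_Times)

lemma C_spacetime_continuous:
  assumes "0 < T" and "C_spacetime k T \<Omega> F"
  shows "continuous_on ({0..T} \<times> closure \<Omega>) (\<lambda>(t, x). F t x)"
  using assms by (cases k) (auto simp: C_spacetime_def closure_cylinder)

lemma C_spacetime_continuous_time:
  assumes "0 < T" and "C_spacetime k T \<Omega> F" and "x \<in> closure \<Omega>"
  shows "continuous_on {0..T} (\<lambda>t. F t x)"
proof -
  have "continuous_on {0..T} (\<lambda>t. (\<lambda>(t, x). F t x) (t, x))"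
    by (rule continuous_on_compose2[OF C_spacetime_continuous[OF assms(1,2)]])
      (use assms(3) in \<open>auto intro!: continuous_intros\<close>)
  then show ?thesis by simp
qed

lemma C_spacetime_continuous_space:
  assumes "0 < T" and "C_spacetime k T \<Omega> F" and "t \<in> {0..T}"
  shows "continuous_on (closure \<Omega>) (F t)"
proof -
  have "continuous_on (closure \<Omega>) (\<lambda>x. (\<lambda>(t, x). F t x) (t, x))"
    by (rule continuous_on_compose2[OF C_spacetime_continuous[OF assms(1,2)]])
      (use assms(3) in \<open>auto intro!: continuous_intros\<close>)
  then show ?thesis by simp
qed

lemma C_spacetime_bounded:
  assumes "0 < T" and "bounded \<Omega>" and "C_spacetime k T \<Omega> F"
  obtains M where "0 < M" "\<And>t x. t \<in> {0..T} \<Longrightarrow> x \<in> closure \<Omega> \<Longrightarrow> norm (F t x) \<le> M"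
proof -
  have "compact ({0..T} \<times> closure \<Omega>)"
    using assms(2) by (intro compact_Times) (auto simp: compact_closure)
  then have "bounded ((\<lambda>(t, x). F t x) ` ({0..T} \<times> closure \<Omega>))"
    using compact_continuous_image[OF C_spacetime_continuous[OF assms(1,3)]] compact_imp_bounded by blast
  then obtain M where M: "0 < M" "\<And>y. y \<in> (\<lambda>(t, x). F t x) ` ({0..T} \<times> closure \<Omega>) \<Longrightarrow> norm y \<le> M"
    by (meson bounded_pos)
  show ?thesis
  proof (rule that[OF M(1)])
    fix t x assume "t \<in> {0..T}" "x \<in> closure \<Omega>"
    then show "norm (F t x) \<le> M" by (intro M(2)) (auto intro!: image_eqI[of _ _ "(t, x)"])
  qed
qed

lemma C_spacetime_SucD_time:
  assumes "C_spacetime (Suc k) T \<Omega> F"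
  obtains G where "C_spacetime k T \<Omega> G"
    and "\<And>t x. 0 < t \<Longrightarrow> t < T \<Longrightarrow> x \<in> \<Omega> \<Longrightarrow> ((\<lambda>s. F s x) has_vector_derivative G t x) (at t)"
proof -
  have "(1::real, 0::real^3) \<in> Basis" by (simp add: Basis_prod_def)
  then obtain G where G: "\<forall>z\<in>{0<..<T} \<times> \<Omega>. ((\<lambda>s. (\<lambda>(t, x). F t x) (z + s *\<^sub>R (1, 0))) has_vector_derivative G z) (at 0)"
    and C: "C_closure k ({0<..<T} \<times> \<Omega>) G"
    using assms unfolding C_spacetime_def C_closure.simps by blast
  show ?thesis
  proof (rule that[of "\<lambda>t x. G (t, x)"])
    show "C_spacetime k T \<Omega> (\<lambda>t x. G (t, x))" using C by (simp add: C_spacetime_def)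
    fix t x assume tx: "0 < t" "t < T" "x \<in> \<Omega>"
    then have "((\<lambda>s. F (t + s) x) has_vector_derivative G (t, x)) (at 0)"
      using G by auto
    then have "((\<lambda>s. F (t + s) x) has_vector_derivative G (t, x)) (at (t - t))" by simp
    moreover have "((\<lambda>s. s - t) has_vector_derivative 1) (at t)"
      by (auto intro!: derivative_eq_intros)
    ultimately show "((\<lambda>s. F s x) has_vector_derivative G (t, x)) (at t)"
      using vector_diff_chain_at[of "\<lambda>s. s - t" 1 t "\<lambda>s. F (t + s) x"] by (simp add: o_def)
  qed
qed

lemma C_spacetime_SucD_space:
  assumes "C_spacetime (Suc k) T \<Omega> F"
  obtains G where "\<And>i. C_spacetime k T \<Omega> (G i)"
    and "\<And>i t x s. 0 < t \<Longrightarrow> t < T \<Longrightarrow> x + s *\<^sub>R ax i \<in> \<Omega> \<Longrightarrow>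
      ((\<lambda>s. F t (x + s *\<^sub>R ax i)) has_vector_derivative G i t (x + s *\<^sub>R ax i)) (at s)"
proof -
  have "\<exists>G. C_closure k ({0<..<T} \<times> \<Omega>) G \<and>
      (\<forall>z\<in>{0<..<T} \<times> \<Omega>. ((\<lambda>s. (\<lambda>(t, x). F t x) (z + s *\<^sub>R (0, ax i))) has_vector_derivative G z) (at 0))" for i
  proof -
    have "(0::real, ax i) \<in> Basis" by (simp add: Basis_prod_def)
    then show ?thesis using assms unfolding C_spacetime_def C_closure.simps by blast
  qed
  then obtain G where C: "\<And>i. C_closure k ({0<..<T} \<times> \<Omega>) (G i)" and
      G: "\<And>i z. z\<in>{0<..<T} \<times> \<Omega> \<Longrightarrow> ((\<lambda>s. (\<lambda>(t, x). F t x) (z + s *\<^sub>R (0, ax i))) has_vector_derivative G i z) (at 0)"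
    by metis
  show ?thesis
  proof (rule that[of "\<lambda>i t x. G i (t, x)"])
    show "C_spacetime k T \<Omega> (\<lambda>t x. G i (t, x))" for i using C by (simp add: C_spacetime_def)
    fix i t x s assume tx: "0 < t" "t < T" "x + s *\<^sub>R ax i \<in> \<Omega>"
    then have "((\<lambda>r. F t (x + s *\<^sub>R ax i + r *\<^sub>R ax i)) has_vector_derivative G i (t, x + s *\<^sub>R ax i)) (at 0)"
      using G[of "(t, x + s *\<^sub>R ax i)" i] by auto
    then have "((\<lambda>r. F t (x + s *\<^sub>R ax i + r *\<^sub>R ax i)) has_vector_derivative G i (t, x + s *\<^sub>R ax i)) (at (s - s))"
      by simp
    moreover have "((\<lambda>r. r - s) has_vector_derivative 1) (at s)"
      by (auto intro!: derivative_eq_intros)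
    moreover have "x + s *\<^sub>R ax i + (r - s) *\<^sub>R ax i = x + r *\<^sub>R ax i" for r
      by (simp add: algebra_simps)
    ultimately show "((\<lambda>s. F t (x + s *\<^sub>R ax i)) has_vector_derivative G i (t, x + s *\<^sub>R ax i)) (at s)"
      using vector_diff_chain_at[of "\<lambda>r. r - s" 1 s "\<lambda>r. F t (x + s *\<^sub>R ax i + r *\<^sub>R ax i)"] by (simp add: o_def add.assoc)
  qed
qed

text \<open>Derivatives are available for 0 < t < T only; estimates reach the end times by
  continuity.\<close>

lemma bound_on_closed_times:
  assumes "0 < T" and "continuous_on {0..T::real} g" and "\<And>t. 0 < t \<Longrightarrow> t < T \<Longrightarrow> norm (g t) \<le> B"
    and "t \<in> {0..T}"
  shows "norm (g t :: 'b::real_normed_vector) \<le> B"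
  using continuous_on_closure_norm_le[of "{0<..<T}" g B t] assms by simp

lemma axis_segment_bound:
  fixes F :: "real^3 \<Rightarrow> 'b::real_normed_vector"
  assumes seg: "\<And>s. min 0 d \<le> s \<Longrightarrow> s \<le> max 0 d \<Longrightarrow>
      ((\<lambda>s. F (x + s *\<^sub>R ax i)) has_vector_derivative G s) (at s) \<and> norm (G s) \<le> M"
  shows "norm (F (x + d *\<^sub>R ax i) - F x) \<le> M * \<bar>d\<bar>"
proof (cases "0 \<le> d")
  case True
  have "norm (F (x + d *\<^sub>R ax i) - F (x + 0 *\<^sub>R ax i)) \<le> M * (d - 0)"
    by (rule vector_derivative_bound[where g="\<lambda>s. F (x + s *\<^sub>R ax i)" and g'=G]) (use seg True in auto)
  then show ?thesis using True by simp
next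
  case False
  have "norm (F (x + 0 *\<^sub>R ax i) - F (x + d *\<^sub>R ax i)) \<le> M * (0 - d)"
    by (rule vector_derivative_bound[where g="\<lambda>s. F (x + s *\<^sub>R ax i)" and g'=G]) (use seg False in auto)
  then show ?thesis using False by (simp add: norm_minus_commute)
qed

text \<open>The coordinate box with opposite corners \<open>x\<close> and \<open>y\<close>. It
  contains the axis-parallel path from one to the other, along which partial derivatives are
  enough.\<close>

definition box_hull :: "real^3 \<Rightarrow> real^3 \<Rightarrow> (real^3) set" where
  "box_hull x y = {z. \<forall>i. min (x $ i) (y $ i) \<le> z $ i \<and> z $ i \<le> max (x $ i) (y $ i)}"

lemma C_spacetime_lipschitz_space:
  assumes T: "0 < T" and bd: "bounded \<Omega>" and C: "C_spacetime (Suc k) T \<Omega> F"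
  obtains M where "0 < M" "\<And>t x y. t \<in> {0..T} \<Longrightarrow> box_hull x y \<subseteq> \<Omega> \<Longrightarrow>
      norm (F t y - F t x) \<le> M * (\<Sum>i\<in>UNIV. \<bar>y $ i - x $ i\<bar>)"
proof -
  obtain G where G: "\<And>i. C_spacetime k T \<Omega> (G i)"
    and dG: "\<And>i t x s. 0 < t \<Longrightarrow> t < T \<Longrightarrow> x + s *\<^sub>R ax i \<in> \<Omega> \<Longrightarrow>
      ((\<lambda>s. F t (x + s *\<^sub>R ax i)) has_vector_derivative G i t (x + s *\<^sub>R ax i)) (at s)"
    using C_spacetime_SucD_space[OF C] by blast
  have "\<forall>i. \<exists>M>0. \<forall>t x. t \<in> {0..T} \<longrightarrow> x \<in> closure \<Omega> \<longrightarrow> norm (G i t x) \<le> M"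
    using C_spacetime_bounded[OF T bd G] by metis
  then obtain m where m: "\<And>i. 0 < m i" "\<And>i t x. t \<in> {0..T} \<Longrightarrow> x \<in> closure \<Omega> \<Longrightarrow> norm (G i t x) \<le> m i"
    by metis
  define M where "M = m 1 + m 2 + m 3"
  have mM: "m i \<le> M" for i using m(1)[of 1] m(1)[of 2] m(1)[of 3] exhaust_3[of i] by (auto simp: M_def)
  show ?thesis
  proof (rule that[of M])
    show "0 < M" using m(1)[of 1] m(1)[of 2] m(1)[of 3] by (simp add: M_def)
    fix t x y assume t: "t \<in> {0..T}" and sub: "box_hull x y \<subseteq> \<Omega>"
    define z1 where "z1 = x + (y $ 1 - x $ 1) *\<^sub>R ax 1"
    define z2 where "z2 = z1 + (y $ 2 - x $ 2) *\<^sub>R ax 2"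
    have y: "y = z2 + (y $ 3 - x $ 3) *\<^sub>R ax 3"
      by (simp add: z2_def z1_def vec_eq_iff forall_3 axis_def)
    have step: "norm (F t (z + d *\<^sub>R ax i) - F t z) \<le> M * \<bar>d\<bar>"
      if t: "0 < t" "t < T" and z: "\<And>s. min 0 d \<le> s \<Longrightarrow> s \<le> max 0 d \<Longrightarrow> z + s *\<^sub>R ax i \<in> box_hull x y" for t z d i
    proof (rule axis_segment_bound[where G="\<lambda>s. G i t (z + s *\<^sub>R ax i)"])
      fix s assume "min 0 d \<le> s" "s \<le> max 0 d"
      then have in\<Omega>: "z + s *\<^sub>R ax i \<in> \<Omega>" using z sub by blast
      then have "norm (G i t (z + s *\<^sub>R ax i)) \<le> m i" using t closure_subset by (intro m(2)) auto
      then show "((\<lambda>s. F t (z + s *\<^sub>R ax i)) has_vector_derivative G i t (z + s *\<^sub>R ax i)) (at s) \<and>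
          norm (G i t (z + s *\<^sub>R ax i)) \<le> M"
        using dG[OF t in\<Omega>] mM[of i] by auto
    qed
    have main: "norm (F t y - F t x) \<le> M * (\<Sum>i\<in>UNIV. \<bar>y $ i - x $ i\<bar>)" if t: "0 < t" "t < T" for t
    proof -
      have 1: "norm (F t z1 - F t x) \<le> M * \<bar>y $ 1 - x $ 1\<bar>"
        unfolding z1_def by (rule step[OF t]) (auto simp: box_hull_def forall_3 axis_def)
      have 2: "norm (F t z2 - F t z1) \<le> M * \<bar>y $ 2 - x $ 2\<bar>"
        unfolding z2_def by (rule step[OF t]) (auto simp: box_hull_def forall_3 axis_def z1_def)
      have 3: "norm (F t y - F t z2) \<le> M * \<bar>y $ 3 - x $ 3\<bar>"
        by (subst (1) y, rule step[OF t]) (auto simp: box_hull_def forall_3 axis_def z1_def z2_def)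
      have "norm (F t y - F t x) \<le> norm (F t y - F t z2) + norm (F t z2 - F t z1) + norm (F t z1 - F t x)"
        using norm_triangle_ineq[of "F t y - F t z2" "F t z2 - F t x"]
          norm_triangle_ineq[of "F t z2 - F t z1" "F t z1 - F t x"] by simp
      then show ?thesis using 1 2 3 by (simp add: sum_3 distrib_left)
    qed
    have "x \<in> box_hull x y" "y \<in> box_hull x y" by (auto simp: box_hull_def)
    then have xy: "x \<in> closure \<Omega>" "y \<in> closure \<Omega>" using sub closure_subset by blast+
    have "continuous_on {0..T} (\<lambda>t. F t y - F t x)"
      using C_spacetime_continuous_time[OF T C] xy by (intro continuous_on_diff) auto
    from bound_on_closed_times[OF T this main t]
    show "norm (F t y - F t x) \<le> M * (\<Sum>i\<in>UNIV. \<bar>y $ i - x $ i\<bar>)" .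
  qed
qed

lemma C_spacetime_lipschitz_time:
  assumes T: "0 < T" and bd: "bounded \<Omega>" and C: "C_spacetime (Suc k) T \<Omega> F"
  obtains M where "0 < M" "\<And>t s x. t \<in> {0..T} \<Longrightarrow> s \<in> {0..T} \<Longrightarrow> x \<in> \<Omega> \<Longrightarrow>
      norm (F t x - F s x) \<le> M * \<bar>t - s\<bar>"
proof -
  obtain G where G: "C_spacetime k T \<Omega> G"
    and dG: "\<And>t x. 0 < t \<Longrightarrow> t < T \<Longrightarrow> x \<in> \<Omega> \<Longrightarrow> ((\<lambda>s. F s x) has_vector_derivative G t x) (at t)"
    using C_spacetime_SucD_time[OF C] by blast
  obtain M where M: "0 < M" "\<And>t x. t \<in> {0..T} \<Longrightarrow> x \<in> closure \<Omega> \<Longrightarrow> norm (G t x) \<le> M"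
    using C_spacetime_bounded[OF T bd G] by blast
  show ?thesis
  proof (rule that[OF M(1)])
    fix t s x assume ts: "t \<in> {0..T}" "s \<in> {0..T}" and x: "x \<in> \<Omega>"
    then have xc: "x \<in> closure \<Omega>" using closure_subset by auto
    have ordered: "norm (F t x - F s x) \<le> M * (t - s)" if "0 < s" "s \<le> t" "t < T" for s t
      by (rule vector_derivative_bound[where g'="\<lambda>s. G s x"]) (use that x xc dG M(2) in auto)
    have inner: "norm (F t x - F s x) \<le> M * \<bar>t - s\<bar>" if "0 < s" "s < T" "0 < t" "t < T" for s t
      using ordered[of s t] ordered[of t s] that by (cases "s \<le> t") (auto simp: norm_minus_commute)
    have cont: "continuous_on {0..T} (\<lambda>t. F t x)" by (rule C_spacetime_continuous_time[OF T C xc])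
    have cl: "closure {0<..<T} = {0..T}" using T by simp
    \<comment> \<open>The two times are moved to the closed interval one after the other.\<close>
    have half: "norm (F t x - F s x) - M * \<bar>t - s\<bar> \<le> 0" if s: "0 < s" "s < T" and t: "t \<in> {0..T}" for s t
    proof (rule continuous_le_on_closure[of "{0<..<T}" "\<lambda>t. norm (F t x - F s x) - M * \<bar>t - s\<bar>"])
      show "continuous_on (closure {0<..<T}) (\<lambda>t. norm (F t x - F s x) - M * \<bar>t - s\<bar>)"
        unfolding cl by (intro continuous_intros cont)
    qed (use inner s t in \<open>auto simp: cl\<close>)
    have "norm (F t x - F s x) - M * \<bar>t - s\<bar> \<le> 0"
    proof (rule continuous_le_on_closure[of "{0<..<T}" "\<lambda>s. norm (F t x - F s x) - M * \<bar>t - s\<bar>"])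
      show "continuous_on (closure {0<..<T}) (\<lambda>s. norm (F t x - F s x) - M * \<bar>t - s\<bar>)"
        unfolding cl by (intro continuous_intros cont)
    qed (use half ts in \<open>auto simp: cl\<close>)
    then show "norm (F t x - F s x) \<le> M * \<bar>t - s\<bar>" by simp
  qed
qed

definition box_in :: "(real^3) set \<Rightarrow> real \<Rightarrow> real^3 \<Rightarrow> bool" where
  "box_in \<Omega> r x \<longleftrightarrow> (\<forall>w. (\<forall>k. \<bar>w $ k - x $ k\<bar> \<le> r) \<longrightarrow> w \<in> \<Omega>)"

lemma box_in_hull:
  assumes "box_in \<Omega> r x" and "\<And>k. \<bar>y $ k - x $ k\<bar> \<le> r" and "\<And>k. \<bar>z $ k - x $ k\<bar> \<le> r"
  shows "box_hull y z \<subseteq> \<Omega>"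
proof
  fix w assume w: "w \<in> box_hull y z"
  have "\<bar>w $ k - x $ k\<bar> \<le> r" for k
  proof -
    have "min (y $ k) (z $ k) \<le> w $ k" "w $ k \<le> max (y $ k) (z $ k)" using w by (auto simp: box_hull_def)
    then show ?thesis using assms(2)[of k] assms(3)[of k] by linarith
  qed
  then show "w \<in> \<Omega>" using assms(1) by (auto simp: box_in_def)
qed

lemma box_inD: "box_in \<Omega> r x \<Longrightarrow> (\<And>k. \<bar>w $ k - x $ k\<bar> \<le> r) \<Longrightarrow> w \<in> \<Omega>"
  by (auto simp: box_in_def)

lemma sum_axis_displacement: "(\<Sum>k\<in>UNIV. \<bar>(x + s *\<^sub>R ax i) $ k - x $ k\<bar>) = \<bar>s\<bar>"
proof -
  have "(\<Sum>k\<in>UNIV. \<bar>(x + s *\<^sub>R ax i) $ k - x $ k\<bar>) = (\<Sum>k\<in>UNIV. if k = i then \<bar>s\<bar> else 0)"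
    by (intro sum.cong) (auto simp: axis_def)
  then show ?thesis by simp
qed

lemma axis_displacement_le: "\<bar>(x + s *\<^sub>R ax i) $ k - x $ k\<bar> \<le> \<bar>s\<bar>"
  by (simp add: axis_def)

text \<open>Two orders of smoothness make the first derivatives Lipschitz, which gives the O(h)
  accuracy of \<open>D1\<close>. One constant serves all directions.\<close>

lemma C2_space_data:
  fixes F :: "real \<Rightarrow> real^3 \<Rightarrow> 'b::real_normed_vector"
  assumes T: "0 < T" and bd: "bounded \<Omega>" and C: "C_spacetime (Suc (Suc k)) T \<Omega> F"
  obtains G M where "0 < M" "\<And>i. C_spacetime (Suc k) T \<Omega> (G i)"
    and "\<And>i t x s. 0 < t \<Longrightarrow> t < T \<Longrightarrow> x + s *\<^sub>R ax i \<in> \<Omega> \<Longrightarrow>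
      ((\<lambda>s. F t (x + s *\<^sub>R ax i)) has_vector_derivative G i t (x + s *\<^sub>R ax i)) (at s)"
    and "\<And>i t x. t \<in> {0..T} \<Longrightarrow> x \<in> closure \<Omega> \<Longrightarrow> norm (G i t x) \<le> M"
    and "\<And>i t x y. t \<in> {0..T} \<Longrightarrow> box_hull x y \<subseteq> \<Omega> \<Longrightarrow> norm (G i t y - G i t x) \<le> M * (\<Sum>k\<in>UNIV. \<bar>y $ k - x $ k\<bar>)"
    and "\<And>i t x h. 0 < t \<Longrightarrow> t < T \<Longrightarrow> 0 < h \<Longrightarrow> box_in \<Omega> h x \<Longrightarrow> norm (D1 h i (F t) x - G i t x) \<le> M * h"
proof -
  obtain G where G: "\<And>i. C_spacetime (Suc k) T \<Omega> (G i)"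
    and dG: "\<And>i t x s. 0 < t \<Longrightarrow> t < T \<Longrightarrow> x + s *\<^sub>R ax i \<in> \<Omega> \<Longrightarrow>
      ((\<lambda>s. F t (x + s *\<^sub>R ax i)) has_vector_derivative G i t (x + s *\<^sub>R ax i)) (at s)"
    using C_spacetime_SucD_space[OF C] by blast
  have "\<forall>i. \<exists>M>0. \<forall>t x. t \<in> {0..T} \<longrightarrow> x \<in> closure \<Omega> \<longrightarrow> norm (G i t x) \<le> M"
    using C_spacetime_bounded[OF T bd G] by metis
  then obtain m where m: "\<And>i. 0 < m i" "\<And>i t x. t \<in> {0..T} \<Longrightarrow> x \<in> closure \<Omega> \<Longrightarrow> norm (G i t x) \<le> m i"
    by metis
  have "\<forall>i. \<exists>M>0. \<forall>t x y. t \<in> {0..T} \<longrightarrow> box_hull x y \<subseteq> \<Omega> \<longrightarrow> norm (G i t y - G i t x) \<le> M * (\<Sum>k\<in>UNIV. \<bar>y $ k - x $ k\<bar>)"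
    using C_spacetime_lipschitz_space[OF T bd G] by metis
  then obtain l where l: "\<And>i. 0 < l i" "\<And>i t x y. t \<in> {0..T} \<Longrightarrow> box_hull x y \<subseteq> \<Omega> \<Longrightarrow> norm (G i t y - G i t x) \<le> l i * (\<Sum>k\<in>UNIV. \<bar>y $ k - x $ k\<bar>)"
    by metis
  define M where "M = (\<Sum>i\<in>UNIV. m i + l i)"
  have M: "m i \<le> M" "l i \<le> M" for i
  proof -
    have "m i + l i \<le> M" unfolding M_def
      by (rule member_le_sum) (use m(1) l(1) in \<open>auto intro: add_nonneg_nonneg less_imp_le\<close>)
    then show "m i \<le> M" "l i \<le> M" using m(1)[of i] l(1)[of i] by linarith+
  qed
  have lip: "norm (G i t y - G i t x) \<le> M * (\<Sum>k\<in>UNIV. \<bar>y $ k - x $ k\<bar>)" if "t \<in> {0..T}" "box_hull x y \<subseteq> \<Omega>" for i t x y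
    using l(2)[OF that, of i] mult_right_mono[OF M(2)[of i], of "\<Sum>k\<in>UNIV. \<bar>y $ k - x $ k\<bar>"]
    by (simp add: sum_nonneg)
  show ?thesis
  proof (rule that[of M G])
    show "0 < M" using m(1)[of 1] M(1)[of 1] by linarith
    show "norm (G i t x) \<le> M" if "t \<in> {0..T}" "x \<in> closure \<Omega>" for i t x using m(2)[OF that, of i] M(1)[of i] by linarith
    show "norm (D1 h i (F t) x - G i t x) \<le> M * h" if t: "0 < t" "t < T" and h: "0 < h" and box: "box_in \<Omega> h x" for i t x h
    proof -
      have "norm ((F t (x + h *\<^sub>R ax i) - F t (x + (-h) *\<^sub>R ax i)) /\<^sub>R (h - (-h)) - G i t x) \<le> M * h"
      proof (rule difference_quotient_bound[where g="\<lambda>s. F t (x + s *\<^sub>R ax i)" and g'="\<lambda>s. G i t (x + s *\<^sub>R ax i)"])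
        fix s assume s: "-h \<le> s" "s \<le> h"
        then have sh: "\<bar>s\<bar> \<le> h" by simp
        have k: "\<bar>(x + s *\<^sub>R ax i) $ k - x $ k\<bar> \<le> h" for k using axis_displacement_le[of x s i k] sh by linarith
        show "((\<lambda>s. F t (x + s *\<^sub>R ax i)) has_vector_derivative G i t (x + s *\<^sub>R ax i)) (at s)"
          by (intro dG t box_inD[OF box] k)
        have "box_hull x (x + s *\<^sub>R ax i) \<subseteq> \<Omega>" by (rule box_in_hull[OF box _ k]) (use h in auto)
        then have "norm (G i t (x + s *\<^sub>R ax i) - G i t x) \<le> M * \<bar>s\<bar>"
          using lip[of t x "x + s *\<^sub>R ax i" i] t unfolding sum_axis_displacement by simp
        also have "\<dots> \<le> M * h" using sh M(1)[of 1] m(1)[of 1] by (intro mult_left_mono) auto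
        finally show "norm (G i t (x + s *\<^sub>R ax i) - G i t x) \<le> M * h" .
      qed (use h in auto)
      then show ?thesis by (simp add: D1_def)
    qed
  qed (use G dG lip in auto)
qed

text \<open>The second-order statement is applied again to each first derivative; of its output only
  the pure second derivatives are kept, as these are what \<open>D2\<close> approximates.\<close>

lemma C3_space_data:
  fixes F :: "real \<Rightarrow> real^3 \<Rightarrow> 'b::real_normed_vector"
  assumes T: "0 < T" and bd: "bounded \<Omega>" and C: "C_spacetime (Suc (Suc (Suc k))) T \<Omega> F"
  obtains G H M where "0 < M"
    and "\<And>i t x s. 0 < t \<Longrightarrow> t < T \<Longrightarrow> x + s *\<^sub>R ax i \<in> \<Omega> \<Longrightarrow>
      ((\<lambda>s. F t (x + s *\<^sub>R ax i)) has_vector_derivative G i t (x + s *\<^sub>R ax i)) (at s)"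
    and "\<And>i t x s. 0 < t \<Longrightarrow> t < T \<Longrightarrow> x + s *\<^sub>R ax i \<in> \<Omega> \<Longrightarrow>
      ((\<lambda>s. G i t (x + s *\<^sub>R ax i)) has_vector_derivative H i t (x + s *\<^sub>R ax i)) (at s)"
    and "\<And>i t x. t \<in> {0..T} \<Longrightarrow> x \<in> closure \<Omega> \<Longrightarrow> norm (G i t x) \<le> M"
    and "\<And>i t x y. t \<in> {0..T} \<Longrightarrow> box_hull x y \<subseteq> \<Omega> \<Longrightarrow> norm (G i t y - G i t x) \<le> M * (\<Sum>k\<in>UNIV. \<bar>y $ k - x $ k\<bar>)"
    and "\<And>i t x h. 0 < t \<Longrightarrow> t < T \<Longrightarrow> 0 < h \<Longrightarrow> box_in \<Omega> h x \<Longrightarrow> norm (D1 h i (F t) x - G i t x) \<le> M * h"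
    and "\<And>i t x h. 0 < t \<Longrightarrow> t < T \<Longrightarrow> 0 < h \<Longrightarrow> box_in \<Omega> h x \<Longrightarrow> norm (D2 h i (F t) x - H i t x) \<le> M * h"
proof -
  obtain G M1 where M1: "0 < M1" and G: "\<And>i. C_spacetime (Suc (Suc k)) T \<Omega> (G i)"
    and dG: "\<And>i t x s. 0 < t \<Longrightarrow> t < T \<Longrightarrow> x + s *\<^sub>R ax i \<in> \<Omega> \<Longrightarrow>
      ((\<lambda>s. F t (x + s *\<^sub>R ax i)) has_vector_derivative G i t (x + s *\<^sub>R ax i)) (at s)"
    and Gb: "\<And>i t x. t \<in> {0..T} \<Longrightarrow> x \<in> closure \<Omega> \<Longrightarrow> norm (G i t x) \<le> M1"
    and Gl: "\<And>i t x y. t \<in> {0..T} \<Longrightarrow> box_hull x y \<subseteq> \<Omega> \<Longrightarrow> norm (G i t y - G i t x) \<le> M1 * (\<Sum>k\<in>UNIV. \<bar>y $ k - x $ k\<bar>)"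
    and GD: "\<And>i t x h. 0 < t \<Longrightarrow> t < T \<Longrightarrow> 0 < h \<Longrightarrow> box_in \<Omega> h x \<Longrightarrow> norm (D1 h i (F t) x - G i t x) \<le> M1 * h"
    by (rule C2_space_data[OF T bd C]) (rule that; assumption)
  have "\<forall>i. \<exists>H M. 0 < M \<and> (\<forall>t x s. 0 < t \<longrightarrow> t < T \<longrightarrow> x + s *\<^sub>R ax i \<in> \<Omega> \<longrightarrow>
      ((\<lambda>s. G i t (x + s *\<^sub>R ax i)) has_vector_derivative H t (x + s *\<^sub>R ax i)) (at s)) \<and>
      (\<forall>t x y. t \<in> {0..T} \<longrightarrow> box_hull x y \<subseteq> \<Omega> \<longrightarrow> norm (H t y - H t x) \<le> M * (\<Sum>k\<in>UNIV. \<bar>y $ k - x $ k\<bar>))"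
  proof
    fix i
    obtain H M where "0 < M" and dH: "\<And>j t x s. 0 < t \<Longrightarrow> t < T \<Longrightarrow> x + s *\<^sub>R ax j \<in> \<Omega> \<Longrightarrow>
      ((\<lambda>s. G i t (x + s *\<^sub>R ax j)) has_vector_derivative H j t (x + s *\<^sub>R ax j)) (at s)"
      and lH: "\<And>j t x y. t \<in> {0..T} \<Longrightarrow> box_hull x y \<subseteq> \<Omega> \<Longrightarrow> norm (H j t y - H j t x) \<le> M * (\<Sum>k\<in>UNIV. \<bar>y $ k - x $ k\<bar>)"
      by (rule C2_space_data[OF T bd G[of i]]) (rule that; assumption)
    then show "\<exists>H M. 0 < M \<and> (\<forall>t x s. 0 < t \<longrightarrow> t < T \<longrightarrow> x + s *\<^sub>R ax i \<in> \<Omega> \<longrightarrow>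
      ((\<lambda>s. G i t (x + s *\<^sub>R ax i)) has_vector_derivative H t (x + s *\<^sub>R ax i)) (at s)) \<and>
      (\<forall>t x y. t \<in> {0..T} \<longrightarrow> box_hull x y \<subseteq> \<Omega> \<longrightarrow> norm (H t y - H t x) \<le> M * (\<Sum>k\<in>UNIV. \<bar>y $ k - x $ k\<bar>))"
      by (intro exI[of _ "H i"] exI[of _ M]) auto
  qed
  from choice[OF this] obtain H where "\<forall>i. \<exists>M. 0 < M \<and> (\<forall>t x s. 0 < t \<longrightarrow> t < T \<longrightarrow> x + s *\<^sub>R ax i \<in> \<Omega> \<longrightarrow>
      ((\<lambda>s. G i t (x + s *\<^sub>R ax i)) has_vector_derivative H i t (x + s *\<^sub>R ax i)) (at s)) \<and>
      (\<forall>t x y. t \<in> {0..T} \<longrightarrow> box_hull x y \<subseteq> \<Omega> \<longrightarrow> norm (H i t y - H i t x) \<le> M * (\<Sum>k\<in>UNIV. \<bar>y $ k - x $ k\<bar>))" ..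
  from choice[OF this] obtain m where Hm: "\<forall>i. 0 < m i \<and> (\<forall>t x s. 0 < t \<longrightarrow> t < T \<longrightarrow> x + s *\<^sub>R ax i \<in> \<Omega> \<longrightarrow>
      ((\<lambda>s. G i t (x + s *\<^sub>R ax i)) has_vector_derivative H i t (x + s *\<^sub>R ax i)) (at s)) \<and>
      (\<forall>t x y. t \<in> {0..T} \<longrightarrow> box_hull x y \<subseteq> \<Omega> \<longrightarrow> norm (H i t y - H i t x) \<le> m i * (\<Sum>k\<in>UNIV. \<bar>y $ k - x $ k\<bar>))" ..
  have m: "0 < m i" for i using Hm by blast
  have dH: "((\<lambda>s. G i t (x + s *\<^sub>R ax i)) has_vector_derivative H i t (x + s *\<^sub>R ax i)) (at s)"
    if "0 < t" "t < T" "x + s *\<^sub>R ax i \<in> \<Omega>" for i t x s using Hm that by blast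
  have lH: "norm (H i t y - H i t x) \<le> m i * (\<Sum>k\<in>UNIV. \<bar>y $ k - x $ k\<bar>)"
    if "t \<in> {0..T}" "box_hull x y \<subseteq> \<Omega>" for i t x y using Hm that by blast
  define M where "M = M1 + 2 * (\<Sum>i\<in>UNIV. m i)"
  have mM: "2 * m i \<le> M" for i
  proof -
    have "m i \<le> (\<Sum>i\<in>UNIV. m i)" by (rule member_le_sum) (simp_all add: m less_imp_le)
    then show ?thesis using M1 by (simp add: M_def)
  qed
  have M1M: "M1 \<le> M" using m by (simp add: M_def sum_nonneg less_imp_le)
  show ?thesis
  proof (rule that[of M G H])
    show "0 < M" using M1 M1M by simp
    show "norm (G i t x) \<le> M" if "t \<in> {0..T}" "x \<in> closure \<Omega>" for i t x using Gb[OF that, of i] M1M by linarith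
    show "norm (G i t y - G i t x) \<le> M * (\<Sum>k\<in>UNIV. \<bar>y $ k - x $ k\<bar>)" if "t \<in> {0..T}" "box_hull x y \<subseteq> \<Omega>" for i t x y
      using Gl[OF that, of i] mult_right_mono[OF M1M, of "\<Sum>k\<in>UNIV. \<bar>y $ k - x $ k\<bar>"] by (simp add: sum_nonneg)
    show "norm (D1 h i (F t) x - G i t x) \<le> M * h" if "0 < t" "t < T" "0 < h" "box_in \<Omega> h x" for i t x h
      using GD[OF that, of i] mult_right_mono[OF M1M, of h] that(3) by linarith
    show "norm (D2 h i (F t) x - H i t x) \<le> M * h" if t: "0 < t" "t < T" and h: "0 < h" and box: "box_in \<Omega> h x" for i t x h
    proof -
      have k: "\<bar>(x + s *\<^sub>R ax i) $ k - x $ k\<bar> \<le> h" if "\<bar>s\<bar> \<le> h" for s k using axis_displacement_le[of x s i k] that by linarith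
      have in\<Omega>: "x + s *\<^sub>R ax i \<in> \<Omega>" if "\<bar>s\<bar> \<le> h" for s by (rule box_inD[OF box k[OF that]])
      have "norm ((F t (x + h *\<^sub>R ax i) + F t (x + (-h) *\<^sub>R ax i) - 2 *\<^sub>R F t (x + 0 *\<^sub>R ax i)) /\<^sub>R h\<^sup>2 - H i t x) \<le> 2 * (m i * h)"
      proof (rule second_difference_bound[where g="\<lambda>s. F t (x + s *\<^sub>R ax i)" and g'="\<lambda>s. G i t (x + s *\<^sub>R ax i)"
            and g''="\<lambda>s. H i t (x + s *\<^sub>R ax i)"])
        fix s assume s: "\<bar>s\<bar> \<le> h"
        show "((\<lambda>s. F t (x + s *\<^sub>R ax i)) has_vector_derivative G i t (x + s *\<^sub>R ax i)) (at s)"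
          "((\<lambda>s. G i t (x + s *\<^sub>R ax i)) has_vector_derivative H i t (x + s *\<^sub>R ax i)) (at s)"
          by (intro dG dH t in\<Omega>[OF s])+
        have "box_hull x (x + s *\<^sub>R ax i) \<subseteq> \<Omega>" by (rule box_in_hull[OF box _ k[OF s]]) (use h in auto)
        then have "norm (H i t (x + s *\<^sub>R ax i) - H i t x) \<le> m i * \<bar>s\<bar>"
          using lH[of t x "x + s *\<^sub>R ax i" i] t unfolding sum_axis_displacement by simp
        also have "\<dots> \<le> m i * h" using s m[of i] by (intro mult_left_mono) auto
        finally show "norm (H i t (x + s *\<^sub>R ax i) - H i t x) \<le> m i * h" .
      qed (use h in auto)
      also have "\<dots> \<le> M * h" using mult_right_mono[OF mM[of i], of h] h by simp
      finally show ?thesis by (simp add: D2_def)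
    qed
  qed (use dG dH in auto)
qed

text \<open>The derivative is compared at the later time, where the implicit scheme evaluates the
  viscous term.\<close>

lemma C2_time_data:
  fixes F :: "real \<Rightarrow> real^3 \<Rightarrow> 'b::real_normed_vector"
  assumes T: "0 < T" and bd: "bounded \<Omega>" and C: "C_spacetime (Suc (Suc k)) T \<Omega> F"
  obtains G M where "0 < M"
    and "\<And>t x. 0 < t \<Longrightarrow> t < T \<Longrightarrow> x \<in> \<Omega> \<Longrightarrow> ((\<lambda>s. F s x) has_vector_derivative G t x) (at t)"
    and "\<And>t \<tau> x. 0 < t \<Longrightarrow> 0 < \<tau> \<Longrightarrow> t + \<tau> < T \<Longrightarrow> x \<in> \<Omega> \<Longrightarrow>
      norm ((F (t + \<tau>) x - F t x) /\<^sub>R \<tau> - G (t + \<tau>) x) \<le> M * \<tau>"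
proof -
  obtain G where G: "C_spacetime (Suc k) T \<Omega> G"
    and dG: "\<And>t x. 0 < t \<Longrightarrow> t < T \<Longrightarrow> x \<in> \<Omega> \<Longrightarrow> ((\<lambda>s. F s x) has_vector_derivative G t x) (at t)"
    using C_spacetime_SucD_time[OF C] by blast
  obtain M where M: "0 < M" "\<And>t s x. t \<in> {0..T} \<Longrightarrow> s \<in> {0..T} \<Longrightarrow> x \<in> \<Omega> \<Longrightarrow> norm (G t x - G s x) \<le> M * \<bar>t - s\<bar>"
    using C_spacetime_lipschitz_time[OF T bd G] by blast
  show ?thesis
  proof (rule that[OF M(1) dG])
    fix t \<tau> x assume t: "0 < t" "0 < \<tau>" "t + \<tau> < T" and x: "x \<in> \<Omega>"
    have "norm ((F (t + \<tau>) x - F t x) /\<^sub>R (t + \<tau> - t) - G (t + \<tau>) x) \<le> M * \<tau>"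
    proof (rule difference_quotient_bound[where g'="\<lambda>s. G s x"])
      fix s assume s: "t \<le> s" "s \<le> t + \<tau>"
      then show "((\<lambda>s. F s x) has_vector_derivative G s x) (at s)" using dG t x by simp
      have "norm (G s x - G (t + \<tau>) x) \<le> M * \<bar>s - (t + \<tau>)\<bar>" using M(2)[of s "t + \<tau>" x] s t x by simp
      also have "\<dots> \<le> M * \<tau>" using s M(1) by (intro mult_left_mono) auto
      finally show "norm (G s x - G (t + \<tau>) x) \<le> M * \<tau>" .
    qed (use t in auto)
    then show "norm ((F (t + \<tau>) x - F t x) /\<^sub>R \<tau> - G (t + \<tau>) x) \<le> M * \<tau>" by simp
  qed
qed

lemma pderiv_at_eq:
  assumes "\<And>i t x s. 0 < t \<Longrightarrow> t < T \<Longrightarrow> x + s *\<^sub>R ax i \<in> \<Omega> \<Longrightarrow>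
      ((\<lambda>s. F t (x + s *\<^sub>R ax i)) has_vector_derivative G i t (x + s *\<^sub>R ax i)) (at s)"
    and "0 < t" "t < T" "x \<in> \<Omega>"
  shows "pderiv_at i (F t) x = G i t x"
proof -
  have "((\<lambda>s. F t (x + s *\<^sub>R ax i)) has_vector_derivative G i t (x + 0 *\<^sub>R ax i)) (at 0)"
    by (rule assms(1)) (use assms(2-4) in simp_all)
  then show ?thesis unfolding pderiv_at_def by (simp add: vector_derivative_at)
qed

text \<open>The equations are stated with \<open>vector_derivative\<close> and
  \<open>pderiv_at\<close>; here these are identified with the derivative fields supplied by the C^k
  classes.\<close>

lemma navier_stokes_pointwise:
  assumes op: "open \<Omega>" and T: "0 < T" and ns: "navier_stokes \<Omega> T f v\<^sub>0 v p"
    and dGt: "\<And>t x. 0 < t \<Longrightarrow> t < T \<Longrightarrow> x \<in> \<Omega> \<Longrightarrow> ((\<lambda>s. v s x) has_vector_derivative Gt t x) (at t)"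
    and dG: "\<And>i t x s. 0 < t \<Longrightarrow> t < T \<Longrightarrow> x + s *\<^sub>R ax i \<in> \<Omega> \<Longrightarrow>
      ((\<lambda>s. v t (x + s *\<^sub>R ax i)) has_vector_derivative G i t (x + s *\<^sub>R ax i)) (at s)"
    and dH: "\<And>i t x s. 0 < t \<Longrightarrow> t < T \<Longrightarrow> x + s *\<^sub>R ax i \<in> \<Omega> \<Longrightarrow>
      ((\<lambda>s. G i t (x + s *\<^sub>R ax i)) has_vector_derivative H i t (x + s *\<^sub>R ax i)) (at s)"
    and dP: "\<And>i t x s. 0 < t \<Longrightarrow> t < T \<Longrightarrow> x + s *\<^sub>R ax i \<in> \<Omega> \<Longrightarrow>
      ((\<lambda>s. p t (x + s *\<^sub>R ax i)) has_vector_derivative P i t (x + s *\<^sub>R ax i)) (at s)"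
    and t: "0 < t" "t < T" and x: "x \<in> \<Omega>"
  shows "Gt t x = - (\<Sum>j\<in>UNIV. v t x $ j *\<^sub>R G j t x) + (\<Sum>j\<in>UNIV. H j t x) + f t x - (\<chi> i. P i t x)"
    and "(\<Sum>i\<in>UNIV. G i t x $ i) = 0"
proof -
  have 1: "vector_derivative (\<lambda>s. v s x) (at t within {0..T}) = Gt t x"
    by (rule vector_derivative_at_within_ivl[OF dGt]) (use t x in auto)
  have 2: "pderiv_at j (v t) y = G j t y" if "y \<in> \<Omega>" for j y
    by (rule pderiv_at_eq[OF dG t that])
  have 3: "pderiv_at j (p t) x = P j t x" for j
    by (rule pderiv_at_eq[OF dP t x])
  have 4: "pderiv_at j (pderiv_at j (v t)) x = H j t x" for j
  proof -
    \<comment> \<open>For the iterated derivative the inner one must be known on a whole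
      neighbourhood of s = 0, hence the open set of parameters.\<close>
    have op': "open {s::real. x + s *\<^sub>R ax j \<in> \<Omega>}"
    proof -
      have "continuous_on UNIV (\<lambda>s. x + s *\<^sub>R ax j)" by (intro continuous_intros)
      from open_vimage[OF op this] show ?thesis by (simp add: vimage_def)
    qed
    have "((\<lambda>s. G j t (x + s *\<^sub>R ax j)) has_vector_derivative H j t (x + 0 *\<^sub>R ax j)) (at 0)"
      by (rule dH) (use t x in auto)
    then have "((\<lambda>s. pderiv_at j (v t) (x + s *\<^sub>R ax j)) has_vector_derivative H j t (x + 0 *\<^sub>R ax j)) (at 0)"
      by (rule has_vector_derivative_transform_within_open[OF _ op']) (use x 2 in auto)
    then show ?thesis unfolding pderiv_at_def[of j "pderiv_at j (v t)"] by (simp add: vector_derivative_at)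
  qed
  have "vector_derivative (\<lambda>s. v s x) (at t within {0..T}) =
          - (\<Sum>j\<in>UNIV. v t x $ j *\<^sub>R pderiv_at j (v t) x)
          + (\<Sum>j\<in>UNIV. pderiv_at j (pderiv_at j (v t)) x) + f t x - (\<chi> i. pderiv_at i (p t) x)"
    using ns t x unfolding navier_stokes_def by simp
  then show "Gt t x = - (\<Sum>j\<in>UNIV. v t x $ j *\<^sub>R G j t x) + (\<Sum>j\<in>UNIV. H j t x) + f t x - (\<chi> i. P i t x)"
    unfolding 1 3 4 2[OF x] .
  have "(\<Sum>i\<in>UNIV. pderiv_at i (v t) x $ i) = 0" using ns t x unfolding navier_stokes_def by simp
  then show "(\<Sum>i\<in>UNIV. G i t x $ i) = 0" unfolding 2[OF x] .
qed

lemma box_in_mono: "box_in \<Omega> r x \<Longrightarrow> s \<le> r \<Longrightarrow> box_in \<Omega> s x"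
  unfolding box_in_def by (meson order_trans)

section \<open>Consistency of the scheme\<close>

text \<open>All terms are compared with the equation at time t + \<tau>; that the transporting
  velocity is lagged and the convection taken at neighbours costs O(h + \<tau>). The half-width 2 h
  is the reach of \<open>D1\<close> at a neighbour. The pressure gradient stands on the left because
  the scheme has no such term.\<close>

lemma scheme_consistency:
  assumes op: "open \<Omega>" and bd: "bounded \<Omega>" and T: "0 < T"
    and v: "C_spacetime 3 T \<Omega> v" and p: "C_spacetime 2 T \<Omega> p" and f: "C_spacetime 1 T \<Omega> f"
    and ns: "navier_stokes \<Omega> T f v\<^sub>0 v p"
  shows "\<exists>C\<ge>0. \<forall>h \<tau> t x. 0 < h \<and> 0 < \<tau> \<and> \<tau> < T \<and> 0 \<le> t \<and> t + \<tau> \<le> T \<and> box_in \<Omega> (2 * h) x \<longrightarrow>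
    norm ((v (t + \<tau>) x - v t x) /\<^sub>R \<tau> + convection h (v t) (v (t + \<tau>)) x
      - (\<Sum>j\<in>UNIV. D2 h j (v (t + \<tau>)) x) - f (t + \<tau>) x + grid_grad h (p (t + \<tau>)) x) \<le> C * (h + \<tau>)"
proof -
  have v1: "C_spacetime (Suc (Suc (Suc 0))) T \<Omega> v" using v by (simp add: numeral_3_eq_3)
  have p1: "C_spacetime (Suc (Suc 0)) T \<Omega> p" using p by (simp add: numeral_2_eq_2)
  obtain Mv where Mv: "0 < Mv" "\<And>t x. t \<in> {0..T} \<Longrightarrow> x \<in> closure \<Omega> \<Longrightarrow> norm (v t x) \<le> Mv"
    using C_spacetime_bounded[OF T bd v] by blast
  obtain Ls where Ls: "0 < Ls" "\<And>t x y. t \<in> {0..T} \<Longrightarrow> box_hull x y \<subseteq> \<Omega> \<Longrightarrow>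
      norm (v t y - v t x) \<le> Ls * (\<Sum>i\<in>UNIV. \<bar>y $ i - x $ i\<bar>)"
    using C_spacetime_lipschitz_space[OF T bd v1] by blast
  obtain Lt where Lt: "0 < Lt" "\<And>t s x. t \<in> {0..T} \<Longrightarrow> s \<in> {0..T} \<Longrightarrow> x \<in> \<Omega> \<Longrightarrow>
      norm (v t x - v s x) \<le> Lt * \<bar>t - s\<bar>"
    using C_spacetime_lipschitz_time[OF T bd v1] by blast
  obtain Gt M1 where M1: "0 < M1"
    and dGt: "\<And>t x. 0 < t \<Longrightarrow> t < T \<Longrightarrow> x \<in> \<Omega> \<Longrightarrow> ((\<lambda>s. v s x) has_vector_derivative Gt t x) (at t)"
    and Gt: "\<And>t \<tau> x. 0 < t \<Longrightarrow> 0 < \<tau> \<Longrightarrow> t + \<tau> < T \<Longrightarrow> x \<in> \<Omega> \<Longrightarrow>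
      norm ((v (t + \<tau>) x - v t x) /\<^sub>R \<tau> - Gt (t + \<tau>) x) \<le> M1 * \<tau>"
    by (rule C2_time_data[OF T bd v1]) (rule that; assumption)
  obtain G H M2 where M2: "0 < M2"
    and dG: "\<And>i t x s. 0 < t \<Longrightarrow> t < T \<Longrightarrow> x + s *\<^sub>R ax i \<in> \<Omega> \<Longrightarrow>
      ((\<lambda>s. v t (x + s *\<^sub>R ax i)) has_vector_derivative G i t (x + s *\<^sub>R ax i)) (at s)"
    and dH: "\<And>i t x s. 0 < t \<Longrightarrow> t < T \<Longrightarrow> x + s *\<^sub>R ax i \<in> \<Omega> \<Longrightarrow>
      ((\<lambda>s. G i t (x + s *\<^sub>R ax i)) has_vector_derivative H i t (x + s *\<^sub>R ax i)) (at s)"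
    and Gb: "\<And>i t x. t \<in> {0..T} \<Longrightarrow> x \<in> closure \<Omega> \<Longrightarrow> norm (G i t x) \<le> M2"
    and Gl: "\<And>i t x y. t \<in> {0..T} \<Longrightarrow> box_hull x y \<subseteq> \<Omega> \<Longrightarrow> norm (G i t y - G i t x) \<le> M2 * (\<Sum>k\<in>UNIV. \<bar>y $ k - x $ k\<bar>)"
    and GD: "\<And>i t x h. 0 < t \<Longrightarrow> t < T \<Longrightarrow> 0 < h \<Longrightarrow> box_in \<Omega> h x \<Longrightarrow> norm (D1 h i (v t) x - G i t x) \<le> M2 * h"
    and HD: "\<And>i t x h. 0 < t \<Longrightarrow> t < T \<Longrightarrow> 0 < h \<Longrightarrow> box_in \<Omega> h x \<Longrightarrow> norm (D2 h i (v t) x - H i t x) \<le> M2 * h"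
    by (rule C3_space_data[OF T bd v1]) (rule that; assumption)
  obtain P M3 where M3: "0 < M3"
    and dP: "\<And>i t x s. 0 < t \<Longrightarrow> t < T \<Longrightarrow> x + s *\<^sub>R ax i \<in> \<Omega> \<Longrightarrow>
      ((\<lambda>s. p t (x + s *\<^sub>R ax i)) has_vector_derivative P i t (x + s *\<^sub>R ax i)) (at s)"
    and PD: "\<And>i t x h. 0 < t \<Longrightarrow> t < T \<Longrightarrow> 0 < h \<Longrightarrow> box_in \<Omega> h x \<Longrightarrow> norm (D1 h i (p t) x - P i t x) \<le> M3 * h"
    by (rule C2_space_data[OF T bd p1]) (rule that; assumption)
  \<comment> \<open>Product rule: the velocity changes by at most (Lt + Ls) (h + \<tau>) against a
    derivative bounded by M2, and the difference quotient by at most 2 M2 h against a velocity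
    bounded by Mv.\<close>
  define K where "K = (Lt + Ls) * M2 + 2 * (Mv * M2)"
  have K: "0 \<le> K" using Lt(1) Ls(1) M2 Mv(1) by (simp add: K_def)
  define C where "C = M1 + 3 * K + 3 * M2 + 3 * M3"
  have C: "0 \<le> C" using M1 M2 M3 K by (simp add: C_def)
  define E where "E h \<tau> x t = (v (t + \<tau>) x - v t x) /\<^sub>R \<tau> + convection h (v t) (v (t + \<tau>)) x
      - (\<Sum>j\<in>UNIV. D2 h j (v (t + \<tau>)) x) - f (t + \<tau>) x + grid_grad h (p (t + \<tau>)) x" for h \<tau> x t
  have main: "norm (E h \<tau> x t) \<le> C * (h + \<tau>)"
    if h: "0 < h" and \<tau>: "0 < \<tau>" and t: "0 < t" "t + \<tau> < T" and box: "box_in \<Omega> (2 * h) x" for h \<tau> x t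
  proof -
    define t' where "t' = t + \<tau>"
    have t': "0 < t'" "t' < T" "t' \<in> {0..T}" "t \<in> {0..T}" using t \<tau> by (auto simp: t'_def)
    have box1: "box_in \<Omega> h x" by (rule box_in_mono[OF box]) (use h in simp)
    have x: "x \<in> \<Omega>" by (rule box_inD[OF box]) (use h in auto)
    have e1: "norm ((v t' x - v t x) /\<^sub>R \<tau> - Gt t' x) \<le> M1 * \<tau>" using Gt[OF t(1) \<tau> t(2) x] by (simp add: t'_def)
    have piece: "norm (v t y $ j *\<^sub>R D1 h j (v t') y - v t' x $ j *\<^sub>R G j t' x) \<le> K * (h + \<tau>)"
      if y: "y = x + s *\<^sub>R ax j" "\<bar>s\<bar> = h" for y j s
    proof -
      have k: "\<bar>y $ k - x $ k\<bar> \<le> h" for k using axis_displacement_le[of x s j k] y by simp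
      have boxy: "box_in \<Omega> h y"
        unfolding box_in_def
      proof (intro allI impI)
        fix w assume w: "\<forall>k. \<bar>w $ k - y $ k\<bar> \<le> h"
        show "w \<in> \<Omega>"
        proof (rule box_inD[OF box])
          fix i show "\<bar>w $ i - x $ i\<bar> \<le> 2 * h" using w[rule_format, of i] k[of i] by linarith
        qed
      qed
      have y\<Omega>: "y \<in> \<Omega>" by (rule box_inD[OF boxy]) (use h in auto)
      have hull: "box_hull x y \<subseteq> \<Omega>" by (rule box_in_hull[OF box1 _ k]) (use h in auto)
      have sum: "(\<Sum>k\<in>UNIV. \<bar>y $ k - x $ k\<bar>) = h" using sum_axis_displacement[of x s j] y by simp
      have a: "norm (v t y - v t' x) \<le> (Lt + Ls) * (h + \<tau>)"
      proof -
        have "norm (v t y - v t' x) \<le> norm (v t y - v t' y) + norm (v t' y - v t' x)"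
          using norm_triangle_ineq[of "v t y - v t' y" "v t' y - v t' x"] by simp
        also have "\<dots> \<le> Lt * \<tau> + Ls * h"
          using Lt(2)[OF t'(4,3) y\<Omega>] Ls(2)[OF t'(3) hull] \<tau> unfolding sum by (simp add: t'_def)
        also have "\<dots> \<le> (Lt + Ls) * (h + \<tau>)" using Lt(1) Ls(1) h \<tau> by (simp add: algebra_simps)
        finally show ?thesis .
      qed
      have g: "norm (D1 h j (v t') y - G j t' x) \<le> 2 * M2 * h"
      proof -
        have "norm (D1 h j (v t') y - G j t' x) \<le> norm (D1 h j (v t') y - G j t' y) + norm (G j t' y - G j t' x)"
          using norm_triangle_ineq[of "D1 h j (v t') y - G j t' y" "G j t' y - G j t' x"] by simp
        also have "\<dots> \<le> M2 * h + M2 * h"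
          using GD[OF t'(1,2) h boxy, of j] Gl[OF t'(3) hull, of j] unfolding sum by simp
        finally show ?thesis by simp
      qed
      have xc: "x \<in> closure \<Omega>" "y \<in> closure \<Omega>" using x y\<Omega> closure_subset by auto
      have "v t y $ j *\<^sub>R D1 h j (v t') y - v t' x $ j *\<^sub>R G j t' x
        = (v t y - v t' x) $ j *\<^sub>R G j t' x + v t y $ j *\<^sub>R (D1 h j (v t') y - G j t' x)"
        by (simp add: algebra_simps)
      then have "norm (v t y $ j *\<^sub>R D1 h j (v t') y - v t' x $ j *\<^sub>R G j t' x)
        \<le> \<bar>(v t y - v t' x) $ j\<bar> * norm (G j t' x) + \<bar>v t y $ j\<bar> * norm (D1 h j (v t') y - G j t' x)"
        by (metis norm_scaleR norm_triangle_ineq)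
      also have "\<dots> \<le> ((Lt + Ls) * (h + \<tau>)) * M2 + Mv * (2 * M2 * h)"
      proof (intro add_mono mult_mono)
        show "\<bar>(v t y - v t' x) $ j\<bar> \<le> (Lt + Ls) * (h + \<tau>)" using a component_le_norm_cart order_trans by blast
        show "norm (G j t' x) \<le> M2" by (rule Gb[OF t'(3) xc(1)])
        show "\<bar>v t y $ j\<bar> \<le> Mv" using Mv(2)[OF t'(4) xc(2)] component_le_norm_cart order_trans by blast
      qed (use g Mv(1) Lt(1) Ls(1) h \<tau> in auto)
      also have "\<dots> \<le> K * (h + \<tau>)" using Mv(1) M2 \<tau> by (simp add: K_def algebra_simps)
      finally show ?thesis .
    qed
    have e2: "norm (convection h (v t) (v t') x - (\<Sum>j\<in>UNIV. v t' x $ j *\<^sub>R G j t' x)) \<le> 3 * K * (h + \<tau>)"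
    proof -
      let ?A = "\<lambda>j. v t (x - h *\<^sub>R ax j) $ j *\<^sub>R D1 h j (v t') (x - h *\<^sub>R ax j)"
      let ?B = "\<lambda>j. v t (x + h *\<^sub>R ax j) $ j *\<^sub>R D1 h j (v t') (x + h *\<^sub>R ax j)"
      let ?X = "\<lambda>j. v t' x $ j *\<^sub>R G j t' x"
      have 1: "(\<Sum>j\<in>UNIV. (?A j - ?X j) + (?B j - ?X j)) = (\<Sum>j\<in>UNIV. ?A j + ?B j) - 2 *\<^sub>R (\<Sum>j\<in>UNIV. ?X j)"
        by (simp only: sum.distrib sum_subtractf scaleR_2) (simp only: algebra_simps)
      have "convection h (v t) (v t') x - (\<Sum>j\<in>UNIV. ?X j) = (1/2) *\<^sub>R (\<Sum>j\<in>UNIV. (?A j - ?X j) + (?B j - ?X j))"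
        unfolding 1 convection_def scaleR_right_diff_distrib by (simp only: scaleR_scaleR) simp
      then have "norm (convection h (v t) (v t') x - (\<Sum>j\<in>UNIV. ?X j)) = (1/2) * norm (\<Sum>j\<in>UNIV. (?A j - ?X j) + (?B j - ?X j))"
        by simp
      also have "\<dots> \<le> (1/2) * (\<Sum>j\<in>(UNIV::3 set). K * (h + \<tau>) + K * (h + \<tau>))"
      proof (intro mult_left_mono order_trans[OF norm_sum] sum_mono order_trans[OF norm_triangle_ineq] add_mono)
        fix j
        show "norm (?A j - ?X j) \<le> K * (h + \<tau>)" by (rule piece[of _ "-h"]) (use h in auto)
        show "norm (?B j - ?X j) \<le> K * (h + \<tau>)" by (rule piece[of _ "h"]) (use h in auto)
      qed simp
      finally show ?thesis by simp
    qed
    have e3: "norm ((\<Sum>j\<in>UNIV. D2 h j (v t') x) - (\<Sum>j\<in>UNIV. H j t' x)) \<le> 3 * M2 * h"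
    proof -
      have "norm ((\<Sum>j\<in>UNIV. D2 h j (v t') x) - (\<Sum>j\<in>UNIV. H j t' x)) \<le> (\<Sum>j\<in>(UNIV::3 set). M2 * h)"
        unfolding sum_subtractf[symmetric]
        by (intro order_trans[OF norm_sum] sum_mono HD t' h box1)
      then show ?thesis by simp
    qed
    have e5: "norm (grid_grad h (p t') x - (\<chi> i. P i t' x)) \<le> 3 * (M3 * h)"
      by (rule norm_le_3_components) (use PD[OF t'(1,2) h box1] in \<open>simp add: grid_grad_def\<close>)
    have pde: "Gt t' x = - (\<Sum>j\<in>UNIV. v t' x $ j *\<^sub>R G j t' x) + (\<Sum>j\<in>UNIV. H j t' x) + f t' x - (\<chi> i. P i t' x)"
      by (rule navier_stokes_pointwise(1)[OF op T ns dGt dG dH dP t'(1,2) x])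
    have "E h \<tau> x t = ((v t' x - v t x) /\<^sub>R \<tau> - Gt t' x) + (convection h (v t) (v t') x - (\<Sum>j\<in>UNIV. v t' x $ j *\<^sub>R G j t' x))
       + ((\<Sum>j\<in>UNIV. H j t' x) - (\<Sum>j\<in>UNIV. D2 h j (v t') x)) + (grid_grad h (p t') x - (\<chi> i. P i t' x))"
      unfolding E_def t'_def[symmetric] pde by simp
    also have "norm \<dots> \<le> M1 * \<tau> + 3 * K * (h + \<tau>) + 3 * M2 * h + 3 * (M3 * h)"
      by (intro norm_triangle_mono e1 e2 e5) (use e3 in \<open>simp only: norm_minus_commute\<close>)
    finally have "norm (E h \<tau> x t) \<le> M1 * \<tau> + 3 * K * (h + \<tau>) + 3 * M2 * h + 3 * (M3 * h)" .
    also have "\<dots> \<le> C * (h + \<tau>)" using M1 M2 M3 h \<tau> by (simp add: C_def algebra_simps)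
    finally show ?thesis .
  qed
  \<comment> \<open>For fixed h, \<tau> and x the residual is continuous in t on [0, T - \<tau>], so
    the end times 0 and T - \<tau> are covered as well.\<close>
  have "norm (E h \<tau> x t) \<le> C * (h + \<tau>)"
    if h: "0 < h" and \<tau>: "0 < \<tau>" "\<tau> < T" and t: "0 \<le> t" "t + \<tau> \<le> T" and box: "box_in \<Omega> (2 * h) x" for h \<tau> x t
  proof (rule bound_on_closed_times[of "T - \<tau>"])
    have near: "x + a *\<^sub>R ax i + b *\<^sub>R ax j \<in> closure \<Omega>" if "\<bar>a\<bar> \<le> h" "\<bar>b\<bar> \<le> h" for a b i j
    proof -
      have "x + a *\<^sub>R ax i + b *\<^sub>R ax j \<in> \<Omega>"
      proof (rule box_inD[OF box])
        fix k
        show "\<bar>(x + a *\<^sub>R ax i + b *\<^sub>R ax j) $ k - x $ k\<bar> \<le> 2 * h"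
          using that axis_displacement_le[of x a i k] axis_displacement_le[of "x + a *\<^sub>R ax i" b j k] by linarith
      qed
      then show ?thesis using closure_subset by blast
    qed
    have c: "continuous_on {0..T - \<tau>} (\<lambda>t. F t y)" "continuous_on {0..T - \<tau>} (\<lambda>t. F (t + \<tau>) y)"
      if F: "C_spacetime k T \<Omega> F" and y: "y \<in> closure \<Omega>" for F :: "real \<Rightarrow> real^3 \<Rightarrow> 'c::real_normed_vector" and y k
    proof -
      have "continuous_on {0..T} (\<lambda>t. F t y)" by (rule C_spacetime_continuous_time[OF T F y])
      then show "continuous_on {0..T - \<tau>} (\<lambda>t. F t y)" by (rule continuous_on_subset) (use \<tau> in auto)
      show "continuous_on {0..T - \<tau>} (\<lambda>t. F (t + \<tau>) y)"
        by (rule continuous_on_compose2[OF \<open>continuous_on {0..T} (\<lambda>t. F t y)\<close>]) (use \<tau> in \<open>auto intro!: continuous_intros\<close>)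
    qed
    have pts: "x \<in> closure \<Omega>" "x + h *\<^sub>R ax j \<in> closure \<Omega>" "x - h *\<^sub>R ax j \<in> closure \<Omega>"
        "x + h *\<^sub>R ax j + h *\<^sub>R ax j \<in> closure \<Omega>" "x + h *\<^sub>R ax j - h *\<^sub>R ax j \<in> closure \<Omega>"
        "x - h *\<^sub>R ax j + h *\<^sub>R ax j \<in> closure \<Omega>" "x - h *\<^sub>R ax j - h *\<^sub>R ax j \<in> closure \<Omega>" for j
      using near[of 0 0 j j] near[of h 0 j j] near[of "-h" 0 j j] near[of h h j j] near[of "-h" "-h" j j] h by auto
    show "continuous_on {0..T - \<tau>} (E h \<tau> x)"
      unfolding E_def convection_def grid_grad_def D1_def D2_def
      by (intro continuous_intros c[OF v] c[OF p] c[OF f] pts)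
    show "norm (E h \<tau> x t) \<le> C * (h + \<tau>)" if "0 < t" "t < T - \<tau>" for t
      by (rule main[OF h \<tau>(1) that(1) _ box]) (use that in simp)
  qed (use \<tau> t in auto)
  then show ?thesis unfolding E_def using C by blast
qed

section \<open>Averages of the initial velocity and of the force\<close>

lemma content_cube: "0 < h \<Longrightarrow> measure lborel (cube h x) = h^3"
proof -
  assume h: "0 < h"
  then have "x \<in> cbox (x - vec (h/2)) (x + vec (h/2))" by (simp add: mem_box_cart)
  then have ne: "cbox (x - vec (h/2)) (x + vec (h/2)) \<noteq> {}" by blast
  show ?thesis unfolding cube_def content_cbox_cart[OF ne] by (simp add: field_simps power3_eq_cube)
qed

lemma cube_average:
  fixes g :: "real^3 \<Rightarrow> real^3"
  assumes h: "0 < h" and g: "continuous_on (cube h x) g" and B: "\<And>y. y \<in> cube h x \<Longrightarrow> norm (g y - c) \<le> B" "0 \<le> B"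
  shows "norm (integral (cube h x) g /\<^sub>R h^3 - c) \<le> B"
proof -
  have h3: "0 < h^3" using h by simp
  have "g integrable_on cube h x" using g unfolding cube_def by (rule integrable_continuous)
  then have "(g has_integral integral (cube h x) g) (cube h x)" by (rule integrable_integral)
  then have "((\<lambda>y. g y - c) has_integral (integral (cube h x) g - measure lborel (cube h x) *\<^sub>R c)) (cube h x)"
    unfolding cube_def by (intro has_integral_diff has_integral_const)
  then have "norm (integral (cube h x) g - h^3 *\<^sub>R c) \<le> B * h^3"
    using has_integral_bound[OF B(2), of "\<lambda>y. g y - c"] B(1) h content_cube[OF h, of x] unfolding cube_def by metis
  moreover have "integral (cube h x) g /\<^sub>R h^3 - c = (integral (cube h x) g - h^3 *\<^sub>R c) /\<^sub>R h^3"
    using h by (simp add: scaleR_right_diff_distrib)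
  ultimately show ?thesis using h3 by (simp add: pos_divide_le_eq divide_inverse_commute[symmetric] del: zero_less_power)
qed

lemma cube_component: "y \<in> cube h x \<Longrightarrow> \<bar>y $ k - x $ k\<bar> \<le> h / 2"
proof -
  assume "y \<in> cube h x"
  then have "\<forall>i. x $ i - h / 2 \<le> y $ i \<and> y $ i \<le> x $ i + h / 2"
    by (simp add: cube_def mem_box_cart)
  from spec[OF this, of k] show ?thesis by linarith
qed

lemma cube_box_in:
  assumes "box_in \<Omega> h x" and "0 < h" and "y \<in> cube h x"
  shows "y \<in> \<Omega>" and "box_hull x y \<subseteq> \<Omega>" and "(\<Sum>k\<in>UNIV. \<bar>y $ k - x $ k\<bar>) \<le> 3 * h"
proof -
  have k: "\<bar>y $ k - x $ k\<bar> \<le> h" for k using cube_component[OF assms(3), of k] assms(2) by linarith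
  show "y \<in> \<Omega>" by (rule box_inD[OF assms(1) k])
  show "box_hull x y \<subseteq> \<Omega>" by (rule box_in_hull[OF assms(1) _ k]) (use assms(2) in auto)
  show "(\<Sum>k\<in>UNIV. \<bar>y $ k - x $ k\<bar>) \<le> 3 * h" using k[of 1] k[of 2] k[of 3] by (simp add: sum_3)
qed

lemma initial_average_error:
  fixes v :: "real \<Rightarrow> real^3 \<Rightarrow> real^3"
  assumes bd: "bounded \<Omega>" and T: "0 < T" and v: "C_spacetime 3 T \<Omega> v" and v0: "\<And>x. x \<in> \<Omega> \<Longrightarrow> v 0 x = v\<^sub>0 x"
  shows "\<exists>C\<ge>0. \<forall>h x. 0 < h \<and> box_in \<Omega> h x \<longrightarrow> norm (integral (cube h x) v\<^sub>0 /\<^sub>R h^3 - v 0 x) \<le> C * h"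
proof -
  have v1: "C_spacetime (Suc 2) T \<Omega> v" using v by simp
  obtain Ls where Ls: "0 < Ls" "\<And>t x y. t \<in> {0..T} \<Longrightarrow> box_hull x y \<subseteq> \<Omega> \<Longrightarrow>
      norm (v t y - v t x) \<le> Ls * (\<Sum>i\<in>UNIV. \<bar>y $ i - x $ i\<bar>)"
    using C_spacetime_lipschitz_space[OF T bd v1] by blast
  have "norm (integral (cube h x) v\<^sub>0 /\<^sub>R h^3 - v 0 x) \<le> 3 * Ls * h" if h: "0 < h" and box: "box_in \<Omega> h x" for h x
  proof -
    have eq: "integral (cube h x) v\<^sub>0 = integral (cube h x) (v 0)"
      by (rule integral_cong) (use v0 cube_box_in(1)[OF box h] in auto)
    have "norm (integral (cube h x) (v 0) /\<^sub>R h^3 - v 0 x) \<le> 3 * Ls * h"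
    proof (rule cube_average[OF h])
      have "continuous_on (closure \<Omega>) (v 0)" by (rule C_spacetime_continuous_space[OF T v]) (use T in auto)
      then show "continuous_on (cube h x) (v 0)"
        by (rule continuous_on_subset) (use cube_box_in(1)[OF box h] closure_subset in blast)
      fix y assume y: "y \<in> cube h x"
      have "norm (v 0 y - v 0 x) \<le> Ls * (\<Sum>i\<in>UNIV. \<bar>y $ i - x $ i\<bar>)"
        using Ls(2)[of 0 x y] cube_box_in(2)[OF box h y] T by auto
      also have "\<dots> \<le> Ls * (3 * h)" using cube_box_in(3)[OF box h y] Ls(1) by (intro mult_left_mono) auto
      finally show "norm (v 0 y - v 0 x) \<le> 3 * Ls * h" by simp
    qed (use Ls h in auto)
    then show ?thesis unfolding eq .
  qed
  then show ?thesis using Ls(1) by (intro exI[of _ "3 * Ls"]) auto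
qed

lemma force_average_error:
  fixes f :: "real \<Rightarrow> real^3 \<Rightarrow> real^3"
  assumes bd: "bounded \<Omega>" and T: "0 < T" and f: "C_spacetime 1 T \<Omega> f"
  shows "\<exists>C\<ge>0. \<forall>h \<tau> n x. 0 < h \<and> 0 < \<tau> \<and> \<tau> * real (n + 1) \<le> T \<and> box_in \<Omega> h x \<longrightarrow>
    norm (force_avg h \<tau> f n x - f (\<tau> * real n + \<tau>) x) \<le> C * (h + \<tau>)"
proof -
  have f1: "C_spacetime (Suc 0) T \<Omega> f" using f by simp
  obtain Ls where Ls: "0 < Ls" "\<And>t x y. t \<in> {0..T} \<Longrightarrow> box_hull x y \<subseteq> \<Omega> \<Longrightarrow>
      norm (f t y - f t x) \<le> Ls * (\<Sum>i\<in>UNIV. \<bar>y $ i - x $ i\<bar>)"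
    using C_spacetime_lipschitz_space[OF T bd f1] by blast
  obtain Lt where Lt: "0 < Lt" "\<And>t s x. t \<in> {0..T} \<Longrightarrow> s \<in> {0..T} \<Longrightarrow> x \<in> \<Omega> \<Longrightarrow>
      norm (f t x - f s x) \<le> Lt * \<bar>t - s\<bar>"
    using C_spacetime_lipschitz_time[OF T bd f1] by blast
  have "norm (force_avg h \<tau> f n x - f (\<tau> * real n + \<tau>) x) \<le> (3 * Ls + Lt) * (h + \<tau>)"
    if h: "0 < h" and \<tau>: "0 < \<tau>" and n: "\<tau> * real (n + 1) \<le> T" and box: "box_in \<Omega> h x" for h \<tau> n x
  proof -
    define a where "a = \<tau> * real n"
    define c where "c = f (a + \<tau>) x"
    have a: "0 \<le> a" "a + \<tau> \<le> T" using \<tau> n by (auto simp: a_def algebra_simps)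
    have x: "x \<in> \<Omega>" by (rule box_inD[OF box]) (use h in auto)
    have cf: "continuous_on ({a..a+\<tau>} \<times> cube h x) (\<lambda>(t, y). f t y)"
      by (rule continuous_on_subset[OF C_spacetime_continuous[OF T f]])
        (use a cube_box_in(1)[OF box h] closure_subset in \<open>auto simp: subset_iff\<close>)
    define \<psi> where "\<psi> t = integral (cube h x) (f t) /\<^sub>R h^3" for t
    have c\<psi>: "continuous_on {a..a+\<tau>} \<psi>"
      unfolding \<psi>_def using integral_continuous_on_param[of "{a..a+\<tau>}" "x - vec (h/2)" "x + vec (h/2)" f] cf
      unfolding cube_def by (intro continuous_intros) auto
    have \<psi>c: "norm (\<psi> t - c) \<le> (3 * Ls + Lt) * (h + \<tau>)" if t: "t \<in> {a..a+\<tau>}" for t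
      unfolding \<psi>_def
    proof (rule cube_average[OF h])
      have tT: "t \<in> {0..T}" "a + \<tau> \<in> {0..T}" using t a \<tau> by auto
      have "continuous_on (closure \<Omega>) (f t)" by (rule C_spacetime_continuous_space[OF T f tT(1)])
      then show "continuous_on (cube h x) (f t)"
        by (rule continuous_on_subset) (use cube_box_in(1)[OF box h] closure_subset in blast)
      fix y assume y: "y \<in> cube h x"
      have 1: "norm (f t y - f t x) \<le> Ls * (\<Sum>i\<in>UNIV. \<bar>y $ i - x $ i\<bar>)"
        by (rule Ls(2)[OF tT(1) cube_box_in(2)[OF box h y]])
      also have "\<dots> \<le> Ls * (3 * h)" using cube_box_in(3)[OF box h y] Ls(1) by (intro mult_left_mono) auto
      finally have 1: "norm (f t y - f t x) \<le> Ls * (3 * h)" .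
      have "norm (f t x - c) \<le> Lt * \<bar>t - (a + \<tau>)\<bar>" unfolding c_def by (rule Lt(2)[OF tT x])
      also have "\<dots> \<le> Lt * \<tau>" using t Lt(1) by (intro mult_left_mono) auto
      finally have 2: "norm (f t x - c) \<le> Lt * \<tau>" .
      have "norm (f t y - c) \<le> Ls * (3 * h) + Lt * \<tau>"
        using norm_triangle_ineq[of "f t y - f t x" "f t x - c"] 1 2 by simp
      also have "\<dots> \<le> (3 * Ls + Lt) * (h + \<tau>)" using Ls(1) Lt(1) h \<tau> by (simp add: algebra_simps)
      finally show "norm (f t y - c) \<le> (3 * Ls + Lt) * (h + \<tau>)" .
    qed (use Ls Lt h \<tau> in auto)
    have eq: "force_avg h \<tau> f n x - c = integral {a..a+\<tau>} (\<lambda>t. \<psi> t - c) /\<^sub>R \<tau>"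
    proof -
      have "integral {a..a+\<tau>} (\<lambda>t. \<psi> t - c) = integral {a..a+\<tau>} \<psi> - \<tau> *\<^sub>R c"
        using integral_diff[OF integrable_continuous_real[OF c\<psi>] integrable_const_ivl[of c a "a+\<tau>"]] \<tau> by simp
      moreover have "integral {a..a+\<tau>} \<psi> = integral {a..a+\<tau>} (\<lambda>t. integral (cube h x) (f t)) /\<^sub>R h^3"
        unfolding \<psi>_def by simp
      moreover have "force_avg h \<tau> f n x = integral {a..a+\<tau>} (\<lambda>t. integral (cube h x) (f t)) /\<^sub>R (\<tau> * h^3)"
        by (simp add: force_avg_def a_def algebra_simps)
      ultimately show ?thesis using \<tau> by (simp add: scaleR_right_diff_distrib mult.commute)
    qed
    have "norm (integral {a..a+\<tau>} (\<lambda>t. \<psi> t - c)) \<le> ((3 * Ls + Lt) * (h + \<tau>)) * (a + \<tau> - a)"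
      by (rule integral_bound) (use \<tau> \<psi>c c\<psi> in \<open>auto intro!: continuous_intros\<close>)
    then have "norm (force_avg h \<tau> f n x - c) \<le> (3 * Ls + Lt) * (h + \<tau>)"
      unfolding eq using \<tau> by (simp add: field_simps)
    then show ?thesis by (simp add: c_def a_def)
  qed
  then show ?thesis using Ls(1) Lt(1) by (intro exI[of _ "3 * Ls + Lt"]) auto
qed

section \<open>Decay at the boundary and Lipschitz continuity of the zero extension\<close>

definition zext :: "(real^3) set \<Rightarrow> (real^3 \<Rightarrow> real^3) \<Rightarrow> real^3 \<Rightarrow> real^3" where
  "zext \<Omega> g x = (if x \<in> \<Omega> then g x else 0)"

text \<open>The boundary condition is stated for t > 0 and passes to t = 0 by continuity.\<close>

lemma velocity_zero_on_frontier:
  assumes T: "0 < T" and v: "C_spacetime k T \<Omega> v" and ns: "navier_stokes \<Omega> T f v\<^sub>0 v p"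
    and t: "t \<in> {0..T}" and q: "q \<in> frontier \<Omega>"
  shows "v t q = 0"
proof -
  have "q \<in> closure \<Omega>" using q by (simp add: frontier_def)
  from bound_on_closed_times[OF T C_spacetime_continuous_time[OF T v this], of 0 t] ns q t
  show ?thesis unfolding navier_stokes_def by simp
qed

lemma infdist_pos_compl:
  fixes \<Omega> :: "(real^3) set"
  assumes "open \<Omega>" "bounded \<Omega>" "x \<in> \<Omega>"
  shows "0 < infdist x (-\<Omega>)"
proof -
  obtain p where p: "p \<notin> \<Omega>" "infdist x (-\<Omega>) = dist x p" using infdist_compl_attained[OF assms(1,2)] by blast
  then have "x \<noteq> p" using assms(3) by blast
  then show ?thesis using p by simp
qed

lemma infdist_compl_ball: "dist x y < infdist x (-\<Omega>) \<Longrightarrow> y \<in> \<Omega>"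
  using infdist_le[of y "-\<Omega>" x] by (meson ComplI not_le)

lemma box_hull_ball:
  assumes "w \<in> box_hull x y"
  shows "norm (w - x) \<le> norm (y - x)"
proof (rule norm_le_componentwise_cart)
  fix k
  have "min (x $ k) (y $ k) \<le> w $ k" "w $ k \<le> max (x $ k) (y $ k)" using assms by (auto simp: box_hull_def)
  then show "norm ((w - x) $ k) \<le> norm ((y - x) $ k)" by auto
qed

text \<open>Go straight from \<open>x\<close> to a frontier point no farther than the complement.
  The Lipschitz bound is available only for boxes inside \<Omega>, so it is applied within the open
  ball and then passed to the limit at the frontier.\<close>

lemma boundary_decay:
  assumes op: "open \<Omega>" and bd: "bounded \<Omega>" and T: "0 < T"
    and v: "C_spacetime (Suc k) T \<Omega> v" and ns: "navier_stokes \<Omega> T f v\<^sub>0 v p"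
  shows "\<exists>C\<ge>0. \<forall>t\<in>{0..T}. \<forall>x. norm (zext \<Omega> (v t) x) \<le> C * infdist x (-\<Omega>)"
proof -
  obtain L where L: "0 < L" "\<And>t x y. t \<in> {0..T} \<Longrightarrow> box_hull x y \<subseteq> \<Omega> \<Longrightarrow>
      norm (v t y - v t x) \<le> L * (\<Sum>i\<in>UNIV. \<bar>y $ i - x $ i\<bar>)"
    using C_spacetime_lipschitz_space[OF T bd v] by blast
  have "norm (v t x) \<le> 3 * L * infdist x (-\<Omega>)" if t: "t \<in> {0..T}" and x: "x \<in> \<Omega>" for t x
  proof -
    define d where "d = infdist x (-\<Omega>)"
    have d: "0 < d" unfolding d_def by (rule infdist_pos_compl[OF op bd x])
    obtain p' where p: "p' \<notin> \<Omega>" "d = dist x p'" unfolding d_def using infdist_compl_attained[OF op bd] by blast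
    obtain q where q: "q \<in> frontier \<Omega>" "dist x q \<le> d" using near_frontier[OF x p(1)] p(2) by auto
    have qc: "q \<in> closure \<Omega>" using q by (simp add: frontier_def)
    define y where "y l = x + l *\<^sub>R (q - x)" for l :: real
    have inball: "box_hull x (y l) \<subseteq> \<Omega>" if "0 < l" "l < 1" for l
    proof
      fix w assume "w \<in> box_hull x (y l)"
      then have "norm (w - x) \<le> l * norm (q - x)"
        using box_hull_ball[of w x "y l"] that by (simp add: y_def)
      also have "\<dots> \<le> l * d" using q(2) that by (simp add: dist_norm norm_minus_commute)
      also have "\<dots> < d" using d that by simp
      finally show "w \<in> \<Omega>" by (intro infdist_compl_ball[of x]) (simp add: d_def dist_norm norm_minus_commute)
    qed
    have y\<Omega>: "y l \<in> \<Omega>" if "0 < l" "l < 1" for l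
      using inball[OF that] by (auto simp: box_hull_def)
    have bound: "norm (v t (y l) - v t x) \<le> 3 * L * d" if "0 < l" "l < 1" for l
    proof -
      have "\<bar>y l $ k - x $ k\<bar> \<le> d" for k
      proof -
        have "\<bar>y l $ k - x $ k\<bar> = l * \<bar>(q - x) $ k\<bar>" using that by (simp add: y_def abs_mult)
        also have "\<dots> \<le> 1 * d"
          using that component_le_norm_cart[of "q - x" k] q(2) d by (intro mult_mono) (auto simp: dist_norm norm_minus_commute)
        finally show ?thesis by simp
      qed
      then have "(\<Sum>i\<in>UNIV. \<bar>y l $ i - x $ i\<bar>) \<le> 3 * d"
        using sum_mono[of "UNIV :: 3 set" "\<lambda>i. \<bar>y l $ i - x $ i\<bar>" "\<lambda>_. d"] by simp
      then have "L * (\<Sum>i\<in>UNIV. \<bar>y l $ i - x $ i\<bar>) \<le> L * (3 * d)" using L(1) by (intro mult_left_mono) auto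
      then show ?thesis using L(2)[OF t inball[OF that]] by simp
    qed
    have cl: "closure {0<..<1::real} = {0..1}" by simp
    have "norm (v t (y 1) - v t x) \<le> 3 * L * d"
    proof (rule continuous_on_closure_norm_le[where s="{0<..<1}" and f="\<lambda>l. v t (y l) - v t x" and x=1])
      have "continuous_on {0..1} (\<lambda>l. v t (y l))"
      proof (rule continuous_on_compose2[OF C_spacetime_continuous_space[OF T v t]])
        show "continuous_on {0..1} y" unfolding y_def by (intro continuous_intros)
        show "y ` {0..1} \<subseteq> closure \<Omega>"
        proof
          fix w assume "w \<in> y ` {0..1}"
          then obtain l where l: "w = y l" "0 \<le> l" "l \<le> 1" by auto
          consider "l = 0" | "l = 1" | "0 < l" "l < 1" using l by linarith
          then show "w \<in> closure \<Omega>"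
            using l(1) x qc y\<Omega>[of l] closure_subset[of \<Omega>] by cases (auto simp: y_def)
        qed
      qed
      then show "continuous_on (closure {0<..<1}) (\<lambda>l. v t (y l) - v t x)"
        unfolding cl by (intro continuous_intros)
    qed (use bound in auto)
    moreover have "v t (y 1) = 0"
      using velocity_zero_on_frontier[OF T v ns t q(1)] by (simp add: y_def)
    ultimately show ?thesis by (simp add: d_def)
  qed
  then have "norm (zext \<Omega> (v t) x) \<le> 3 * L * infdist x (-\<Omega>)" if "t \<in> {0..T}" for t x
    using that L(1) by (simp add: zext_def infdist_nonneg)
  then show ?thesis using L(1) by (intro exI[of _ "3 * L"]) auto
qed

text \<open>Either \<open>y\<close> lies in the largest ball around \<open>x\<close> inside
  \<Omega>, where \<open>v\<close> is Lipschitz, or both points are within 2 |x - y| of the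
  complement, where the extension is itself of that size.\<close>

lemma zext_lipschitz:
  assumes op: "open \<Omega>" and bd: "bounded \<Omega>" and T: "0 < T"
    and v: "C_spacetime (Suc k) T \<Omega> v" and ns: "navier_stokes \<Omega> T f v\<^sub>0 v p"
  shows "\<exists>C\<ge>0. \<forall>t\<in>{0..T}. \<forall>x y. norm (zext \<Omega> (v t) x - zext \<Omega> (v t) y) \<le> C * norm (x - y)"
proof -
  obtain L where L: "0 < L" "\<And>t x y. t \<in> {0..T} \<Longrightarrow> box_hull x y \<subseteq> \<Omega> \<Longrightarrow>
      norm (v t y - v t x) \<le> L * (\<Sum>i\<in>UNIV. \<bar>y $ i - x $ i\<bar>)"
    using C_spacetime_lipschitz_space[OF T bd v] by blast
  obtain C where C: "0 \<le> C" "\<And>t x. t \<in> {0..T} \<Longrightarrow> norm (zext \<Omega> (v t) x) \<le> C * infdist x (-\<Omega>)"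
    using boundary_decay[OF op bd T v ns] by blast
  have "norm (zext \<Omega> (v t) x - zext \<Omega> (v t) y) \<le> (3 * L + 3 * C) * norm (x - y)" if t: "t \<in> {0..T}" for t x y
  proof (cases "norm (x - y) < infdist x (-\<Omega>)")
    case True
    have sub: "box_hull x y \<subseteq> \<Omega>"
    proof
      fix w assume "w \<in> box_hull x y"
      then show "w \<in> \<Omega>"
        using box_hull_ball[of w x y] True by (intro infdist_compl_ball[of x]) (simp add: dist_norm norm_minus_commute)
    qed
    then have xy: "x \<in> \<Omega>" "y \<in> \<Omega>" by (auto simp: box_hull_def)
    have "(\<Sum>i\<in>UNIV. \<bar>y $ i - x $ i\<bar>) \<le> (\<Sum>i\<in>(UNIV::3 set). norm (x - y))"
    proof (rule sum_mono)
      fix i show "\<bar>y $ i - x $ i\<bar> \<le> norm (x - y)" using component_le_norm_cart[of "x - y" i] by simp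
    qed
    then have "L * (\<Sum>i\<in>UNIV. \<bar>y $ i - x $ i\<bar>) \<le> L * (3 * norm (x - y))" using L(1) by (intro mult_left_mono) auto
    then have "norm (v t x - v t y) \<le> 3 * L * norm (x - y)"
      using L(2)[OF t sub] by (simp add: norm_minus_commute)
    also have "\<dots> \<le> (3 * L + 3 * C) * norm (x - y)" using C(1) by (intro mult_right_mono) auto
    finally show ?thesis using xy by (simp add: zext_def)
  next
    case False
    have "infdist y (-\<Omega>) \<le> infdist x (-\<Omega>) + norm (x - y)"
      using infdist_triangle[of y "-\<Omega>" x] by (simp add: dist_norm norm_minus_commute)
    then have "infdist y (-\<Omega>) \<le> 2 * norm (x - y)" using False by simp
    then have "C * infdist x (-\<Omega>) \<le> C * norm (x - y)" "C * infdist y (-\<Omega>) \<le> C * (2 * norm (x - y))"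
      using False C(1) by (auto intro!: mult_left_mono)
    then have "norm (zext \<Omega> (v t) x - zext \<Omega> (v t) y) \<le> C * norm (x - y) + C * (2 * norm (x - y))"
      using C(2)[OF t, of x] C(2)[OF t, of y] norm_triangle_ineq4[of "zext \<Omega> (v t) x" "zext \<Omega> (v t) y"] by linarith
    also have "\<dots> \<le> (3 * L + 3 * C) * norm (x - y)" using L(1) by (simp add: algebra_simps)
    finally show ?thesis .
  qed
  then show ?thesis using L(1) C(1) by (intro exI[of _ "3 * L + 3 * C"]) auto
qed

section \<open>Fluxes through cubes and duality with discrete gradients\<close>

definition off :: "real \<Rightarrow> real \<Rightarrow> real \<Rightarrow> real^3" where
  "off a b c = a *\<^sub>R ax 1 + b *\<^sub>R ax 2 + c *\<^sub>R ax 3"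

text \<open>Outward flux of \<open>W\<close> through the boundary of the cube of side 2 h centred at
  \<open>x\<close>, with opposite faces paired.\<close>

definition flux :: "real \<Rightarrow> (real^3 \<Rightarrow> real^3) \<Rightarrow> real^3 \<Rightarrow> real" where
  "flux h W x =
     integral {-h..h} (\<lambda>b. integral {-h..h} (\<lambda>c. W (x + off h b c) $ 1 - W (x + off (-h) b c) $ 1))
   + integral {-h..h} (\<lambda>a. integral {-h..h} (\<lambda>c. W (x + off a h c) $ 2 - W (x + off a (-h) c) $ 2))
   + integral {-h..h} (\<lambda>a. integral {-h..h} (\<lambda>b. W (x + off a b h) $ 3 - W (x + off a b (-h)) $ 3))"

lemma continuous_off:
  fixes G :: "real^3 \<Rightarrow> 'b::topological_space"
  assumes "continuous_on UNIV G" "continuous_on S f" "continuous_on S g" "continuous_on S k"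
  shows "continuous_on S (\<lambda>p. G (x + off (f p) (g p) (k p)))"
  unfolding off_def
  by (rule continuous_on_compose2[OF assms(1)]) (auto intro!: continuous_intros assms)

lemma continuous_integral_param:
  fixes F :: "'a::topological_space \<Rightarrow> real \<Rightarrow> real"
  assumes "continuous_on (S \<times> {-h..h}) (\<lambda>p. F (fst p) (snd p))"
  shows "continuous_on S (\<lambda>p. integral {-h..h} (F p))"
  using integral_continuous_on_param[of S "-h" h F] assms by (simp add: split_beta)

lemma integral_swap_interval:
  fixes F :: "real \<Rightarrow> real \<Rightarrow> real"
  assumes "continuous_on UNIV (\<lambda>p. F (fst p) (snd p))"
  shows "integral {-h..h} (\<lambda>a. integral {-h..h} (F a)) = integral {-h..h} (\<lambda>b. integral {-h..h} (\<lambda>a. F a b))"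
  using integral_swap_continuous[of "-h" "-h" h h F] continuous_on_subset[OF assms] by (simp add: split_beta)

lemma integral_interval_bound:
  fixes F :: "real \<Rightarrow> real"
  assumes "0 < h" "continuous_on {-h..h} F" "\<And>a. \<bar>F a\<bar> \<le> B"
  shows "\<bar>integral {-h..h} F\<bar> \<le> B * (2 * h)"
  using integral_bound[of "-h" h F B] assms by simp

lemma ftc_axis:
  fixes W :: "real^3 \<Rightarrow> real^3"
  assumes h: "0 < h" and d: "\<And>y. ((\<lambda>s. W (y + s *\<^sub>R ax i) $ i) has_vector_derivative H y) (at 0)"
  shows "W (x + h *\<^sub>R ax i) $ i - W (x - h *\<^sub>R ax i) $ i = integral {-h..h} (\<lambda>a. H (x + a *\<^sub>R ax i))"
proof -
  have "((\<lambda>s. W (x + s *\<^sub>R ax i) $ i) has_vector_derivative H (x + a *\<^sub>R ax i)) (at a)" for a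
  proof -
    have "((\<lambda>s. W ((x + a *\<^sub>R ax i) + s *\<^sub>R ax i) $ i) has_vector_derivative H (x + a *\<^sub>R ax i)) (at (a - a))"
      using d[of "x + a *\<^sub>R ax i"] by simp
    moreover have "((\<lambda>s. s - a) has_vector_derivative 1) (at a)" by (auto intro!: derivative_eq_intros)
    moreover have "x + a *\<^sub>R ax i + (s - a) *\<^sub>R ax i = x + s *\<^sub>R ax i" for s by (simp add: algebra_simps)
    ultimately show ?thesis
      using vector_diff_chain_at[of "\<lambda>s. s - a" 1 a "\<lambda>s. W ((x + a *\<^sub>R ax i) + s *\<^sub>R ax i) $ i"]
      by (simp add: o_def add.assoc)
  qed
  then have "((\<lambda>a. H (x + a *\<^sub>R ax i)) has_integral (W (x + h *\<^sub>R ax i) $ i - W (x + (-h) *\<^sub>R ax i) $ i)) {-h..h}"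
    by (intro fundamental_theorem_of_calculus) (use h in \<open>auto intro: has_vector_derivative_at_within\<close>)
  then show ?thesis by (simp add: integral_unique)
qed

text \<open>Gauss's theorem on a cube, from the fundamental theorem of calculus and Fubini: each
  pair of faces gives the triple integral of one derivative of component i along axis i, and (2 h)^3
  is the volume.\<close>

lemma flux_bound_by_divergence:
  fixes W :: "real^3 \<Rightarrow> real^3"
  assumes h: "0 < h" and d: "\<And>i y. ((\<lambda>s. W (y + s *\<^sub>R ax i) $ i) has_vector_derivative H i y) (at 0)"
    and c: "\<And>i. continuous_on UNIV (H i)" and B: "\<And>y. \<bar>H 1 y + H 2 y + H 3 y\<bar> \<le> B"
  shows "\<bar>flux h W x\<bar> \<le> B * (2 * h)^3"
proof -
  define F where "F i a b c = H i (x + off a b c)" for i a b c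
  have cF: "continuous_on S (\<lambda>p. F i (f p) (g p) (k p))"
    if "continuous_on S f" "continuous_on S g" "continuous_on S k" for S :: "'z::topological_space set" and i f g k
    unfolding F_def by (rule continuous_off[OF c that])
  have cI: "continuous_on S (\<lambda>p. integral {-h..h} (\<lambda>c. F i (f p) (g p) c))"
    if "continuous_on S f" "continuous_on S g" for S :: "'z::topological_space set" and i f g
    by (rule continuous_integral_param)
      (intro cF continuous_intros continuous_on_compose2[OF that(1)] continuous_on_compose2[OF that(2)], auto)
  have 1: "integral {-h..h} (\<lambda>b. integral {-h..h} (\<lambda>c. W (x + off h b c) $ 1 - W (x + off (-h) b c) $ 1))
     = integral {-h..h} (\<lambda>a. integral {-h..h} (\<lambda>b. integral {-h..h} (\<lambda>c. F 1 a b c)))"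
  proof -
    have "W (x + off h b c) $ 1 - W (x + off (-h) b c) $ 1 = integral {-h..h} (\<lambda>a. F 1 a b c)" for b c
      using ftc_axis[OF h d[of _ 1], of "x + off 0 b c"] by (simp add: F_def off_def algebra_simps)
    then have "integral {-h..h} (\<lambda>b. integral {-h..h} (\<lambda>c. W (x + off h b c) $ 1 - W (x + off (-h) b c) $ 1))
      = integral {-h..h} (\<lambda>b. integral {-h..h} (\<lambda>c. integral {-h..h} (\<lambda>a. F 1 a b c)))" by simp
    also have "\<dots> = integral {-h..h} (\<lambda>b. integral {-h..h} (\<lambda>a. integral {-h..h} (\<lambda>c. F 1 a b c)))"
      by (subst integral_swap_interval) (auto intro!: cF continuous_intros)
    also have "\<dots> = integral {-h..h} (\<lambda>a. integral {-h..h} (\<lambda>b. integral {-h..h} (\<lambda>c. F 1 a b c)))"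
      by (rule integral_swap_interval) (intro cI continuous_intros)
    finally show ?thesis .
  qed
  have 2: "integral {-h..h} (\<lambda>a. integral {-h..h} (\<lambda>c. W (x + off a h c) $ 2 - W (x + off a (-h) c) $ 2))
     = integral {-h..h} (\<lambda>a. integral {-h..h} (\<lambda>b. integral {-h..h} (\<lambda>c. F 2 a b c)))"
  proof -
    have "W (x + off a h c) $ 2 - W (x + off a (-h) c) $ 2 = integral {-h..h} (\<lambda>b. F 2 a b c)" for a c
      using ftc_axis[OF h d[of _ 2], of "x + off a 0 c"] by (simp add: F_def off_def algebra_simps)
    then have "integral {-h..h} (\<lambda>a. integral {-h..h} (\<lambda>c. W (x + off a h c) $ 2 - W (x + off a (-h) c) $ 2))
      = integral {-h..h} (\<lambda>a. integral {-h..h} (\<lambda>c. integral {-h..h} (\<lambda>b. F 2 a b c)))" by simp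
    also have "\<dots> = integral {-h..h} (\<lambda>a. integral {-h..h} (\<lambda>b. integral {-h..h} (\<lambda>c. F 2 a b c)))"
      by (subst integral_swap_interval) (auto intro!: cF continuous_intros)
    finally show ?thesis .
  qed
  have 3: "integral {-h..h} (\<lambda>a. integral {-h..h} (\<lambda>b. W (x + off a b h) $ 3 - W (x + off a b (-h)) $ 3))
     = integral {-h..h} (\<lambda>a. integral {-h..h} (\<lambda>b. integral {-h..h} (\<lambda>c. F 3 a b c)))"
  proof -
    have "W (x + off a b h) $ 3 - W (x + off a b (-h)) $ 3 = integral {-h..h} (\<lambda>c. F 3 a b c)" for a b
      using ftc_axis[OF h d[of _ 3], of "x + off a b 0"] by (simp add: F_def off_def algebra_simps)
    then show ?thesis by simp
  qed
  define S where "S a b c = F 1 a b c + F 2 a b c + F 3 a b c" for a b c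
  have cJ: "continuous_on UNIV (\<lambda>a. integral {-h..h} (\<lambda>b. integral {-h..h} (\<lambda>c. F i a b c)))" for i
    by (rule continuous_integral_param) (intro cI continuous_intros)
  have int: "f integrable_on {-h..h}" if "continuous_on UNIV f" for f :: "real \<Rightarrow> real"
    by (rule integrable_continuous_real[OF continuous_on_subset[OF that]]) simp
  have c3: "integral {-h..h} (S a b) = integral {-h..h} (F 1 a b) + integral {-h..h} (F 2 a b) + integral {-h..h} (F 3 a b)" for a b
  proof -
    have "F i a b integrable_on {-h..h}" for i by (rule int) (intro cF continuous_intros)
    then show ?thesis unfolding S_def by (simp add: integral_add integrable_add)
  qed
  have c2: "integral {-h..h} (\<lambda>b. integral {-h..h} (S a b)) = integral {-h..h} (\<lambda>b. integral {-h..h} (F 1 a b))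
     + integral {-h..h} (\<lambda>b. integral {-h..h} (F 2 a b)) + integral {-h..h} (\<lambda>b. integral {-h..h} (F 3 a b))" for a
  proof -
    have "(\<lambda>b. integral {-h..h} (F i a b)) integrable_on {-h..h}" for i by (rule int) (intro cI continuous_intros)
    then show ?thesis unfolding c3 by (simp add: integral_add integrable_add)
  qed
  have c1: "integral {-h..h} (\<lambda>a. integral {-h..h} (\<lambda>b. integral {-h..h} (S a b))) = flux h W x"
  proof -
    have "(\<lambda>a. integral {-h..h} (\<lambda>b. integral {-h..h} (F i a b))) integrable_on {-h..h}" for i by (rule int) (rule cJ)
    then show ?thesis unfolding c2 flux_def 1 2 3 by (simp add: integral_add integrable_add)
  qed
  have S: "\<bar>S a b c\<bar> \<le> B" for a b c unfolding S_def F_def by (rule B)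
  have cS: "continuous_on {-h..h} (S a b)" for a b unfolding S_def by (intro continuous_intros cF)
  have b3: "\<bar>integral {-h..h} (S a b)\<bar> \<le> B * (2 * h)" for a b
    by (rule integral_interval_bound[OF h cS S])
  have cS2: "continuous_on {-h..h} (\<lambda>b. integral {-h..h} (S a b))" for a unfolding c3 by (intro continuous_intros cI)
  have b2: "\<bar>integral {-h..h} (\<lambda>b. integral {-h..h} (S a b))\<bar> \<le> B * (2 * h) * (2 * h)" for a
    by (rule integral_interval_bound[OF h cS2 b3])
  have cS1: "continuous_on {-h..h} (\<lambda>a. integral {-h..h} (\<lambda>b. integral {-h..h} (S a b)))"
    unfolding c2 by (intro continuous_intros continuous_on_subset[OF cJ]) auto
  have "\<bar>flux h W x\<bar> \<le> B * (2 * h) * (2 * h) * (2 * h)"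
    unfolding c1[symmetric] by (rule integral_interval_bound[OF h cS1 b2])
  then show ?thesis by (simp add: power3_eq_cube mult_ac)
qed

lemma face_continuous:
  fixes W :: "real^3 \<Rightarrow> real^3"
  assumes "continuous_on UNIV W" "continuous_on S f" "continuous_on S g" "continuous_on S k"
  shows "continuous_on S (\<lambda>p. W (x + off (f p) (g p) (k p)) $ i)"
  by (intro continuous_intros continuous_off assms)

lemma face_difference_integral:
  fixes f g :: "real \<Rightarrow> real \<Rightarrow> real"
  assumes cf: "continuous_on UNIV (\<lambda>p. f (fst p) (snd p))" and cg: "continuous_on UNIV (\<lambda>p. g (fst p) (snd p))"
  shows "integral {-h..h} (\<lambda>a. integral {-h..h} (\<lambda>b. f a b - g a b)) =
     integral {-h..h} (\<lambda>a. integral {-h..h} (f a)) - integral {-h..h} (\<lambda>a. integral {-h..h} (g a))"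
proof -
  have int: "f integrable_on {-h..h}" if "continuous_on UNIV f" for f :: "real \<Rightarrow> real"
    by (rule integrable_continuous_real[OF continuous_on_subset[OF that]]) simp
  have slice: "continuous_on UNIV (F a)" if "continuous_on UNIV (\<lambda>p. F (fst p) (snd p))" for F :: "real \<Rightarrow> real \<Rightarrow> real" and a
    using continuous_on_compose2[OF that, of UNIV "\<lambda>b. (a, b)"] by (simp add: continuous_intros)
  have out: "continuous_on UNIV (\<lambda>a. integral {-h..h} (F a))" if "continuous_on UNIV (\<lambda>p. F (fst p) (snd p))" for F :: "real \<Rightarrow> real \<Rightarrow> real"
    by (rule continuous_integral_param) (rule continuous_on_subset[OF that], simp)
  have "integral {-h..h} (\<lambda>b. f a b - g a b) = integral {-h..h} (f a) - integral {-h..h} (g a)" for a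
    by (intro integral_diff int slice cf cg)
  then show ?thesis by (simp add: integral_diff int out cf cg)
qed

text \<open>The factor 24 h^2 is the surface area of the cube, so the flux is continuous under
  uniform convergence of the field.\<close>

lemma flux_perturbation:
  fixes W W' :: "real^3 \<Rightarrow> real^3"
  assumes h: "0 < h" and cW: "continuous_on UNIV W" "continuous_on UNIV W'" and B: "\<And>y. norm (W y - W' y) \<le> B"
  shows "\<bar>flux h W x - flux h W' x\<bar> \<le> 24 * B * h\<^sup>2"
proof -
  have bd: "\<bar>integral {-h..h} (\<lambda>a. integral {-h..h} (\<lambda>b. f a b)) - integral {-h..h} (\<lambda>a. integral {-h..h} (\<lambda>b. g a b))\<bar> \<le> 8 * B * h\<^sup>2"
    if cf: "continuous_on UNIV (\<lambda>p. f (fst p) (snd p))" and cg: "continuous_on UNIV (\<lambda>p. g (fst p) (snd p))"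
      and fg: "\<And>a b. \<bar>f a b - g a b\<bar> \<le> 2 * B" for f g :: "real \<Rightarrow> real \<Rightarrow> real"
  proof -
    have c: "continuous_on UNIV (\<lambda>p. f (fst p) (snd p) - g (fst p) (snd p))" by (intro continuous_intros cf cg)
    have c1: "continuous_on {-h..h} (\<lambda>b. f a b - g a b)" for a
      using continuous_on_compose2[OF c, of "{-h..h}" "\<lambda>b. (a, b)"] by (simp add: continuous_intros)
    have c2: "continuous_on {-h..h} (\<lambda>a. integral {-h..h} (\<lambda>b. f a b - g a b))"
      by (rule continuous_integral_param) (rule continuous_on_subset[OF c], simp)
    have "\<bar>integral {-h..h} (\<lambda>a. integral {-h..h} (\<lambda>b. f a b - g a b))\<bar> \<le> 2 * B * (2 * h) * (2 * h)"
      by (rule integral_interval_bound[OF h c2 integral_interval_bound[OF h c1 fg]])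
    then show ?thesis unfolding face_difference_integral[OF cf cg] by (simp add: power2_eq_square mult_ac)
  qed
  have comp: "\<bar>(W y $ i - W z $ i) - (W' y $ i - W' z $ i)\<bar> \<le> 2 * B" for y z i
    using component_le_norm_cart[of "W y - W' y" i] component_le_norm_cart[of "W z - W' z" i] B[of y] B[of z] by simp
  note ci = continuous_intros face_continuous[OF cW(1)] face_continuous[OF cW(2)]
  show ?thesis unfolding flux_def
    using bd[of "\<lambda>b c. W (x + off h b c) $ 1 - W (x + off (-h) b c) $ 1" "\<lambda>b c. W' (x + off h b c) $ 1 - W' (x + off (-h) b c) $ 1"]
      bd[of "\<lambda>a c. W (x + off a h c) $ 2 - W (x + off a (-h) c) $ 2" "\<lambda>a c. W' (x + off a h c) $ 2 - W' (x + off a (-h) c) $ 2"]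
      bd[of "\<lambda>a b. W (x + off a b h) $ 3 - W (x + off a b (-h)) $ 3" "\<lambda>a b. W' (x + off a b h) $ 3 - W' (x + off a b (-h)) $ 3"]
      comp by (simp add: ci)
qed

section \<open>Vanishing flux of a divergence-free field extended by zero\<close>

text \<open>From r^(2p) >= 1 + 2 p ln r and - r ln r <= 1. The bound is uniform in r, so the
  modified fields converge uniformly as p tends to 0.\<close>

lemma powr_near_one:
  fixes r p :: real
  assumes "0 \<le> r" "r \<le> 1" "0 < p"
  shows "\<bar>(r * r) powr p * r - r\<bar> \<le> 2 * p"
proof (cases "r = 0")
  case True
  then show ?thesis using assms by simp
next
  case False
  then have r: "0 < r" using assms by simp
  define a where "a = (r * r) powr p"
  have "a \<le> 1" unfolding a_def using r assms by (intro powr_le1) (auto simp: mult_le_one)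
  have "1 + 2 * p * ln r \<le> exp (2 * p * ln r)" by (rule exp_ge_add_one_self)
  also have "exp (2 * p * ln r) = a" using r by (simp add: a_def powr_def ln_mult)
  finally have a1: "1 + 2 * p * ln r \<le> a" .
  have "ln (1 / r) \<le> 1 / r - 1" using r by (intro ln_le_minus_one) auto
  then have "- ln r \<le> 1 / r - 1" using r by (simp add: ln_div)
  then have "r * (- ln r) \<le> r * (1 / r - 1)" using r by (intro mult_left_mono) auto
  also have "\<dots> \<le> 1" using r by (simp add: algebra_simps)
  finally have lr: "r * (- ln r) \<le> 1" .
  have "r - a * r \<le> r - (1 + 2 * p * ln r) * r" using a1 r by simp
  also have "\<dots> = 2 * p * (r * (- ln r))" by (simp add: algebra_simps)
  also have "\<dots> \<le> 2 * p * 1" using lr assms by (intro mult_left_mono) auto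
  finally have "r - a * r \<le> 2 * p" by simp
  moreover have "a * r \<le> r" using \<open>a \<le> 1\<close> r by simp
  ultimately show ?thesis by (simp add: a_def)
qed

text \<open>A bounded Lipschitz field that is divergence-free on \<open>\<Omega>\<close> and zero outside need not be
  differentiable on the frontier. Its modification by the factor \<open>(g \<bullet> g) powr p\<close> is continuously
  differentiable everywhere, with divergence \<open>O(p)\<close>; then \<open>p\<close> tends to \<open>0\<close>.\<close>

lemma flux_zero_unit:
  fixes g :: "real^3 \<Rightarrow> real^3"
  assumes op: "open \<Omega>" and h: "0 < h" and g0: "\<And>x. x \<notin> \<Omega> \<Longrightarrow> g x = 0"
    and lip: "\<And>x y. norm (g x - g y) \<le> C * norm (x - y)" and g1: "\<And>x. norm (g x) \<le> 1"
    and cG: "\<And>i. continuous_on \<Omega> (G i)" and GC: "\<And>i x. x \<in> \<Omega> \<Longrightarrow> norm (G i x) \<le> C"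
    and dG: "\<And>i x. x \<in> \<Omega> \<Longrightarrow> ((\<lambda>s. g (x + s *\<^sub>R ax i)) has_vector_derivative G i x) (at 0)"
    and div: "\<And>x. x \<in> \<Omega> \<Longrightarrow> (\<Sum>i\<in>UNIV. G i x $ i) = 0"
  shows "flux h g x = 0"
proof -
  have "norm (g 0 - g (ax 1)) \<le> C" using lip[of 0 "ax 1"] by simp
  then have C0: "0 \<le> C" by (meson norm_ge_zero order_trans)
  have cg: "continuous_on UNIV g"
  proof -
    have "C-lipschitz_on UNIV g" using lip C0 by (intro lipschitz_onI) (auto simp: dist_norm)
    then show ?thesis by (rule lipschitz_on_continuous_on)
  qed
  have gg: "g y \<bullet> g y \<le> 1" for y
    using g1[of y] by (metis norm_ge_zero norm_eq_sqrt_inner real_sqrt_le_1_iff)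
  have bound: "\<bar>flux h g x\<bar> \<le> p * (48 * C * h^3 + 48 * h\<^sup>2)" if p: "0 < p" "p \<le> 1" for p
  proof -
    define q where "q y = g y \<bullet> g y" for y
    have q0: "0 \<le> q y" for y by (simp add: q_def)
    have qpos: "g y \<noteq> 0 \<Longrightarrow> 0 < q y" for y by (simp add: q_def)
    define W where "W y = q y powr p *\<^sub>R g y" for y
    define Hv where "Hv i y = (if g y = 0 then 0 else
        q y powr p *\<^sub>R G i y + (2 * p * q y powr (p - 1) * (g y \<bullet> G i y)) *\<^sub>R g y)" for i y
    have qq: "q y powr (p - 1) * q y = q y powr p" if "g y \<noteq> 0" for y
      using qpos[OF that] powr_add[of "q y" "p - 1" 1] by simp
    have in\<Omega>: "y \<in> \<Omega>" if "g y \<noteq> 0" for y using g0 that by blast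
    \<comment> \<open>Both summands are of size q^p: in the second one q^(p - 1) meets two factors
      |g|. The same bound later gives the continuity of \<open>Hv\<close> at the zeros of
      \<open>g\<close>.\<close>
    have HvB: "norm (Hv i y) \<le> 3 * C * q y powr p" for i y
    proof (cases "g y = 0")
      case True
      then show ?thesis using C0 by (simp add: Hv_def)
    next
      case False
      have GCy: "norm (G i y) \<le> C" by (rule GC[OF in\<Omega>[OF False]])
      define c where "c = 2 * p * q y powr (p - 1)"
      have c0: "0 \<le> c" using p by (simp add: c_def)
      have cq: "c * q y = 2 * p * q y powr p" using qq[OF False] by (simp add: c_def)
      have "\<bar>g y \<bullet> G i y\<bar> * norm (g y) \<le> (norm (g y) * C) * norm (g y)"
        by (intro mult_right_mono order_trans[OF Cauchy_Schwarz_ineq2] mult_left_mono GCy) auto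
      also have "\<dots> = C * q y" by (simp add: q_def power2_norm_eq_inner[symmetric] power2_eq_square)
      finally have "c * (\<bar>g y \<bullet> G i y\<bar> * norm (g y)) \<le> c * (C * q y)" using c0 by (rule mult_left_mono)
      also have "\<dots> = C * (c * q y)" by simp
      finally have 1: "norm ((c * (g y \<bullet> G i y)) *\<^sub>R g y) \<le> C * (2 * p * q y powr p)"
        unfolding cq using c0 by (simp add: abs_mult mult.assoc)
      have "norm (q y powr p *\<^sub>R G i y) \<le> q y powr p * C" using GCy by (simp add: mult_left_mono)
      then have "norm (Hv i y) \<le> q y powr p * C + C * (2 * p * q y powr p)"
        unfolding Hv_def c_def[symmetric] if_not_P[OF False] using 1 by (rule norm_triangle_mono)
      also have "\<dots> = (C * q y powr p) * (1 + 2 * p)" by (simp add: algebra_simps)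
      also have "\<dots> \<le> (C * q y powr p) * 3" using p C0 by (intro mult_left_mono) auto
      finally show ?thesis by (simp add: mult_ac)
    qed
    have dW: "((\<lambda>s. W (y + s *\<^sub>R ax i)) has_vector_derivative Hv i y) (at 0)" for i y
    proof (cases "g y = 0")
      case True
      have qb: "q (y + s *\<^sub>R ax i) \<le> C\<^sup>2 * s\<^sup>2" "norm (g (y + s *\<^sub>R ax i)) \<le> C * \<bar>s\<bar>" for s
      proof -
        show 1: "norm (g (y + s *\<^sub>R ax i)) \<le> C * \<bar>s\<bar>" using lip[of "y + s *\<^sub>R ax i" y] True by simp
        have "(norm (g (y + s *\<^sub>R ax i)))\<^sup>2 \<le> (C * \<bar>s\<bar>)\<^sup>2" by (rule power_mono[OF 1]) simp
        then show "q (y + s *\<^sub>R ax i) \<le> C\<^sup>2 * s\<^sup>2" by (simp add: q_def power2_norm_eq_inner power_mult_distrib)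
      qed
      have "((\<lambda>s. W (y + s *\<^sub>R ax i)) has_derivative (\<lambda>s. 0)) (at 0)"
      proof (rule has_derivativeI_sandwich[where e=1 and H="\<lambda>s. (C\<^sup>2 * s\<^sup>2) powr p * C"])
        fix s :: real assume s: "s \<noteq> 0"
        have "norm (W (y + s *\<^sub>R ax i)) \<le> (C\<^sup>2 * s\<^sup>2) powr p * (C * \<bar>s\<bar>)"
          unfolding W_def norm_scaleR using qb[of s] q0 p by (intro mult_mono) (auto intro!: powr_mono2)
        then show "norm (W (y + s *\<^sub>R ax i) - W (y + 0 *\<^sub>R ax i) - 0) / norm (s - 0) \<le> (C\<^sup>2 * s\<^sup>2) powr p * C"
          using s True by (simp add: W_def q_def divide_le_eq mult.assoc)
      next
        have "((\<lambda>s::real. C\<^sup>2 * s\<^sup>2) \<longlongrightarrow> C\<^sup>2 * 0\<^sup>2) (at 0)" by (intro tendsto_intros)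
        then have "((\<lambda>s::real. (C\<^sup>2 * s\<^sup>2) powr p) \<longlongrightarrow> 0) (at 0)"
          using p by (intro tendsto_zero_powrI[of _ _ _ p]) auto
        then show "((\<lambda>s::real. (C\<^sup>2 * s\<^sup>2) powr p * C) \<longlongrightarrow> 0) (at 0)" by (rule tendsto_mult_left_zero)
      qed auto
      then show ?thesis using True by (simp add: has_vector_derivative_def Hv_def)
    next
      case False
      have d: "((\<lambda>s. g (y + s *\<^sub>R ax i)) has_vector_derivative G i y) (at 0)" by (rule dG[OF in\<Omega>[OF False]])
      have dq: "((\<lambda>s. q (y + s *\<^sub>R ax i)) has_real_derivative 2 * (g y \<bullet> G i y)) (at 0)"
      proof -
        have "((\<lambda>s. g (y + s *\<^sub>R ax i) \<bullet> g (y + s *\<^sub>R ax i)) has_derivative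
            (\<lambda>h. g (y + 0 *\<^sub>R ax i) \<bullet> (h *\<^sub>R G i y) + (h *\<^sub>R G i y) \<bullet> g (y + 0 *\<^sub>R ax i))) (at 0)"
          by (rule has_derivative_inner) (use d in \<open>auto simp: has_vector_derivative_def\<close>)
        moreover have "(\<lambda>h. g (y + 0 *\<^sub>R ax i) \<bullet> (h *\<^sub>R G i y) + (h *\<^sub>R G i y) \<bullet> g (y + 0 *\<^sub>R ax i)) = (*) (2 * (g y \<bullet> G i y))"
          by (auto simp: fun_eq_iff inner_commute)
        ultimately show ?thesis by (simp add: has_field_derivative_def q_def)
      qed
      have "((\<lambda>s. q (y + s *\<^sub>R ax i) powr p) has_real_derivative p * q (y + 0 *\<^sub>R ax i) powr (p - of_nat 1) * (2 * (g y \<bullet> G i y))) (at 0)"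
        by (rule DERIV_fun_powr[OF dq]) (use qpos[OF False] in simp)
      then have "((\<lambda>s. q (y + s *\<^sub>R ax i) powr p) has_real_derivative 2 * p * q y powr (p - 1) * (g y \<bullet> G i y)) (at 0)"
        by (simp add: mult_ac)
      from has_vector_derivative_scaleR[OF this d]
      show ?thesis using False by (simp add: W_def Hv_def)
    qed
    have cq: "continuous_on UNIV q" unfolding q_def by (intro continuous_intros cg)
    have cHv: "continuous_on UNIV (Hv i)" for i
      unfolding continuous_on_eq_continuous_at[OF open_UNIV]
    proof (intro ballI)
      fix y :: "real^3"
      show "isCont (Hv i) y"
      proof (cases "g y = 0")
        case False
        define A where "A = {y. g y \<noteq> 0}"
        have A: "open A" unfolding A_def using cg by (intro open_Collect_neq continuous_intros)
        have "continuous_on A (\<lambda>y. q y powr p *\<^sub>R G i y + (2 * p * q y powr (p - 1) * (g y \<bullet> G i y)) *\<^sub>R g y)"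
        proof -
          have A\<Omega>: "A \<subseteq> \<Omega>" using in\<Omega> by (auto simp: A_def)
          note c = continuous_on_subset[OF cg, of A] continuous_on_subset[OF cq, of A] continuous_on_subset[OF cG[of i] A\<Omega>]
          have "\<forall>y\<in>A. q y \<noteq> 0" using qpos by (force simp: A_def)
          then show ?thesis by (intro continuous_intros c) auto
        qed
        then have "continuous_on A (Hv i)"
          by (rule continuous_on_eq) (auto simp: A_def Hv_def)
        then show ?thesis using A False by (simp add: continuous_on_eq_continuous_at A_def)
      next
        case True
        have "isCont q y" using cq by (simp add: continuous_on_eq_continuous_at)
        then have "(q \<longlongrightarrow> 0) (at y)" using True by (simp add: isCont_def q_def)
        then have "((\<lambda>z. q z powr p) \<longlongrightarrow> 0) (at y)"
          using p q0 by (intro tendsto_zero_powrI[of _ _ _ p]) auto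
        then have "((\<lambda>z. 3 * C * q z powr p) \<longlongrightarrow> 0) (at y)" by (rule tendsto_mult_right_zero)
        then have "(Hv i \<longlongrightarrow> 0) (at y)"
          by (rule Lim_null_comparison[rotated]) (use HvB in auto)
        then show ?thesis using True by (simp add: isCont_def Hv_def)
      qed
    qed
    \<comment> \<open>The summand q^p div g vanishes, and what remains carries the factor 2
      p.\<close>
    have divW: "\<bar>Hv 1 y $ 1 + Hv 2 y $ 2 + Hv 3 y $ 3\<bar> \<le> 6 * p * C" for y
    proof (cases "g y = 0")
      case True
      then show ?thesis using p C0 by (simp add: Hv_def)
    next
      case False
      have y: "y \<in> \<Omega>" by (rule in\<Omega>[OF False])
      have "(\<Sum>i\<in>UNIV. Hv i y $ i) = q y powr p * (\<Sum>i\<in>UNIV. G i y $ i)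
          + 2 * p * q y powr (p - 1) * (\<Sum>i\<in>UNIV. (g y \<bullet> G i y) * g y $ i)"
        using False by (simp add: Hv_def sum_distrib_left sum.distrib mult.assoc)
      then have 1: "\<bar>\<Sum>i\<in>UNIV. Hv i y $ i\<bar> = 2 * p * q y powr (p - 1) * \<bar>\<Sum>i\<in>UNIV. (g y \<bullet> G i y) * g y $ i\<bar>"
        using p by (simp add: div[OF y] abs_mult)
      have "\<bar>\<Sum>i\<in>UNIV. (g y \<bullet> G i y) * g y $ i\<bar> \<le> (\<Sum>i\<in>(UNIV::3 set). C * q y)"
      proof (intro order_trans[OF sum_abs] sum_mono)
        fix i
        have "\<bar>(g y \<bullet> G i y) * g y $ i\<bar> \<le> (norm (g y) * C) * norm (g y)"
          unfolding abs_mult using C0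
          by (intro mult_mono component_le_norm_cart order_trans[OF Cauchy_Schwarz_ineq2] mult_left_mono GC y) auto
        also have "\<dots> = C * q y" by (simp add: q_def power2_norm_eq_inner[symmetric] power2_eq_square)
        finally show "\<bar>(g y \<bullet> G i y) * g y $ i\<bar> \<le> C * q y" .
      qed
      then have "2 * p * q y powr (p - 1) * \<bar>\<Sum>i\<in>UNIV. (g y \<bullet> G i y) * g y $ i\<bar> \<le> 2 * p * q y powr (p - 1) * (3 * (C * q y))"
        using p by (intro mult_left_mono) auto
      also have "\<dots> = 6 * p * C * (q y powr (p - 1) * q y)" by simp
      also have "\<dots> \<le> 6 * p * C * 1"
        unfolding qq[OF False] using p C0 gg[of y] q0[of y] by (intro mult_left_mono powr_le1) (auto simp: q_def)
      finally show ?thesis using 1 by (simp add: sum_3)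
    qed
    have "\<bar>flux h W x\<bar> \<le> 6 * p * C * (2 * h)^3"
    proof (rule flux_bound_by_divergence[OF h, where H="\<lambda>i y. Hv i y $ i"])
      show "((\<lambda>s. W (y + s *\<^sub>R ax i) $ i) has_vector_derivative Hv i y $ i) (at 0)" for i y
        using bounded_linear.has_vector_derivative[OF bounded_linear_vec_nth dW] .
      show "continuous_on UNIV (\<lambda>y. Hv i y $ i)" for i by (intro continuous_intros cHv)
    qed (rule divW)
    moreover have "\<bar>flux h W x - flux h g x\<bar> \<le> 24 * (2 * p) * h\<^sup>2"
    proof (rule flux_perturbation[OF h _ cg])
      show "continuous_on UNIV W"
        unfolding W_def using p q0
        by (intro continuous_on_scaleR cg continuous_on_powr' cq continuous_on_const) auto
      fix y
      have "norm (W y - g y) = \<bar>(norm (g y) * norm (g y)) powr p * norm (g y) - norm (g y)\<bar>"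
      proof -
        have "W y - g y = (q y powr p - 1) *\<^sub>R g y" by (simp add: W_def algebra_simps)
        then have "norm (W y - g y) = \<bar>q y powr p - 1\<bar> * norm (g y)" by simp
        also have "\<dots> = \<bar>(q y powr p - 1) * norm (g y)\<bar>" by (simp add: abs_mult)
        finally show ?thesis
          by (simp add: q_def power2_norm_eq_inner[symmetric] power2_eq_square left_diff_distrib)
      qed
      then show "norm (W y - g y) \<le> 2 * p" using powr_near_one[OF norm_ge_zero g1 p(1)] by simp
    qed
    ultimately have "\<bar>flux h g x\<bar> \<le> 6 * p * C * (2 * h)^3 + 24 * (2 * p) * h\<^sup>2" by linarith
    then show ?thesis by (simp add: power_mult_distrib algebra_simps)
  qed
  define D where "D = 48 * C * h^3 + 48 * h\<^sup>2"
  have D: "0 < D" unfolding D_def using C0 h by (intro add_nonneg_pos) auto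
  show ?thesis
  proof (rule ccontr)
    assume "flux h g x \<noteq> 0"
    then have f: "0 < \<bar>flux h g x\<bar>" by simp
    \<comment> \<open>Small enough that p D is at most half of the flux.\<close>
    define p where "p = min 1 (\<bar>flux h g x\<bar> / (2 * D))"
    have p: "0 < p" "p \<le> 1" using f D by (auto simp: p_def)
    have "\<bar>flux h g x\<bar> \<le> p * D" using bound[OF p] by (simp add: D_def)
    also have "\<dots> \<le> \<bar>flux h g x\<bar> / (2 * D) * D" using D by (intro mult_right_mono) (auto simp: p_def)
    also have "\<dots> = \<bar>flux h g x\<bar> / 2" using D by simp
    finally show False using f by simp
  qed
qed

lemma flux_scaleR: "flux h (\<lambda>x. c *\<^sub>R g x) x = c * flux h g x"
proof -
  have "flux h (\<lambda>x. c *\<^sub>R g x) x =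
     integral {-h..h} (\<lambda>b. integral {-h..h} (\<lambda>d. c * (g (x + off h b d) $ 1 - g (x + off (-h) b d) $ 1)))
   + integral {-h..h} (\<lambda>a. integral {-h..h} (\<lambda>d. c * (g (x + off a h d) $ 2 - g (x + off a (-h) d) $ 2)))
   + integral {-h..h} (\<lambda>a. integral {-h..h} (\<lambda>b. c * (g (x + off a b h) $ 3 - g (x + off a b (-h)) $ 3)))"
    by (simp add: flux_def right_diff_distrib)
  then show ?thesis by (simp add: flux_def distrib_left)
qed

text \<open>Division by \<open>M\<close> reduces to fields bounded by 1, the range in which r^(2p) r
  is close to r uniformly.\<close>

lemma flux_zero:
  fixes g :: "real^3 \<Rightarrow> real^3"
  assumes op: "open \<Omega>" and h: "0 < h" and g0: "\<And>x. x \<notin> \<Omega> \<Longrightarrow> g x = 0"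
    and lip: "\<And>x y. norm (g x - g y) \<le> C * norm (x - y)" and M: "0 < M" and gM: "\<And>x. norm (g x) \<le> M"
    and cG: "\<And>i. continuous_on \<Omega> (G i)" and GC: "\<And>i x. x \<in> \<Omega> \<Longrightarrow> norm (G i x) \<le> C"
    and dG: "\<And>i x. x \<in> \<Omega> \<Longrightarrow> ((\<lambda>s. g (x + s *\<^sub>R ax i)) has_vector_derivative G i x) (at 0)"
    and div: "\<And>x. x \<in> \<Omega> \<Longrightarrow> (\<Sum>i\<in>UNIV. G i x $ i) = 0"
  shows "flux h g x = 0"
proof -
  have "flux h (\<lambda>x. (1 / M) *\<^sub>R g x) x = 0"
  proof (rule flux_zero_unit[OF op h, where C="C / M" and G="\<lambda>i x. (1 / M) *\<^sub>R G i x"])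
    show "norm ((1 / M) *\<^sub>R g x - (1 / M) *\<^sub>R g y) \<le> C / M * norm (x - y)" for x y
      using divide_right_mono[OF lip[of x y], of M] M by (simp add: scaleR_right_diff_distrib[symmetric])
    show "norm ((1 / M) *\<^sub>R g x) \<le> 1" for x using gM[of x] M by simp
    show "continuous_on \<Omega> (\<lambda>x. (1 / M) *\<^sub>R G i x)" for i by (intro continuous_intros cG)
    show "norm ((1 / M) *\<^sub>R G i x) \<le> C / M" if "x \<in> \<Omega>" for i x
      using divide_right_mono[OF GC[OF that, of i], of M] M by simp
    show "((\<lambda>s. (1 / M) *\<^sub>R g (x + s *\<^sub>R ax i)) has_vector_derivative (1 / M) *\<^sub>R G i x) (at 0)" if "x \<in> \<Omega>" for i x
      using dG[OF that, of i] by (intro bounded_linear.has_vector_derivative[OF bounded_linear_scaleR_right])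
    show "(\<Sum>i\<in>UNIV. ((1 / M) *\<^sub>R G i x) $ i) = 0" if "x \<in> \<Omega>" for x
      using div[OF that] by (simp add: sum_divide_distrib[symmetric])
  qed (use g0 in auto)
  then show ?thesis using M unfolding flux_scaleR by simp
qed

section \<open>Face averages and their discrete divergence\<close>

text \<open>Component i is averaged over the square of side 2 h centred at \<open>x\<close> and
  orthogonal to axis i. Its central difference then compares opposite faces of one cube, which turns
  the discrete divergence into a flux.\<close>

definition face :: "real \<Rightarrow> (real^3 \<Rightarrow> real^3) \<Rightarrow> real^3 \<Rightarrow> real^3" where
  "face h g x = (\<chi> i. (if i = 1 then integral {-h..h} (\<lambda>b. integral {-h..h} (\<lambda>c. g (x + off 0 b c) $ 1))
    else if i = 2 then integral {-h..h} (\<lambda>a. integral {-h..h} (\<lambda>c. g (x + off a 0 c) $ 2))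
    else integral {-h..h} (\<lambda>a. integral {-h..h} (\<lambda>b. g (x + off a b 0) $ 3))) / (4 * h\<^sup>2))"

lemma face_component:
  "face h g x $ 1 = integral {-h..h} (\<lambda>b. integral {-h..h} (\<lambda>c. g (x + off 0 b c) $ 1)) / (4 * h\<^sup>2)"
  "face h g x $ 2 = integral {-h..h} (\<lambda>a. integral {-h..h} (\<lambda>c. g (x + off a 0 c) $ 2)) / (4 * h\<^sup>2)"
  "face h g x $ 3 = integral {-h..h} (\<lambda>a. integral {-h..h} (\<lambda>b. g (x + off a b 0) $ 3)) / (4 * h\<^sup>2)"
  by (simp_all add: face_def)

lemma grid_div_face:
  assumes h: "0 < h" and c: "continuous_on UNIV g"
  shows "grid_div h (face h g) x = flux h g x / (8 * h^3)"
proof -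
  have shift: "x + h *\<^sub>R ax 1 + off 0 b d = x + off h b d" "x - h *\<^sub>R ax 1 + off 0 b d = x + off (-h) b d"
    "x + h *\<^sub>R ax 2 + off b 0 d = x + off b h d" "x - h *\<^sub>R ax 2 + off b 0 d = x + off b (-h) d"
    "x + h *\<^sub>R ax 3 + off b d 0 = x + off b d h" "x - h *\<^sub>R ax 3 + off b d 0 = x + off b d (-h)" for b d
    by (simp_all add: off_def algebra_simps)
  note ci = continuous_intros face_continuous[OF c]
  have 1: "D1 h 1 (\<lambda>y. face h g y $ 1) x =
     integral {-h..h} (\<lambda>b. integral {-h..h} (\<lambda>c. g (x + off h b c) $ 1 - g (x + off (-h) b c) $ 1)) / (8 * h^3)"
    unfolding D1_real face_component shift
    by (subst face_difference_integral) (simp_all add: ci diff_divide_distrib[symmetric] power2_eq_square power3_eq_cube)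
  have 2: "D1 h 2 (\<lambda>y. face h g y $ 2) x =
     integral {-h..h} (\<lambda>a. integral {-h..h} (\<lambda>c. g (x + off a h c) $ 2 - g (x + off a (-h) c) $ 2)) / (8 * h^3)"
    unfolding D1_real face_component shift
    by (subst face_difference_integral) (simp_all add: ci diff_divide_distrib[symmetric] power2_eq_square power3_eq_cube)
  have 3: "D1 h 3 (\<lambda>y. face h g y $ 3) x =
     integral {-h..h} (\<lambda>a. integral {-h..h} (\<lambda>b. g (x + off a b h) $ 3 - g (x + off a b (-h)) $ 3)) / (8 * h^3)"
    unfolding D1_real face_component shift
    by (subst face_difference_integral) (simp_all add: ci diff_divide_distrib[symmetric] power2_eq_square power3_eq_cube)
  show ?thesis unfolding grid_div_def sum_3 1 2 3 flux_def by (simp add: add_divide_distrib)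
qed

lemma double_average:
  fixes f :: "real \<Rightarrow> real \<Rightarrow> real"
  assumes h: "0 < h" and c: "continuous_on UNIV (\<lambda>p. f (fst p) (snd p))"
    and B: "\<And>a b. \<bar>a\<bar> \<le> h \<Longrightarrow> \<bar>b\<bar> \<le> h \<Longrightarrow> \<bar>f a b - k\<bar> \<le> B"
  shows "\<bar>integral {-h..h} (\<lambda>a. integral {-h..h} (f a)) / (4 * h\<^sup>2) - k\<bar> \<le> B"
proof -
  have c': "continuous_on UNIV (\<lambda>p. f (fst p) (snd p) - k)" by (intro continuous_intros c)
  have c1: "continuous_on {-h..h} (\<lambda>b. f a b - k)" for a
    using continuous_on_compose2[OF c', of "{-h..h}" "\<lambda>b. (a, b)"] by (simp add: continuous_intros)
  have c2: "continuous_on {-h..h} (\<lambda>a. integral {-h..h} (\<lambda>b. f a b - k))"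
    by (rule continuous_integral_param) (rule continuous_on_subset[OF c'], simp)
  have inner: "norm (integral {-h..h} (\<lambda>b. f a b - k)) \<le> B * (h - (-h))" if "a \<in> {-h..h}" for a
    by (rule integral_bound) (use h that B c1 in auto)
  have "norm (integral {-h..h} (\<lambda>a. integral {-h..h} (\<lambda>b. f a b - k))) \<le> (B * (h - (-h))) * (h - (-h))"
    by (rule integral_bound) (use h inner c2 in auto)
  moreover have "integral {-h..h} (\<lambda>a. integral {-h..h} (\<lambda>b. f a b - k)) = integral {-h..h} (\<lambda>a. integral {-h..h} (f a)) - 4 * h\<^sup>2 * k"
    using face_difference_integral[OF c, of "\<lambda>_ _. k" h] h by (simp add: continuous_intros power2_eq_square)
  ultimately have "\<bar>integral {-h..h} (\<lambda>a. integral {-h..h} (f a)) - 4 * h\<^sup>2 * k\<bar> \<le> B * (4 * h\<^sup>2)"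
    by (simp add: power2_eq_square mult_ac)
  moreover have "integral {-h..h} (\<lambda>a. integral {-h..h} (f a)) / (4 * h\<^sup>2) - k
      = (integral {-h..h} (\<lambda>a. integral {-h..h} (f a)) - 4 * h\<^sup>2 * k) / (4 * h\<^sup>2)"
    using h by (simp add: field_simps)
  ultimately show ?thesis using h by (simp add: abs_divide pos_divide_le_eq)
qed

lemma norm_off_le: "norm (off a b c) \<le> \<bar>a\<bar> + \<bar>b\<bar> + \<bar>c\<bar>"
  unfolding off_def by (intro norm_triangle_mono) simp_all

lemma face_close:
  assumes h: "0 < h" and c: "continuous_on UNIV g" and B: "\<And>y. norm (y - x) \<le> 2 * h \<Longrightarrow> norm (g y - w) \<le> B"
  shows "norm (face h g x - w) \<le> 3 * B"
proof (rule norm_le_3_components)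
  fix k
  have pt: "\<bar>g (x + off a b c) $ i - w $ i\<bar> \<le> B" if "\<bar>a\<bar> + \<bar>b\<bar> + \<bar>c\<bar> \<le> 2 * h" for a b c i
    using component_le_norm_cart[of "g (x + off a b c) - w" i] B[of "x + off a b c"] norm_off_le[of a b c] that by simp
  note ci = continuous_intros face_continuous[OF c]
  have "\<bar>face h g x $ 1 - w $ 1\<bar> \<le> B" "\<bar>face h g x $ 2 - w $ 2\<bar> \<le> B" "\<bar>face h g x $ 3 - w $ 3\<bar> \<le> B"
    unfolding face_component by (rule double_average[OF h]; (intro ci pt)?; simp)+
  then show "\<bar>(face h g x - w) $ k\<bar> \<le> B" using exhaust_3[of k] by auto
qed

text \<open>Contains all lattice points whose averaging squares meet \<Omega>, since these reach at
  most 2 h from their centre. Outside it the face averages of the zero extension vanish.\<close>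

definition grid_nbhd :: "(real^3) set \<Rightarrow> real \<Rightarrow> (real^3) set" where
  "grid_nbhd \<Omega> h = {x \<in> grid h. \<exists>z\<in>\<Omega>. dist x z \<le> 2 * h}"

lemma grid_nbhd_volume:
  assumes "bounded \<Omega>"
  shows "\<exists>V\<ge>0. \<forall>h. 0 < h \<and> h \<le> 1 \<longrightarrow> finite (grid_nbhd \<Omega> h) \<and> real (card (grid_nbhd \<Omega> h)) * h^3 \<le> V"
proof -
  obtain R where R: "0 < R" "\<And>x. x \<in> \<Omega> \<Longrightarrow> norm x \<le> R" using assms bounded_pos by metis
  have "finite (grid_nbhd \<Omega> h) \<and> real (card (grid_nbhd \<Omega> h)) * h^3 \<le> (2 * (R + 2) + 1)^3" if h: "0 < h" "h \<le> 1" for h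
  proof -
    let ?S = "{x \<in> grid h. \<forall>k. \<bar>x $ k - (0 :: real^3) $ k\<bar> \<le> R + 2}"
    have sub: "grid_nbhd \<Omega> h \<subseteq> ?S"
    proof
      fix x assume "x \<in> grid_nbhd \<Omega> h"
      then obtain z where z: "x \<in> grid h" "z \<in> \<Omega>" "dist x z \<le> 2 * h" by (auto simp: grid_nbhd_def)
      have "norm x \<le> norm z + dist x z" using norm_triangle_sub[of x z] by (simp add: dist_norm)
      then have "norm x \<le> R + 2" using R(2)[OF z(2)] z(3) h by simp
      then have "\<bar>x $ k\<bar> \<le> R + 2" for k using component_le_norm_cart[of x k] by linarith
      then show "x \<in> ?S" using z by simp
    qed
    have R2: "0 \<le> R + 2" using R by simp
    note cnt = grid_box_count[OF h(1) R2, of 0]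
    have fin: "finite (grid_nbhd \<Omega> h)" by (rule finite_subset[OF sub cnt(1)])
    have "real (card (grid_nbhd \<Omega> h)) \<le> real (card ?S)" using card_mono[OF cnt(1) sub] by simp
    also have "\<dots> \<le> (2 * (R + 2) / h + 1)^3" by (rule cnt(2))
    finally have "real (card (grid_nbhd \<Omega> h)) * h^3 \<le> (2 * (R + 2) / h + 1)^3 * h^3"
      using h by (intro mult_right_mono) auto
    also have "\<dots> = (2 * (R + 2) + h)^3"
    proof -
      have "(2 * (R + 2) / h + 1) * h = 2 * (R + 2) + h" using h by (simp only: distrib_right) simp
      then show ?thesis by (simp only: power_mult_distrib[symmetric])
    qed
    also have "\<dots> \<le> (2 * (R + 2) + 1)^3" using h R by (intro power_mono) auto
    finally show ?thesis using fin by blast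
  qed
  then show ?thesis using R(1) by (intro exI[of _ "(2 * (R + 2) + 1)^3"]) auto
qed

lemma grid_interior_nbhd: "0 < h \<Longrightarrow> grid_interior \<Omega> h \<subseteq> grid_nbhd \<Omega> h"
  using grid_interior_subset[of \<Omega> h] by (force simp: grid_domain_def grid_nbhd_def)

lemma sum_norm_gnorm:
  assumes h: "0 \<le> h" and V: "real (card N) * h^3 \<le> V"
  shows "(\<Sum>x\<in>N. norm (a x) * h^3) \<le> gnorm h N a * sqrt V"
proof -
  have "(\<Sum>x\<in>N. norm (a x)) \<le> L2_set (\<lambda>x. norm (a x)) N * sqrt (real (card N))"
    using L2_set_mult_ineq[of "\<lambda>x. norm (a x)" "\<lambda>_. 1" N] by (simp add: L2_set_constant)
  then have "(\<Sum>x\<in>N. norm (a x)) * (sqrt (h^3) * sqrt (h^3)) \<le> (L2_set (\<lambda>x. norm (a x)) N * sqrt (real (card N))) * (sqrt (h^3) * sqrt (h^3))"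
    using h by (intro mult_right_mono) auto
  also have "\<dots> = gnorm h N a * sqrt (real (card N) * h^3)"
    by (simp add: gnorm_L2_set real_sqrt_mult)
  also have "\<dots> \<le> gnorm h N a * sqrt V" using V h by (intro mult_left_mono) auto
  finally show ?thesis using h by (simp add: sum_distrib_right)
qed

section \<open>Almost orthogonality of the exact velocity to discrete gradients\<close>

text \<open>The pairing is compared with that of the face averages \<open>W\<close> and the extended
  potential \<Phi>, which is exactly zero; each of the two replacements costs O(h) times the norm of
  the gradient. The result is applied both to the potentials of the decomposition and to the
  pressure.\<close>

lemma pressure_duality:
  assumes op: "open \<Omega>" and bd: "bounded \<Omega>" and lip: "lipschitz_boundary \<Omega>" and T: "0 < T"
    and v: "C_spacetime 3 T \<Omega> v" and p: "C_spacetime 2 T \<Omega> p" and ns: "navier_stokes \<Omega> T f v\<^sub>0 v p"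
  shows "\<exists>C\<ge>0. \<exists>\<delta>>0. \<forall>h t \<phi>. 0 < h \<and> h < \<delta> \<and> t \<in> {0..T} \<longrightarrow>
    \<bar>\<Sum>x\<in>grid_interior \<Omega> h. v t x \<bullet> grid_grad h \<phi> x * h^3\<bar> \<le> C * h * gnorm h (grid_interior \<Omega> h) (grid_grad h \<phi>)"
proof -
  have v1: "C_spacetime (Suc (Suc (Suc 0))) T \<Omega> v" using v by (simp add: numeral_3_eq_3)
  obtain M where M: "0 < M" "\<And>t x. t \<in> {0..T} \<Longrightarrow> x \<in> closure \<Omega> \<Longrightarrow> norm (v t x) \<le> M"
    using C_spacetime_bounded[OF T bd v] by blast
  obtain G MG where MG: "0 < MG" and CG: "\<And>i. C_spacetime (Suc (Suc 0)) T \<Omega> (G i)"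
    and dG: "\<And>i t x s. 0 < t \<Longrightarrow> t < T \<Longrightarrow> x + s *\<^sub>R ax i \<in> \<Omega> \<Longrightarrow>
      ((\<lambda>s. v t (x + s *\<^sub>R ax i)) has_vector_derivative G i t (x + s *\<^sub>R ax i)) (at s)"
    and GB: "\<And>i t x. t \<in> {0..T} \<Longrightarrow> x \<in> closure \<Omega> \<Longrightarrow> norm (G i t x) \<le> MG"
    by (rule C2_space_data[OF T bd v1]) (rule that; assumption)
  obtain L where L: "0 \<le> L" "\<And>t x y. t \<in> {0..T} \<Longrightarrow> norm (zext \<Omega> (v t) x - zext \<Omega> (v t) y) \<le> L * norm (x - y)"
    using zext_lipschitz[OF op bd T v1 ns] by blast
  obtain Cb where Cb: "0 \<le> Cb" "\<And>t x. t \<in> {0..T} \<Longrightarrow> norm (zext \<Omega> (v t) x) \<le> Cb * infdist x (-\<Omega>)"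
    using boundary_decay[OF op bd T v1 ns] by blast
  obtain C1 c \<delta>1 where C1: "0 \<le> C1" and c: "0 \<le> c" and \<delta>1: "0 < \<delta>1"
    and ext: "\<forall>h (\<phi> :: real^3 \<Rightarrow> real). 0 < h \<and> h < \<delta>1 \<longrightarrow>
    (\<exists>\<Phi>. (\<forall>x. c * h \<le> infdist x (-\<Omega>) \<longrightarrow> \<Phi> x = \<phi> x) \<and>
      (\<forall>N. finite N \<and> N \<subseteq> grid h \<and> (\<forall>x\<in>N. \<exists>z\<in>\<Omega>. dist x z \<le> 2 * h) \<longrightarrow>
        (\<Sum>x\<in>N. (norm (grid_grad h \<Phi> x))\<^sup>2) \<le> C1 * (\<Sum>x\<in>grid_interior \<Omega> h. (norm (grid_grad h \<phi> x))\<^sup>2)))"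
    using potential_extension[OF op bd lip] by blast
  obtain V where V: "0 \<le> V" "\<And>h. 0 < h \<Longrightarrow> h \<le> 1 \<Longrightarrow> finite (grid_nbhd \<Omega> h)"
      "\<And>h. 0 < h \<Longrightarrow> h \<le> 1 \<Longrightarrow> real (card (grid_nbhd \<Omega> h)) * h^3 \<le> V"
    using grid_nbhd_volume[OF bd] by blast
  define \<delta> where "\<delta> = min 1 \<delta>1"
  have \<delta>: "0 < \<delta>" using \<delta>1 by (simp add: \<delta>_def)
  \<comment> \<open>K h bounds |W| at depth at most (c + 11) h; the remaining 2 h are the reach of a
    face. Deeper points belong to \<open>grid_interior\<close>, which takes 9 h, and their
    neighbours have depth at least c h, where \<Phi> and \<phi> coincide.\<close>
  define K where "K = 3 * Cb * (c + 13)"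
  have K: "0 \<le> K" using Cb(1) c by (simp add: K_def)
  define C where "C = (6 * L + K * (1 + sqrt C1)) * sqrt V"
  have C: "0 \<le> C" using L(1) K C1 V(1) by (simp add: C_def)
  have main: "\<bar>\<Sum>x\<in>grid_interior \<Omega> h. v t x \<bullet> grid_grad h \<phi> x * h^3\<bar> \<le> C * h * gnorm h (grid_interior \<Omega> h) (grid_grad h \<phi>)"
    if h: "0 < h" "h < \<delta>" and t: "0 < t" "t < T" for h t \<phi>
  proof -
    have h1: "h \<le> 1" "h < \<delta>1" using h by (auto simp: \<delta>_def)
    have tT: "t \<in> {0..T}" using t by simp
    define g where "g = zext \<Omega> (v t)"
    note gL = L(2)[OF tT, folded g_def]
    note gb = Cb(2)[OF tT, folded g_def]
    have cg: "continuous_on UNIV g"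
    proof -
      have "L-lipschitz_on UNIV g" using gL L(1) by (intro lipschitz_onI) (auto simp: dist_norm)
      then show ?thesis by (rule lipschitz_on_continuous_on)
    qed
    have fl: "flux h g x = 0" for x
    proof (rule flux_zero[OF op h(1), where C="max L MG" and M=M and G="\<lambda>i. G i t"])
      show "g x = 0" if "x \<notin> \<Omega>" for x using that by (simp add: g_def zext_def)
      show "norm (g x - g y) \<le> max L MG * norm (x - y)" for x y
        using gL[of x y] mult_right_mono[of L "max L MG" "norm (x - y)"] by simp
      show "norm (g x) \<le> M" for x
        using M(1) M(2)[OF tT, of x] closure_subset[of \<Omega>] by (auto simp: g_def zext_def)
      show "continuous_on \<Omega> (G i t)" for i
        by (rule continuous_on_subset[OF C_spacetime_continuous_space[OF T CG tT] closure_subset])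
      show "norm (G i t x) \<le> max L MG" if "x \<in> \<Omega>" for i x
        using GB[OF tT, of x i] closure_subset[of \<Omega>] that by fastforce
      show "((\<lambda>s. g (x + s *\<^sub>R ax i)) has_vector_derivative G i t x) (at 0)" if x: "x \<in> \<Omega>" for i x
      proof -
        have "continuous_on UNIV (\<lambda>s. x + s *\<^sub>R ax i)" by (intro continuous_intros)
        from open_vimage[OF op this] have op': "open {s::real. x + s *\<^sub>R ax i \<in> \<Omega>}" by (simp add: vimage_def)
        have "((\<lambda>s. v t (x + s *\<^sub>R ax i)) has_vector_derivative G i t (x + 0 *\<^sub>R ax i)) (at 0)"
          by (rule dG[OF t]) (use x in simp)
        then have "((\<lambda>s. g (x + s *\<^sub>R ax i)) has_vector_derivative G i t (x + 0 *\<^sub>R ax i)) (at 0)"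
          by (rule has_vector_derivative_transform_within_open[OF _ op']) (use x in \<open>auto simp: g_def zext_def\<close>)
        then show ?thesis by simp
      qed
      show "(\<Sum>i\<in>UNIV. G i t x $ i) = 0" if x: "x \<in> \<Omega>" for x
      proof -
        have "pderiv_at i (v t) x = G i t x" for i by (rule pderiv_at_eq[OF dG t x])
        moreover have "(\<Sum>i\<in>UNIV. pderiv_at i (v t) x $ i) = 0" using ns t x unfolding navier_stokes_def by simp
        ultimately show ?thesis by simp
      qed
    qed (rule M(1))
    let ?I = "grid_interior \<Omega> h" and ?N = "grid_nbhd \<Omega> h"
    let ?D = "grid_grad h \<phi>"
    note finN = V(2)[OF h(1) h1(1)]
    have IN: "?I \<subseteq> ?N" by (rule grid_interior_nbhd[OF h(1)])
    have finI: "finite ?I" by (rule finite_subset[OF IN finN])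
    \<comment> \<open>Set to zero off the lattice, so that the support is finite; differences at
      lattice points do not notice.\<close>
    define W where "W x = (if x \<in> grid h then face h g x else 0)" for x
    have W0: "W x = 0" if "x \<notin> ?N" for x
    proof (cases "x \<in> grid h")
      case True
      have "norm (face h g x - 0) \<le> 3 * 0"
      proof (rule face_close[OF h(1) cg])
        fix y assume "norm (y - x) \<le> 2 * h"
        then have "y \<notin> \<Omega>" using that True by (auto simp: grid_nbhd_def dist_norm norm_minus_commute)
        then show "norm (g y - 0) \<le> 0" by (simp add: g_def zext_def)
      qed
      then show ?thesis using True by (simp add: W_def)
    qed (simp add: W_def)
    have Wg: "norm (W x - g x) \<le> 6 * L * h" if "x \<in> grid h" for x
    proof -
      have "norm (face h g x - g x) \<le> 3 * (L * (2 * h))"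
        by (rule face_close[OF h(1) cg]) (use gL L(1) in \<open>meson mult_left_mono order_trans\<close>)
      then show ?thesis using that by (simp add: W_def)
    qed
    have Wb: "norm (W x) \<le> 3 * (Cb * (infdist x (-\<Omega>) + 2 * h))" for x
    proof (cases "x \<in> grid h")
      case True
      have "norm (face h g x - 0) \<le> 3 * (Cb * (infdist x (-\<Omega>) + 2 * h))"
      proof (rule face_close[OF h(1) cg])
        fix y assume y: "norm (y - x) \<le> 2 * h"
        have "infdist y (-\<Omega>) \<le> infdist x (-\<Omega>) + 2 * h"
          using infdist_triangle[of y "-\<Omega>" x] y by (simp add: dist_norm)
        then have "Cb * infdist y (-\<Omega>) \<le> Cb * (infdist x (-\<Omega>) + 2 * h)" using Cb(1) by (rule mult_left_mono)
        then show "norm (g y - 0) \<le> Cb * (infdist x (-\<Omega>) + 2 * h)" using gb[of y] by simp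
      qed
      then show ?thesis using True by (simp add: W_def)
    next
      case False
      then show ?thesis using Cb(1) h by (simp add: W_def infdist_nonneg)
    qed
    from ext[rule_format, OF conjI[OF h(1) h1(2)], of \<phi>] obtain \<Phi>
      where \<Phi>1: "\<forall>x. c * h \<le> infdist x (-\<Omega>) \<longrightarrow> \<Phi> x = \<phi> x"
      and \<Phi>2: "\<forall>N. finite N \<and> N \<subseteq> grid h \<and> (\<forall>x\<in>N. \<exists>z\<in>\<Omega>. dist x z \<le> 2 * h) \<longrightarrow>
        (\<Sum>x\<in>N. (norm (grid_grad h \<Phi> x))\<^sup>2) \<le> C1 * (\<Sum>x\<in>?I. (norm (?D x))\<^sup>2)"
      by (elim exE conjE) (rule that)
    note \<Phi> = \<Phi>1[rule_format]
    have \<Phi>s: "(\<Sum>x\<in>N. (norm (grid_grad h \<Phi> x))\<^sup>2) \<le> C1 * (\<Sum>x\<in>?I. (norm (?D x))\<^sup>2)"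
      if "finite N" "N \<subseteq> grid h" "\<forall>x\<in>N. \<exists>z\<in>\<Omega>. dist x z \<le> 2 * h" for N
      using \<Phi>2 that by blast
    let ?D' = "grid_grad h \<Phi>"
    have zero: "(\<Sum>x\<in>?N. W x \<bullet> ?D' x) = 0"
    proof -
      \<comment> \<open>One more layer of neighbours, so that \<open>W\<close> is padded. The
        divergence vanishes there too, because the flux is zero around every point.\<close>
      define G' where "G' = ?N \<union> (\<Union>i. (\<lambda>x. x + h *\<^sub>R ax i) ` ?N \<union> (\<lambda>x. x - h *\<^sub>R ax i) ` ?N)"
      have finG: "finite G'" unfolding G'_def using finN by auto
      have Gg: "G' \<subseteq> grid h"
        unfolding G'_def using grid_add[OF _ grid_axis] grid_diff[OF _ grid_axis] by (auto simp: grid_nbhd_def)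
      have pad: "padded h G' W" unfolding padded_def G'_def using W0 by blast
      have "(\<Sum>x\<in>G'. W x \<bullet> ?D' x) = - (\<Sum>x\<in>G'. grid_div h W x * \<Phi> x)"
        by (rule grad_adjoint[OF finG pad])
      also have "(\<Sum>x\<in>G'. grid_div h W x * \<Phi> x) = 0"
      proof (rule sum.neutral, rule ballI)
        fix x assume "x \<in> G'"
        then have x: "x \<in> grid h" using Gg by blast
        have "x + h *\<^sub>R ax i \<in> grid h" "x - h *\<^sub>R ax i \<in> grid h" for i
          by (intro grid_add grid_diff x grid_axis)+
        then have "grid_div h W x = grid_div h (face h g) x"
          by (simp add: grid_div_def D1_def W_def)
        then show "grid_div h W x * \<Phi> x = 0" by (simp add: grid_div_face[OF h(1) cg] fl)
      qed
      also have "(\<Sum>x\<in>G'. W x \<bullet> ?D' x) = (\<Sum>x\<in>?N. W x \<bullet> ?D' x)"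
        by (rule sum.mono_neutral_right) (use finG W0 in \<open>auto simp: G'_def\<close>)
      finally show ?thesis by simp
    qed
    \<comment> \<open>The gradient of \<phi> cut off to \<open>grid_interior\<close>, since its
      values elsewhere are not controlled. It pairs with \<open>W\<close> over the larger set like
      the original over the interior.\<close>
    define J where "J x = (if x \<in> ?I then ?D x else 0)" for x
    have JI: "(\<Sum>x\<in>?N. W x \<bullet> J x) = (\<Sum>x\<in>?I. W x \<bullet> ?D x)"
      unfolding J_def using finN IN by (simp add: if_distrib sum.inter_restrict[symmetric] Int_absorb1 cong: if_cong)
    have local: "\<bar>W x \<bullet> (J x - ?D' x)\<bar> \<le> K * h * (norm (J x) + norm (?D' x))" if x: "x \<in> ?N" for x
    proof (cases "(c + 11) * h \<le> infdist x (-\<Omega>)")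
      case True
      have xg: "x \<in> grid h" using x by (simp add: grid_nbhd_def)
      have "x \<in> ?I"
      proof (rule grid_interiorI[OF h(1) xg])
        fix w assume "\<And>k. \<bar>w $ k - x $ k\<bar> \<le> 3 * h"
        then have "norm (w - x) \<le> 3 * (3 * h)" by (intro norm_le_3_components) simp
        also have "\<dots> < (c + 11) * h" using c h by simp
        finally show "w \<in> \<Omega>"
          using True by (intro infdist_compl_ball[of x]) (simp add: dist_norm norm_minus_commute)
      qed
      moreover have "?D' x = ?D x"
      proof -
        have "\<Phi> (x + s *\<^sub>R ax i) = \<phi> (x + s *\<^sub>R ax i)" if "\<bar>s\<bar> = h" for s i
        proof (rule \<Phi>)
          have "infdist x (-\<Omega>) \<le> infdist (x + s *\<^sub>R ax i) (-\<Omega>) + h"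
            using infdist_triangle[of x "-\<Omega>" "x + s *\<^sub>R ax i"] that by (simp add: dist_norm)
          then show "c * h \<le> infdist (x + s *\<^sub>R ax i) (-\<Omega>)" using True h by (simp add: algebra_simps)
        qed
        from this[of h] this[of "-h"] show ?thesis using h by (simp add: grid_grad_def D1_def)
      qed
      ultimately show ?thesis using K h by (simp add: J_def)
    next
      case False
      have "norm (W x) \<le> 3 * (Cb * (infdist x (-\<Omega>) + 2 * h))" by (rule Wb)
      also have "\<dots> \<le> 3 * (Cb * ((c + 11) * h + 2 * h))" using False Cb(1) by (intro mult_left_mono) auto
      also have "\<dots> = K * h" by (simp add: K_def algebra_simps)
      finally have "norm (W x) * norm (J x - ?D' x) \<le> (K * h) * (norm (J x) + norm (?D' x))"
        using norm_triangle_ineq4 by (intro mult_mono) (auto intro: order_trans[OF norm_ge_zero])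
      then show ?thesis using Cauchy_Schwarz_ineq2[of "W x" "J x - ?D' x"] by linarith
    qed
    have VI: "real (card ?I) * h^3 \<le> V"
    proof -
      have "real (card ?I) * h^3 \<le> real (card ?N) * h^3"
        using card_mono[OF finN IN] h by (intro mult_right_mono) auto
      then show ?thesis using V(3)[OF h(1) h1(1)] by linarith
    qed
    have h0: "0 \<le> h" using h by simp
    have t1: "\<bar>\<Sum>x\<in>?I. (v t x - W x) \<bullet> ?D x * h^3\<bar> \<le> 6 * L * h * (gnorm h ?I ?D * sqrt V)"
    proof -
      have "\<bar>\<Sum>x\<in>?I. (v t x - W x) \<bullet> ?D x * h^3\<bar> \<le> (\<Sum>x\<in>?I. 6 * L * h * (norm (?D x) * h^3))"
      proof (intro order_trans[OF sum_abs] sum_mono)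
        fix x assume x: "x \<in> ?I"
        then have x': "x \<in> grid h" "x \<in> \<Omega>" using grid_interior_subset[of \<Omega> h] by (auto simp: grid_domain_def)
        then have "norm (v t x - W x) \<le> 6 * L * h" using Wg[of x] by (simp add: g_def zext_def norm_minus_commute)
        then have "norm (v t x - W x) * norm (?D x) \<le> 6 * L * h * norm (?D x)" by (intro mult_right_mono) auto
        then have "\<bar>(v t x - W x) \<bullet> ?D x\<bar> \<le> 6 * L * h * norm (?D x)"
          using Cauchy_Schwarz_ineq2[of "v t x - W x" "?D x"] by linarith
        then have "\<bar>(v t x - W x) \<bullet> ?D x\<bar> * h^3 \<le> 6 * L * h * norm (?D x) * h^3" using h by (intro mult_right_mono) auto
        then show "\<bar>(v t x - W x) \<bullet> ?D x * h^3\<bar> \<le> 6 * L * h * (norm (?D x) * h^3)" using h by (simp add: abs_mult mult.assoc)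
      qed
      also have "\<dots> = 6 * L * h * (\<Sum>x\<in>?I. norm (?D x) * h^3)" by (simp add: sum_distrib_left)
      also have "\<dots> \<le> 6 * L * h * (gnorm h ?I ?D * sqrt V)"
        using L(1) h by (intro mult_left_mono sum_norm_gnorm[OF h0 VI]) auto
      finally show ?thesis .
    qed
    have gJ: "gnorm h ?N J = gnorm h ?I ?D"
    proof -
      have "(\<Sum>x\<in>?N. (norm (J x))\<^sup>2 * h^3) = (\<Sum>x\<in>?I. (norm (J x))\<^sup>2 * h^3)"
        by (rule sum.mono_neutral_right[OF finN IN]) (simp add: J_def)
      then show ?thesis by (simp add: gnorm_def J_def)
    qed
    have gD': "gnorm h ?N ?D' \<le> sqrt C1 * gnorm h ?I ?D"
    proof -
      have "(\<Sum>x\<in>?N. (norm (?D' x))\<^sup>2) \<le> C1 * (\<Sum>x\<in>?I. (norm (?D x))\<^sup>2)"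
        by (rule \<Phi>s[OF finN]) (auto simp: grid_nbhd_def)
      then have "(\<Sum>x\<in>?N. (norm (?D' x))\<^sup>2) * h^3 \<le> C1 * (\<Sum>x\<in>?I. (norm (?D x))\<^sup>2) * h^3"
        using h by (intro mult_right_mono) auto
      then have "sqrt (\<Sum>x\<in>?N. (norm (?D' x))\<^sup>2 * h^3) \<le> sqrt (C1 * (\<Sum>x\<in>?I. (norm (?D x))\<^sup>2 * h^3))"
        by (intro real_sqrt_le_mono) (simp add: sum_distrib_right mult.assoc)
      then show ?thesis by (simp add: gnorm_def real_sqrt_mult)
    qed
    have t2: "\<bar>\<Sum>x\<in>?I. W x \<bullet> ?D x * h^3\<bar> \<le> K * h * ((1 + sqrt C1) * gnorm h ?I ?D * sqrt V)"
    proof -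
      have "(\<Sum>x\<in>?I. W x \<bullet> ?D x * h^3) = (\<Sum>x\<in>?N. W x \<bullet> (J x - ?D' x) * h^3)"
        using JI zero by (simp add: sum_distrib_right[symmetric] inner_diff_right sum_subtractf)
      also have "\<bar>\<dots>\<bar> \<le> (\<Sum>x\<in>?N. K * h * (norm (J x) * h^3 + norm (?D' x) * h^3))"
      proof (intro order_trans[OF sum_abs] sum_mono)
        fix x assume "x \<in> ?N"
        then have "\<bar>W x \<bullet> (J x - ?D' x)\<bar> * h^3 \<le> K * h * (norm (J x) + norm (?D' x)) * h^3"
          using h by (intro mult_right_mono local) auto
        moreover have "\<bar>W x \<bullet> (J x - ?D' x) * h^3\<bar> = \<bar>W x \<bullet> (J x - ?D' x)\<bar> * h^3"
          using h by (simp add: abs_mult)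
        ultimately show "\<bar>W x \<bullet> (J x - ?D' x) * h^3\<bar> \<le> K * h * (norm (J x) * h^3 + norm (?D' x) * h^3)"
          by (simp only: distrib_right mult.assoc)
      qed
      also have "\<dots> = K * h * ((\<Sum>x\<in>?N. norm (J x) * h^3) + (\<Sum>x\<in>?N. norm (?D' x) * h^3))"
        by (simp only: sum_distrib_left[symmetric] sum.distrib)
      also have "\<dots> \<le> K * h * (gnorm h ?N J * sqrt V + gnorm h ?N ?D' * sqrt V)"
        using K h by (intro mult_left_mono add_mono sum_norm_gnorm[OF h0 V(3)[OF h(1) h1(1)]]) auto
      also have "\<dots> \<le> K * h * (gnorm h ?I ?D * sqrt V + sqrt C1 * gnorm h ?I ?D * sqrt V)"
        unfolding gJ using K h gD' V(1) by (intro mult_left_mono add_left_mono mult_right_mono) auto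
      finally show ?thesis by (simp add: algebra_simps)
    qed
    have "(\<Sum>x\<in>?I. v t x \<bullet> ?D x * h^3) = (\<Sum>x\<in>?I. (v t x - W x) \<bullet> ?D x * h^3) + (\<Sum>x\<in>?I. W x \<bullet> ?D x * h^3)"
      by (simp add: sum.distrib[symmetric] inner_diff_left algebra_simps)
    then have "\<bar>\<Sum>x\<in>?I. v t x \<bullet> ?D x * h^3\<bar> \<le> 6 * L * h * (gnorm h ?I ?D * sqrt V) + K * h * ((1 + sqrt C1) * gnorm h ?I ?D * sqrt V)"
      using t1 t2 by linarith
    also have "\<dots> = C * h * gnorm h ?I ?D" by (simp add: C_def algebra_simps)
    finally show ?thesis .
  qed
  have "\<bar>\<Sum>x\<in>grid_interior \<Omega> h. v t x \<bullet> grid_grad h \<phi> x * h^3\<bar> \<le> C * h * gnorm h (grid_interior \<Omega> h) (grid_grad h \<phi>)"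
    if h: "0 < h" "h < \<delta>" and t: "t \<in> {0..T}" for h t \<phi>
  proof -
    have "norm (\<Sum>x\<in>grid_interior \<Omega> h. v t x \<bullet> grid_grad h \<phi> x * h^3) \<le> C * h * gnorm h (grid_interior \<Omega> h) (grid_grad h \<phi>)"
    proof (rule bound_on_closed_times[OF T _ _ t])
      show "continuous_on {0..T} (\<lambda>t. \<Sum>x\<in>grid_interior \<Omega> h. v t x \<bullet> grid_grad h \<phi> x * h^3)"
      proof (intro continuous_intros)
        fix x assume "x \<in> grid_interior \<Omega> h"
        then have "x \<in> closure \<Omega>" using grid_interior_subset[of \<Omega> h] closure_subset[of \<Omega>] by (auto simp: grid_domain_def)
        then show "continuous_on {0..T} (\<lambda>t. v t x)" by (rule C_spacetime_continuous_time[OF T v])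
      qed
    qed (use main[OF h] in auto)
    then show ?thesis by simp
  qed
  then show ?thesis using C \<delta> by blast
qed

section \<open>The error estimate\<close>

lemma two_step:
  fixes a :: "'a::real_vector"
  shows "(y + h *\<^sub>R a) - (y - h *\<^sub>R a) = (2 * h) *\<^sub>R a"
  by (simp only: mult_2 scaleR_left_distrib) (simp only: algebra_simps)

lemma norm_scaled_le:
  assumes "0 < c" and "norm w \<le> B * c"
  shows "norm (w /\<^sub>R c) \<le> B"
proof -
  have "norm (w /\<^sub>R c) = norm w / c" using assms(1) by (simp add: divide_inverse mult.commute)
  also have "\<dots> \<le> B" using assms by (simp add: pos_divide_le_eq)
  finally show ?thesis .
qed

text \<open>Half-width 3 h in the maximum norm is at most 9 h in norm; 10 h makes the inequality
  strict.\<close>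

lemma not_interior_near_boundary:
  assumes h: "0 < h" and x: "x \<in> grid h" "x \<notin> grid_interior \<Omega> h"
  shows "infdist x (-\<Omega>) \<le> 10 * h"
proof (rule ccontr)
  assume far: "\<not> ?thesis"
  have "x \<in> grid_interior \<Omega> h"
  proof (rule grid_interiorI[OF h x(1)])
    fix w assume "\<And>k. \<bar>w $ k - x $ k\<bar> \<le> 3 * h"
    then have "norm (w - x) \<le> 3 * (3 * h)" by (intro norm_le_3_components) simp
    then show "w \<in> \<Omega>" using far h by (intro infdist_compl_ball[of x]) (simp add: dist_norm norm_minus_commute)
  qed
  then show False using x by simp
qed

lemma grid_domain_box_in:
  assumes "x \<in> grid_domain \<Omega> h"
  shows "box_in \<Omega> (2 * h) x"
proof -
  have sub: "cube (4 * h) x \<subseteq> \<Omega>" using assms by (simp add: grid_domain_def)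
  show ?thesis
    unfolding box_in_def
  proof (intro allI impI)
    fix w assume w: "\<forall>k. \<bar>w $ k - x $ k\<bar> \<le> 2 * h"
    have "x $ k - 2 * h \<le> w $ k \<and> w $ k \<le> x $ k + 2 * h" for k using w[rule_format, of k] by linarith
    then have "w \<in> cube (4 * h) x" by (simp add: cube_def mem_box_cart)
    then show "w \<in> \<Omega>" using sub by blast
  qed
qed

section \<open>Restriction of the exact velocity to the interior of the grid\<close>

text \<open>\<open>u\<close> and \<open>ut\<close> vanish off the interior. Subtracting this field
  instead of the exact velocity gives an error with the same support, which can serve as a test
  function.\<close>

definition restr :: "(real^3) set \<Rightarrow> real \<Rightarrow> (real^3 \<Rightarrow> real^3) \<Rightarrow> real^3 \<Rightarrow> real^3" where
  "restr \<Omega> h z x = (if x \<in> grid_interior \<Omega> h then z x else 0)"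

text \<open>What the restriction discards. It is seen by the second differences near the boundary
  and is the field \<open>B\<close> of the energy estimate.\<close>

definition defect :: "(real^3) set \<Rightarrow> real \<Rightarrow> (real^3 \<Rightarrow> real^3) \<Rightarrow> real^3 \<Rightarrow> real^3" where
  "defect \<Omega> h z x = (if x \<in> grid h then z x - restr \<Omega> h z x else 0)"

lemma grid_interior_grid: "x \<in> grid_interior \<Omega> h \<Longrightarrow> x \<in> grid h \<and> x \<in> \<Omega>"
  using grid_interior_subset grid_domain_subset by blast

text \<open>If just one of the two points is interior, the other is within 10 h of the complement,
  so the value is at most 12 Cb h; divided by 2 h this gives 6 Cb.\<close>

lemma restr_D1_bound:
  assumes h: "0 < h" and decay: "\<And>x. norm (z x) \<le> Cb * infdist x (-\<Omega>)" and Cb: "0 \<le> Cb"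
    and lip: "\<And>x y. norm (z x - z y) \<le> L * norm (x - y)" and L: "0 \<le> L"
  shows "norm (D1 h j (restr \<Omega> h z) y) \<le> L + 6 * Cb"
proof -
  let ?I = "grid_interior \<Omega> h"
  let ?a = "y + h *\<^sub>R ax j" and ?b = "y - h *\<^sub>R ax j"
  have ab: "norm (?a - ?b) = 2 * h"
  proof -
    have "?a - ?b = (2 * h) *\<^sub>R ax j" by (rule two_step)
    then show ?thesis using h by simp
  qed
  have one: "norm (z u) \<le> 12 * Cb * h" if u: "u \<in> ?I" and w: "w \<notin> ?I" "w \<in> grid h" and uw: "norm (u - w) = 2 * h" for u w
  proof -
    have "infdist u (-\<Omega>) \<le> infdist w (-\<Omega>) + 2 * h"
      using infdist_triangle[of u "-\<Omega>" w] uw by (simp add: dist_norm)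
    also have "\<dots> \<le> 12 * h" using not_interior_near_boundary[OF h w(2,1)] by simp
    finally have "Cb * infdist u (-\<Omega>) \<le> Cb * (12 * h)" using Cb by (rule mult_left_mono)
    then show ?thesis using decay[of u] by simp
  qed
  have grid2: "?b \<in> grid h" if "?a \<in> grid h"
  proof -
    have "?b = ?a - h *\<^sub>R ax j - h *\<^sub>R ax j" by simp
    then show ?thesis using grid_diff[OF grid_diff[OF that grid_axis] grid_axis] by metis
  qed
  have grid1: "?a \<in> grid h" if "?b \<in> grid h"
  proof -
    have "?a = ?b + h *\<^sub>R ax j + h *\<^sub>R ax j" by simp
    then show ?thesis using grid_add[OF grid_add[OF that grid_axis] grid_axis] by metis
  qed
  have "norm (restr \<Omega> h z ?a - restr \<Omega> h z ?b) \<le> (L + 6 * Cb) * (2 * h)"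
  proof -
    consider "?a \<in> ?I" "?b \<in> ?I" | "?a \<in> ?I" "?b \<notin> ?I" | "?a \<notin> ?I" "?b \<in> ?I" | "?a \<notin> ?I" "?b \<notin> ?I" by blast
    then show ?thesis
    proof cases
      case 1
      then have "norm (restr \<Omega> h z ?a - restr \<Omega> h z ?b) \<le> L * (2 * h)" using lip[of ?a ?b] ab by (simp add: restr_def)
      also have "\<dots> \<le> (L + 6 * Cb) * (2 * h)" using Cb h by (intro mult_right_mono) auto
      finally show ?thesis .
    next
      case 2
      have "norm (z ?a) \<le> 12 * Cb * h"
        by (rule one[OF 2 grid2 ab]) (use 2 grid_interior_grid in blast)
      also have "\<dots> \<le> (L + 6 * Cb) * (2 * h)" using L h by (simp add: algebra_simps)
      finally show ?thesis using 2 by (simp add: restr_def)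
    next
      case 3
      have "norm (z ?b) \<le> 12 * Cb * h"
        by (rule one[OF 3(2,1) grid1]) (use 3 grid_interior_grid ab norm_minus_commute in \<open>blast, metis\<close>)
      also have "\<dots> \<le> (L + 6 * Cb) * (2 * h)" using L h by (simp add: algebra_simps)
      finally show ?thesis using 3 by (simp add: restr_def)
    next
      case 4
      then show ?thesis using L Cb h by (simp add: restr_def)
    qed
  qed
  then show ?thesis unfolding D1_def using h by (intro norm_scaled_le) auto
qed

text \<open>Width 10 h would do for the defect; 13 h is the width shared with the convection term,
  whose stencil reaches 2 h further.\<close>

lemma defect_props:
  assumes h: "0 < h" and decay: "\<And>x. norm (z x) \<le> Cb * infdist x (-\<Omega>)" and Cb: "0 \<le> Cb"
    and z0: "\<And>x. x \<notin> \<Omega> \<Longrightarrow> z x = 0"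
  shows "norm (defect \<Omega> h z x) \<le> 10 * Cb * h" and "defect \<Omega> h z x \<noteq> 0 \<Longrightarrow> x \<in> boundary_layer \<Omega> h 13"
proof -
  have main: "norm (defect \<Omega> h z x) \<le> 10 * Cb * h \<and> (defect \<Omega> h z x \<noteq> 0 \<longrightarrow> x \<in> boundary_layer \<Omega> h 13)"
  proof (cases "x \<in> grid h \<and> x \<notin> grid_interior \<Omega> h")
    case True
    then have d: "infdist x (-\<Omega>) \<le> 10 * h" using not_interior_near_boundary[OF h] by blast
    then have "Cb * infdist x (-\<Omega>) \<le> Cb * (10 * h)" using Cb by (rule mult_left_mono)
    then have "norm (z x) \<le> 10 * Cb * h" using decay[of x] by simp
    moreover have "z x \<noteq> 0 \<Longrightarrow> x \<in> boundary_layer \<Omega> h 13" using z0[of x] True d h by (auto simp: boundary_layer_def)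
    ultimately show ?thesis using True by (simp add: defect_def restr_def)
  next
    case False
    then show ?thesis using Cb h by (auto simp: defect_def restr_def)
  qed
  then show "norm (defect \<Omega> h z x) \<le> 10 * Cb * h" and "defect \<Omega> h z x \<noteq> 0 \<Longrightarrow> x \<in> boundary_layer \<Omega> h 13" by blast+
qed

lemma finite_boundary_layer: "0 < h \<Longrightarrow> bounded \<Omega> \<Longrightarrow> finite (boundary_layer \<Omega> h K)"
  by (rule finite_subset[OF _ finite_grid_bounded]) (auto simp: boundary_layer_def)

text \<open>The defect is O(h) but jumps from point to point, so its difference quotients are O(1),
  on a layer of volume O(h). The factor 800 is 20^2 times 2, as a quotient sees the layer and its
  translate.\<close>

lemma defect_Df_bound:
  assumes h: "0 < h" and bd: "bounded \<Omega>" and decay: "\<And>x. norm (z x) \<le> Cb * infdist x (-\<Omega>)" and Cb: "0 \<le> Cb"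
    and z0: "\<And>x. x \<notin> \<Omega> \<Longrightarrow> z x = 0" and fin: "finite G" and Cl: "0 \<le> Cl"
    and cnt: "real (card (boundary_layer \<Omega> h 13)) * h^3 \<le> Cl * h"
  shows "(gnorm h G (Df h j (defect \<Omega> h z)))\<^sup>2 \<le> 800 * Cb\<^sup>2 * Cl * h"
proof -
  let ?B = "defect \<Omega> h z" and ?L = "boundary_layer \<Omega> h 13"
  note finL = finite_boundary_layer[OF h bd, of 13]
  note bp = defect_props[where z=z, OF h decay Cb z0]
  have "gnorm h G (Df h j ?B) \<le> (20 * Cb) * sqrt (2 * (Cl * h))"
  proof (rule gnorm_le)
    fix x
    have "norm (?B (x + h *\<^sub>R ax j) - ?B x) \<le> 10 * Cb * h + 10 * Cb * h"
      by (rule order_trans[OF norm_triangle_ineq4 add_mono[OF bp(1) bp(1)]])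
    then show "norm (Df h j ?B x) \<le> 20 * Cb"
      unfolding Df_def using h by (intro norm_scaled_le) auto
  next
    have "{x \<in> G. Df h j ?B x \<noteq> 0} \<subseteq> ?L \<union> (\<lambda>x. x - h *\<^sub>R ax j) ` ?L"
    proof
      fix x assume "x \<in> {x \<in> G. Df h j ?B x \<noteq> 0}"
      then have "?B (x + h *\<^sub>R ax j) \<noteq> 0 \<or> ?B x \<noteq> 0" by (auto simp: Df_def)
      then have "x + h *\<^sub>R ax j \<in> ?L \<or> x \<in> ?L" using bp(2) by blast
      then show "x \<in> ?L \<union> (\<lambda>x. x - h *\<^sub>R ax j) ` ?L" by (auto intro!: image_eqI[of x _ "x + h *\<^sub>R ax j"])
    qed
    then have "card {x \<in> G. Df h j ?B x \<noteq> 0} \<le> card (?L \<union> (\<lambda>x. x - h *\<^sub>R ax j) ` ?L)"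
      using finL by (intro card_mono) auto
    also have "\<dots> \<le> card ?L + card ?L"
      by (rule order_trans[OF card_Un_le]) (intro add_left_mono card_image_le finL)
    finally have "real (card {x \<in> G. Df h j ?B x \<noteq> 0}) \<le> 2 * real (card ?L)" by simp
    then have "real (card {x \<in> G. Df h j ?B x \<noteq> 0}) * h^3 \<le> 2 * real (card ?L) * h^3"
      using h by (intro mult_right_mono) auto
    then show "real (card {x \<in> G. Df h j ?B x \<noteq> 0}) * h^3 \<le> 2 * (Cl * h)" using cnt by simp
  qed (use h Cb Cl fin in auto)
  then have "(gnorm h G (Df h j ?B))\<^sup>2 \<le> ((20 * Cb) * sqrt (2 * (Cl * h)))\<^sup>2"
    using h by (intro power_mono) auto
  also have "\<dots> = 800 * Cb\<^sup>2 * Cl * h" using Cl h by (simp add: power_mult_distrib)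
  finally show ?thesis .
qed

lemma lipschitz_D1_bound:
  assumes h: "0 < h" and lip: "\<And>x y. norm (z x - z y) \<le> L * norm (x - y)"
  shows "norm (D1 h j z y) \<le> L"
proof -
  have "(y + h *\<^sub>R ax j) - (y - h *\<^sub>R ax j) = (2 * h) *\<^sub>R ax j"
    by (rule two_step)
  then have "norm (z (y + h *\<^sub>R ax j) - z (y - h *\<^sub>R ax j)) \<le> L * (2 * h)"
    using lip[of "y + h *\<^sub>R ax j" "y - h *\<^sub>R ax j"] h by simp
  then show ?thesis unfolding D1_def using h by (intro norm_scaled_le) auto
qed

lemma norm_convection_bounded:
  assumes "\<And>y j. norm (D1 h j b y) \<le> L" and "\<And>y. norm (a y) \<le> M"
  shows "norm (convection h a b x) \<le> 3 * L * M"
proof -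
  have L: "0 \<le> L" using assms(1)[of undefined undefined] norm_ge_zero order_trans by blast
  have "norm (convection h a b x) \<le> L / 2 * (\<Sum>j\<in>UNIV. norm (a (x - h *\<^sub>R ax j)) + norm (a (x + h *\<^sub>R ax j)))"
    by (rule norm_convection_le) (rule assms(1))
  also have "\<dots> \<le> L / 2 * (\<Sum>j\<in>(UNIV :: 3 set). M + M)"
    using L by (intro mult_left_mono sum_mono add_mono assms(2)) auto
  finally show ?thesis by simp
qed

text \<open>Deeper than 13 h the whole stencil is interior and the two terms agree; in the layer
  each of them is O(1), whence the factor sqrt h.\<close>

lemma convection_restr_error:
  assumes h: "0 < h" and bd: "bounded \<Omega>"
    and decay': "\<And>x. norm (z' x) \<le> Cb * infdist x (-\<Omega>)" and Cb: "0 \<le> Cb"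
    and lip': "\<And>x y. norm (z' x - z' y) \<le> L * norm (x - y)" and L: "0 \<le> L"
    and M: "\<And>x. norm (z x) \<le> M" and Cl: "0 \<le> Cl"
    and cnt: "real (card (boundary_layer \<Omega> h 13)) * h^3 \<le> Cl * h"
  shows "gnorm h (grid_interior \<Omega> h) (\<lambda>x. convection h (restr \<Omega> h z) (restr \<Omega> h z') x - convection h z z' x)
    \<le> (3 * (L + 6 * Cb) * M + 3 * L * M) * sqrt (Cl * h)"
proof (rule gnorm_le)
  let ?I = "grid_interior \<Omega> h"
  have M0: "0 \<le> M" using M[of undefined] norm_ge_zero order_trans by blast
  fix x
  have 1: "norm (convection h (restr \<Omega> h z) (restr \<Omega> h z') x) \<le> 3 * (L + 6 * Cb) * M"
    by (rule norm_convection_bounded[OF restr_D1_bound[OF h decay' Cb lip' L]]) (use M M0 in \<open>simp add: restr_def\<close>)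
  have 2: "norm (convection h z z' x) \<le> 3 * L * M"
    by (rule norm_convection_bounded[OF lipschitz_D1_bound[OF h lip'] M])
  show "norm (convection h (restr \<Omega> h z) (restr \<Omega> h z') x - convection h z z' x) \<le> 3 * (L + 6 * Cb) * M + 3 * L * M"
    by (rule order_trans[OF norm_triangle_ineq4 add_mono[OF 1 2]])
next
  let ?I = "grid_interior \<Omega> h"
  have "{x \<in> ?I. convection h (restr \<Omega> h z) (restr \<Omega> h z') x - convection h z z' x \<noteq> 0} \<subseteq> boundary_layer \<Omega> h 13"
  proof
    fix x assume x: "x \<in> {x \<in> ?I. convection h (restr \<Omega> h z) (restr \<Omega> h z') x - convection h z z' x \<noteq> 0}"
    then have xg: "x \<in> grid h" "x \<in> \<Omega>" using grid_interior_grid by blast+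
    show "x \<in> boundary_layer \<Omega> h 13"
    proof (rule ccontr)
      assume "x \<notin> boundary_layer \<Omega> h 13"
      then have far: "13 * h < infdist x (-\<Omega>)" using xg by (simp add: boundary_layer_def)
      have int: "y \<in> ?I" if y: "y \<in> grid h" "norm (y - x) \<le> 2 * h" for y
      proof (rule ccontr)
        assume "y \<notin> ?I"
        then have "infdist y (-\<Omega>) \<le> 10 * h" by (rule not_interior_near_boundary[OF h y(1)])
        then show False using infdist_triangle[of x "-\<Omega>" y] y(2) far h by (simp add: dist_norm norm_minus_commute)
      qed
      have pts: "restr \<Omega> h w y = w y" if "y \<in> grid h" "norm (y - x) \<le> 2 * h" for w y
        using int[OF that] by (simp add: restr_def)
      have n2: "norm (h *\<^sub>R ax j + h *\<^sub>R ax j) \<le> 2 * h" for j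
        using norm_triangle_ineq[of "h *\<^sub>R ax j" "h *\<^sub>R ax j"] h by simp
      have e: "restr \<Omega> h w (x - h *\<^sub>R ax j) = w (x - h *\<^sub>R ax j)" "restr \<Omega> h w (x + h *\<^sub>R ax j) = w (x + h *\<^sub>R ax j)"
        "restr \<Omega> h w (x - h *\<^sub>R ax j + h *\<^sub>R ax j) = w (x - h *\<^sub>R ax j + h *\<^sub>R ax j)"
        "restr \<Omega> h w (x + h *\<^sub>R ax j - h *\<^sub>R ax j) = w (x + h *\<^sub>R ax j - h *\<^sub>R ax j)"
        "restr \<Omega> h w (x - h *\<^sub>R ax j - h *\<^sub>R ax j) = w (x - h *\<^sub>R ax j - h *\<^sub>R ax j)"
        "restr \<Omega> h w (x + h *\<^sub>R ax j + h *\<^sub>R ax j) = w (x + h *\<^sub>R ax j + h *\<^sub>R ax j)" for w j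
      proof -
        have nm: "norm (- (h *\<^sub>R ax j) - h *\<^sub>R ax j) \<le> 2 * h" using n2[of j] by (metis minus_add_distrib norm_minus_cancel uminus_add_conv_diff add.commute)
        show "restr \<Omega> h w (x - h *\<^sub>R ax j - h *\<^sub>R ax j) = w (x - h *\<^sub>R ax j - h *\<^sub>R ax j)"
          by (rule pts[OF grid_diff[OF grid_diff[OF xg(1) grid_axis] grid_axis]]) (use nm in \<open>simp add: algebra_simps\<close>)
        show "restr \<Omega> h w (x + h *\<^sub>R ax j + h *\<^sub>R ax j) = w (x + h *\<^sub>R ax j + h *\<^sub>R ax j)"
          by (rule pts[OF grid_add[OF grid_add[OF xg(1) grid_axis] grid_axis]]) (use n2 in \<open>simp add: algebra_simps\<close>)
        show "restr \<Omega> h w (x - h *\<^sub>R ax j) = w (x - h *\<^sub>R ax j)"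
          by (rule pts[OF grid_diff[OF xg(1) grid_axis]]) (use h in simp)
        show "restr \<Omega> h w (x + h *\<^sub>R ax j) = w (x + h *\<^sub>R ax j)"
          by (rule pts[OF grid_add[OF xg(1) grid_axis]]) (use h in simp)
        show "restr \<Omega> h w (x - h *\<^sub>R ax j + h *\<^sub>R ax j) = w (x - h *\<^sub>R ax j + h *\<^sub>R ax j)"
          "restr \<Omega> h w (x + h *\<^sub>R ax j - h *\<^sub>R ax j) = w (x + h *\<^sub>R ax j - h *\<^sub>R ax j)"
          using pts[OF xg(1)] h by simp_all
      qed
      have "convection h (restr \<Omega> h z) (restr \<Omega> h z') x = convection h z z' x"
        unfolding convection_def D1_def e ..
      then show False using x by simp
    qed
  qed
  then have "real (card {x \<in> ?I. convection h (restr \<Omega> h z) (restr \<Omega> h z') x - convection h z z' x \<noteq> 0}) \<le> real (card (boundary_layer \<Omega> h 13))"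
    using finite_boundary_layer[OF h bd] by (simp add: card_mono)
  then have "real (card {x \<in> ?I. convection h (restr \<Omega> h z) (restr \<Omega> h z') x - convection h z z' x \<noteq> 0}) * h^3 \<le> real (card (boundary_layer \<Omega> h 13)) * h^3"
    using h by (intro mult_right_mono) auto
  then show "real (card {x \<in> ?I. convection h (restr \<Omega> h z) (restr \<Omega> h z') x - convection h z z' x \<noteq> 0}) * h^3 \<le> Cl * h"
    using cnt by linarith
next
  have "0 \<le> M" using M[of undefined] norm_ge_zero order_trans by blast
  then show "0 \<le> 3 * (L + 6 * Cb) * M + 3 * L * M" using L Cb by simp
qed (use h Cl finite_grid_interior[OF h bd] in auto)

section \<open>One time step: projection, pressure and energy\<close>

text \<open>Expand ut - z = (u - z) + D\<phi>. The cross term with \<open>u\<close> vanishes by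
  orthogonality, and the one with \<open>z\<close> is the pairing assumed to be O(h d).\<close>

lemma projection_step:
  assumes h: "0 < h" and bd: "bounded \<Omega>" and hh: "helmholtz_hodge \<Omega> h ut u \<phi>"
    and dual: "\<bar>\<Sum>x\<in>grid_interior \<Omega> h. z x \<bullet> grid_grad h \<phi> x * h^3\<bar>
      \<le> C * h * gnorm h (grid_interior \<Omega> h) (grid_grad h \<phi>)"
  defines "d \<equiv> gnorm h (grid_interior \<Omega> h) (grid_grad h \<phi>)"
  shows "(gnorm h (grid_interior \<Omega> h) (\<lambda>x. u x - z x))\<^sup>2 \<le>
    (gnorm h (grid_interior \<Omega> h) (\<lambda>x. ut x - z x))\<^sup>2 - d\<^sup>2 + 2 * C * h * d"
proof -
  let ?I = "grid_interior \<Omega> h" and ?g = "grid_grad h \<phi>"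
  have h0: "0 \<le> h" using h by simp
  have dec: "ut x - z x = (u x - z x) + ?g x" if "x \<in> ?I" for x
  proof -
    have "u x + ?g x = ut x" using hh that by (simp add: helmholtz_hodge_def)
    then show ?thesis by (simp add: algebra_simps)
  qed
  have "(gnorm h ?I (\<lambda>x. ut x - z x))\<^sup>2 = (\<Sum>x\<in>?I. (norm ((u x - z x) + ?g x))\<^sup>2 * h^3)"
    unfolding gnorm_sq[OF h0] by (intro sum.cong refl) (simp only: dec)
  also have "\<dots> = (\<Sum>x\<in>?I. (norm (u x - z x))\<^sup>2 * h^3 + (norm (?g x))\<^sup>2 * h^3
      + 2 * (u x \<bullet> ?g x * h^3) - 2 * (z x \<bullet> ?g x * h^3))"
    by (intro sum.cong refl) (simp add: power2_norm_eq_inner inner_add_left inner_add_right inner_diff_left inner_diff_right inner_commute algebra_simps)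
  also have "\<dots> = (gnorm h ?I (\<lambda>x. u x - z x))\<^sup>2 + d\<^sup>2 + 2 * (\<Sum>x\<in>?I. u x \<bullet> ?g x * h^3) - 2 * (\<Sum>x\<in>?I. z x \<bullet> ?g x * h^3)"
    unfolding gnorm_sq[OF h0] d_def by (simp add: sum.distrib sum_subtractf sum_distrib_left)
  also have "(\<Sum>x\<in>?I. u x \<bullet> ?g x * h^3) = 0"
    using helmholtz_hodge_orthogonal[OF h bd hh, of \<phi>] hh
    by (simp add: helmholtz_hodge_def sum_distrib_right[symmetric])
  finally show ?thesis using dual unfolding d_def[symmetric] by linarith
qed

text \<open>The gradient of \<open>q\<close> is not small, but \<open>u\<close> is orthogonal to it.
  Of ut - z there remain the gradient removed by the projection and the O(h) pairing with
  \<open>z\<close>.\<close>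

lemma pressure_term:
  fixes q :: "real^3 \<Rightarrow> real"
  assumes h: "0 < h" and bd: "bounded \<Omega>" and hh: "helmholtz_hodge \<Omega> h ut u \<phi>"
    and dual: "\<bar>\<Sum>x\<in>grid_interior \<Omega> h. z x \<bullet> grid_grad h q x * h^3\<bar>
      \<le> C * h * gnorm h (grid_interior \<Omega> h) (grid_grad h q)"
    and P: "gnorm h (grid_interior \<Omega> h) (grid_grad h q) \<le> P" and C: "0 \<le> C"
  shows "(\<Sum>x\<in>grid_interior \<Omega> h. grid_grad h q x \<bullet> (ut x - z x) * h^3)
    \<le> P * (C * h + gnorm h (grid_interior \<Omega> h) (grid_grad h \<phi>))"
proof -
  let ?I = "grid_interior \<Omega> h" and ?g = "grid_grad h \<phi>" and ?q = "grid_grad h q"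
  have h0: "0 \<le> h" using h by simp
  \<comment> \<open>Orthogonality is known for grid functions only; the cut-off leaves the gradient
    on the interior unchanged, since the neighbours of interior points lie in
    \<open>grid_domain\<close>.\<close>
  define \<psi> where "\<psi> x = (if x \<in> grid_domain \<Omega> h then q x else 0)" for x
  have \<psi>: "grid_grad h \<psi> x = ?q x" if "x \<in> ?I" for x
    using grid_interior_nbr[OF that] by (simp add: grid_grad_def D1_def \<psi>_def)
  have "(\<Sum>x\<in>?I. u x \<bullet> grid_grad h \<psi> x) = 0"
    by (rule helmholtz_hodge_orthogonal[OF h bd hh]) (simp add: grid_fun_def \<psi>_def)
  then have u: "(\<Sum>x\<in>?I. u x \<bullet> ?q x) = 0" by (simp add: \<psi>)
  have "(\<Sum>x\<in>?I. ?q x \<bullet> (ut x - z x) * h^3) = (\<Sum>x\<in>?I. u x \<bullet> ?q x * h^3 + ?q x \<bullet> ?g x * h^3 - z x \<bullet> ?q x * h^3)"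
  proof (intro sum.cong refl)
    fix x assume "x \<in> ?I"
    then have "ut x = u x + ?g x" using hh by (simp add: helmholtz_hodge_def)
    then show "?q x \<bullet> (ut x - z x) * h^3 = u x \<bullet> ?q x * h^3 + ?q x \<bullet> ?g x * h^3 - z x \<bullet> ?q x * h^3"
      by (simp add: inner_diff_right inner_add_right inner_commute algebra_simps)
  qed
  also have "\<dots> = (\<Sum>x\<in>?I. ?q x \<bullet> ?g x * h^3) - (\<Sum>x\<in>?I. z x \<bullet> ?q x * h^3)"
    by (simp add: sum.distrib sum_subtractf u sum_distrib_right[symmetric])
  also have "\<dots> \<le> gnorm h ?I ?q * gnorm h ?I ?g + C * h * gnorm h ?I ?q"
    using gnorm_cauchy_schwarz[OF h0, of "?q" "?g" ?I] dual by linarith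
  also have "\<dots> = gnorm h ?I ?q * (C * h + gnorm h ?I ?g)" by (simp add: algebra_simps)
  also have "\<dots> \<le> P * (C * h + gnorm h ?I ?g)" using P C h by (intro mult_right_mono) auto
  finally show ?thesis .
qed

text \<open>\<open>z\<close> and \<open>z'\<close> are the exact velocity at the beginning and the
  end of the step, \<open>F\<close> is the averaged force, \<open>g\<close> the pressure gradient
  and \<rho> the consistency error. The difference of the convection terms splits into the
  convection of the error by \<open>u\<close>, which is skew, the transport of the restricted exact
  velocity by the old error, and the boundary error of the restriction.\<close>

lemma step_estimate:
  assumes h: "0 < h" and bd: "bounded \<Omega>" and \<tau>: "0 < \<tau>"
    and decay': "\<And>x. norm (z' x) \<le> Cb * infdist x (-\<Omega>)" and Cb: "0 \<le> Cb"
    and z0: "\<And>x. x \<notin> \<Omega> \<Longrightarrow> z' x = 0"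
    and lip': "\<And>x y. norm (z' x - z' y) \<le> L * norm (x - y)" and L: "0 \<le> L"
    and M: "\<And>x. norm (z x) \<le> M" and Cl: "0 \<le> Cl"
    and cnt: "real (card (boundary_layer \<Omega> h 13)) * h^3 \<le> Cl * h"
    and vol: "real (card (grid_interior \<Omega> h)) * h^3 \<le> Vol" and Vol: "0 \<le> Vol"
    and divu: "\<And>x. x \<in> grid_interior \<Omega> h \<Longrightarrow> grid_div h u x = 0"
    and u0: "\<And>x. x \<notin> grid_interior \<Omega> h \<Longrightarrow> u x = 0"
    and ut0: "\<And>x. x \<notin> grid_interior \<Omega> h \<Longrightarrow> ut x = 0"
    and eqn: "\<And>x. x \<in> grid_interior \<Omega> h \<Longrightarrow>
      (ut x - u x) /\<^sub>R \<tau> = - convection h u ut x + (\<Sum>j\<in>UNIV. D2 h j ut x) + F x"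
    and cons: "\<And>x. x \<in> grid_interior \<Omega> h \<Longrightarrow>
      norm ((z' x - z x) /\<^sub>R \<tau> + convection h z z' x - (\<Sum>j\<in>UNIV. D2 h j z' x) - F x + g x) \<le> \<rho>" and \<rho>: "0 \<le> \<rho>"
  defines "a \<equiv> gnorm h (grid_interior \<Omega> h) (\<lambda>x. u x - z x)"
    and "b \<equiv> gnorm h (grid_interior \<Omega> h) (\<lambda>x. ut x - z' x)"
  shows "b\<^sup>2 - a\<^sup>2 \<le> 2 * \<tau> * ((3 * (L + 6 * Cb) * a + (3 * (L + 6 * Cb) * M + 3 * L * M) * sqrt (Cl * h)) * b
     + \<rho> * sqrt Vol * b + (\<Sum>x\<in>grid_interior \<Omega> h. g x \<bullet> (ut x - z' x) * h^3) + 600 * Cb\<^sup>2 * Cl * h)"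
proof -
  let ?I = "grid_interior \<Omega> h"
  have h0: "0 \<le> h" using h by simp
  note finI = finite_grid_interior[OF h bd]
  define V where "V = restr \<Omega> h z"
  define V' where "V' = restr \<Omega> h z'"
  define B where "B = defect \<Omega> h z'"
  define e where "e x = u x - V x" for x
  define Et where "Et x = ut x - V' x" for x
  define Q where "Q x = convection h e V' x + (convection h V V' x - convection h z z' x)" for x
  define R where "R x = (z' x - z x) /\<^sub>R \<tau> + convection h z z' x - (\<Sum>j\<in>UNIV. D2 h j z' x) - F x + g x" for x
  have e0: "e x = 0" if "x \<notin> ?I" for x using that by (simp add: e_def V_def restr_def u0)
  have Et0: "Et x = 0" if "x \<notin> ?I" for x using that by (simp add: Et_def V'_def restr_def ut0)
  have onI: "V x = z x" "V' x = z' x" if "x \<in> ?I" for x using that by (simp_all add: V_def V'_def restr_def)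
  have ga: "gnorm h ?I e = a" unfolding a_def gnorm_def e_def by (simp add: onI)
  have gb: "gnorm h ?I Et = b" unfolding b_def gnorm_def Et_def by (simp add: onI)
  define G where "G = ?I \<union> (\<Union>i. (\<lambda>x. x + h *\<^sub>R ax i) ` ?I \<union> (\<lambda>x. x - h *\<^sub>R ax i) ` ?I)"
  have finG: "finite G" unfolding G_def using finI by auto
  have pad: "padded h G Et" unfolding padded_def G_def using Et0 by blast
  have convlin: "convection h u ut x = convection h u Et x + convection h u V' x" for x
  proof -
    have "D1 h j ut y = D1 h j Et y + D1 h j V' y" for j y
      by (simp add: D1_def Et_def scaleR_right_diff_distrib[symmetric] scaleR_right_distrib[symmetric] del: scaleR_left_diff_distrib)
    then show ?thesis
      by (simp add: convection_def scaleR_right_distrib[symmetric] sum.distrib[symmetric]) (simp add: algebra_simps)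
  qed
  have convlin2: "convection h u V' x = convection h e V' x + convection h V V' x" for x
    unfolding convection_def scaleR_right_distrib[symmetric] sum.distrib[symmetric]
    by (intro arg_cong[where f="(*\<^sub>R) (1/2)"] sum.cong refl) (simp add: e_def algebra_simps)
  \<comment> \<open>On the lattice ut - z' = Et - B, so the viscous term produces the defect as a
    source. The residual can thus be formed with the exact velocity, not with its
    restriction.\<close>
  have D2lin: "D2 h j ut x - D2 h j z' x = D2 h j Et x - D2 h j B x" if x: "x \<in> ?I" for j x
  proof -
    have pt: "ut y - z' y = Et y - B y" if "y \<in> grid h" for y
      using that by (simp add: Et_def B_def defect_def V'_def)
    have xg: "x \<in> grid h" using grid_interior_grid[OF x] by blast
    have p: "ut (x + h *\<^sub>R ax j) = z' (x + h *\<^sub>R ax j) + Et (x + h *\<^sub>R ax j) - B (x + h *\<^sub>R ax j)"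
      "ut (x - h *\<^sub>R ax j) = z' (x - h *\<^sub>R ax j) + Et (x - h *\<^sub>R ax j) - B (x - h *\<^sub>R ax j)"
      "ut x = z' x + Et x - B x"
      using pt[OF grid_add[OF xg grid_axis[of h j]]] pt[OF grid_diff[OF xg grid_axis[of h j]]] pt[OF xg]
      by (simp_all add: algebra_simps)
    show ?thesis unfolding D2_def p scaleR_right_diff_distrib[symmetric]
      by (intro arg_cong[where f="(*\<^sub>R) (inverse (h\<^sup>2))"]) (simp add: algebra_simps)
  qed
  have eq: "(Et x - e x) /\<^sub>R \<tau> = - convection h u Et x - Q x
        + (\<Sum>j\<in>UNIV. D2 h j Et x) - (\<Sum>j\<in>UNIV. D2 h j B x) + g x - R x" if x: "x \<in> ?I" for x
  proof -
    have "(Et x - e x) /\<^sub>R \<tau> = (ut x - u x) /\<^sub>R \<tau> - (z' x - z x) /\<^sub>R \<tau>"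
      using onI[OF x] by (simp add: Et_def e_def scaleR_right_diff_distrib[symmetric])
    also have "\<dots> = - convection h u ut x + convection h z z' x + ((\<Sum>j\<in>UNIV. D2 h j ut x) - (\<Sum>j\<in>UNIV. D2 h j z' x)) + g x - R x"
      unfolding eqn[OF x] R_def by simp
    also have "(\<Sum>j\<in>UNIV. D2 h j ut x) - (\<Sum>j\<in>UNIV. D2 h j z' x) = (\<Sum>j\<in>UNIV. D2 h j Et x) - (\<Sum>j\<in>UNIV. D2 h j B x)"
      unfolding sum_subtractf[symmetric] by (intro sum.cong refl D2lin x)
    also have "- convection h u ut x + convection h z z' x = - convection h u Et x - Q x"
      unfolding convlin convlin2 Q_def by simp
    finally show ?thesis by simp
  qed
  have main: "b\<^sup>2 - a\<^sup>2 \<le> 2 * \<tau> * (gnorm h ?I Q * b + gnorm h ?I R * b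
      + (\<Sum>x\<in>?I. g x \<bullet> Et x * h^3) + (\<Sum>j\<in>UNIV. (gnorm h G (Df h j B))\<^sup>2) / 4)"
    using energy_step[OF h \<tau> finI finG _ pad Et0 divu eq] unfolding ga gb by (auto simp: G_def)
  have b0: "0 \<le> b" unfolding b_def using h0 by simp
  have gQ: "gnorm h ?I Q \<le> 3 * (L + 6 * Cb) * a + (3 * (L + 6 * Cb) * M + 3 * L * M) * sqrt (Cl * h)"
  proof -
    have "gnorm h ?I Q \<le> gnorm h ?I (convection h e V') + gnorm h ?I (\<lambda>x. convection h V V' x - convection h z z' x)"
      unfolding Q_def by (rule gnorm_triangle[OF h0])
    also have "gnorm h ?I (convection h e V') \<le> 3 * (L + 6 * Cb) * gnorm h ?I e"
      unfolding V'_def by (rule gnorm_convection_le[OF h0 finI e0 restr_D1_bound[OF h decay' Cb lip' L]])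
    also have "gnorm h ?I (\<lambda>x. convection h V V' x - convection h z z' x) \<le> (3 * (L + 6 * Cb) * M + 3 * L * M) * sqrt (Cl * h)"
      unfolding V_def V'_def by (rule convection_restr_error[OF h bd decay' Cb lip' L M Cl cnt])
    finally show ?thesis unfolding ga by simp
  qed
  have gR: "gnorm h ?I R \<le> \<rho> * sqrt Vol"
  proof (rule gnorm_le[OF h0 \<rho> Vol finI])
    show "norm (R x) \<le> \<rho>" if "x \<in> ?I" for x using cons[OF that] by (simp add: R_def)
    have "card {x \<in> ?I. R x \<noteq> 0} \<le> card ?I" using finI by (intro card_mono) auto
    then have "real (card {x \<in> ?I. R x \<noteq> 0}) * h^3 \<le> real (card ?I) * h^3" using h by (intro mult_right_mono) auto
    then show "real (card {x \<in> ?I. R x \<noteq> 0}) * h^3 \<le> Vol" using vol by linarith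
  qed
  have gB: "(\<Sum>j\<in>UNIV. (gnorm h G (Df h j B))\<^sup>2) / 4 \<le> 600 * Cb\<^sup>2 * Cl * h"
  proof -
    have "(\<Sum>j\<in>UNIV. (gnorm h G (Df h j B))\<^sup>2) \<le> (\<Sum>j\<in>(UNIV::3 set). 800 * Cb\<^sup>2 * Cl * h)"
      unfolding B_def by (intro sum_mono defect_Df_bound[OF h bd decay' Cb z0 finG Cl cnt])
    then show ?thesis by simp
  qed
  have gE: "(\<Sum>x\<in>?I. g x \<bullet> Et x * h^3) = (\<Sum>x\<in>?I. g x \<bullet> (ut x - z' x) * h^3)"
    by (intro sum.cong refl) (simp add: Et_def onI)
  note main
  also have "2 * \<tau> * (gnorm h ?I Q * b + gnorm h ?I R * b
      + (\<Sum>x\<in>?I. g x \<bullet> Et x * h^3) + (\<Sum>j\<in>UNIV. (gnorm h G (Df h j B))\<^sup>2) / 4) \<le>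
    2 * \<tau> * ((3 * (L + 6 * Cb) * a + (3 * (L + 6 * Cb) * M + 3 * L * M) * sqrt (Cl * h)) * b
     + \<rho> * sqrt Vol * b + (\<Sum>x\<in>?I. g x \<bullet> (ut x - z' x) * h^3) + 600 * Cb\<^sup>2 * Cl * h)"
    unfolding gE using \<tau> b0 by (intro mult_left_mono add_mono mult_right_mono gQ gR gB) auto
  finally show ?thesis .
qed

section \<open>Constants and the growth of the squared errors\<close>

text \<open>Young's inequality for each product; h^2 <= h turns the squared consistency error into h
  + \<tau>^2. The term linear in \<open>d\<close> is left for the projection to absorb.\<close>

lemma step_arithmetic:
  fixes x y h \<tau> d :: real
  assumes nn: "0 \<le> x" "0 \<le> y" "0 \<le> d" "0 \<le> A1" "0 \<le> A2" "0 \<le> A3" "0 \<le> A4" "0 \<le> P" "0 \<le> C"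
    and h: "0 < h" "h \<le> 1" and \<tau>: "0 < \<tau>"
    and main: "y\<^sup>2 - x\<^sup>2 \<le> 2 * \<tau> * ((A1 * x + A2 * sqrt h) * y + A3 * (h + \<tau>) * y + P * (C * h + d) + A4 * h)"
    and K: "2 * (A1 + A2 + 2 * A3 + P * C + P + A4) \<le> K"
  shows "y\<^sup>2 - x\<^sup>2 \<le> K * \<tau> * (x\<^sup>2 + y\<^sup>2 + h + \<tau>\<^sup>2) + K * \<tau> * d"
proof -
  have prod: "r * s \<le> r\<^sup>2 + s\<^sup>2" if "0 \<le> r" "0 \<le> s" for r s :: real
  proof -
    have "0 \<le> r * s" using that by simp
    then show ?thesis using zero_le_power2[of "r - s"] by (simp add: power2_diff)
  qed
  define Z where "Z = x\<^sup>2 + y\<^sup>2 + h + \<tau>\<^sup>2"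
  have Z0: "0 \<le> Z" using h by (simp add: Z_def)
  have 1: "A1 * x * y \<le> A1 * Z"
    unfolding mult.assoc using prod[of x y] nn h by (intro mult_left_mono) (auto simp: Z_def intro: order_trans)
  have 2: "A2 * sqrt h * y \<le> A2 * Z"
  proof -
    have "sqrt h * y \<le> (sqrt h)\<^sup>2 + y\<^sup>2" using prod[of "sqrt h" y] nn h by simp
    also have "\<dots> \<le> Z" using h by (simp add: Z_def)
    finally show ?thesis unfolding mult.assoc using nn by (intro mult_left_mono) auto
  qed
  have 3: "A3 * (h + \<tau>) * y \<le> 2 * A3 * Z"
  proof -
    have "(h + \<tau>) * y \<le> (h + \<tau>)\<^sup>2 + y\<^sup>2" using prod[of "h + \<tau>" y] nn h \<tau> by simp
    also have "(h + \<tau>)\<^sup>2 \<le> 2 * h\<^sup>2 + 2 * \<tau>\<^sup>2" using zero_le_power2[of "h - \<tau>"] by (simp add: power2_diff power2_sum)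
    also have "h\<^sup>2 \<le> h" using h by (simp add: power2_eq_square mult_left_le)
    finally have "(h + \<tau>) * y \<le> 2 * h + 2 * \<tau>\<^sup>2 + y\<^sup>2" by simp
    also have "\<dots> \<le> 2 * Z" by (simp add: Z_def)
    finally have "A3 * ((h + \<tau>) * y) \<le> A3 * (2 * Z)" using nn by (intro mult_left_mono) auto
    then show ?thesis by simp
  qed
  have hZ: "h \<le> Z" by (simp add: Z_def)
  have 4: "P * (C * h + d) \<le> P * C * Z + P * d"
    using mult_left_mono[OF hZ, of "P * C"] nn by (simp add: algebra_simps)
  have 5: "A4 * h \<le> A4 * Z" using hZ nn by (intro mult_left_mono) auto
  have "(A1 * x + A2 * sqrt h) * y + A3 * (h + \<tau>) * y + P * (C * h + d) + A4 * h
      \<le> (A1 + A2 + 2 * A3 + P * C + A4) * Z + P * d"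
    using 1 2 3 4 5 by (simp add: algebra_simps)
  also have "\<dots> \<le> (A1 + A2 + 2 * A3 + P * C + P + A4) * Z + (A1 + A2 + 2 * A3 + P * C + P + A4) * d"
  proof (rule add_mono; rule mult_right_mono)
    have "0 \<le> P * C" using nn by simp
    then show "A1 + A2 + 2 * A3 + P * C + A4 \<le> A1 + A2 + 2 * A3 + P * C + P + A4"
      "P \<le> A1 + A2 + 2 * A3 + P * C + P + A4" using nn by linarith+
  qed (use nn Z0 in auto)
  also have "\<dots> = (A1 + A2 + 2 * A3 + P * C + P + A4) * (Z + d)" by (simp add: algebra_simps)
  finally have "2 * \<tau> * ((A1 * x + A2 * sqrt h) * y + A3 * (h + \<tau>) * y + P * (C * h + d) + A4 * h)
     \<le> 2 * \<tau> * ((A1 + A2 + 2 * A3 + P * C + P + A4) * (Z + d))" using \<tau> by (intro mult_left_mono) auto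
  also have "\<dots> = (2 * (A1 + A2 + 2 * A3 + P * C + P + A4)) * (\<tau> * (Z + d))" by simp
  also have "\<dots> \<le> K * (\<tau> * (Z + d))" using K \<tau> Z0 nn by (intro mult_right_mono) auto
  finally show ?thesis using main by (simp add: Z_def algebra_simps)
qed

text \<open>Uniform in \<theta>: the bound \<open>\<theta>\<^sub>1\<close> limits \<tau> from above,
  and \<open>1 / \<theta>\<^sub>0\<close> comes from adding up h^2 over about T / \<tau> steps. The
  factor 6 and the remaining terms pass from the projected errors to the unprojected ones.\<close>

definition growth_const :: "real \<Rightarrow> real \<Rightarrow> real \<Rightarrow> real \<Rightarrow> real \<Rightarrow> real" where
  "growth_const K \<theta>\<^sub>0 \<theta>\<^sub>1 T Kb =
     6 * (exp (4 * K * T) * (Kb + K\<^sup>2 + T * (2 * K * (1 + \<theta>\<^sub>1\<^sup>2) + 2 * K\<^sup>2 * \<theta>\<^sub>1 + K\<^sup>2 / \<theta>\<^sub>0)))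
     + 4 * K * \<theta>\<^sub>1 * (1 + \<theta>\<^sub>1\<^sup>2) + K\<^sup>2 + 8 * K\<^sup>2 * \<theta>\<^sub>1\<^sup>2 + Kb"

text \<open>With s = h^(1/4) every quantity is a power of s, which avoids real exponents: h = s^4
  and \<tau> = \<theta> s^3. The sequences \<open>a\<close> and \<open>b\<close> hold squared
  errors, so s^2 = h^(1/2) is the target.\<close>

lemma error_growth:
  fixes a b d :: "nat \<Rightarrow> real"
  assumes s: "0 < s" "s \<le> 1" and h: "h = s^4" and \<tau>: "\<tau> = \<theta> * s^3" and \<theta>: "0 < \<theta>\<^sub>0" "\<theta>\<^sub>0 \<le> \<theta>" "\<theta> \<le> \<theta>\<^sub>1"
    and K: "0 < K" "K * \<tau> \<le> 1/2" and T: "\<tau> * real N \<le> T" and Kb: "0 \<le> Kb"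
    and nn: "\<And>n. 0 \<le> a n" "\<And>n. 0 \<le> b n" "\<And>n. 0 \<le> d n"
    and step: "\<And>n. n < N \<Longrightarrow> b (Suc n) - a n \<le> K * \<tau> * (a n + b (Suc n) + h + \<tau>\<^sup>2) + K * \<tau> * d (Suc n)"
    and proj: "\<And>n. n \<le> N \<Longrightarrow> a n \<le> b n - (d n)\<^sup>2 + K * h * d n"
    and init: "b 0 \<le> Kb * h\<^sup>2" and n: "n \<le> N"
  shows "a n \<le> growth_const K \<theta>\<^sub>0 \<theta>\<^sub>1 T Kb * s\<^sup>2" and "b n \<le> growth_const K \<theta>\<^sub>0 \<theta>\<^sub>1 T Kb * s\<^sup>2"
proof -
  have s2: "0 < s\<^sup>2" "s\<^sup>2 \<le> 1" using s by (auto simp: power_le_one)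
  have h0: "0 < h" using s h by simp
  have \<theta>0: "0 < \<theta>" "0 \<le> \<theta>\<^sub>1" using \<theta> by auto
  have \<tau>0: "0 < \<tau>" using \<tau> \<theta>0 s by simp
  have hs: "h \<le> s\<^sup>2" using power_decreasing[of 2 4 s] s h by simp
  have h2s: "h\<^sup>2 \<le> s\<^sup>2" using power_decreasing[of 2 8 s] s h by (simp add: power_mult[symmetric])
  have \<tau>2: "\<tau>\<^sup>2 \<le> \<theta>\<^sub>1\<^sup>2 * s\<^sup>2"
  proof -
    have "\<tau>\<^sup>2 = \<theta>\<^sup>2 * s^6" unfolding \<tau> by (simp add: power_mult_distrib power_mult[symmetric])
    also have "\<dots> \<le> \<theta>\<^sub>1\<^sup>2 * s\<^sup>2" using \<theta> \<theta>0 s power_decreasing[of 2 6 s] by (intro mult_mono power_mono) auto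
    finally show ?thesis .
  qed
  have \<tau>s: "\<tau> \<le> \<theta>\<^sub>1 * s\<^sup>2" unfolding \<tau> using \<theta> \<theta>0 s power_decreasing[of 2 3 s] by (intro mult_mono) auto
  have \<tau>1: "\<tau> \<le> \<theta>\<^sub>1" using \<tau>s s2 \<theta>0 mult_left_mono[of "s\<^sup>2" 1 \<theta>\<^sub>1] by simp
  have T0: "0 \<le> T" using T \<tau>0 by (meson mult_nonneg_nonneg of_nat_0_le_iff less_imp_le order_trans)
  define R where "R = 2 * K * (1 + \<theta>\<^sub>1\<^sup>2) + 2 * K\<^sup>2 * \<theta>\<^sub>1 + K\<^sup>2 / \<theta>\<^sub>0"
  have R0: "0 \<le> R" using K \<theta> \<theta>0 by (simp add: R_def)
  define r where "r = 2 * K * \<tau> * (h + \<tau>\<^sup>2) + 2 * K\<^sup>2 * \<tau>\<^sup>2 + K\<^sup>2 * h\<^sup>2"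
  have r0: "0 \<le> r" using K \<tau>0 h0 by (simp add: r_def)
  have h\<tau>: "h + \<tau>\<^sup>2 \<le> (1 + \<theta>\<^sub>1\<^sup>2) * s\<^sup>2" using hs \<tau>2 by (simp add: algebra_simps)
  have rR: "r \<le> \<tau> * s\<^sup>2 * R"
  proof -
    have 1: "2 * K * \<tau> * (h + \<tau>\<^sup>2) \<le> 2 * K * \<tau> * ((1 + \<theta>\<^sub>1\<^sup>2) * s\<^sup>2)"
      using h\<tau> K \<tau>0 by (intro mult_left_mono) auto
    have 2: "2 * K\<^sup>2 * \<tau>\<^sup>2 \<le> 2 * K\<^sup>2 * (\<tau> * (\<theta>\<^sub>1 * s\<^sup>2))"
      unfolding power2_eq_square[of \<tau>] using \<tau>s \<tau>0 by (intro mult_left_mono) auto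
    \<comment> \<open>h^2 = s^8 is at most s^2 s^3, and s^3 is at most
      \<open>\<tau> / \<theta>\<^sub>0\<close>. Extracting the factor \<tau> keeps the sum over all
      steps bounded.\<close>
    have 3: "h\<^sup>2 \<le> s\<^sup>2 * (\<tau> / \<theta>\<^sub>0)"
    proof -
      have "h\<^sup>2 = s\<^sup>2 * s^6" unfolding h by (simp add: power_mult[symmetric] power_add[symmetric])
      also have "\<dots> \<le> s\<^sup>2 * s^3" using s power_decreasing[of 3 6 s] by (intro mult_left_mono) auto
      also have "s^3 \<le> \<tau> / \<theta>\<^sub>0"
        unfolding \<tau> using \<theta> s by (simp add: pos_le_divide_eq mult.commute mult_left_mono)
      finally show ?thesis by (simp add: mult_left_mono)
    qed
    have "K\<^sup>2 * h\<^sup>2 \<le> K\<^sup>2 * (s\<^sup>2 * (\<tau> / \<theta>\<^sub>0))" using 3 by (intro mult_left_mono) auto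
    then have "r \<le> 2 * K * \<tau> * ((1 + \<theta>\<^sub>1\<^sup>2) * s\<^sup>2) + 2 * K\<^sup>2 * (\<tau> * (\<theta>\<^sub>1 * s\<^sup>2)) + K\<^sup>2 * (s\<^sup>2 * (\<tau> / \<theta>\<^sub>0))"
      unfolding r_def using 1 2 by linarith
    also have "\<dots> = \<tau> * s\<^sup>2 * R" by (simp add: R_def algebra_simps)
    finally show ?thesis .
  qed
  have rec: "a (Suc n) \<le> (1 + 4 * K * \<tau>) * a n + r" "b (Suc n) \<le> 6 * a n + 4 * K * \<tau> * (h + \<tau>\<^sup>2) + K\<^sup>2 * h\<^sup>2 + 8 * K\<^sup>2 * \<tau>\<^sup>2"
    if "n < N" for n
  proof -
    have p: "a (Suc n) \<le> b (Suc n) - (d (Suc n))\<^sup>2 + K * h * d (Suc n)" using proj that by simp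
    note rs = recurrence_step[OF nn(1) nn(2) less_imp_le[OF h0] nn(3) K(1) \<tau>0 K(2) step[OF that] p]
    show "a (Suc n) \<le> (1 + 4 * K * \<tau>) * a n + r" using rs(1) by (simp add: r_def)
    show "b (Suc n) \<le> 6 * a n + 4 * K * \<tau> * (h + \<tau>\<^sup>2) + K\<^sup>2 * h\<^sup>2 + 8 * K\<^sup>2 * \<tau>\<^sup>2" by (rule rs(2)[OF nn(1)])
  qed
  have b0: "b 0 \<le> Kb * s\<^sup>2" using init mult_left_mono[OF h2s Kb] by linarith
  have a0: "a 0 \<le> (Kb + K\<^sup>2) * s\<^sup>2"
  proof -
    have "K * h * d 0 \<le> (d 0)\<^sup>2 + K\<^sup>2 * h\<^sup>2"
    proof -
      have "0 \<le> K * h * d 0" using K h0 nn(3) by simp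
      then show ?thesis using zero_le_power2[of "d 0 - K * h"] by (simp add: power2_diff power_mult_distrib algebra_simps)
    qed
    then have "a 0 \<le> b 0 + K\<^sup>2 * h\<^sup>2" using proj[of 0] by simp
    also have "\<dots> \<le> Kb * s\<^sup>2 + K\<^sup>2 * s\<^sup>2" using b0 h2s by (intro add_mono mult_left_mono) auto
    finally show ?thesis by (simp add: algebra_simps)
  qed
  define A where "A = exp (4 * K * T) * (Kb + K\<^sup>2 + T * R)"
  have A0: "0 \<le> A" using Kb T0 R0 by (simp add: A_def)
  have aA: "a n \<le> A * s\<^sup>2" if "n \<le> N" for n
  proof -
    have n\<tau>: "real n * \<tau> \<le> T"
    proof -
      have "real n * \<tau> \<le> real N * \<tau>" using that \<tau>0 by (intro mult_right_mono) auto
      then show ?thesis using T by (simp add: mult.commute)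
    qed
    have "real n * r \<le> real n * (\<tau> * s\<^sup>2 * R)" using rR by (intro mult_left_mono) auto
    also have "\<dots> = (real n * \<tau>) * (s\<^sup>2 * R)" by simp
    also have "\<dots> \<le> T * (s\<^sup>2 * R)" using n\<tau> R0 by (intro mult_right_mono) auto
    finally have nr: "real n * r \<le> T * (s\<^sup>2 * R)" .
    have ex: "exp (4 * K * \<tau> * real n) \<le> exp (4 * K * T)"
      using n\<tau> K mult_left_mono[OF n\<tau>, of "4 * K"] by (simp add: mult_ac)
    have "a n \<le> exp (4 * K * \<tau> * real n) * (a 0 + real n * r)"
      by (rule discrete_gronwall[where N=N]) (use K \<tau>0 r0 nn rec(1) that in auto)
    also have "\<dots> \<le> exp (4 * K * T) * ((Kb + K\<^sup>2) * s\<^sup>2 + T * (s\<^sup>2 * R))"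
      using nn(1)[of 0] r0 by (intro mult_mono[OF ex add_mono[OF a0 nr]]) auto
    also have "\<dots> = A * s\<^sup>2" by (simp add: A_def algebra_simps)
    finally show ?thesis .
  qed
  define E where "E = 4 * K * \<theta>\<^sub>1 * (1 + \<theta>\<^sub>1\<^sup>2) + K\<^sup>2 + 8 * K\<^sup>2 * \<theta>\<^sub>1\<^sup>2"
  have E0: "0 \<le> E" using K \<theta>0 by (simp add: E_def)
  have gc: "growth_const K \<theta>\<^sub>0 \<theta>\<^sub>1 T Kb = 6 * A + E + Kb" by (simp add: growth_const_def A_def E_def R_def)
  have bE: "b (Suc n) \<le> (6 * A + E) * s\<^sup>2" if "n < N" for n
  proof -
    have 1: "4 * K * \<tau> * (h + \<tau>\<^sup>2) \<le> 4 * K * \<theta>\<^sub>1 * ((1 + \<theta>\<^sub>1\<^sup>2) * s\<^sup>2)"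
      using \<tau>1 h\<tau> K \<theta>0 h0 \<tau>0 by (intro mult_mono) auto
    have 2: "K\<^sup>2 * h\<^sup>2 \<le> K\<^sup>2 * s\<^sup>2" "8 * K\<^sup>2 * \<tau>\<^sup>2 \<le> 8 * K\<^sup>2 * (\<theta>\<^sub>1\<^sup>2 * s\<^sup>2)"
      using h2s \<tau>2 by (intro mult_left_mono; simp)+
    have "b (Suc n) \<le> 6 * (A * s\<^sup>2) + 4 * K * \<theta>\<^sub>1 * ((1 + \<theta>\<^sub>1\<^sup>2) * s\<^sup>2) + K\<^sup>2 * s\<^sup>2 + 8 * K\<^sup>2 * (\<theta>\<^sub>1\<^sup>2 * s\<^sup>2)"
      using rec(2)[OF that] aA[of n] that 1 2 by linarith
    also have "\<dots> = (6 * A + E) * s\<^sup>2" by (simp add: E_def algebra_simps)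
    finally show ?thesis .
  qed
  show "a n \<le> growth_const K \<theta>\<^sub>0 \<theta>\<^sub>1 T Kb * s\<^sup>2"
    using aA[OF n] mult_right_mono[of A "6 * A + E + Kb" "s\<^sup>2"] A0 E0 Kb s2 unfolding gc by linarith
  show "b n \<le> growth_const K \<theta>\<^sub>0 \<theta>\<^sub>1 T Kb * s\<^sup>2"
  proof (cases n)
    case 0
    have "Kb * s\<^sup>2 \<le> (6 * A + E + Kb) * s\<^sup>2" using A0 E0 by (intro mult_right_mono) auto
    then show ?thesis using b0 unfolding gc 0 by linarith
  next
    case (Suc m)
    have "(6 * A + E) * s\<^sup>2 \<le> (6 * A + E + Kb) * s\<^sup>2" using Kb by (intro mult_right_mono) auto
    then show ?thesis using bE[of m] n unfolding gc Suc by simp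
  qed
qed

text \<open>At points of \<open>grid_domain\<close> outside the interior \<open>w\<close> is zero
  and the exact velocity is O(h) by its decay, so \<open>grid_norm\<close> exceeds the norm over the
  interior by O(h) only.\<close>

lemma grid_norm_split:
  assumes h: "0 < h" and bd: "bounded \<Omega>" and w0: "\<And>x. x \<notin> grid_interior \<Omega> h \<Longrightarrow> w x = 0"
    and decay: "\<And>x. norm (zext \<Omega> g x) \<le> Cb * infdist x (-\<Omega>)" and Cb: "0 \<le> Cb"
    and vol: "real (card (grid_domain \<Omega> h)) * h^3 \<le> Vol" and Vol: "0 \<le> Vol"
  shows "grid_norm \<Omega> h (\<lambda>x. w x - g x) \<le>
    gnorm h (grid_interior \<Omega> h) (\<lambda>x. w x - zext \<Omega> g x) + 10 * Cb * h * sqrt Vol"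
proof -
  let ?I = "grid_interior \<Omega> h" and ?D = "grid_domain \<Omega> h"
  have h0: "0 \<le> h" using h by simp
  note finD = finite_grid_domain[OF h bd]
  define p where "p x = (if x \<in> ?I then w x - g x else 0)" for x
  define q where "q x = (if x \<in> ?I then 0 else w x - g x)" for x
  have "grid_norm \<Omega> h (\<lambda>x. w x - g x) = gnorm h ?D (\<lambda>x. p x + q x)"
    unfolding grid_norm_gnorm gnorm_def p_def q_def by (intro arg_cong[where f=sqrt] sum.cong refl) auto
  also have "\<dots> \<le> gnorm h ?D p + gnorm h ?D q" by (rule gnorm_triangle[OF h0])
  also have "gnorm h ?D p = gnorm h ?I (\<lambda>x. w x - zext \<Omega> g x)"
  proof -
    have "(\<Sum>x\<in>?D. (norm (p x))\<^sup>2 * h^3) = (\<Sum>x\<in>?I. (norm (p x))\<^sup>2 * h^3)"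
      by (rule sum.mono_neutral_right[OF finD grid_interior_subset]) (simp add: p_def)
    also have "\<dots> = (\<Sum>x\<in>?I. (norm (w x - zext \<Omega> g x))\<^sup>2 * h^3)"
      by (intro sum.cong refl) (use grid_interior_grid in \<open>force simp: p_def zext_def\<close>)
    finally show ?thesis by (simp add: gnorm_def)
  qed
  also have "gnorm h ?D q \<le> 10 * Cb * h * sqrt Vol"
  proof (rule gnorm_le[OF h0 _ Vol finD])
    show "0 \<le> 10 * Cb * h" using Cb h by simp
    fix x assume x: "x \<in> ?D"
    then have xg: "x \<in> grid h" "x \<in> \<Omega>" using grid_domain_subset by blast+
    show "norm (q x) \<le> 10 * Cb * h"
    proof (cases "x \<in> ?I")
      case True
      then show ?thesis using Cb h by (simp add: q_def)
    next
      case False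
      have "Cb * infdist x (-\<Omega>) \<le> Cb * (10 * h)"
        using not_interior_near_boundary[OF h xg(1) False] Cb by (rule mult_left_mono)
      then show ?thesis using decay[of x] False xg w0[OF False] by (simp add: q_def zext_def)
    qed
  next
    have "card {x \<in> ?D. q x \<noteq> 0} \<le> card ?D" using finD by (intro card_mono) auto
    then have "real (card {x \<in> ?D. q x \<noteq> 0}) * h^3 \<le> real (card ?D) * h^3" using h by (intro mult_right_mono) auto
    then show "real (card {x \<in> ?D. q x \<noteq> 0}) * h^3 \<le> Vol" using vol by linarith
  qed
  finally show ?thesis by simp
qed

lemma zext_stencil:
  assumes x: "box_in \<Omega> (2 * h) x" and h: "0 < h"
  shows "convection h (zext \<Omega> a) (zext \<Omega> b) x = convection h a b x"
    and "D2 h j (zext \<Omega> b) x = D2 h j b x" and "zext \<Omega> a x = a x"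
proof -
  have mem: "x + w \<in> \<Omega>" if "\<And>k. \<bar>w $ k\<bar> \<le> 2 * h" for w using x that by (simp add: box_in_def)
  have near: "x \<in> \<Omega>" "x + h *\<^sub>R ax i \<in> \<Omega>" "x - h *\<^sub>R ax i \<in> \<Omega>"
    "x + h *\<^sub>R ax i + h *\<^sub>R ax k \<in> \<Omega>" "x + h *\<^sub>R ax i - h *\<^sub>R ax k \<in> \<Omega>"
    "x - h *\<^sub>R ax i + h *\<^sub>R ax k \<in> \<Omega>" "x - h *\<^sub>R ax i - h *\<^sub>R ax k \<in> \<Omega>" for i k
    using mem[of 0] mem[of "h *\<^sub>R ax i"] mem[of "- h *\<^sub>R ax i"]
      mem[of "h *\<^sub>R ax i + h *\<^sub>R ax k"] mem[of "h *\<^sub>R ax i - h *\<^sub>R ax k"]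
      mem[of "- h *\<^sub>R ax i + h *\<^sub>R ax k"] mem[of "- h *\<^sub>R ax i - h *\<^sub>R ax k"] h
    by (simp_all add: axis_def algebra_simps)
  show "convection h (zext \<Omega> a) (zext \<Omega> b) x = convection h a b x"
    by (simp only: convection_def D1_def zext_def near if_True)
  show "D2 h j (zext \<Omega> b) x = D2 h j b x" by (simp add: D2_def zext_def near)
  show "zext \<Omega> a x = a x" by (simp add: zext_def near)
qed

lemma pressure_gradient_bound:
  fixes p :: "real \<Rightarrow> real^3 \<Rightarrow> real"
  assumes T: "0 < T" and bd: "bounded \<Omega>" and p: "C_spacetime (Suc k) T \<Omega> p"
  shows "\<exists>P\<ge>0. \<forall>h t. 0 < h \<and> h \<le> 1 \<and> t \<in> {0..T} \<longrightarrow>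
    gnorm h (grid_interior \<Omega> h) (grid_grad h (p t)) \<le> P"
proof -
  obtain M where M: "0 < M" "\<And>t x y. t \<in> {0..T} \<Longrightarrow> box_hull x y \<subseteq> \<Omega> \<Longrightarrow>
      norm (p t y - p t x) \<le> M * (\<Sum>i\<in>UNIV. \<bar>y $ i - x $ i\<bar>)"
    by (rule C_spacetime_lipschitz_space[OF T bd p]) blast
  obtain V where V: "0 \<le> V" "\<And>h. 0 < h \<and> h \<le> 1 \<Longrightarrow> finite (grid_nbhd \<Omega> h) \<and> real (card (grid_nbhd \<Omega> h)) * h^3 \<le> V"
    using grid_nbhd_volume[OF bd] by blast
  have "gnorm h (grid_interior \<Omega> h) (grid_grad h (p t)) \<le> (3 * M) * sqrt V"
    if h: "0 < h" "h \<le> 1" and t: "t \<in> {0..T}" for h t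
  proof (rule gnorm_le)
    show "0 \<le> h" "0 \<le> 3 * M" "0 \<le> V" "finite (grid_interior \<Omega> h)"
      using h M(1) V(1) finite_grid_interior[OF h(1) bd] by auto
    fix x assume x: "x \<in> grid_interior \<Omega> h"
    have bx: "box_in \<Omega> (2 * h) x" using grid_domain_box_in x grid_interior_subset by blast
    have "\<bar>grid_grad h (p t) x $ i\<bar> \<le> M" for i
    proof -
      have d: "(x + h *\<^sub>R ax i) $ k - (x - h *\<^sub>R ax i) $ k = (if k = i then 2 * h else 0)" for k
        by (simp add: axis_def)
      have "box_hull (x - h *\<^sub>R ax i) (x + h *\<^sub>R ax i) \<subseteq> \<Omega>"
        by (rule box_in_hull[OF bx]) (use h in \<open>simp_all add: axis_def\<close>)
      from M(2)[OF t this] have "norm (p t (x + h *\<^sub>R ax i) - p t (x - h *\<^sub>R ax i)) \<le> M * (\<Sum>k\<in>UNIV. if k = i then 2 * h else 0)"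
        unfolding d using h by (simp add: if_distrib[of abs] cong: if_cong)
      then have "norm (p t (x + h *\<^sub>R ax i) - p t (x - h *\<^sub>R ax i)) \<le> M * (2 * h)" by simp
      then have "norm (D1 h i (p t) x) \<le> M" unfolding D1_def using h by (intro norm_scaled_le) auto
      then show ?thesis by (simp add: grid_grad_def)
    qed
    then show "norm (grid_grad h (p t) x) \<le> 3 * M" by (rule norm_le_3_components)
  next
    have fin: "finite (grid_nbhd \<Omega> h)" and vol: "real (card (grid_nbhd \<Omega> h)) * h^3 \<le> V" using V(2)[of h] h by auto
    have "card {x \<in> grid_interior \<Omega> h. grid_grad h (p t) x \<noteq> 0} \<le> card (grid_nbhd \<Omega> h)"
      by (rule card_mono[OF fin]) (use grid_interior_nbhd[OF h(1), of \<Omega>] in blast)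
    then have "real (card {x \<in> grid_interior \<Omega> h. grid_grad h (p t) x \<noteq> 0}) * h^3 \<le> real (card (grid_nbhd \<Omega> h)) * h^3"
      using h by (intro mult_right_mono) auto
    then show "real (card {x \<in> grid_interior \<Omega> h. grid_grad h (p t) x \<noteq> 0}) * h^3 \<le> V" using vol by linarith
  qed
  then show ?thesis using M(1) V(1) by (intro exI[of _ "3 * M * sqrt V"]) auto
qed

lemma quarter_power:
  fixes h :: real
  assumes "0 < h" and "h \<le> 1"
  defines "s \<equiv> h powr (1/4)"
  shows "0 < s" and "s \<le> 1" and "h = s^4" and "h powr (3/4) = s^3"
proof -
  show s0: "0 < s" using assms by (simp add: s_def)
  show "s \<le> 1" using assms by (simp add: s_def powr_le1)
  show "h = s^4" using assms by (simp add: s_def powr_power)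
  show "h powr (3/4) = s^3" using assms by (simp add: s_def powr_power)
qed

section \<open>Assembly of the convergence estimate\<close>

theorem theorem3p1:
  fixes \<Omega> :: "(real^3) set" and T \<theta>\<^sub>0 \<theta>\<^sub>1 :: real
    and f v :: "real \<Rightarrow> real^3 \<Rightarrow> real^3" and p :: "real \<Rightarrow> real^3 \<Rightarrow> real"
    and v\<^sub>0 :: "real^3 \<Rightarrow> real^3"
  assumes "open \<Omega>" and "connected \<Omega>" and "bounded \<Omega>" and "lipschitz_boundary \<Omega>"
    and "condition_A \<Omega>"
    and "T > 0"
    and "\<forall>k. C_spacetime k T \<Omega> f"
    and "C_spacetime 3 T \<Omega> v" and "C_spacetime 2 T \<Omega> p"
    and "navier_stokes \<Omega> T f v\<^sub>0 v p"
    and "\<theta>\<^sub>0 > 0" and "\<theta>\<^sub>1 > 0"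
  shows "\<exists>\<beta>>0. \<exists>\<delta>>0. \<forall>h \<tau> \<theta> N u ut.
           0 < h \<and> h < \<delta> \<and> 0 < \<tau> \<and> \<tau> < \<delta> \<and>
           \<theta> \<in> {\<theta>\<^sub>0..\<theta>\<^sub>1} \<and> \<tau> = \<theta> * h powr (3/4) \<and>
           (\<forall>c. grid_connected h (grid_core_class \<Omega> h c)) \<and>
           T \<in> {\<tau> * real N ..< \<tau> * real N + \<tau>} \<and>
           discrete_navier_stokes \<Omega> h \<tau> N f v\<^sub>0 u ut \<longrightarrow>
             (MAX n\<in>{0..N}. grid_norm \<Omega> h (\<lambda>x. u n x - v (\<tau> * real n) x)) \<le> \<beta> * h powr (1/4) \<and>
             (MAX n\<in>{0..N}. grid_norm \<Omega> h (\<lambda>x. ut n x - v (\<tau> * real n) x)) \<le> \<beta> * h powr (1/4)"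
proof -
  note op = \<open>open \<Omega>\<close> and bd = \<open>bounded \<Omega>\<close> and lip = \<open>lipschitz_boundary \<Omega>\<close> and T = \<open>T > 0\<close>
    and Cv = \<open>C_spacetime 3 T \<Omega> v\<close> and Cp = \<open>C_spacetime 2 T \<Omega> p\<close> and ns = \<open>navier_stokes \<Omega> T f v\<^sub>0 v p\<close>
  have Cf: "C_spacetime 1 T \<Omega> f" using \<open>\<forall>k. C_spacetime k T \<Omega> f\<close> by blast
  have CvS: "C_spacetime (Suc 2) T \<Omega> v" using Cv by (simp only: eval_nat_numeral)
  have CpS: "C_spacetime (Suc 1) T \<Omega> p" using Cp by (simp only: numeral_2_eq_2 One_nat_def)
  have v0: "v 0 x = v\<^sub>0 x" if "x \<in> \<Omega>" for x using ns that by (simp add: navier_stokes_def)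
  obtain M where M: "0 < M" "\<And>t x. t \<in> {0..T} \<Longrightarrow> x \<in> closure \<Omega> \<Longrightarrow> norm (v t x) \<le> M"
    by (rule C_spacetime_bounded[OF T bd Cv]) blast
  obtain Cb where Cb: "0 \<le> Cb" "\<And>t x. t \<in> {0..T} \<Longrightarrow> norm (zext \<Omega> (v t) x) \<le> Cb * infdist x (-\<Omega>)"
    using boundary_decay[OF op bd T CvS ns] by blast
  obtain L where L: "0 \<le> L"
    "\<And>t x y. t \<in> {0..T} \<Longrightarrow> norm (zext \<Omega> (v t) x - zext \<Omega> (v t) y) \<le> L * norm (x - y)"
    using zext_lipschitz[OF op bd T CvS ns] by blast
  obtain P where P: "0 \<le> P" "\<And>h t. 0 < h \<and> h \<le> 1 \<and> t \<in> {0..T} \<Longrightarrow>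
      gnorm h (grid_interior \<Omega> h) (grid_grad h (p t)) \<le> P"
    using pressure_gradient_bound[OF T bd CpS] by blast
  obtain Cc where Cc: "0 \<le> Cc"
    "\<And>h \<tau> t x. 0 < h \<and> 0 < \<tau> \<and> \<tau> < T \<and> 0 \<le> t \<and> t + \<tau> \<le> T \<and> box_in \<Omega> (2 * h) x \<Longrightarrow>
      norm ((v (t + \<tau>) x - v t x) /\<^sub>R \<tau> + convection h (v t) (v (t + \<tau>)) x
      - (\<Sum>j\<in>UNIV. D2 h j (v (t + \<tau>)) x) - f (t + \<tau>) x + grid_grad h (p (t + \<tau>)) x) \<le> Cc * (h + \<tau>)"
    using scheme_consistency[OF op bd T Cv Cp Cf ns] by blast
  obtain Cg where Cg: "0 \<le> Cg" "\<And>h \<tau> n x. 0 < h \<and> 0 < \<tau> \<and> \<tau> * real (n + 1) \<le> T \<and> box_in \<Omega> h x \<Longrightarrow>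
      norm (force_avg h \<tau> f n x - f (\<tau> * real n + \<tau>) x) \<le> Cg * (h + \<tau>)"
    using force_average_error[OF bd T Cf] by blast
  obtain Ci where Ci: "0 \<le> Ci" "\<And>h x. 0 < h \<and> box_in \<Omega> h x \<Longrightarrow>
      norm (integral (cube h x) v\<^sub>0 /\<^sub>R h^3 - v 0 x) \<le> Ci * h"
    using initial_average_error[OF bd T Cv v0] by blast
  obtain Cd \<delta>d where Cd: "0 \<le> Cd" "0 < \<delta>d" "\<And>h t \<phi>. 0 < h \<and> h < \<delta>d \<and> t \<in> {0..T} \<Longrightarrow>
      \<bar>\<Sum>x\<in>grid_interior \<Omega> h. v t x \<bullet> grid_grad h \<phi> x * h^3\<bar>
        \<le> Cd * h * gnorm h (grid_interior \<Omega> h) (grid_grad h \<phi>)"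
    using pressure_duality[OF op bd lip T Cv Cp ns] by blast
  obtain Cl \<delta>l where Cl: "0 \<le> Cl" "0 < \<delta>l"
    "\<And>h. 0 < h \<and> h < \<delta>l \<Longrightarrow> real (card (boundary_layer \<Omega> h 13)) * h^3 \<le> Cl * h"
    using boundary_layer_count[OF op bd lip, of 13] by auto
  obtain Vol where Vol: "0 \<le> Vol"
    "\<And>h. 0 < h \<and> h \<le> 1 \<Longrightarrow> finite (grid_nbhd \<Omega> h) \<and> real (card (grid_nbhd \<Omega> h)) * h^3 \<le> Vol"
    using grid_nbhd_volume[OF bd] by blast
  \<comment> \<open>The four coefficients of the step inequality: transport by the old error,
    convection in the boundary layer, consistency including the averaged force, and viscosity in the
    boundary layer.\<close>
  define A1 where "A1 = 3 * (L + 6 * Cb)"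
  define A2 where "A2 = (3 * (L + 6 * Cb) * M + 3 * L * M) * sqrt Cl"
  define A3 where "A3 = (Cc + Cg) * sqrt Vol"
  define A4 where "A4 = 600 * Cb\<^sup>2 * Cl"
  have Anonneg: "0 \<le> A1" "0 \<le> A2" "0 \<le> A3" "0 \<le> A4"
    using L(1) Cb(1) M(1) Cl(1) Cc(1) Cg(1) Vol(1) by (simp_all add: A1_def A2_def A3_def A4_def)
  have PCd: "0 \<le> P * Cd" using P(1) Cd(1) by simp
  define S where "S = A1 + A2 + 2 * A3 + P * Cd + P + A4"
  have S0: "0 \<le> S" unfolding S_def using Anonneg P(1) PCd by (intro add_nonneg_nonneg) auto
  \<comment> \<open>Dominates both the coefficient 2 S of the step and the coefficient 2 Cd of the
    projection; the 1 makes it positive.\<close>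
  define K where "K = 2 * S + 2 * Cd + 1"
  have K0: "0 < K" and KC: "2 * Cd \<le> K" and KS: "2 * S \<le> K" using S0 Cd(1) by (simp_all add: K_def)
  note KA = KS[unfolded S_def]
  define Kb where "Kb = Ci\<^sup>2 * Vol"
  define G where "G = growth_const K \<theta>\<^sub>0 \<theta>\<^sub>1 T Kb"
  \<comment> \<open>The root of the growth constant for the interior, the contribution of the grid
    points outside the interior, and 1 for positivity. With the absolute value no sign of
    \<open>G\<close> has to be checked.\<close>
  define \<beta> where "\<beta> = sqrt \<bar>G\<bar> + 10 * Cb * sqrt Vol + 1"
  \<comment> \<open>The entry 1 / (2 K) enforces K \<tau> <= 1/2 for the recurrence, T keeps a
    single step inside the time interval, \<open>\<delta>d\<close> and \<open>\<delta>l\<close>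
    belong to the almost orthogonality and to the layer count.\<close>
  define \<delta> where "\<delta> = Min {1, T, 1 / (2 * K), \<delta>d, \<delta>l}"
  have Kb0: "0 \<le> Kb" using Vol(1) by (simp add: Kb_def)
  have \<delta>0: "0 < \<delta>" using T K0 Cd(2) Cl(2) by (simp add: \<delta>_def)
  have \<beta>0: "0 < \<beta>"
  proof -
    have "0 \<le> 10 * Cb * sqrt Vol" using Cb(1) Vol(1) by simp
    then show ?thesis unfolding \<beta>_def using real_sqrt_ge_zero[of "\<bar>G\<bar>"] by linarith
  qed
  have rate: "grid_norm \<Omega> h (\<lambda>x. u n x - v (\<tau> * real n) x) \<le> \<beta> * h powr (1/4) \<and>
      grid_norm \<Omega> h (\<lambda>x. ut n x - v (\<tau> * real n) x) \<le> \<beta> * h powr (1/4)"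
    if h: "0 < h" "h < \<delta>" and \<tau>: "0 < \<tau>" "\<tau> < \<delta>" and \<theta>: "\<theta> \<in> {\<theta>\<^sub>0..\<theta>\<^sub>1}" and scal: "\<tau> = \<theta> * h powr (3/4)"
      and TN: "T \<in> {\<tau> * real N ..< \<tau> * real N + \<tau>}"
      and dns: "discrete_navier_stokes \<Omega> h \<tau> N f v\<^sub>0 u ut" and n: "n \<le> N" for h \<tau> \<theta> N u ut n
  proof -
    let ?I = "grid_interior \<Omega> h"
    have h1: "h \<le> 1" "h < \<delta>d" "h < \<delta>l" and \<tau>T: "\<tau> < T" and \<tau>K: "\<tau> < 1 / (2 * K)" using h \<tau> by (auto simp: \<delta>_def)
    have h0: "0 \<le> h" using h by simp
    have K\<tau>: "K * \<tau> \<le> 1/2"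
    proof -
      have "K * \<tau> \<le> K * (1 / (2 * K))" using \<tau>K K0 by (intro mult_left_mono) auto
      then show ?thesis using K0 by simp
    qed
    have NT: "\<tau> * real N \<le> T" using TN by simp
    have times: "\<tau> * real m \<in> {0..T}" if "m \<le> N" for m
    proof -
      have "\<tau> * real m \<le> \<tau> * real N" using that \<tau> by (intro mult_left_mono) auto
      then have "\<tau> * real m \<le> T" using NT by linarith
      then show ?thesis using \<tau> by simp
    qed
    define z where "z m = zext \<Omega> (v (\<tau> * real m))" for m
    have fun0: "grid_fun \<Omega> h (u m)" "grid_fun \<Omega> h (ut m)" if "m \<le> N" for m
      using dns that by (simp_all add: discrete_navier_stokes_def)
    have bdry: "ut m x = 0" if "m \<le> N" "x \<in> grid_boundary h (grid_domain \<Omega> h)" for m x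
      using dns that by (cases m) (auto simp: discrete_navier_stokes_def)
    have uP: "u m = P_h \<Omega> h (ut m)" if "m \<le> N" for m
      using dns that by (cases m) (auto simp: discrete_navier_stokes_def)
    have "\<exists>\<phi>. \<forall>m. m \<le> N \<longrightarrow> helmholtz_hodge \<Omega> h (ut m) (u m) (\<phi> m)"
      using helmholtz_hodge_P_h[OF h(1) bd] uP by (intro choice) metis
    then obtain \<phi> where \<phi>: "\<And>m. m \<le> N \<Longrightarrow> helmholtz_hodge \<Omega> h (ut m) (u m) (\<phi> m)" by blast
    have u0: "u m x = 0" if "m \<le> N" "x \<notin> ?I" for m x by (rule helmholtz_hodge_zero[OF \<phi>[OF that(1)] that(2)])
    have ut0: "ut m x = 0" if "m \<le> N" "x \<notin> ?I" for m x
      using fun0(2)[OF that(1)] bdry[OF that(1)] that(2) by (auto simp: grid_fun_def grid_interior_def)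
    have bx: "box_in \<Omega> (2 * h) x" if "x \<in> ?I" for x
      using grid_domain_box_in that grid_interior_subset by blast
    have bx1: "box_in \<Omega> h x" if "x \<in> ?I" for x using box_in_mono[OF bx[OF that], of h] h by simp
    have zI: "z m x = v (\<tau> * real m) x" if "x \<in> ?I" for m x
      unfolding z_def by (rule zext_stencil(3)[OF bx[OF that] h(1)])
    have zdecay: "norm (z m x) \<le> Cb * infdist x (-\<Omega>)" if "m \<le> N" for m x
      unfolding z_def by (rule Cb(2)[OF times[OF that]])
    have zlip: "norm (z m x - z m y) \<le> L * norm (x - y)" if "m \<le> N" for m x y
      unfolding z_def by (rule L(2)[OF times[OF that]])
    have zM: "norm (z m x) \<le> M" if "m \<le> N" for m x
      using M(1) M(2)[OF times[OF that], of x] closure_subset[of \<Omega>] by (auto simp: z_def zext_def)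
    have zdual: "\<bar>\<Sum>x\<in>?I. z m x \<bullet> grid_grad h q x * h^3\<bar> \<le> Cd * h * gnorm h ?I (grid_grad h q)" if "m \<le> N" for m q
    proof -
      have "(\<Sum>x\<in>?I. z m x \<bullet> grid_grad h q x * h^3) = (\<Sum>x\<in>?I. v (\<tau> * real m) x \<bullet> grid_grad h q x * h^3)"
        by (intro sum.cong refl) (simp only: zI)
      then show ?thesis using Cd(3)[of h "\<tau> * real m" q] h(1) h1(2) times[OF that] by simp
    qed
    have volD: "real (card (grid_domain \<Omega> h)) * h^3 \<le> Vol" and volI: "real (card ?I) * h^3 \<le> Vol"
    proof -
      have fin: "finite (grid_nbhd \<Omega> h)" and V: "real (card (grid_nbhd \<Omega> h)) * h^3 \<le> Vol" using Vol(2)[of h] h h1 by auto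
      have sub: "grid_domain \<Omega> h \<subseteq> grid_nbhd \<Omega> h"
      proof
        fix x assume "x \<in> grid_domain \<Omega> h"
        then have "x \<in> grid h" "x \<in> \<Omega>" using grid_domain_subset by blast+
        moreover have "dist x x \<le> 2 * h" using h by simp
        ultimately show "x \<in> grid_nbhd \<Omega> h" unfolding grid_nbhd_def by blast
      qed
      have "real (card (grid_domain \<Omega> h)) * h^3 \<le> real (card (grid_nbhd \<Omega> h)) * h^3"
        using card_mono[OF fin sub] h by (intro mult_right_mono) auto
      then show volD: "real (card (grid_domain \<Omega> h)) * h^3 \<le> Vol" using V by linarith
      have "real (card ?I) * h^3 \<le> real (card (grid_domain \<Omega> h)) * h^3"
        using card_mono[OF finite_grid_domain[OF h(1) bd] grid_interior_subset] h by (intro mult_right_mono) auto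
      then show "real (card ?I) * h^3 \<le> Vol" using volD by linarith
    qed
    define x where "x m = gnorm h ?I (\<lambda>y. u m y - z m y)" for m
    define y where "y m = gnorm h ?I (\<lambda>y. ut m y - z m y)" for m
    define d where "d m = gnorm h ?I (grid_grad h (\<phi> m))" for m
    have nn: "0 \<le> x m" "0 \<le> y m" "0 \<le> d m" for m using h0 by (simp_all add: x_def y_def d_def)
    have proj: "(x m)\<^sup>2 \<le> (y m)\<^sup>2 - (d m)\<^sup>2 + K * h * d m" if m: "m \<le> N" for m
    proof -
      have "(x m)\<^sup>2 \<le> (y m)\<^sup>2 - (d m)\<^sup>2 + 2 * Cd * h * d m"
        unfolding x_def y_def d_def by (rule projection_step[OF h(1) bd \<phi>[OF m] zdual[OF m]])
      moreover have "2 * Cd * h * d m \<le> K * h * d m"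
        using KC h0 nn(3) by (intro mult_right_mono) auto
      ultimately show ?thesis by linarith
    qed
    have step: "(y (Suc m))\<^sup>2 - (x m)\<^sup>2 \<le> K * \<tau> * ((x m)\<^sup>2 + (y (Suc m))\<^sup>2 + h + \<tau>\<^sup>2) + K * \<tau> * d (Suc m)"
      if m: "m < N" for m
    proof -
      have mN: "m \<le> N" "Suc m \<le> N" using m by auto
      let ?t = "\<tau> * real m" and ?t' = "\<tau> * real (Suc m)"
      have t': "?t' = ?t + \<tau>" by (simp add: algebra_simps)
      let ?g = "grid_grad h (p ?t')"
      have eqn: "(ut (Suc m) w - u m w) /\<^sub>R \<tau> = - convection h (u m) (ut (Suc m)) w
          + (\<Sum>j\<in>UNIV. D2 h j (ut (Suc m)) w) + force_avg h \<tau> f m w" if w: "w \<in> ?I" for w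
      proof -
        have "(ut (m+1) w - u m w) /\<^sub>R \<tau> =
             - (1/2) *\<^sub>R (\<Sum>j\<in>UNIV.
                  u m (w - h *\<^sub>R ax j) $ j *\<^sub>R D1 h j (ut (m+1)) (w - h *\<^sub>R ax j)
                + u m (w + h *\<^sub>R ax j) $ j *\<^sub>R D1 h j (ut (m+1)) (w + h *\<^sub>R ax j))
             + (\<Sum>j\<in>UNIV. D2 h j (ut (m+1)) w) + force_avg h \<tau> f m w"
          using dns m w unfolding discrete_navier_stokes_def by blast
        then show ?thesis unfolding convection_def Suc_eq_plus1 scaleR_minus_left .
      qed
      have cons: "norm ((z (Suc m) w - z m w) /\<^sub>R \<tau> + convection h (z m) (z (Suc m)) w
          - (\<Sum>j\<in>UNIV. D2 h j (z (Suc m)) w) - force_avg h \<tau> f m w + ?g w) \<le> (Cc + Cg) * (h + \<tau>)" if w: "w \<in> ?I" for w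
      proof -
        note st = zext_stencil[OF bx[OF w] h(1)]
        let ?c = "(v ?t' w - v ?t w) /\<^sub>R \<tau> + convection h (v ?t) (v ?t') w - (\<Sum>j\<in>UNIV. D2 h j (v ?t') w)"
        have 1: "norm (?c - f ?t' w + ?g w) \<le> Cc * (h + \<tau>)"
          using Cc(2)[of h \<tau> ?t w] h(1) \<tau>(1) \<tau>T times[OF mN(1)] times[OF mN(2)] bx[OF w] unfolding t' by auto
        have 2: "norm (force_avg h \<tau> f m w - f ?t' w) \<le> Cg * (h + \<tau>)"
          using Cg(2)[of h \<tau> m w] h(1) \<tau>(1) times[OF mN(2)] bx1[OF w] unfolding t' by (auto simp: algebra_simps)
        have "?c - force_avg h \<tau> f m w + ?g w = (?c - f ?t' w + ?g w) - (force_avg h \<tau> f m w - f ?t' w)"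
          by simp
        then have "norm (?c - force_avg h \<tau> f m w + ?g w) \<le> Cc * (h + \<tau>) + Cg * (h + \<tau>)"
          by (simp only:) (rule order_trans[OF norm_triangle_ineq4 add_mono[OF 1 2]])
        then have "norm (?c - force_avg h \<tau> f m w + ?g w) \<le> (Cc + Cg) * (h + \<tau>)"
          by (simp only: distrib_right)
        then show ?thesis unfolding z_def st .
      qed
      have divu: "grid_div h (u m) w = 0" if "w \<in> ?I" for w
        using \<phi>[OF mN(1)] that grid_interior_subset unfolding helmholtz_hodge_def by blast
      have \<rho>: "0 \<le> (Cc + Cg) * (h + \<tau>)" using Cc(1) Cg(1) h0 \<tau>(1) by simp
      have cnt: "real (card (boundary_layer \<Omega> h 13)) * h^3 \<le> Cl * h" using Cl(3)[of h] h(1) h1(3) by simp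
      have zout: "z (Suc m) w = 0" if "w \<notin> \<Omega>" for w using that by (simp add: z_def zext_def)
      have "(y (Suc m))\<^sup>2 - (x m)\<^sup>2 \<le> 2 * \<tau> * ((3 * (L + 6 * Cb) * x m + (3 * (L + 6 * Cb) * M + 3 * L * M) * sqrt (Cl * h)) * y (Suc m)
          + (Cc + Cg) * (h + \<tau>) * sqrt Vol * y (Suc m)
          + (\<Sum>w\<in>?I. ?g w \<bullet> (ut (Suc m) w - z (Suc m) w) * h^3) + 600 * Cb\<^sup>2 * Cl * h)"
        unfolding x_def y_def
        by (rule step_estimate[OF h(1) bd \<tau>(1) zdecay[OF mN(2)] Cb(1) zout zlip[OF mN(2)] L(1) zM[OF mN(1)] Cl(1) cnt
            volI Vol(1) divu u0[OF mN(1)] ut0[OF mN(2)] eqn cons \<rho>])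
      also have "\<dots> \<le> 2 * \<tau> * ((A1 * x m + A2 * sqrt h) * y (Suc m) + A3 * (h + \<tau>) * y (Suc m)
          + P * (Cd * h + d (Suc m)) + A4 * h)"
      proof (rule mult_left_mono)
        have "(\<Sum>w\<in>?I. ?g w \<bullet> (ut (Suc m) w - z (Suc m) w) * h^3) \<le> P * (Cd * h + d (Suc m))"
          unfolding d_def
          by (rule pressure_term[OF h(1) bd \<phi>[OF mN(2)] zdual[OF mN(2)] _ Cd(1)])
            (use P(2) h(1) h1(1) times[OF mN(2)] in blast)
        moreover have "(3 * (L + 6 * Cb) * x m + (3 * (L + 6 * Cb) * M + 3 * L * M) * sqrt (Cl * h)) * y (Suc m)
            = (A1 * x m + A2 * sqrt h) * y (Suc m)" by (simp add: A1_def A2_def real_sqrt_mult)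
        moreover have "(Cc + Cg) * (h + \<tau>) * sqrt Vol * y (Suc m) = A3 * (h + \<tau>) * y (Suc m)" by (simp add: A3_def)
        moreover have "600 * Cb\<^sup>2 * Cl * h = A4 * h" by (simp add: A4_def)
        ultimately show "(3 * (L + 6 * Cb) * x m + (3 * (L + 6 * Cb) * M + 3 * L * M) * sqrt (Cl * h)) * y (Suc m)
          + (Cc + Cg) * (h + \<tau>) * sqrt Vol * y (Suc m)
          + (\<Sum>w\<in>?I. ?g w \<bullet> (ut (Suc m) w - z (Suc m) w) * h^3) + 600 * Cb\<^sup>2 * Cl * h
          \<le> (A1 * x m + A2 * sqrt h) * y (Suc m) + A3 * (h + \<tau>) * y (Suc m) + P * (Cd * h + d (Suc m)) + A4 * h"
          by linarith
      qed (use \<tau> in simp)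
      finally show ?thesis
        by (rule step_arithmetic[OF nn(1,2,3) Anonneg P(1) Cd(1) h(1) h1(1) \<tau>(1) _ KA])
    qed
    have init: "(y 0)\<^sup>2 \<le> Kb * h\<^sup>2"
    proof -
      have "y 0 \<le> (Ci * h) * sqrt Vol"
        unfolding y_def
      proof (rule gnorm_le[OF h0 _ Vol(1) finite_grid_interior[OF h(1) bd]])
        show "0 \<le> Ci * h" using Ci(1) h by simp
        show "norm (ut 0 w - z 0 w) \<le> Ci * h" if w: "w \<in> ?I" for w
        proof -
          have "ut 0 w = integral (cube h w) v\<^sub>0 /\<^sub>R h^3" using dns w by (simp add: discrete_navier_stokes_def)
          then show ?thesis using Ci(2)[of h w] h(1) bx1[OF w] zI[OF w, of 0] by simp
        qed
        have "card {w \<in> ?I. ut 0 w - z 0 w \<noteq> 0} \<le> card ?I"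
          using finite_grid_interior[OF h(1) bd] by (intro card_mono) auto
        then have "real (card {w \<in> ?I. ut 0 w - z 0 w \<noteq> 0}) * h^3 \<le> real (card ?I) * h^3"
          using h by (intro mult_right_mono) auto
        then show "real (card {w \<in> ?I. ut 0 w - z 0 w \<noteq> 0}) * h^3 \<le> Vol" using volI by linarith
      qed
      then have "(y 0)\<^sup>2 \<le> ((Ci * h) * sqrt Vol)\<^sup>2" using nn(2) by (intro power_mono)
      also have "\<dots> = Kb * h\<^sup>2" using Vol(1) by (simp add: Kb_def power_mult_distrib)
      finally show ?thesis .
    qed
    define s where "s = h powr (1/4)"
    note s = quarter_power[OF h(1) h1(1), folded s_def]
    have \<tau>s: "\<tau> = \<theta> * s^3" using scal s(4) by simp
    have \<theta>': "\<theta>\<^sub>0 \<le> \<theta>" "\<theta> \<le> \<theta>\<^sub>1" using \<theta> by auto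
    have growth: "(x n)\<^sup>2 \<le> G * s\<^sup>2" "(y n)\<^sup>2 \<le> G * s\<^sup>2"
      using error_growth[where a="\<lambda>m. (x m)\<^sup>2" and b="\<lambda>m. (y m)\<^sup>2" and d=d,
          OF s(1,2,3) \<tau>s \<open>\<theta>\<^sub>0 > 0\<close> \<theta>' K0 K\<tau> NT Kb0 zero_le_power2 zero_le_power2 nn(3) step proj init n]
      by (simp_all add: G_def)
    have root: "r \<le> sqrt \<bar>G\<bar> * s" if "r\<^sup>2 \<le> G * s\<^sup>2" for r
    proof -
      have "r\<^sup>2 \<le> (sqrt \<bar>G\<bar> * s)\<^sup>2"
        using that mult_right_mono[OF abs_ge_self[of G], of "s\<^sup>2"] by (simp add: power_mult_distrib)
      moreover have "0 \<le> sqrt \<bar>G\<bar> * s" using s(1) by simp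
      ultimately show ?thesis by (rule power2_le_imp_le)
    qed
    have "s^4 \<le> s^1" using s(1,2) by (intro power_decreasing) auto
    then have hs: "h \<le> s" unfolding s(3)[symmetric] by simp
    have final: "r + 10 * Cb * h * sqrt Vol \<le> \<beta> * s" if "r \<le> sqrt \<bar>G\<bar> * s" for r
    proof -
      have "(10 * Cb * sqrt Vol) * h \<le> (10 * Cb * sqrt Vol) * s" using hs Cb(1) Vol(1) by (intro mult_left_mono) auto
      moreover have "\<beta> * s = sqrt \<bar>G\<bar> * s + (10 * Cb * sqrt Vol) * s + s" unfolding \<beta>_def by (simp only: distrib_right mult_1_left)
      moreover have "10 * Cb * h * sqrt Vol = (10 * Cb * sqrt Vol) * h" by (simp only: mult_ac)
      ultimately show ?thesis using that s(1) by linarith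
    qed
    have split: "grid_norm \<Omega> h (\<lambda>y. w y - v (\<tau> * real n) y) \<le> gnorm h ?I (\<lambda>y. w y - z n y) + 10 * Cb * h * sqrt Vol"
      if "\<And>y. y \<notin> ?I \<Longrightarrow> w y = 0" for w
      unfolding z_def by (rule grid_norm_split[OF h(1) bd that Cb(2)[OF times[OF n]] Cb(1) volD Vol(1)])
    have "grid_norm \<Omega> h (\<lambda>y. u n y - v (\<tau> * real n) y) \<le> \<beta> * s"
      by (rule order_trans[OF split final[OF root[OF growth(1), unfolded x_def]]]) (rule u0[OF n])
    moreover have "grid_norm \<Omega> h (\<lambda>x. ut n x - v (\<tau> * real n) x) \<le> \<beta> * s"
      by (rule order_trans[OF split final[OF root[OF growth(2), unfolded y_def]]]) (rule ut0[OF n])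
    ultimately show ?thesis unfolding s_def by blast
  qed
  show ?thesis
  proof (rule exI[of _ \<beta>], rule conjI[OF \<beta>0], rule exI[of _ \<delta>], rule conjI[OF \<delta>0], intro allI impI)
    fix h \<tau> \<theta> N u ut
    assume asm: "0 < h \<and> h < \<delta> \<and> 0 < \<tau> \<and> \<tau> < \<delta> \<and>
           \<theta> \<in> {\<theta>\<^sub>0..\<theta>\<^sub>1} \<and> \<tau> = \<theta> * h powr (3/4) \<and>
           (\<forall>c. grid_connected h (grid_core_class \<Omega> h c)) \<and>
           T \<in> {\<tau> * real N ..< \<tau> * real N + \<tau>} \<and>
           discrete_navier_stokes \<Omega> h \<tau> N f v\<^sub>0 u ut"
    have "grid_norm \<Omega> h (\<lambda>x. u n x - v (\<tau> * real n) x) \<le> \<beta> * h powr (1/4) \<and>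
      grid_norm \<Omega> h (\<lambda>x. ut n x - v (\<tau> * real n) x) \<le> \<beta> * h powr (1/4)" if "n \<le> N" for n
      by (rule rate[where \<theta>=\<theta> and N=N]) (use asm that in auto)
    then show "(MAX n\<in>{0..N}. grid_norm \<Omega> h (\<lambda>x. u n x - v (\<tau> * real n) x)) \<le> \<beta> * h powr (1/4) \<and>
             (MAX n\<in>{0..N}. grid_norm \<Omega> h (\<lambda>x. ut n x - v (\<tau> * real n) x)) \<le> \<beta> * h powr (1/4)"
      by (auto intro!: Max.boundedI)
  qed
qed

end
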